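(* Let $\Omega\subset\mathbb{R}^2$ be compact with Lipschitz boundary $\Gamma$ and connected complement $\Omega_e=\mathbb{R}^2\setminus\Omega$. Suppose that, for some $a_1>a_2>0$, $\Omega_e$ contains the ellipse $E:=\{(x_1,x_2):(x_1/a_1)^2+(x_2/a_2)^2<1\}$, and that $\Gamma$ coincides with the boundary of this ellipse in neighbourhoods of the points $(0,\pm a_2)$. Then there exist a sequence $0<k_0<k_1<k_2<\ldots$ with $k_m\to\infty$ as $m\to\infty$, and constants $\gamma>0$ and $C>0$, such that $$\mathrm{cond}\,A_{k_m,\eta}\ \ge\ C\,\mathrm{e}^{\gamma k_m}$$ for all $\eta\in\mathbb{R}\setminus\{0\}$ and $m=0,1,2,\ldots$.
   Context: For $k>0$ let $\Phi(x,y):=\frac{\mathrm{i}}{4}H_0^{(1)}(k|x-y|)$, $x,y\in\mathbb{R}^2$, $x\ne y$, where $H_0^{(1)}$ is the Hankel function of the first kind of order zero. For $\varphi\in L^2(\Gamma)$ and $x\in\Gamma$ define $$S_k\varphi(x):=2\int_\Gamma\Phi(x,y)\varphi(y)\,ds(y),\qquad D_k\varphi(x):=2\int_\Gamma\frac{\partial\Phi(x,y)}{\partial\nu(y)}\varphi(y)\,ds(y),$$ where $\nu$ is the unit normal directed into $\Omega_e$ and, on a Lipschitz boundary, the integral for $D_k$ is understood in the usual principal value sense. For $\eta\in\mathbb{R}\setminus\{0\}$ put $A_{k,\eta}:=I+D_k-\mathrm{i}\eta S_k$ on $L^2(\Gamma)$; it is known that $A_{k,\eta}$ is invertible on $L^2(\Gamma)$.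 $\|\cdot\|$ denotes the operator norm on $L^2(\Gamma)$, and $\mathrm{cond}\,A_{k,\eta}:=\|A_{k,\eta}\|\,\|A_{k,\eta}^{-1}\|$. *)

theory Defs
  imports "HOL-Analysis.Analysis"
begin

section \<open>The fundamental solution of the Helmholtz equation\<close>

text \<open>Bessel functions of order zero for a positive real argument, by their standard power series.
  Since \<open>harm 0 = 0\<close>, the second series effectively starts at \<open>m = 1\<close>.\<close>

definition bessel_J0 :: "real \<Rightarrow> real" where
  "bessel_J0 t = (\<Sum>m. (-1) ^ m * (t / 2) ^ (2 * m) / (fact m)\<^sup>2)"

definition bessel_Y0 :: "real \<Rightarrow> real" where
  "bessel_Y0 t = 2 / pi * (ln (t / 2) + euler_mascheroni) * bessel_J0 t
     - 2 / pi * (\<Sum>m. (-1) ^ m * harm m * (t / 2) ^ (2 * m) / (fact m)\<^sup>2)"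

definition hankel1_0 :: "real \<Rightarrow> complex" where
  "hankel1_0 t = Complex (bessel_J0 t) (bessel_Y0 t)"

definition helmholtz_Phi :: "real \<Rightarrow> real ^ 2 \<Rightarrow> real ^ 2 \<Rightarrow> complex" where
  "helmholtz_Phi k x y = \<i> / 4 * hankel1_0 (k * norm (x - y))"


section \<open>Lipschitz boundaries and the unit normal\<close>

text \<open>In suitable orthonormal coordinates \<open>(s, t)\<close> centred at any boundary point, the set is locally
  the closed hypograph of a Lipschitz function; the boundary is \<^term>\<open>frontier \<Omega>\<close>.\<close>

definition lipschitz_boundary :: "(real ^ 2) set \<Rightarrow> bool" where
  "lipschitz_boundary \<Omega> \<longleftrightarrow>
     (\<forall>p \<in> frontier \<Omega>. \<exists>e1 e2 r h L. \<exists>f :: real \<Rightarrow> real.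
        norm e1 = 1 \<and> norm e2 = 1 \<and> e1 \<bullet> e2 = 0 \<and> 0 < r \<and> 0 < h \<and>
        L-lipschitz_on {-r<..<r} f \<and>
        (\<forall>s. \<bar>s\<bar> < r \<longrightarrow> \<bar>f s\<bar> < h) \<and>
        (\<forall>s t. \<bar>s\<bar> < r \<and> \<bar>t\<bar> < h \<longrightarrow>
           (p + s *\<^sub>R e1 + t *\<^sub>R e2 \<in> \<Omega> \<longleftrightarrow> t \<le> f s)))"

text \<open>A unit vector orthogonal to the tangent of the boundary at \<open>y\<close> and pointing into the
  complement. On a Lipschitz boundary there is at most one such vector at every point, and there is
  one at almost every point (where the local graph function is differentiable).\<close>

definition is_unit_normal :: "(real ^ 2) set \<Rightarrow> real ^ 2 \<Rightarrow> real ^ 2 \<Rightarrow> bool" where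
  "is_unit_normal \<Omega> y n \<longleftrightarrow>
     norm n = 1 \<and>
     ((\<lambda>z. ((z - y) \<bullet> n) / norm (z - y)) \<longlongrightarrow> 0) (at y within frontier \<Omega>) \<and>
     (\<forall>\<^sub>F t in at_right 0. y + t *\<^sub>R n \<in> - \<Omega>)"

definition unit_normal :: "(real ^ 2) set \<Rightarrow> real ^ 2 \<Rightarrow> real ^ 2" where
  "unit_normal \<Omega> y = (THE n. is_unit_normal \<Omega> y n)"


section \<open>Arc length\<close>

text \<open>Arc length is the one-dimensional Hausdorff measure, normalised so that a segment has its
  length as measure, on the sets measurable in the sense of Caratheodory.\<close>

definition hausdorff1_pre :: "real \<Rightarrow> 'a::metric_space set \<Rightarrow> ennreal" where
  "hausdorff1_pre \<delta> A =
     (INF C \<in> {C :: nat \<Rightarrow> 'a set. A \<subseteq> (\<Union>n. C n) \<and> (\<forall>n. bounded (C n) \<and> diameter (C n) \<le> \<delta>)}.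
        \<Sum>n. ennreal (diameter (C n)))"

definition hausdorff1 :: "'a::metric_space set \<Rightarrow> ennreal" where
  "hausdorff1 A = (SUP \<delta> \<in> {0<..}. hausdorff1_pre \<delta> A)"

definition hausdorff1_measure :: "'a::metric_space measure" where
  "hausdorff1_measure = measure_of UNIV (lambda_system UNIV UNIV hausdorff1) hausdorff1"

text \<open>By the following facts, \<open>hausdorff1_measure\<close> is the measure that its definition intends:
  \<open>measure_of\<close> does not fall back to the trivial measure.\<close>

lemma hausdorff1_pre_empty: "0 < \<delta> \<Longrightarrow> hausdorff1_pre \<delta> {} = 0"
  unfolding hausdorff1_pre_def
  by (intro antisym INF_lower2[of "\<lambda>_. {}"]) auto

lemma hausdorff1_pre_mono: "A \<subseteq> B \<Longrightarrow> hausdorff1_pre \<delta> A \<le> hausdorff1_pre \<delta> B"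
  unfolding hausdorff1_pre_def by (rule INF_superset_mono) auto

lemma hausdorff1_pre_countably_subadditive:
  "hausdorff1_pre \<delta> (\<Union>i. A i) \<le> (\<Sum>i. hausdorff1_pre \<delta> (A i))"
proof (rule ennreal_le_epsilon)
  fix e :: real
  assume fin: "(\<Sum>i. hausdorff1_pre \<delta> (A i)) < top" and e: "0 < e"
  have "\<exists>C. A i \<subseteq> (\<Union>n. C n) \<and> (\<forall>n. bounded (C n) \<and> diameter (C n) \<le> \<delta>) \<and>
          (\<Sum>n. ennreal (diameter (C n))) \<le> hausdorff1_pre \<delta> (A i) + ennreal (e * (1/2) ^ Suc i)" for i
  proof -
    have ne: "hausdorff1_pre \<delta> (A i) \<noteq> \<infinity>"
    proof
      assume "hausdorff1_pre \<delta> (A i) = \<infinity>"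
      moreover have "hausdorff1_pre \<delta> (A i) \<le> (\<Sum>i. hausdorff1_pre \<delta> (A i))"
        using sum_le_suminf[of "\<lambda>i. hausdorff1_pre \<delta> (A i)" "{i}"] by simp
      ultimately show False using fin by simp
    qed
    have "0 < e * (1/2) ^ Suc i" using e by simp
    from INF_approx_ennreal[OF this hausdorff1_pre_def[of \<delta> "A i"] ne]
    obtain C where "C \<in> {C. A i \<subseteq> (\<Union>n. C n) \<and> (\<forall>n. bounded (C n) \<and> diameter (C n) \<le> \<delta>)}"
      and "(\<Sum>n. ennreal (diameter (C n))) < hausdorff1_pre \<delta> (A i) + ennreal (e * (1/2) ^ Suc i)" ..
    then show ?thesis by (intro exI[of _ C]) (simp add: less_imp_le)
  qed
  then obtain C where
    C: "\<And>i. A i \<subseteq> (\<Union>n. C i n)" "\<And>i n. bounded (C i n)" "\<And>i n. diameter (C i n) \<le> \<delta>"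
    "\<And>i. (\<Sum>n. ennreal (diameter (C i n))) \<le> hausdorff1_pre \<delta> (A i) + ennreal (e * (1/2) ^ Suc i)"
    by metis
  define D where "D j = case_prod C (prod_decode j)" for j
  have "(\<Union>i. A i) \<subseteq> (\<Union>j. D j)"
  proof
    fix x assume "x \<in> (\<Union>i. A i)"
    then obtain i n where "x \<in> C i n" using C(1) by blast
    then have "x \<in> D (prod_encode (i, n))" by (simp add: D_def)
    then show "x \<in> (\<Union>j. D j)" by blast
  qed
  then have "hausdorff1_pre \<delta> (\<Union>i. A i) \<le> (\<Sum>j. ennreal (diameter (D j)))"
    unfolding hausdorff1_pre_def
    by (intro INF_lower) (auto simp: D_def C split: prod.split)
  also have "\<dots> = (\<Sum>i. \<Sum>n. ennreal (diameter (C i n)))"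
    using suminf_ennreal_2dimen[of "\<lambda>i. \<Sum>n. ennreal (diameter (C i n))"
        "\<lambda>(i, n). ennreal (diameter (C i n))"]
    by (simp add: D_def case_prod_beta)
  also have "\<dots> \<le> (\<Sum>i. hausdorff1_pre \<delta> (A i) + ennreal (e * (1/2) ^ Suc i))"
    by (intro suminf_le C) auto
  also have "\<dots> = (\<Sum>i. hausdorff1_pre \<delta> (A i)) + (\<Sum>i. ennreal (e * (1/2) ^ Suc i))"
    by (subst suminf_add[symmetric]) auto
  also have "(\<Sum>i. ennreal (e * (1/2) ^ Suc i)) = ennreal e"
  proof -
    have "(\<lambda>i. e * (1/2) ^ Suc i) sums e"
      using sums_mult[OF power_half_series, of e] by simp
    then show ?thesis using e by (intro suminf_ennreal_eq) auto
  qed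
  finally show "hausdorff1_pre \<delta> (\<Union>i. A i) \<le> (\<Sum>i. hausdorff1_pre \<delta> (A i)) + ennreal e" .
qed

lemma outer_measure_space_hausdorff1: "outer_measure_space (UNIV :: 'a::metric_space set set) hausdorff1"
  unfolding outer_measure_space_def
proof (intro conjI)
  show "positive (UNIV :: 'a set set) hausdorff1"
    by (auto simp: positive_def hausdorff1_def hausdorff1_pre_empty)
  show "increasing (UNIV :: 'a set set) hausdorff1"
    unfolding increasing_def hausdorff1_def by (auto intro!: SUP_mono' hausdorff1_pre_mono)
  show "countably_subadditive (UNIV :: 'a set set) hausdorff1"
    unfolding countably_subadditive_def
  proof (intro allI impI)
    fix A :: "nat \<Rightarrow> 'a set"
    show "hausdorff1 (\<Union>i. A i) \<le> (\<Sum>i. hausdorff1 (A i))"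
      unfolding hausdorff1_def[of "\<Union>i. A i"]
    proof (rule SUP_least)
      fix \<delta> :: real assume "\<delta> \<in> {0<..}"
      then have "hausdorff1_pre \<delta> (A i) \<le> hausdorff1 (A i)" for i
        unfolding hausdorff1_def by (rule SUP_upper)
      then have "(\<Sum>i. hausdorff1_pre \<delta> (A i)) \<le> (\<Sum>i. hausdorff1 (A i))"
        by (intro suminf_le) auto
      with hausdorff1_pre_countably_subadditive
      show "hausdorff1_pre \<delta> (\<Union>i. A i) \<le> (\<Sum>i. hausdorff1 (A i))"
        by (rule order_trans)
    qed
  qed
qed

lemma measure_space_hausdorff1:
  "measure_space UNIV (lambda_system UNIV UNIV hausdorff1) hausdorff1"
  using sigma_algebra.caratheodory_lemma[OF sigma_algebra_Pow[of UNIV]]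
    outer_measure_space_hausdorff1 by simp

lemma sets_hausdorff1_measure: "sets hausdorff1_measure = lambda_system UNIV UNIV hausdorff1"
  unfolding hausdorff1_measure_def
  by (intro sigma_algebra.sets_measure_of_eq) (use measure_space_hausdorff1 in \<open>auto simp: measure_space_def\<close>)

lemma emeasure_hausdorff1_measure:
  assumes "A \<in> sets hausdorff1_measure"
  shows "emeasure hausdorff1_measure A = hausdorff1 A"
proof -
  have "A \<in> lambda_system UNIV UNIV hausdorff1"
    using assms by (simp add: sets_hausdorff1_measure)
  then show ?thesis
    unfolding hausdorff1_measure_def
    using measure_space_hausdorff1[where 'a = 'a]
    by (intro emeasure_measure_of_sigma) (auto simp: measure_space_def)
qed

definition surface_measure :: "(real ^ 2) set \<Rightarrow> (real ^ 2) measure" where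
  "surface_measure \<Omega> = restrict_space hausdorff1_measure (frontier \<Omega>)"


section \<open>Operators on square-integrable functions and their condition number\<close>

text \<open>Elements of \<open>L\<^sup>2\<close> are represented by functions, with equality almost everywhere made explicit.\<close>

definition L2 :: "'a measure \<Rightarrow> ('a \<Rightarrow> complex) set" where
  "L2 M = {f \<in> borel_measurable M. integrable M (\<lambda>x. (cmod (f x))\<^sup>2)}"

definition L2_norm :: "'a measure \<Rightarrow> ('a \<Rightarrow> complex) \<Rightarrow> real" where
  "L2_norm M f = sqrt (LINT x|M. (cmod (f x))\<^sup>2)"

definition L2_op_norm :: "'a measure \<Rightarrow> (('a \<Rightarrow> complex) \<Rightarrow> 'a \<Rightarrow> complex) \<Rightarrow> ennreal" where
  "L2_op_norm M T = (SUP f \<in> {f \<in> L2 M. L2_norm M f \<le> 1}. ennreal (L2_norm M (T f)))"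

definition L2_invertible :: "'a measure \<Rightarrow> (('a \<Rightarrow> complex) \<Rightarrow> 'a \<Rightarrow> complex) \<Rightarrow> bool" where
  "L2_invertible M T \<longleftrightarrow>
     (\<forall>f \<in> L2 M. T f \<in> L2 M) \<and>
     (\<forall>f \<in> L2 M. \<forall>g \<in> L2 M. (AE x in M. T f x = T g x) \<longleftrightarrow> (AE x in M. f x = g x)) \<and>
     (\<forall>g \<in> L2 M. \<exists>f \<in> L2 M. AE x in M. T f x = g x)"

definition L2_inverse ::
  "'a measure \<Rightarrow> (('a \<Rightarrow> complex) \<Rightarrow> 'a \<Rightarrow> complex) \<Rightarrow> ('a \<Rightarrow> complex) \<Rightarrow> 'a \<Rightarrow> complex" where
  "L2_inverse M T g = (SOME f. f \<in> L2 M \<and> (AE x in M. T f x = g x))"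

text \<open>The usual convention: an operator that is not invertible has infinite condition number.\<close>

definition L2_cond :: "'a measure \<Rightarrow> (('a \<Rightarrow> complex) \<Rightarrow> 'a \<Rightarrow> complex) \<Rightarrow> ennreal" where
  "L2_cond M T =
     (if L2_invertible M T then L2_op_norm M T * L2_op_norm M (L2_inverse M T) else \<infinity>)"


section \<open>The combined layer potential operator\<close>

definition single_layer ::
  "(real ^ 2) set \<Rightarrow> real \<Rightarrow> (real ^ 2 \<Rightarrow> complex) \<Rightarrow> real ^ 2 \<Rightarrow> complex" where
  "single_layer \<Omega> k \<phi> x = 2 * (LINT y|surface_measure \<Omega>. helmholtz_Phi k x y * \<phi> y)"

definition normal_deriv_Phi :: "(real ^ 2) set \<Rightarrow> real \<Rightarrow> real ^ 2 \<Rightarrow> real ^ 2 \<Rightarrow> complex" where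
  "normal_deriv_Phi \<Omega> k x y =
     vector_derivative (\<lambda>t. helmholtz_Phi k x (y + t *\<^sub>R unit_normal \<Omega> y)) (at 0)"

text \<open>Principal value: the limit exists for almost every \<open>x\<close>, which determines the function in
  \<open>L\<^sup>2\<close>.\<close>

definition double_layer ::
  "(real ^ 2) set \<Rightarrow> real \<Rightarrow> (real ^ 2 \<Rightarrow> complex) \<Rightarrow> real ^ 2 \<Rightarrow> complex" where
  "double_layer \<Omega> k \<phi> x =
     2 * Lim (at_right 0)
       (\<lambda>\<epsilon>. LINT y:{y. \<epsilon> \<le> dist x y}|surface_measure \<Omega>. normal_deriv_Phi \<Omega> k x y * \<phi> y)"

definition combined_layer ::
  "(real ^ 2) set \<Rightarrow> real \<Rightarrow> real \<Rightarrow> (real ^ 2 \<Rightarrow> complex) \<Rightarrow> real ^ 2 \<Rightarrow> complex" where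
  "combined_layer \<Omega> k \<eta> \<phi> x =
     \<phi> x + double_layer \<Omega> k \<phi> x - \<i> * of_real \<eta> * single_layer \<Omega> k \<phi> x"


definition open_ellipse :: "real \<Rightarrow> real \<Rightarrow> (real ^ 2) set" where
  "open_ellipse a1 a2 = {x. (x $ 1 / a1)\<^sup>2 + (x $ 2 / a2)\<^sup>2 < 1}"

end

theory Submission
  imports Defs "HOL-Probability.Sinc_Integral"
begin

text \<open>
  The Helmholtz equation separates in elliptic coordinates \<open>x = (c cosh \<mu> sin \<phi>, c sinh \<mu> cos \<phi>)\<close>. For arbitrarily
  large \<open>k\<close> there are quasimodes \<open>\<rho>(\<phi>) M(\<mu>)\<close> of the ellipse that vanish on its boundary, are concentrated near the
  minor axis and have an exponentially small residual. By Green's identity the single layer potential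
  of their Neumann data \<open>\<psi>\<close> is exponentially small on the whole of \<open>\<Gamma>\<close>, and its normal derivative nearly cancels
  \<open>\<psi>\<close> there (jump relation). So \<open>\<psi>\<close> is an approximate null vector of the transpose of \<open>A\<close>, with error at most
  \<open>C k (1 + \<bar>\<eta>\<bar>) e\<^bsup>-\<gamma>k\<^esup>\<close>, and pairing \<open>\<psi>\<close> with \<open>A (A\<^sup>-\<^sup>1 \<psi>)\<close> bounds the norm of the inverse from below.
  Testing \<open>A\<close> with the indicator of an arc of length \<open>1/k\<close> gives \<open>\<parallel>A\<parallel> \<ge> c (1 + \<bar>\<eta>\<bar>) / k\<close>, so \<open>\<eta>\<close> cancels in the product.
\<close>

section \<open>The Bessel equation of order zero\<close>

text \<open>The minor axis carries a stable bouncing orbit, and only near its ends is the boundary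
  known, so the quasimode has to live in a thin strip around the axis. Letting \<mu> take negative
  values as well makes the coordinates regular across the focal segment, so that the strip is the
  one-to-one image of a full rectangle. Both separated factors must meet a boundary condition at
  once, and the free parameters are just the frequency and the separation constant; a
  two-dimensional intermediate value argument finds them. The double layer on a merely Lipschitz
  curve is a singular integral, but \<psi> lives on two smooth arcs, and seen from these the kernel
  is bounded against the whole boundary, so there the principal value is an ordinary integral. That
  the operator maps into the square-integrable functions is part of the definition of invertibility,
  and otherwise the condition number is infinite. Real and imaginary part of the kernel solve the
  same Bessel equation and run in parallel; they differ in the coefficient of the pole of the
  derivative, and this coefficient produces the jump.\<close>

definition bessel_coeff :: "nat => real" where
 "bessel_coeff m = (-1) ^ m / (fact m)^2"

definition bessel_log_coeff :: "nat => real" where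
 "bessel_log_coeff m = bessel_coeff m * harm m"

lemma harm_le_fact: "harm m \<le> (fact m :: real)"
proof (induction m)
 case (Suc m)
 show ?case
 proof (cases "m = 0")
 case True then show ?thesis by (simp add: harm_def)
 next case False
 have "harm (Suc m) = harm m + inverse (real (Suc m))" by (rule harm_Suc)
 also have "... \<le> fact m + inverse (real (Suc m))" using Suc by simp
 also have "... \<le> fact (Suc m)"
 proof -
  have "inverse (real (Suc m)) \<le> 1" by (simp add: divide_simps)
  also have "1 \<le> real m * fact m" using False by (metis fact_ge_1 mult_mono of_nat_0_le_iff of_nat_1 of_nat_le_iff One_nat_def Suc_leI neq0_conv mult_1 zero_le_one)
  finally show ?thesis by (simp add: algebra_simps)
 qed
 finally show ?thesis .
 qed
qed (simp add: harm_def)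

lemma summable_bessel_coeff: "summable (\<lambda>m. bessel_coeff m * s ^ m)"
proof (rule summable_comparison_test)
 show "\<exists>N. \<forall>n\<ge>N. norm (bessel_coeff n * s ^ n) \<le> \<bar>s\<bar> ^ n /\<^sub>R fact n"
 proof (intro exI allI impI)
  fix n
  have "inverse ((fact n)^2) \<le> inverse (fact n :: real)"
   by (rule le_imp_inverse_le) (auto simp: power2_eq_square fact_ge_1)
  then have "inverse ((fact n)^2) * \<bar>s\<bar> ^ n \<le> inverse (fact n) * \<bar>s\<bar> ^ n"
   by (intro mult_right_mono) auto
  then show "norm (bessel_coeff n * s ^ n) \<le> \<bar>s\<bar> ^ n /\<^sub>R fact n"
   by (simp add: bessel_coeff_def abs_mult power_abs divide_inverse)
 qed
qed (rule summable_exp_generic)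

lemma summable_bessel_log_coeff: "summable (\<lambda>m. bessel_log_coeff m * s ^ m)"
proof (rule summable_comparison_test)
 show "\<exists>N. \<forall>n\<ge>N. norm (bessel_log_coeff n * s ^ n) \<le> \<bar>s\<bar> ^ n /\<^sub>R fact n"
 proof (intro exI allI impI)
  fix n
  have "harm n / ((fact n)^2) \<le> inverse (fact n :: real)"
   using harm_le_fact[of n] by (simp add: divide_simps power2_eq_square)
  then have "harm n / ((fact n)^2) * \<bar>s\<bar> ^ n \<le> inverse (fact n) * \<bar>s\<bar> ^ n"
   by (intro mult_right_mono) auto
  then show "norm (bessel_log_coeff n * s ^ n) \<le> \<bar>s\<bar> ^ n /\<^sub>R fact n"
   by (simp add: bessel_log_coeff_def bessel_coeff_def abs_mult power_abs harm_nonneg divide_inverse ac_simps)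
 qed
qed (rule summable_exp_generic)

definition pseries :: "(nat => real) => real => real" where
 "pseries c s = (\<Sum>m. c m * s ^ m)"

definition entire_coeff :: "(nat => real) => bool" where
 "entire_coeff c \<longleftrightarrow> (\<forall>s. summable (\<lambda>m. c m * s ^ m))"

lemma entire_bessel_coeff: "entire_coeff bessel_coeff" "entire_coeff bessel_log_coeff"
 by (auto simp: entire_coeff_def summable_bessel_coeff summable_bessel_log_coeff)

lemma entire_coeff_diffs: "entire_coeff c ==> entire_coeff (diffs c)"
 unfolding entire_coeff_def using termdiff_converges_all by blast

lemma pseries_deriv [derivative_intros]:
 assumes "entire_coeff c"
 shows "(pseries c has_real_derivative pseries (diffs c) s) (at s)"
 using termdiffs_strong_converges_everywhere[of c s] assms
 unfolding pseries_def entire_coeff_def by (simp add: fun_eq_iff[symmetric])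

lemma pseries_isCont: "entire_coeff c ==> continuous_on A (pseries c)"
 by (meson DERIV_isCont continuous_at_imp_continuous_on pseries_deriv)

text \<open>In the variable \<open>s = (t/2)^2\<close> Bessel's equation of order zero reads
  \<open>s w'' + w' + w = 0\<close>, which for the coefficients is the recurrence
  \<open>(m+1)^2 a(m+1) = - a(m)\<close>.\<close>

lemma bessel_ode:
 "s * pseries (diffs (diffs bessel_coeff)) s + pseries (diffs bessel_coeff) s + pseries bessel_coeff s = 0"
proof -
 let ?a = bessel_coeff
 have e: "entire_coeff (diffs (diffs ?a))" "entire_coeff (diffs ?a)" "entire_coeff ?a"
  by (auto intro!: entire_coeff_diffs entire_bessel_coeff)
 \<comment> \<open>\<open>d m\<close> is the term of order \<open>m\<close> in \<open>s\<close>
   times the second derivative; as \<open>d 0 = 0\<close>, the shifted series can start at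
   0.\<close>
 define d where "d m = real m * (real m + 1) * ?a (Suc m) * s ^ m" for m
 have "(\<lambda>m. d (Suc m)) sums (s * pseries (diffs (diffs ?a)) s)"
  using sums_mult[OF summable_sums, of "\<lambda>m. diffs (diffs ?a) m * s ^ m" s] e
  by (simp add: entire_coeff_def pseries_def d_def diffs_def ac_simps add_ac)
 then have 1: "d sums (s * pseries (diffs (diffs ?a)) s)"
  by (subst (asm) sums_Suc_iff) (simp add: d_def)
 have 2: "(\<lambda>m. diffs ?a m * s ^ m) sums pseries (diffs ?a) s"
  and 3: "(\<lambda>m. ?a m * s ^ m) sums pseries ?a s"
  using e by (simp_all add: entire_coeff_def pseries_def summable_sums)
 have z: "d m + diffs ?a m * s ^ m + ?a m * s ^ m = 0" for m
 proof -
  have "real m * (real m + 1) * ?a (Suc m) + real (Suc m) * ?a (Suc m) + ?a m = 0"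
  proof -
   have "bessel_coeff (Suc m) = - bessel_coeff m / (real m + 1)^2"
    by (simp add: bessel_coeff_def field_simps power2_eq_square)
   then show ?thesis by (simp add: divide_simps power2_eq_square) (simp add: algebra_simps)
  qed
  then have "(real m * (real m + 1) * ?a (Suc m) + real (Suc m) * ?a (Suc m) + ?a m) * s ^ m = 0"
   by simp
  then show ?thesis by (simp add: d_def diffs_def algebra_simps)
 qed
 show ?thesis
  using sums_unique2[OF sums_add[OF sums_add[OF 1 2] 3], of 0] z by simp
qed

text \<open>The Bessel operator applied to \<open>ln s\<close> times the first series leaves twice
  the derivative of that series. The right-hand side here, which stems from
  \<open>harm (Suc m) = harm m + 1/(m+1)\<close>, is exactly what cancels it in
  \<open>hankel_im\<close>.\<close>

lemma bessel_log_ode: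
 "s * pseries (diffs (diffs bessel_log_coeff)) s + pseries (diffs bessel_log_coeff) s
  + pseries bessel_log_coeff s = pseries (diffs bessel_coeff) s"
proof -
 let ?a = bessel_log_coeff
 have e: "entire_coeff (diffs (diffs ?a))" "entire_coeff (diffs ?a)" "entire_coeff ?a"
  "entire_coeff (diffs bessel_coeff)"
  by (auto intro!: entire_coeff_diffs entire_bessel_coeff)
 define d where "d m = real m * (real m + 1) * ?a (Suc m) * s ^ m" for m
 have "(\<lambda>m. d (Suc m)) sums (s * pseries (diffs (diffs ?a)) s)"
  using sums_mult[OF summable_sums, of "\<lambda>m. diffs (diffs ?a) m * s ^ m" s] e
  by (simp add: entire_coeff_def pseries_def d_def diffs_def ac_simps add_ac)
 then have 1: "d sums (s * pseries (diffs (diffs ?a)) s)"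
  by (subst (asm) sums_Suc_iff) (simp add: d_def)
 have 2: "(\<lambda>m. diffs ?a m * s ^ m) sums pseries (diffs ?a) s"
  and 3: "(\<lambda>m. ?a m * s ^ m) sums pseries ?a s"
  and 4: "(\<lambda>m. diffs bessel_coeff m * s ^ m) sums pseries (diffs bessel_coeff) s"
  using e by (simp_all add: entire_coeff_def pseries_def summable_sums)
 have z: "d m + diffs ?a m * s ^ m + ?a m * s ^ m = diffs bessel_coeff m * s ^ m" for m
 proof -
  have c: "bessel_coeff (Suc m) = - bessel_coeff m / (real m + 1)^2"
   by (simp add: bessel_coeff_def field_simps power2_eq_square)
  have "real m * (real m + 1) * ?a (Suc m) + real (Suc m) * ?a (Suc m) + ?a m
      = real (Suc m) * bessel_coeff (Suc m)"
   unfolding bessel_log_coeff_def harm_Suc c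
   by (simp add: divide_simps power2_eq_square) (simp add: algebra_simps)
  then have "(real m * (real m + 1) * ?a (Suc m) + real (Suc m) * ?a (Suc m) + ?a m) * s ^ m
   = real (Suc m) * bessel_coeff (Suc m) * s ^ m"
   by simp
  then show ?thesis by (simp add: d_def diffs_def algebra_simps)
 qed
 show ?thesis
  using sums_unique2[OF sums_add[OF sums_add[OF 1 2] 3]] z 4 by simp
qed

text \<open>\<open>Re\<close> and \<open>Im\<close> of the Hankel function and of its derivatives, in the variable \<open>s = (t/2)^2\<close>.\<close>

definition hankel_re :: "real => real" where "hankel_re = pseries bessel_coeff"
definition hankel_re' :: "real => real" where "hankel_re' = pseries (diffs bessel_coeff)"
definition hankel_re'' :: "real => real" where "hankel_re'' = pseries (diffs (diffs bessel_coeff))"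

definition hankel_im :: "real => real" where
 "hankel_im s = (ln s + 2 * euler_mascheroni) / pi * hankel_re s - 2 / pi * pseries bessel_log_coeff s"
definition hankel_im' :: "real => real" where
 "hankel_im' s = hankel_re s / (pi * s) + (ln s + 2 * euler_mascheroni) / pi * hankel_re' s
  - 2 / pi * pseries (diffs bessel_log_coeff) s"
definition hankel_im'' :: "real => real" where
 "hankel_im'' s = - hankel_re s / (pi * s^2) + 2 * hankel_re' s / (pi * s)
  + (ln s + 2 * euler_mascheroni) / pi * hankel_re'' s
  - 2 / pi * pseries (diffs (diffs bessel_log_coeff)) s"

lemma hankel_re_deriv [derivative_intros]:
 "(hankel_re has_real_derivative hankel_re' s) (at s)"
 "(hankel_re' has_real_derivative hankel_re'' s) (at s)"
 unfolding hankel_re_def hankel_re'_def hankel_re''_def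
 by (auto intro!: pseries_deriv entire_coeff_diffs entire_bessel_coeff)

lemma hankel_im_deriv:
 assumes "s > 0"
 shows "(hankel_im has_real_derivative hankel_im' s) (at s)"
  "(hankel_im' has_real_derivative hankel_im'' s) (at s)"
 unfolding hankel_im_def [abs_def] hankel_im'_def [abs_def] hankel_im''_def
 using assms
 by (auto intro!: derivative_eq_intros entire_coeff_diffs entire_bessel_coeff pi_gt_zero
    simp: field_simps power2_eq_square)

lemma hankel_ode:
 "s * hankel_re'' s + hankel_re' s + hankel_re s = 0"
 "s > 0 ==> s * hankel_im'' s + hankel_im' s + hankel_im s = 0"
proof -
 show 1: "s * hankel_re'' s + hankel_re' s + hankel_re s = 0"
  unfolding hankel_re_def hankel_re'_def hankel_re''_def by (rule bessel_ode)
 assume s: "s > 0"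
 have "s * hankel_im'' s + hankel_im' s + hankel_im s
  = (ln s + 2 * euler_mascheroni) / pi * (s * hankel_re'' s + hankel_re' s + hankel_re s)
   + 2 / pi * (hankel_re' s - (s * pseries (diffs (diffs bessel_log_coeff)) s
     + pseries (diffs bessel_log_coeff) s + pseries bessel_log_coeff s))"
  using s unfolding hankel_im_def hankel_im'_def hankel_im''_def
  by (simp add: field_simps power2_eq_square)
 also have "... = 0"
  unfolding 1 bessel_log_ode by (simp add: hankel_re'_def)
 finally show "s * hankel_im'' s + hankel_im' s + hankel_im s = 0" .
qed

text \<open>The energy \<open>w\<^sup>2 + s w'\<^sup>2\<close> of a solution is nonincreasing, which gives boundedness at infinity.\<close>

lemma bessel_energy:
 fixes w w' w'' :: "real => real"
 assumes "\<And>s. s > 0 ==> (w has_real_derivative w' s) (at s)"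
  and "\<And>s. s > 0 ==> (w' has_real_derivative w'' s) (at s)"
  and ode: "\<And>s. s > 0 ==> s * w'' s + w' s + w s = 0" and "1 \<le> s"
 shows "(w s)^2 + s * (w' s)^2 \<le> (w 1)^2 + (w' 1)^2"
proof -
 have "(\<lambda>s. (w s)\<^sup>2 + s * (w' s)^2) s \<le> (\<lambda>s. (w s)\<^sup>2 + s * (w' s)^2) 1"
 proof (rule DERIV_nonpos_imp_nonincreasing[OF \<open>1 \<le> s\<close>])
  fix x :: real assume x: "1 \<le> x" "x \<le> s"
  have *: "x * w'' x = - w' x - w x" using ode[of x] x by simp
  have "2 * w x * w' x + (w' x)^2 + 2 * (x * w'' x) * w' x = - (w' x)\<^sup>2"
   unfolding * by (simp add: algebra_simps power2_eq_square)
  then have "DERIV (\<lambda>s. (w s)\<^sup>2 + s * (w' s)^2) x :> - (w' x)\<^sup>2"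
   using x by (auto intro!: derivative_eq_intros assms simp: power2_eq_square algebra_simps)
  then show "\<exists>y. DERIV (\<lambda>s. (w s)\<^sup>2 + s * (w' s)^2) x :> y \<and> y \<le> 0"
   by (meson neg_le_0_iff_le zero_le_power2)
 qed
 then show ?thesis by simp
qed

lemma bessel_bounded_at_infinity:
 fixes w w' w'' :: "real => real"
 assumes "\<And>s. s > 0 ==> (w has_real_derivative w' s) (at s)"
  and "\<And>s. s > 0 ==> (w' has_real_derivative w'' s) (at s)"
  and ode: "\<And>s. s > 0 ==> s * w'' s + w' s + w s = 0"
 shows "\<exists>C. \<forall>s\<ge>1. \<bar>w s\<bar> \<le> C \<and> \<bar>w' s\<bar> \<le> C / sqrt s"
proof (intro exI allI impI)
 fix s :: real assume s: "1 \<le> s"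
 let ?E = "(w 1)^2 + (w' 1)^2"
 have E: "(w s)^2 + s * (w' s)^2 \<le> ?E" by (rule bessel_energy[OF assms s])
 have "(w s)^2 \<le> ?E" using E s by (smt (verit) mult_nonneg_nonneg zero_le_power2)
 then have 1: "\<bar>w s\<bar> \<le> sqrt ?E" by (rule real_le_rsqrt[of "\<bar>w s\<bar>", simplified])
 have "(sqrt s * \<bar>w' s\<bar>)^2 \<le> ?E" using E s by (simp add: power_mult_distrib) (smt (verit) zero_le_power2)
 then have "sqrt s * \<bar>w' s\<bar> \<le> sqrt ?E" by (rule real_le_rsqrt)
 then have "\<bar>w' s\<bar> \<le> sqrt ?E / sqrt s" using s by (simp add: field_simps)
 with 1 show "\<bar>w s\<bar> \<le> sqrt ?E \<and> \<bar>w' s\<bar> \<le> sqrt ?E / sqrt s" by simp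
qed

lemma continuous_bounded_unit_interval:
 assumes "continuous_on {0..1} (f :: real => real)"
 shows "\<exists>B\<ge>0. \<forall>s\<in>{0..1}. \<bar>f s\<bar> \<le> B"
proof -
 have "bounded (f ` {0..1})"
  using assms compact_continuous_image compact_imp_bounded by blast
 then obtain B where "\<forall>x\<in>f ` {0..1}. norm x \<le> B" by (meson bounded_iff)
 then show ?thesis by (intro exI[of _ "max B 0"]) (auto simp: le_max_iff_disj)
qed

lemma abs_ln_le_powr:
 assumes "0 < s" "s \<le> (1::real)" "0 < a"
 shows "\<bar>ln s\<bar> \<le> s powr (- a) / a"
proof -
 have "a * - ln s = ln (s powr (-a))" using assms by (simp add: ln_powr)
 also have "... \<le> s powr (-a) - 1" using assms by (intro ln_le_minus_one) simp
 finally have "a * - ln s \<le> s powr (-a)" by simp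
 then show ?thesis using assms by (simp add: field_simps)
qed

text \<open>Series and logarithm control \<open>s \<le> 1\<close>, the energy controls
  \<open>s \<ge> 1\<close>. The logarithm is traded for a power: with \<open>s\<close> proportional
  to \<open>r^2\<close> the kernel is then at most of order \<open>r powr (-1/2)\<close>, integrable
  along an arc. In the derivative the pole \<open>1 / (pi * s)\<close> is kept exactly, because it
  carries the jump.\<close>

lemma hankel_bounds:
 "\<exists>C>0. \<forall>s>0. \<bar>hankel_re s\<bar> \<le> C * (1 + s powr (-1/4)) \<and> \<bar>hankel_im s\<bar> \<le> C * (1 + s powr (-1/4))
  \<and> \<bar>hankel_re' s\<bar> \<le> C / sqrt s \<and> \<bar>hankel_im' s - 1 / (pi * s)\<bar> \<le> C / sqrt s"
proof -
 let ?g = "2 * euler_mascheroni :: real"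
 have cont: "continuous_on {0..1} hankel_re" "continuous_on {0..1} hankel_re'"
  "continuous_on {0..1} (pseries bessel_log_coeff)" "continuous_on {0..1} (pseries (diffs bessel_log_coeff))"
  unfolding hankel_re_def hankel_re'_def
  by (auto intro!: pseries_isCont entire_coeff_diffs entire_bessel_coeff)
 obtain B1 where B1: "B1 \<ge> 0" "\<And>s. s \<in> {0..1} ==> \<bar>hankel_re s\<bar> \<le> B1"
  using continuous_bounded_unit_interval[OF cont(1)] by blast
 obtain B2 where B2: "B2 \<ge> 0" "\<And>s. s \<in> {0..1} ==> \<bar>hankel_re' s\<bar> \<le> B2"
  using continuous_bounded_unit_interval[OF cont(2)] by blast
 obtain B3 where B3: "B3 \<ge> 0" "\<And>s. s \<in> {0..1} ==> \<bar>pseries bessel_log_coeff s\<bar> \<le> B3"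
  using continuous_bounded_unit_interval[OF cont(3)] by blast
 obtain B4 where B4: "B4 \<ge> 0" "\<And>s. s \<in> {0..1} ==> \<bar>pseries (diffs bessel_log_coeff) s\<bar> \<le> B4"
  using continuous_bounded_unit_interval[OF cont(4)] by blast
 obtain C1 where C1: "\<And>s. s \<ge> 1 ==> \<bar>hankel_re s\<bar> \<le> C1 \<and> \<bar>hankel_re' s\<bar> \<le> C1 / sqrt s"
  using bessel_bounded_at_infinity[of hankel_re hankel_re' hankel_re''] hankel_re_deriv hankel_ode by blast
 obtain C2 where C2: "\<And>s. s \<ge> 1 ==> \<bar>hankel_im s\<bar> \<le> C2 \<and> \<bar>hankel_im' s\<bar> \<le> C2 / sqrt s"
  using bessel_bounded_at_infinity[of hankel_im hankel_im' hankel_im''] hankel_im_deriv hankel_ode by blast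
 have C12: "C1 \<ge> 0" "C2 \<ge> 0" using C1[of 1] C2[of 1] by auto
 \<comment> \<open>The value 1 at the origin makes \<open>(hankel_re s - 1) / (pi * s)\<close>
   bounded near 0, so that subtracting \<open>1 / (pi * s)\<close> removes the pole of
   \<open>hankel_im'\<close> completely.\<close>
 have re0: "hankel_re 0 = 1"
  unfolding hankel_re_def pseries_def by (subst suminf_finite[of "{0}"]) (auto simp: bessel_coeff_def)
 have re1: "\<bar>hankel_re s - 1\<bar> \<le> B2 * s" if "s \<in> {0..1}" for s
 proof -
  have "norm (hankel_re s - hankel_re 0) \<le> B2 * norm (s - 0)"
  proof (rule field_differentiable_bound[of "{0..1}"])
   show "(hankel_re has_field_derivative hankel_re' z) (at z within {0..1})" for z
    using hankel_re_deriv(1) by (rule has_field_derivative_at_within)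
  qed (use that B2 in auto)
  then show ?thesis using that re0 by simp
 qed
 define C where "C = 1 + C1 + C2 + B1 + B2 + B3 + B4 + (4 + ?g) * B1 + (2 + ?g) * B2"
 have g: "?g \<ge> 0" using euler_mascheroni_pos by simp
 have nn: "(4 + ?g) * B1 \<ge> 0" "(2 + ?g) * B2 \<ge> 0" using g B1 B2 by auto
 have pi1: "1 / pi \<le> 1/2" using pi_gt3 by (simp add: field_simps)
 show ?thesis
 proof (intro exI conjI allI impI)
  show "C > 0" unfolding C_def using C12 B1 B2 B3 B4 nn by linarith
  fix s :: real assume s: "s > 0"
  have p1: "1 + s powr (-1/4) \<ge> 1" by simp
  have lg: "\<bar>(ln s + ?g) / pi\<bar> \<le> \<bar>ln s\<bar> + ?g"
  proof -
   have "\<bar>(ln s + ?g) / pi\<bar> = \<bar>ln s + ?g\<bar> * (1 / pi)" by (simp add: abs_divide)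
   also have "... \<le> \<bar>ln s + ?g\<bar> * 1" using pi1 by (intro mult_left_mono) auto
   also have "... \<le> \<bar>ln s\<bar> + ?g" using g abs_triangle_ineq[of "ln s" ?g] by (simp del: abs_triangle_ineq)
   finally show ?thesis .
  qed
  have Cge: "C \<ge> C1" "C \<ge> C2 + 1" "C \<ge> B1" "C \<ge> B2" "C \<ge> (4 + ?g) * B1 + B3" "C \<ge> B2 + (2 + ?g) * B2 + B4"
   using C12 B1 B2 B3 B4 nn unfolding C_def by linarith+
  have C0: "C \<ge> 0" using Cge(2) C12 by linarith
  have up: "x \<le> C * (1 + s powr (-1/4))" if "x \<le> C" for x
   using that mult_left_mono[OF p1 C0] by linarith
  have "\<bar>hankel_re s\<bar> \<le> C"
   using B1(2)[of s] C1[of s] Cge s by (cases "s \<le> 1") auto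
  then show "\<bar>hankel_re s\<bar> \<le> C * (1 + s powr (-1/4))" by (rule up)
  show "\<bar>hankel_re' s\<bar> \<le> C / sqrt s"
  proof (cases "s \<le> 1")
   case True
   have "\<bar>hankel_re' s\<bar> \<le> C" using B2(2)[of s] Cge s True by auto
   also have "C \<le> C / sqrt s" using s True C0 by (simp add: le_divide_eq mult_left_le)
   finally show ?thesis .
  next
   case False
   then have "\<bar>hankel_re' s\<bar> \<le> C1 / sqrt s" using C1 by simp
   also have "... \<le> C / sqrt s" by (rule divide_right_mono) (use Cge s in auto)
   finally show ?thesis .
  qed
  show "\<bar>hankel_im s\<bar> \<le> C * (1 + s powr (-1/4))"
  proof (cases "s \<le> 1")
   case True
   have lns: "ln s \<le> ?g" using s True g ln_le_zero_iff[of s] by linarith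
   have l: "\<bar>ln s\<bar> \<le> 4 * s powr (-1/4)" using abs_ln_le_powr[of s "1/4"] s True by simp
   have "\<bar>hankel_im s\<bar> \<le> \<bar>(ln s + ?g) / pi * hankel_re s\<bar> + \<bar>2 / pi * pseries bessel_log_coeff s\<bar>"
    unfolding hankel_im_def by linarith
   also have "\<bar>(ln s + ?g) / pi * hankel_re s\<bar> \<le> (\<bar>ln s\<bar> + ?g) * B1"
    unfolding abs_mult using lns lg g B1 True s by (intro mult_mono) auto
   also have "... \<le> (4 * s powr (-1/4) + ?g) * B1" using l B1 by (intro mult_right_mono) auto
   also have "... \<le> ((4 + ?g) * (1 + s powr (-1/4))) * B1"
    using g B1 by (intro mult_right_mono) (auto simp: algebra_simps)
   also have "\<bar>2 / pi * pseries bessel_log_coeff s\<bar> \<le> 1 * B3"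
    unfolding abs_mult using pi1 B3 True s by (intro mult_mono) auto
   also have "1 * B3 \<le> B3 * (1 + s powr (-1/4))" using B3 by (simp add: mult_left_le algebra_simps)
   finally have "\<bar>hankel_im s\<bar> \<le> ((4 + ?g) * B1 + B3) * (1 + s powr (-1/4))"
    by (simp add: algebra_simps)
   also have "... \<le> C * (1 + s powr (-1/4))" using Cge by (intro mult_right_mono) auto
   finally show ?thesis .
  next
   case False then show ?thesis using C2[of s] Cge by (intro up) auto
  qed
  show "\<bar>hankel_im' s - 1 / (pi * s)\<bar> \<le> C / sqrt s"
  proof (cases "s \<le> 1")
   case True
   have lns: "ln s \<le> ?g" using s True g ln_le_zero_iff[of s] by linarith
   have l: "\<bar>ln s\<bar> \<le> 2 / sqrt s"
    using abs_ln_le_powr[of s "1/2"] s True by (simp add: powr_minus_divide powr_half_sqrt)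
   have q: "1 \<le> 1 / sqrt s" using s True by simp
   have "hankel_im' s - 1 / (pi * s) = (hankel_re s - 1) / (pi * s) + (ln s + ?g) / pi * hankel_re' s
     - 2 / pi * pseries (diffs bessel_log_coeff) s"
    unfolding hankel_im'_def by (simp add: diff_divide_distrib)
   also have "\<bar>...\<bar> \<le> \<bar>(hankel_re s - 1) / (pi * s)\<bar> + \<bar>(ln s + ?g) / pi * hankel_re' s\<bar>
     + \<bar>2 / pi * pseries (diffs bessel_log_coeff) s\<bar>" by linarith
   also have "\<bar>(ln s + ?g) / pi * hankel_re' s\<bar> \<le> (\<bar>ln s\<bar> + ?g) * B2"
    unfolding abs_mult using lns lg g B2 True s by (intro mult_mono) auto
   also have "... \<le> (2 / sqrt s + ?g * (1 / sqrt s)) * B2"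
    using l B2 mult_left_mono[OF q g] by (intro mult_right_mono) auto
   also have "\<bar>(hankel_re s - 1) / (pi * s)\<bar> \<le> B2 * 1"
   proof -
    have "\<bar>hankel_re s - 1\<bar> \<le> B2 * s" using re1[of s] s True by simp
    then have "\<bar>hankel_re s - 1\<bar> / (pi * s) \<le> B2 * s / (pi * s)"
     using s by (intro divide_right_mono) auto
    then have "\<bar>(hankel_re s - 1) / (pi * s)\<bar> \<le> B2 * s / (pi * s)"
     using s by (simp only: abs_divide abs_mult abs_of_pos pi_gt_zero)
    also have "... = B2 * (1 / pi)" using s by simp
    also have "... \<le> B2 * 1" using pi1 B2 by (intro mult_left_mono) auto
    finally show ?thesis .
   qed
   also have "B2 * 1 \<le> B2 * (1 / sqrt s)" using q B2 by (intro mult_left_mono) auto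
   also have "\<bar>2 / pi * pseries (diffs bessel_log_coeff) s\<bar> \<le> 1 * B4"
    unfolding abs_mult using pi1 B4 True s by (intro mult_mono) auto
   also have "1 * B4 \<le> B4 * (1 / sqrt s)" using q B4 by (simp only: mult_1) (metis mult.right_neutral mult_left_mono)
   finally have "\<bar>hankel_im' s - 1 / (pi * s)\<bar> \<le> (B2 + (2 + ?g) * B2 + B4) * (1 / sqrt s)"
    by (simp add: algebra_simps)
   also have "... \<le> C * (1 / sqrt s)" using Cge s by (intro mult_right_mono) auto
   finally show ?thesis by simp
  next
   case False
   have "\<bar>hankel_im' s - 1 / (pi * s)\<bar> \<le> \<bar>hankel_im' s\<bar> + 1 / (pi * s)"
    using s by (smt (verit) divide_nonneg_pos mult_pos_pos pi_gt_zero)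
   also have "1 / (pi * s) \<le> 1 / sqrt s"
   proof -
    have "sqrt s \<le> s" using False by (simp add: real_le_lsqrt power2_eq_square)
    also have "s \<le> pi * s" using pi_gt3 s by simp
    finally show ?thesis using s by (intro divide_left_mono) auto
   qed
   also have "\<bar>hankel_im' s\<bar> \<le> C2 / sqrt s" using C2 False by simp
   finally have "\<bar>hankel_im' s - 1 / (pi * s)\<bar> \<le> (C2 + 1) / sqrt s" by (simp add: add_divide_distrib)
   also have "... \<le> C / sqrt s" by (rule divide_right_mono) (use Cge s in auto)
   finally show ?thesis .
  qed
 qed
qed

text \<open>Near zero the logarithm dominates. The real part of the fundamental solution is
  \<open>- hankel_im / 4\<close> and its imaginary part \<open>hankel_re / 4\<close>, so the former
  is positive and at least as large as the latter. This drives the lower bound on the norm of the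
  operator.\<close>

lemma hankel_small_argument:
 "\<exists>s0>0. \<forall>s. 0 < s \<and> s \<le> s0 --> hankel_im s \<le> -1 \<and> \<bar>hankel_re s\<bar> \<le> - hankel_im s"
proof -
 let ?g = "2 * euler_mascheroni :: real"
 have cont: "continuous_on {0..1} hankel_re" "continuous_on {0..1} (pseries bessel_log_coeff)"
  unfolding hankel_re_def by (auto intro!: pseries_isCont entire_coeff_diffs entire_bessel_coeff)
 obtain B where B: "B \<ge> 0" "\<And>s. s \<in> {0..1} ==> \<bar>pseries bessel_log_coeff s\<bar> \<le> B"
  using continuous_bounded_unit_interval[OF cont(2)] by blast
 have re0: "hankel_re 0 = 1"
  unfolding hankel_re_def pseries_def by (subst suminf_finite[of "{0}"]) (auto simp: bessel_coeff_def)
 have "isCont hankel_re 0" using hankel_re_deriv(1) by (rule DERIV_isCont)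
 then have "\<forall>\<^sub>F s in at 0. dist (hankel_re s) (hankel_re 0) < 1/2"
  unfolding isCont_def by (rule tendstoD) simp
 then obtain d where d: "d > 0" "\<And>s. s \<noteq> 0 ==> dist s 0 < d ==> \<bar>hankel_re s - 1\<bar> < 1/2"
  unfolding eventually_at re0 dist_real_def by auto
 \<comment> \<open>Below \<open>exp (- X)\<close> the logarithmic factor is at most
   \<open>- 2 * (B + 2)\<close>; multiplied by \<open>hankel_re s \<ge> 1/2\<close> it still beats
   the other series, whose contribution is at most \<open>B\<close>.\<close>
 define X where "X = 2 * pi * (B + 2) + ?g"
 define s0 where "s0 = min (d / 2) (min 1 (exp (- X)))"
 show ?thesis
 proof (intro exI conjI allI impI)
  show "s0 > 0" using d by (simp add: s0_def)
  fix s assume s: "0 < s \<and> s \<le> s0"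
  then have s1: "s \<in> {0..1}" "s < d" "s \<le> exp (- X)" using d by (auto simp: s0_def)
  have h: "\<bar>hankel_re s - 1\<bar> < 1/2" using d s s1 by simp
  have hh: "1/2 \<le> hankel_re s" using h unfolding abs_less_iff by linarith
  have "ln s \<le> - X" using s s1 by (metis exp_gt_zero ln_exp ln_le_cancel_iff)
  then have "ln s + ?g \<le> - (2 * pi * (B + 2))" by (simp add: X_def)
  then have l: "(ln s + ?g) / pi \<le> - (2 * (B + 2))" using pi_gt_zero by (simp add: field_simps)
  have t1: "(ln s + ?g) / pi * hankel_re s \<le> - (2 * (B + 2)) * (1/2)"
  proof -
   have "(ln s + ?g) / pi * hankel_re s \<le> - (2 * (B + 2)) * hankel_re s"
    using l hh by (intro mult_right_mono) auto
   also have "... \<le> - (2 * (B + 2)) * (1/2)"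
    using hh B(1) by (intro mult_left_mono_neg) auto
   finally show ?thesis .
  qed
  have t1': "(ln s + ?g) / pi * hankel_re s \<le> - B - 2" by (rule order_trans[OF t1]) simp
  have t2: "\<bar>2 / pi * pseries bessel_log_coeff s\<bar> \<le> 1 * B"
   unfolding abs_mult using pi_gt3 B s1 by (intro mult_mono) auto
  have "- (2 / pi * pseries bessel_log_coeff s) \<le> B" using abs_le_D2[OF t2] by simp
  then have im: "hankel_im s \<le> - 2" unfolding hankel_im_def using t1' by linarith
  then show "hankel_im s \<le> -1" by simp
  show "\<bar>hankel_re s\<bar> \<le> - hankel_im s" using im h by linarith
 qed
qed

section \<open>Linear differential equations with parameters\<close>

lemma continuous_imp_antiderivative:
 fixes f :: "real => real"
 assumes "continuous_on UNIV f" "0 < T"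
 obtains G where "\<And>t. \<bar>t\<bar> < T ==> (G has_real_derivative f t) (at t)"
proof -
 obtain G where G: "\<And>t. t \<in> {-T..T} ==> (G has_vector_derivative f t) (at t within {-T..T})"
  using antiderivative_continuous[of "-T" T f] assms continuous_on_subset by (metis subset_UNIV)
 show thesis
 proof (rule that)
  fix t assume "\<bar>t\<bar> < T"
  then have "t \<in> interior {-T..T}" by auto
  then show "DERIV G t :> f t"
   using G[of t] at_within_interior[of t "{-T..T}"] interior_subset[of "{-T..T}"]
   by (metis has_real_derivative_iff_has_vector_derivative subsetD)
 qed
qed

text \<open>The oriented integral from \<open>0\<close> to \<open>t\<close>, in a form that is valid for both signs of \<open>t\<close>.\<close>

definition volterra :: "(real \<times> 'p => real) => real \<times> 'p => real" where
 "volterra f = (\<lambda>(t, p). t * integral {0..1} (\<lambda>\<sigma>. f (t * \<sigma>, p)))"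

text \<open>The rescaled integral runs over the fixed interval from 0 to 1, so joint continuity is
  the theorem on parameter integrals.\<close>

lemma continuous_on_volterra:
 fixes f :: "real \<times> 'p::topological_space => real"
 assumes "continuous_on UNIV f"
 shows "continuous_on UNIV (volterra f)"
proof -
 have "continuous_on (UNIV \<times> cbox 0 1) (\<lambda>(z, \<sigma>). f (fst z * \<sigma>, snd z))"
  unfolding split_beta
  by (intro continuous_on_compose2[OF assms]) (auto intro!: continuous_intros)
 then have "continuous_on UNIV (\<lambda>z. integral (cbox 0 1) (\<lambda>\<sigma>. f (fst z * \<sigma>, snd z)))"
  by (rule integral_continuous_on_param)
 then show ?thesis unfolding volterra_def split_beta
  by (intro continuous_intros) simp_all
qed

lemma volterra_deriv:
 fixes f :: "real \<times> 'p::topological_space => real"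
 assumes "continuous_on UNIV f"
 shows "((\<lambda>t. volterra f (t, p)) has_real_derivative f (t, p)) (at t)"
proof -
 define T where "T = \<bar>t\<bar> + 1"
 have T: "T > 0" "\<bar>t\<bar> < T" by (auto simp: T_def)
 have cf: "continuous_on UNIV (\<lambda>t. f (t, p))"
  by (intro continuous_on_compose2[OF assms]) (auto intro!: continuous_intros)
 obtain G where G: "\<And>t. \<bar>t\<bar> < T ==> (G has_real_derivative f (t, p)) (at t)"
  using continuous_imp_antiderivative[OF cf T(1)] by blast
 have eq: "volterra f (s, p) = G s - G 0" if s: "\<bar>s\<bar> < T" for s
 proof -
  have "((\<lambda>\<sigma>. s * f (s * \<sigma>, p)) has_integral (G (s * 1) - G (s * 0))) {0..1}"
  proof (rule fundamental_theorem_of_calculus)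
   fix x :: real assume x: "x \<in> {0..1}"
   have "\<bar>s * x\<bar> \<le> \<bar>s\<bar> * 1" unfolding abs_mult using x by (intro mult_left_mono) auto
   then have "DERIV G (s * x) :> f (s * x, p)" using s by (intro G) simp
   then have "DERIV (\<lambda>\<sigma>. G (s * \<sigma>)) x :> f (s * x, p) * s"
    by (rule DERIV_chain2[where g = "\<lambda>x. s * x"]) (auto intro!: derivative_eq_intros)
   then       show "((\<lambda>\<sigma>. G (s * \<sigma>)) has_vector_derivative s * f (s * x, p)) (at x within {0..1})"
    by (simp add: has_real_derivative_iff_has_vector_derivative[symmetric] mult.commute
      has_field_derivative_at_within)
  qed simp
  then have "integral {0..1} (\<lambda>\<sigma>. s * f (s * \<sigma>, p)) = G s - G 0" by (simp only: mult_1_right mult_zero_right integral_unique)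
  then show ?thesis by (simp add: volterra_def)
 qed
 have "\<forall>\<^sub>F s in nhds t. \<bar>s\<bar> < T"
  using T(2) by (intro eventually_nhds_in_open[of "{s. \<bar>s\<bar> < T}" t, simplified])
   (auto intro!: open_Collect_less continuous_intros)
 then have "\<forall>\<^sub>F s in nhds t. volterra f (s, p) = G s - G 0"
  by eventually_elim (rule eq)
 moreover have "DERIV (\<lambda>s. G s - G 0) t :> f (t, p)"
  using G[OF T(2)] by (auto intro!: derivative_eq_intros)
 ultimately show ?thesis by (subst DERIV_cong_ev) auto
qed

lemma volterra_bound:
 fixes f :: "real \<times> 'p::topological_space => real"
 assumes "continuous_on UNIV f"
  and bd: "\<And>s. \<bar>s\<bar> \<le> \<bar>t\<bar> ==> \<bar>f (s, p)\<bar> \<le> A * \<bar>s\<bar> ^ n"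
 shows "\<bar>volterra f (t, p)\<bar> \<le> A * \<bar>t\<bar> ^ Suc n / Suc n"
proof -
 have cf: "continuous_on {0..1} (\<lambda>\<sigma>. f (t * \<sigma>, p))"
  by (intro continuous_on_compose2[OF assms(1)]) (auto intro!: continuous_intros)
 have "((\<lambda>\<sigma>. A * \<bar>t\<bar> ^ n * \<sigma> ^ n) has_integral (A * \<bar>t\<bar> ^ n * (1 ^ Suc n / Suc n) - A * \<bar>t\<bar> ^ n * (0 ^ Suc n / Suc n))) {0..1::real}"
  by (rule fundamental_theorem_of_calculus)
   (auto simp: has_real_derivative_iff_has_vector_derivative[symmetric] simp del: power_Suc
     intro!: derivative_eq_intros)
 then have I: "((\<lambda>\<sigma>. A * \<bar>t\<bar> ^ n * \<sigma> ^ n) has_integral (A * \<bar>t\<bar> ^ n / Suc n)) {0..1::real}"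
  by simp
 have "norm (integral {0..1} (\<lambda>\<sigma>. f (t * \<sigma>, p))) \<le> integral {0..1} (\<lambda>\<sigma>. A * \<bar>t\<bar> ^ n * \<sigma> ^ n)"
 proof (rule integral_norm_bound_integral)
  show "(\<lambda>\<sigma>. f (t * \<sigma>, p)) integrable_on {0..1}" using cf by (rule integrable_continuous_real)
  show "(\<lambda>\<sigma>. A * \<bar>t\<bar> ^ n * \<sigma> ^ n) integrable_on {0..1}" using I by blast
  fix x :: real assume x: "x \<in> {0..1}"
  have "\<bar>t * x\<bar> \<le> \<bar>t\<bar> * 1" unfolding abs_mult using x by (intro mult_left_mono) auto
  from bd[of "t * x"] this show "norm (f (t * x, p)) \<le> A * \<bar>t\<bar> ^ n * x ^ n"
   using x by (simp add: abs_mult power_mult_distrib)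
 qed
 also have "... = A * \<bar>t\<bar> ^ n / Suc n" using I by (rule integral_unique)
 finally have "\<bar>t\<bar> * \<bar>integral {0..1} (\<lambda>\<sigma>. f (t * \<sigma>, p))\<bar> \<le> \<bar>t\<bar> * (A * \<bar>t\<bar> ^ n / Suc n)"
  by (intro mult_left_mono) auto
 then show ?thesis by (simp add: volterra_def abs_mult ac_simps)
qed

lemma volterra_parity:
 assumes "\<And>s. f (- s, p) = e * f (s, p)"
 shows "volterra f (- t, p) = - e * volterra f (t, p)"
 by (simp add: volterra_def assms)

text \<open>Picard iterates of the system \<open>y' = z\<close>, \<open>z' = q y\<close>, merged
  into one sequence: even terms are the increments of \<open>y\<close>, odd terms those of its
  derivative.\<close>

primrec ode_terms :: "(real \<times> 'p => real) => nat => real \<times> 'p => real" where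
 "ode_terms q 0 = (\<lambda>z. 1)"
| "ode_terms q (Suc m) = volterra (\<lambda>z. (if even m then q z else 1) * ode_terms q m z)"

lemma continuous_on_ode_terms:
 fixes q :: "real \<times> 'p::topological_space => real"
 assumes "continuous_on UNIV q"
 shows "continuous_on UNIV (ode_terms q m)"
proof (induction m)
 case (Suc m)
 then show ?case using assms
  by (cases "even m") (auto intro!: continuous_on_volterra continuous_intros)
qed simp

text \<open>Each integration contributes one factor \<open>\<bar>t\<bar> / (m + 1)\<close>, so the
  terms are dominated by those of an exponential series.\<close>

lemma ode_terms_bound:
 fixes q :: "real \<times> 'p::topological_space => real"
 assumes q: "continuous_on UNIV q" and Q: "1 \<le> Q" "\<And>s. \<bar>s\<bar> \<le> T ==> \<bar>q (s, p)\<bar> \<le> Q" and "\<bar>t\<bar> \<le> T"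
 shows "\<bar>ode_terms q m (t, p)\<bar> \<le> Q ^ m / fact m * \<bar>t\<bar> ^ m"
 using \<open>\<bar>t\<bar> \<le> T\<close>
proof (induction m arbitrary: t)
 case (Suc m)
 let ?f = "\<lambda>z. (if even m then q z else 1) * ode_terms q m z"
 have c: "continuous_on UNIV ?f"
  using q continuous_on_ode_terms[OF q, of m] by (cases "even m") (auto intro!: continuous_intros)
 have "\<bar>volterra ?f (t, p)\<bar> \<le> (Q ^ Suc m / fact m) * \<bar>t\<bar> ^ Suc m / Suc m"
 proof (rule volterra_bound[OF c])
  fix s :: real assume s: "\<bar>s\<bar> \<le> \<bar>t\<bar>"
  have "\<bar>?f (s, p)\<bar> \<le> Q * (Q ^ m / fact m * \<bar>s\<bar> ^ m)"
   unfolding abs_mult using s Suc.prems Q by (intro mult_mono Suc.IH) auto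
  then show "\<bar>?f (s, p)\<bar> \<le> Q ^ Suc m / fact m * \<bar>s\<bar> ^ m" by simp
 qed
 then show ?case by (simp add: field_simps)
qed simp

lemma ode_terms_parity:
 assumes "\<And>s. q (- s, p) = q (s, p)"
 shows "ode_terms q m (- t, p) = (-1) ^ m * ode_terms q m (t, p)"
proof (induction m arbitrary: t)
 case (Suc m)
 show ?case unfolding ode_terms.simps
  by (subst volterra_parity[where e = "(-1) ^ m"]) (simp_all add: Suc.IH assms)
qed simp

text \<open>The point is joint continuity in time and parameter, on which the later fixed point
  argument rests; it comes from uniform convergence of the Picard series on compact sets. Parity is
  inherited from the single terms.\<close>

lemma linear_ode_solution:
 fixes q :: "real \<times> 'p::euclidean_space => real"
 assumes q: "continuous_on UNIV q"
 obtains y y' where "continuous_on UNIV y" "continuous_on UNIV y'"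
  "\<And>p. y (0, p) = 1" "\<And>p. y' (0, p) = 0"
  "\<And>t p. ((\<lambda>t. y (t, p)) has_real_derivative y' (t, p)) (at t)"
  "\<And>t p. ((\<lambda>t. y' (t, p)) has_real_derivative q (t, p) * y (t, p)) (at t)"
  "\<And>t p. (\<And>s. q (- s, p) = q (s, p)) ==> y (- t, p) = y (t, p) \<and> y' (- t, p) = - y' (t, p)"
proof -
 let ?z = "ode_terms q"
 define y where "y x = (\<Sum>n. ?z (2 * n) x)" for x
 define y' where "y' x = (\<Sum>n. ?z (2 * n + 1) x)" for x
 have Qex: "\<exists>Q\<ge>1. \<forall>s u. \<bar>s\<bar> \<le> T \<and> u \<in> cball p 1 --> \<bar>q (s, u)\<bar> \<le> Q" for T p
 proof -
  have "compact (q ` ({-T..T} \<times> cball p 1))"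
   by (intro compact_continuous_image compact_Times continuous_on_subset[OF q]) auto
  then obtain B where "\<forall>x\<in>q ` ({-T..T} \<times> cball p 1). norm x \<le> B"
   by (meson bounded_iff compact_imp_bounded)
  then have "\<forall>s u. \<bar>s\<bar> \<le> T \<and> u \<in> cball p 1 --> \<bar>q (s, u)\<bar> \<le> max B 1"
   by (auto simp: abs_le_iff le_max_iff_disj)
  then show ?thesis by (intro exI[of _ "max B 1"]) auto
 qed
 have smb: "\<exists>M. summable (\<lambda>n. M (2 * n)) \<and> summable (\<lambda>n. M (2 * n + 1)) \<and>
   (\<forall>m. \<forall>x \<in> {-T..T} \<times> cball p 1. norm (?z m x) \<le> M m)" for T p
 proof -
  obtain Q where Q: "Q \<ge> 1" "\<And>s u. \<bar>s\<bar> \<le> T ==> u \<in> cball p 1 ==> \<bar>q (s, u)\<bar> \<le> Q"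
   using Qex[where T = T and p = p] by blast
  define M where "M m = (Q * \<bar>T\<bar>) ^ m /\<^sub>R fact m" for m
  have sM: "summable M" unfolding M_def by (rule summable_exp_generic)
  have pos: "M m \<ge> 0" for m using Q by (simp add: M_def)
  have "summable (\<lambda>n. M (2 * n))"
   using summable_reindex[OF sM, of "\<lambda>n. 2 * n"] pos by (simp add: inj_on_def o_def)
  moreover have "summable (\<lambda>n. M (2 * n + 1))"
   using summable_reindex[OF sM, of "\<lambda>n. 2 * n + 1"] pos by (simp add: inj_on_def o_def)
  moreover have "norm (?z m x) \<le> M m" if "x \<in> {-T..T} \<times> cball p 1" for m x
  proof -
   obtain t u where x: "x = (t, u)" and tu: "\<bar>t\<bar> \<le> T" "u \<in> cball p 1" using \<open>x \<in> _\<close> by auto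
   have "\<bar>?z m x\<bar> \<le> Q ^ m / fact m * \<bar>t\<bar> ^ m"
    unfolding x using Q tu by (intro ode_terms_bound[OF q]) auto
   also have "... \<le> Q ^ m / fact m * \<bar>T\<bar> ^ m"
    using Q tu by (intro mult_left_mono power_mono) auto
   finally show ?thesis by (simp add: M_def power_mult_distrib field_simps)
  qed
  ultimately show ?thesis by blast
 qed
 have ul: "uniform_limit ({-T..T} \<times> cball p 1) (\<lambda>n x. \<Sum>i<n. ?z (2 * i) x) y sequentially"
  "uniform_limit ({-T..T} \<times> cball p 1) (\<lambda>n x. \<Sum>i<n. ?z (2 * i + 1) x) y' sequentially" for T p
 proof -
  obtain M where M: "summable (\<lambda>n. M (2 * n))" "summable (\<lambda>n. M (2 * n + 1))"
   "\<And>m x. x \<in> {-T..T} \<times> cball p 1 ==> norm (?z m x) \<le> M m"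
   using smb[where T = T and p = p] by metis
  show "uniform_limit ({-T..T} \<times> cball p 1) (\<lambda>n x. \<Sum>i<n. ?z (2 * i) x) y sequentially"
   unfolding y_def [abs_def] by (rule Weierstrass_m_test[OF M(3) M(1)])
  show "uniform_limit ({-T..T} \<times> cball p 1) (\<lambda>n x. \<Sum>i<n. ?z (2 * i + 1) x) y' sequentially"
   unfolding y'_def [abs_def] by (rule Weierstrass_m_test[OF M(3) M(2)])
 qed
 have cont: "continuous_on UNIV f"
  if "\<And>T p. continuous_on ({-T..T} \<times> cball p 1) f" for f :: "real \<times> 'p => real"
 proof -
  have "isCont f x" for x
  proof -
   obtain t p where x: "x = (t, p)" by fastforce
   have "x \<in> interior ({-(\<bar>t\<bar>+1)..\<bar>t\<bar>+1} \<times> cball p 1)"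
    using abs_ge_self[of t] abs_ge_minus_self[of t] by (simp add: x interior_Times)
   then show ?thesis using that[of "\<bar>t\<bar>+1" p] continuous_on_interior by blast
  qed
  then show ?thesis by (simp add: continuous_at_imp_continuous_on)
 qed
 have zc: "continuous_on S (?z m)" for m S
  using continuous_on_ode_terms[OF q] continuous_on_subset by blast
 have cy: "continuous_on UNIV y" "continuous_on UNIV y'"
 proof -
  show "continuous_on UNIV y"
   by (rule cont, rule uniform_limit_theorem[OF _ ul(1)]) (simp_all add: continuous_on_sum zc)
  show "continuous_on UNIV y'"
   by (rule cont, rule uniform_limit_theorem[OF _ ul(2)]) (simp_all add: continuous_on_sum zc del: ode_terms.simps)
 qed
 have ulT: "uniform_limit {-T..T} (\<lambda>n t. \<Sum>i<n. ?z (2 * i) (t, p)) (\<lambda>t. y (t, p)) sequentially"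
  "uniform_limit {-T..T} (\<lambda>n t. \<Sum>i<n. ?z (2 * i + 1) (t, p)) (\<lambda>t. y' (t, p)) sequentially" for T p
 proof -
  have sub: "(\<lambda>t. (t, p)) \<in> {-T..T} \<rightarrow> {-T..T} \<times> cball p 1" by simp
  show "uniform_limit {-T..T} (\<lambda>n t. \<Sum>i<n. ?z (2 * i) (t, p)) (\<lambda>t. y (t, p)) sequentially"
   using uniform_limit_compose'[OF ul(1)[where T = T and p = p] sub] .
  show "uniform_limit {-T..T} (\<lambda>n t. \<Sum>i<n. ?z (2 * i + 1) (t, p)) (\<lambda>t. y' (t, p)) sequentially"
   using uniform_limit_compose'[OF ul(2)[where T = T and p = p] sub] .
 qed
 have zder: "((\<lambda>t. ?z (Suc m) (t, p)) has_real_derivative (if even m then q (t, p) else 1) * ?z m (t, p)) (at t)" for m t p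
  unfolding ode_terms.simps using q continuous_on_ode_terms[OF q, of m]
  by (intro volterra_deriv[of "\<lambda>z. (if even m then q z else 1) * ?z m z"])
   (cases "even m", auto intro!: continuous_intros)
 have z0: "?z (Suc m) (0, p) = 0" for m p by (simp add: volterra_def)
 have sums0: "summable (\<lambda>n. ?z (2 * n) (0, p))" "summable (\<lambda>n. ?z (2 * n + 1) (0, p))" for p
 proof -
  have "?z (2 * n) (0, p) = 0" if "n \<notin> {0}" for n
   using z0[of "2 * n - 1" p] that by (cases n) (auto simp del: ode_terms.simps)
  then show "summable (\<lambda>n. ?z (2 * n) (0, p))" by (rule summable_finite[OF finite.insertI[OF finite.emptyI]])
  show "summable (\<lambda>n. ?z (2 * n + 1) (0, p))" using z0 by (simp del: ode_terms.simps)
 qed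
 have y0: "y (0, p) = 1" for p
 proof -
  have "y (0, p) = (\<Sum>n\<in>{0}. ?z (2 * n) (0, p))" unfolding y_def
  proof (rule suminf_finite)
   fix n :: nat assume "n \<notin> {0}"
   then show "?z (2 * n) (0, p) = 0"
    using z0[of "2 * n - 1" p] by (cases n) (auto simp del: ode_terms.simps)
  qed simp
  then show ?thesis by simp
 qed
 have y'0: "y' (0, p) = 0" for p
  unfolding y'_def using z0 by (simp del: ode_terms.simps)
 have der: "DERIV (\<lambda>t. y (t, p)) t :> y' (t, p)" for t p
 proof -
  define T where "T = \<bar>t\<bar> + 1"
  have tS: "t \<in> {-T..T}" and int: "t \<in> interior {-T..T}" by (auto simp: T_def)
  \<comment> \<open>The derivative of an even term is the odd term before it, and the constant first
    term has derivative 0; hence the shift by one.\<close>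
  have uc: "uniform_limit {-T..T} (\<lambda>n t. \<Sum>i<n. (if i = 0 then 0 else ?z (2 * (i - 1) + 1) (t, p))) (\<lambda>t. y' (t, p)) sequentially"
  proof -
   have "(\<Sum>i<Suc n. (if i = 0 then 0 else ?z (2 * (i - 1) + 1) (t, p))) = (\<Sum>i<n. ?z (2 * i + 1) (t, p))" for n t
    by (subst sum.lessThan_Suc_shift) simp
   then have "uniform_limit {-T..T} (\<lambda>n t. \<Sum>i<Suc n. (if i = 0 then 0 else ?z (2 * (i - 1) + 1) (t, p))) (\<lambda>t. y' (t, p)) sequentially"
    using ulT(2)[where T = T and p = p] by simp
   then show ?thesis unfolding filterlim_sequentially_Suc[of "\<lambda>n t. \<Sum>i<n. (if i = 0 then 0 else ?z (2 * (i - 1) + 1) (t, p))"] .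
  qed
  have "((\<lambda>t. ?z (2 * n) (t, p)) has_real_derivative (if n = 0 then 0 else ?z (2 * (n - 1) + 1) (t, p))) (at t within {-T..T})" for n t
  proof (cases n)
   case (Suc m)
   show ?thesis using has_field_derivative_at_within[OF zder[of "2 * m + 1" p t]] by (simp add: Suc)
  qed simp
  note * = this
  have "0 \<in> {-T..T}" by (auto simp: T_def)
  then obtain g where g: "\<And>x. x \<in> {-T..T} ==> (\<lambda>n. ?z (2 * n) (x, p)) sums g x"
   "\<And>x. x \<in> {-T..T} ==> (g has_field_derivative y' (x, p)) (at x within {-T..T})"
   using has_field_derivative_series[OF convex_real_interval(5) * uc _ sums0(1)] by metis
  have geq: "g x = y (x, p)" if "x \<in> {-T..T}" for x
   using g(1)[OF that] by (simp add: y_def sums_iff)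
  then have "((\<lambda>x. y (x, p)) has_field_derivative y' (t, p)) (at t within {-T..T})"
   by (intro has_field_derivative_transform_within[OF g(2)[OF tS] zero_less_one tS]) (rule geq)
  then show ?thesis unfolding at_within_interior[OF int] .
 qed
 have der': "DERIV (\<lambda>t. y' (t, p)) t :> q (t, p) * y (t, p)" for t p
 proof -
  define T where "T = \<bar>t\<bar> + 1"
  have tS: "t \<in> {-T..T}" and int: "t \<in> interior {-T..T}" by (auto simp: T_def)
  obtain Q where Q: "\<And>s. \<bar>s\<bar> \<le> T ==> \<bar>q (s, p)\<bar> \<le> Q" using Qex[where T = T and p = p] centre_in_cball[of p 1] zero_le_one by metis
  have uc: "uniform_limit {-T..T} (\<lambda>n t. \<Sum>i<n. q (t, p) * ?z (2 * i) (t, p)) (\<lambda>t. q (t, p) * y (t, p)) sequentially"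
  proof -
   have "bounded ((\<lambda>t. q (t, p)) ` {-T..T})" using Q by (auto simp: bounded_iff intro!: exI[of _ Q])
   moreover have "bounded ((\<lambda>t. y (t, p)) ` {-T..T})"
    by (intro compact_imp_bounded compact_continuous_image continuous_on_compose2[OF cy(1)]) (auto intro!: continuous_intros)
   ultimately show ?thesis
    unfolding sum_distrib_left[symmetric]
    by (intro bounded_bilinear.bounded_uniform_limit[OF bounded_bilinear_mult] uniform_limit_const ulT(1))
  qed
  have "((\<lambda>t. ?z (2 * n + 1) (t, p)) has_real_derivative q (t, p) * ?z (2 * n) (t, p)) (at t within {-T..T})" for n t
   using has_field_derivative_at_within[OF zder[of "2 * n" p t]] by simp
  note * = this
  have "0 \<in> {-T..T}" by (auto simp: T_def)
  then obtain g where g: "\<And>x. x \<in> {-T..T} ==> (\<lambda>n. ?z (2 * n + 1) (x, p)) sums g x"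
   "\<And>x. x \<in> {-T..T} ==> (g has_field_derivative q (x, p) * y (x, p)) (at x within {-T..T})"
   using has_field_derivative_series[OF convex_real_interval(5) * uc _ sums0(2)] by metis
  have geq: "g x = y' (x, p)" if "x \<in> {-T..T}" for x
   using g(1)[OF that] by (simp add: y'_def sums_iff)
  then have "((\<lambda>x. y' (x, p)) has_field_derivative q (t, p) * y (t, p)) (at t within {-T..T})"
   by (intro has_field_derivative_transform_within[OF g(2)[OF tS] zero_less_one tS]) (rule geq)
  then show ?thesis unfolding at_within_interior[OF int] .
 qed
 have par: "y (- t, p) = y (t, p) \<and> y' (- t, p) = - y' (t, p)" if "\<And>s. q (- s, p) = q (s, p)" for t p
 proof -
  have "summable (\<lambda>n. ?z (2 * n + 1) (t, p))"
  proof -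
   obtain M where M: "summable (\<lambda>n. M (2 * n + 1))"
    "\<And>m x. x \<in> {-\<bar>t\<bar>..\<bar>t\<bar>} \<times> cball p 1 ==> norm (?z m x) \<le> M m"
    using smb[where T = "\<bar>t\<bar>" and p = p] by metis
   have "(t, p) \<in> {-\<bar>t\<bar>..\<bar>t\<bar>} \<times> cball p 1" by simp linarith
   then show ?thesis using M by (intro summable_comparison_test'[OF M(1), of 0]) metis
  qed
  then have "(\<Sum>n. - ?z (2 * n + 1) (t, p)) = - (\<Sum>n. ?z (2 * n + 1) (t, p))" by (rule suminf_minus)
  moreover have "?z (2 * n) (- t, p) = ?z (2 * n) (t, p)" "?z (2 * n + 1) (- t, p) = - ?z (2 * n + 1) (t, p)" for n
   using ode_terms_parity[of q p, OF that] by (simp_all del: ode_terms.simps)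
  ultimately show ?thesis by (simp add: y_def y'_def del: ode_terms.simps)
 qed
 show thesis by (rule that[OF cy y0 y'0 der der' par])
qed

section \<open>Quasimodes in elliptic coordinates\<close>

text \<open>Move each point by \<open>- (f, g)\<close> and clamp it back into the rectangle. At a
  Brouwer fixed point a nonzero value of \<open>f\<close> or \<open>g\<close> would force the point
  onto an edge where the assumption prescribes the opposite sign.\<close>

lemma poincare_miranda:
 fixes f g :: "real \<times> real => real"
 assumes ab: "a \<le> b" "c \<le> d"
  and cont: "continuous_on ({a..b} \<times> {c..d}) f" "continuous_on ({a..b} \<times> {c..d}) g"
  and f: "\<And>y. y \<in> {c..d} ==> f (a, y) \<le> 0 \<and> 0 \<le> f (b, y)"
  and g: "\<And>x. x \<in> {a..b} ==> g (x, c) \<le> 0 \<and> 0 \<le> g (x, d)"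
 obtains x y where "x \<in> {a..b}" "y \<in> {c..d}" "f (x, y) = 0" "g (x, y) = 0"
proof -
 let ?S = "{a..b} \<times> {c..d}"
 define F where "F z = (max a (min b (fst z - f z)), max c (min d (snd z - g z)))" for z
 have "continuous_on ?S F"
  unfolding F_def using cont by (intro continuous_intros)
 moreover have "F \<in> ?S \<rightarrow> ?S" unfolding F_def using ab by auto
 moreover have "compact ?S" "convex ?S" "?S \<noteq> {}"
  using ab by (auto intro!: compact_Times convex_Times)
 ultimately obtain z where z: "z \<in> ?S" "F z = z" using brouwer by metis
 obtain x y where xy: "z = (x, y)" by fastforce
 have 1: "x \<in> {a..b}" "y \<in> {c..d}" using z(1) xy by auto
 have 2: "max a (min b (x - f (x, y))) = x" "max c (min d (y - g (x, y))) = y"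
  using z(2) unfolding F_def xy by auto
 have "f (x, y) = 0"
 proof (rule ccontr)
  assume n: "f (x, y) \<noteq> 0"
  have "x = a \<and> f (x, y) > 0 \<or> x = b \<and> f (x, y) < 0"
   using 2(1) 1(1) n by (auto simp: max_def min_def split: if_splits)
  then show False using f[OF 1(2)] by auto
 qed
 moreover have "g (x, y) = 0"
 proof (rule ccontr)
  assume n: "g (x, y) \<noteq> 0"
  have "y = c \<and> g (x, y) > 0 \<or> y = d \<and> g (x, y) < 0"
   using 2(2) 1(2) n by (auto simp: max_def min_def split: if_splits)
  then show False using g[OF 1(1)] by auto
 qed
 ultimately show thesis using 1 that by blast
qed

text \<open>That the first zero of a solution sits at the end of an interval will be encoded as
  minimum zero over that interval. Unlike the position of a zero, the minimum always exists and
  depends continuously on the parameters.\<close>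

lemma continuous_on_Inf_param:
 fixes F :: "real \<times> 'a::metric_space => real"
 assumes F: "continuous_on ({0..d} \<times> S) F" and S: "compact S" and d: "0 \<le> d"
 shows "continuous_on S (\<lambda>p. Inf ((\<lambda>t. F (t, p)) ` {0..d}))"
proof -
 let ?m = "\<lambda>p. Inf ((\<lambda>t. F (t, p)) ` {0..d})"
 have uc: "uniformly_continuous_on ({0..d} \<times> S) F"
  using F S by (intro compact_uniformly_continuous compact_Times) auto
 have bdd: "bdd_below ((\<lambda>t. F (t, p)) ` {0..d})" if "p \<in> S" for p
 proof -
  have "compact ((\<lambda>t. F (t, p)) ` {0..d})"
   using that by (intro compact_continuous_image continuous_on_compose2[OF F]) (auto intro!: continuous_intros)
  then show ?thesis by (meson bounded_imp_bdd_below compact_imp_bounded)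
 qed
 have le: "?m p \<le> ?m p' + e"
  if "p \<in> S" "p' \<in> S" "\<And>t. t \<in> {0..d} ==> F (t, p) \<le> F (t, p') + e" for p p' e
 proof -
  have "?m p - e \<le> ?m p'"
  proof (rule cInf_greatest)
   show "(\<lambda>t. F (t, p')) ` {0..d} \<noteq> {}" using d by auto
   fix x assume "x \<in> (\<lambda>t. F (t, p')) ` {0..d}"
   then obtain t where t: "t \<in> {0..d}" "x = F (t, p')" by auto
   have "?m p \<le> F (t, p)" using bdd[OF that(1)] t by (intro cInf_lower) auto
   then show "?m p - e \<le> x" using that(3)[OF t(1)] t by simp
  qed
  then show ?thesis by simp
 qed
 show ?thesis
  unfolding continuous_on_iff
 proof (intro ballI allI impI)
  fix p and e :: real assume p: "p \<in> S" and e: "0 < e"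
  have e2: "0 < e / 2" using e by simp
  from uc[unfolded uniformly_continuous_on_def, rule_format, OF e2]
  obtain r where r: "r > 0" "\<And>x x'. x \<in> {0..d} \<times> S ==> x' \<in> {0..d} \<times> S ==> dist x' x < r ==> dist (F x') (F x) < e / 2"
   by blast
  show "\<exists>r>0. \<forall>p'\<in>S. dist p' p < r --> dist (?m p') (?m p) < e"
  proof (intro exI conjI ballI impI)
   show "r > 0" by fact
   fix p' assume p': "p' \<in> S" "dist p' p < r"
   have "dist (F (t, p')) (F (t, p)) < e / 2" if "t \<in> {0..d}" for t
    using r(2)[of "(t, p)" "(t, p')"] p p' that by (simp add: dist_Pair_Pair)
   then have *: "\<bar>F (t, p') - F (t, p)\<bar> < e / 2" if "t \<in> {0..d}" for t
    using that by (simp add: dist_real_def)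
   have "?m p' \<le> ?m p + e / 2"
   proof (rule le)
    show "F (t, p') \<le> F (t, p) + e / 2" if "t \<in> {0..d}" for t using *[OF that] by linarith
   qed fact+
   moreover have "?m p \<le> ?m p' + e / 2"
   proof (rule le)
    show "F (t, p) \<le> F (t, p') + e / 2" if "t \<in> {0..d}" for t using *[OF that] by linarith
   qed fact+
   ultimately show "dist (?m p') (?m p) < e" using e by (simp add: dist_real_def)
  qed
 qed
qed

text \<open>The angle of \<open>(M, - M'/K)\<close>, as an explicit integral; its value detects the zeros of \<open>M\<close>.\<close>

lemma pruefer_angle:
 fixes M P a :: "real => real"
 assumes M: "\<And>t. (M has_real_derivative K * P t) (at t)"
  and P: "\<And>t. (P has_real_derivative - K * a t * M t) (at t)"
  and a: "continuous_on UNIV a" and "0 \<le> T"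
  and nz: "\<And>t. t \<in> {0..T} ==> (M t)^2 + (P t)^2 > 0"
  and "P 0 = 0"
  and c: "cos (integral {0..T} (\<lambda>t. K * ((P t)^2 + a t * (M t)^2) / ((M t)^2 + (P t)^2))) = 0"
 shows "M T = 0"
proof -
 define g where "g t = K * ((P t)^2 + a t * (M t)^2) / ((M t)^2 + (P t)^2)" for t
 \<comment> \<open>\<open>g\<close> is the angular speed and \<open>l\<close> the logarithmic
   derivative of the radius. With both removed, \<open>D\<close> is constant, hence 0, and no branch
   of the angle has to be chosen.\<close>
 define l where "l t = K * (1 - a t) * M t * P t / ((M t)^2 + (P t)^2)" for t
 have cM: "continuous_on S M" "continuous_on S P" "continuous_on S a" for S
  using M P a by (auto intro: continuous_at_imp_continuous_on DERIV_isCont continuous_on_subset)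
 have cg: "continuous_on {0..T} g" "continuous_on {0..T} l"
 proof -
  have "(M t)^2 + (P t)^2 \<noteq> 0" if "t \<in> {0..T}" for t using nz[OF that] by linarith
  then show "continuous_on {0..T} g" "continuous_on {0..T} l"
   unfolding g_def l_def by (intro continuous_intros cM ballI; simp)+
 qed
 define th where "th t = integral {0..t} g" for t
 define L where "L t = integral {0..t} l" for t
 have th: "(th has_real_derivative g t) (at t within {0..T})" "(L has_real_derivative l t) (at t within {0..T})"
  if "t \<in> {0..T}" for t
  using that cg integral_has_real_derivative unfolding th_def L_def by blast+
 define D where "D t = (M t * sin (th t) + P t * cos (th t)) * exp (- L t)" for t
 have "(D has_real_derivative 0) (at t within {0..T})" if t: "t \<in> {0..T}" for t
 proof -
  let ?r = "(M t)^2 + (P t)^2"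
  have r: "?r > 0" using nz[OF t] .
  have g1: "K - g t = K * (1 - a t) * (M t)^2 / ?r" and g2: "g t - K * a t = K * (1 - a t) * (P t)^2 / ?r"
  proof -
   have *: "K - K * (p + b * m) / R = K * (1 - b) * m / R" "K * (p + b * m) / R - K * b = K * (1 - b) * p / R"
    if "R \<noteq> 0" "R = m + p" for R m p b :: real
    using that by (simp_all add: divide_simps) (simp_all add: algebra_simps)
   have "?r \<noteq> 0" using r by linarith
   then show "K - g t = K * (1 - a t) * (M t)^2 / ?r" and "g t - K * a t = K * (1 - a t) * (P t)^2 / ?r"
    unfolding g_def by (intro *; simp)+
  qed
  have "(K - g t) * P t * sin (th t) + (g t - K * a t) * M t * cos (th t)
   = l t * (M t * sin (th t) + P t * cos (th t))"
   unfolding g1 g2 l_def by (simp add: power2_eq_square algebra_simps add_divide_distrib diff_divide_distrib)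
  then have "(K * P t) * sin (th t) + M t * (cos (th t) * g t) + ((- K * a t * M t) * cos (th t) - P t * (sin (th t) * g t))
    - l t * (M t * sin (th t) + P t * cos (th t)) = 0" by (simp add: algebra_simps)
  then have e: "((K * P t) * sin (th t) + M t * (cos (th t) * g t) + ((- K * a t * M t) * cos (th t) - P t * (sin (th t) * g t))) * exp (- L t)
    - l t * (M t * sin (th t) + P t * cos (th t)) * exp (- L t) = 0" 
   by (metis left_diff_distrib mult_zero_left)
  show ?thesis
   unfolding D_def
   apply (rule derivative_eq_intros refl th[OF t] has_field_derivative_at_within[OF M] has_field_derivative_at_within[OF P])+
   using e by (simp add: algebra_simps)
 qed
 then obtain C where C: "\<And>t. t \<in> {0..T} ==> D t = C"
  using has_field_derivative_zero_constant[of "{0..T}" D] by (metis convex_real_interval(5))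
 have "D 0 = 0" using \<open>P 0 = 0\<close> by (simp add: D_def th_def)
 then have "D T = 0" using C[of 0] C[of T] \<open>0 \<le> T\<close> by simp
 moreover have "cos (th T) = 0" using c by (simp add: th_def g_def [abs_def])
 moreover then have "sin (th T) \<noteq> 0" by (metis sin_zero_abs_cos_one abs_zero zero_neq_one)
 ultimately show ?thesis by (simp add: D_def)
qed

text \<open>Multiplied by \<open>exp ((1 + Q) * t)\<close> the energy cannot decrease, so a solution
  and its derivative never vanish together.\<close>

lemma linear_ode_energy_pos:
 fixes N N' q :: "real => real"
 assumes N: "\<And>t. (N has_real_derivative N' t) (at t)" "\<And>t. (N' has_real_derivative q t * N t) (at t)"
  and q: "\<And>t. t \<in> {0..T} ==> \<bar>q t\<bar> \<le> Q" and "N 0 \<noteq> 0" and t: "t \<in> {0..T}"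
 shows "(N t)^2 + (N' t)^2 > 0"
proof -
 let ?E = "\<lambda>t. ((N t)^2 + (N' t)^2) * exp ((1 + Q) * t)"
 have "?E 0 \<le> ?E t"
 proof (rule DERIV_nonneg_imp_nondecreasing[where f = "?E"])
  show "0 \<le> t" using t by simp
  fix x assume x: "0 \<le> x" "x \<le> t"
  have qx: "\<bar>q x\<bar> \<le> Q" using q t x by auto
  have "\<bar>2 * N x * N' x\<bar> \<le> (N x)^2 + (N' x)^2"
   using sum_squares_bound[of "\<bar>N x\<bar>" "\<bar>N' x\<bar>"] by (simp add: abs_mult)
  then have "\<bar>2 * N x * N' x\<bar> * \<bar>1 + q x\<bar> \<le> ((N x)^2 + (N' x)^2) * (1 + Q)"
   using qx by (intro mult_mono) auto
  then have b: "0 \<le> 2 * N x * N' x * (1 + q x) + ((N x)^2 + (N' x)^2) * (1 + Q)"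
   unfolding abs_mult[symmetric] by linarith
  have "DERIV ?E x :> (2 * N x * N' x * (1 + q x) + ((N x)^2 + (N' x)^2) * (1 + Q)) * exp ((1 + Q) * x)"
   by (rule derivative_eq_intros refl N | simp add: algebra_simps power2_eq_square)+
  then show "\<exists>y. DERIV ?E x :> y \<and> 0 \<le> y"
   using b by (meson exp_ge_zero mult_nonneg_nonneg)
 qed
 moreover have "?E 0 > 0" using \<open>N 0 \<noteq> 0\<close> by (simp add: sum_power2_gt_zero_iff)
 ultimately have "?E t > 0" by linarith
 then show ?thesis by (simp add: zero_less_mult_iff)
qed

text \<open>Sturm comparison with \<open>cos (w * t)\<close>: were \<open>N\<close> positive on the
  quarter period, the Wronskian \<open>?W\<close> would be nondecreasing from 0, yet it ends at
  \<open>- N ?T * w < 0\<close>.\<close>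

lemma sturm_zero:
 fixes N N' q :: "real => real"
 assumes N: "\<And>t. (N has_real_derivative N' t) (at t)" "\<And>t. (N' has_real_derivative q t * N t) (at t)"
  and "N' 0 = 0" and w: "w > 0"
  and q: "\<And>t. t \<in> {0..pi / (2 * w)} ==> q t \<le> - w\<^sup>2"
 obtains t where "t \<in> {0..pi / (2 * w)}" "N t \<le> 0"
proof (rule ccontr)
 assume a: "\<not> thesis"
 let ?T = "pi / (2 * w)"
 have pos: "N t > 0" if "t \<in> {0..?T}" for t using a that \<open>\<And>t. t \<in> {0..?T} ==> N t \<le> 0 ==> thesis\<close> by force
 let ?W = "\<lambda>t. - N t * (w * sin (w * t)) - N' t * cos (w * t)"
 have "?W 0 \<le> ?W ?T"
 proof (rule DERIV_nonneg_imp_nondecreasing[where f = "?W"])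
  show "0 \<le> ?T" using w by simp
  fix x assume x: "0 \<le> x" "x \<le> ?T"
  then have "w * x \<le> pi / 2" using w by (simp add: field_simps)
  then have "cos (w * x) \<ge> 0" using x w by (intro cos_ge_zero) (auto intro: order_trans[of _ 0])
  moreover have "N x > 0" using pos x by auto
  moreover have "- w\<^sup>2 - q x \<ge> 0" using q[of x] x by auto
  ultimately have "0 \<le> (- w\<^sup>2 - q x) * N x * cos (w * x)" by (intro mult_nonneg_nonneg) auto
  moreover have "DERIV ?W x :> (- w\<^sup>2 - q x) * N x * cos (w * x)"
   by (rule derivative_eq_intros refl N | simp add: algebra_simps power2_eq_square)+
  ultimately show "\<exists>y. DERIV ?W x :> y \<and> 0 \<le> y" by blast
 qed
 moreover have "?W 0 = 0" using \<open>N' 0 = 0\<close> by simp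
 moreover have "?W ?T = - N ?T * w" using w by (simp add: field_simps)
 moreover have "N ?T > 0" using pos w by simp
 ultimately show False using w by (smt (verit) mult_minus_left mult_pos_pos)
qed

text \<open>\<open>N * N'\<close> is nondecreasing from 0, so \<open>N^2\<close> never falls below 1
  and \<open>N\<close> cannot cross zero.\<close>

lemma convex_solution_pos:
 fixes N N' q :: "real => real"
 assumes N: "\<And>t. (N has_real_derivative N' t) (at t)" "\<And>t. (N' has_real_derivative q t * N t) (at t)"
  and "N 0 = 1" "N' 0 = 0" and q: "\<And>t. t \<in> {0..T} ==> q t \<ge> 0" and t: "t \<in> {0..T}"
 shows "N t \<ge> 0"
proof -
 have NN: "N x * N' x \<ge> 0" if x: "x \<in> {0..T}" for x
 proof -
  have "(\<lambda>t. N t * N' t) 0 \<le> (\<lambda>t. N t * N' t) x"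
  proof (rule DERIV_nonneg_imp_nondecreasing[where f = "\<lambda>t. N t * N' t"])
   show "0 \<le> x" using x by simp
   fix s assume s: "0 \<le> s" "s \<le> x"
   have "DERIV (\<lambda>t. N t * N' t) s :> (N' s)\<^sup>2 + q s * (N s)^2"
    by (rule derivative_eq_intros refl N | simp add: algebra_simps power2_eq_square)+
   moreover have "q s \<ge> 0" using q s x by auto
   ultimately show "\<exists>y. DERIV (\<lambda>t. N t * N' t) s :> y \<and> 0 \<le> y"
    by (meson add_nonneg_nonneg mult_nonneg_nonneg zero_le_power2)
  qed
  then show ?thesis using assms by simp
 qed
 have sq: "(N x)^2 \<ge> 1" if x: "x \<in> {0..T}" for x
 proof -
  have "(\<lambda>t. (N t)\<^sup>2) 0 \<le> (\<lambda>t. (N t)\<^sup>2) x"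
  proof (rule DERIV_nonneg_imp_nondecreasing[where f = "\<lambda>t. (N t)\<^sup>2"])
   show "0 \<le> x" using x by simp
   fix s assume s: "0 \<le> s" "s \<le> x"
   have "DERIV (\<lambda>t. (N t)\<^sup>2) s :> 2 * (N s * N' s)"
    by (rule derivative_eq_intros refl N | simp)+
   moreover have "N s * N' s \<ge> 0" using NN s x by auto
   ultimately show "\<exists>y. DERIV (\<lambda>t. (N t)\<^sup>2) s :> y \<and> 0 \<le> y" by (metis mult_nonneg_nonneg zero_le_numeral)
  qed
  then show ?thesis using assms by simp
 qed
 show ?thesis
 proof (rule ccontr)
  assume "\<not> 0 \<le> N t"
  then obtain x where "0 \<le> x" "x \<le> t" "N x = 0"
   using IVT2[of N t 0 0] assms(3) t N(1) by (auto intro: DERIV_isCont)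
  then show False using sq[of x] t by auto
 qed
qed

text \<open>A nonnegative solution that ends at zero is of decaying type:
  \<open>(N' + k * N) * exp (- k * t)\<close> is nondecreasing and its final value is nonpositive.
  Convexity then bounds the derivative by a difference quotient. The case \<open>k = 0\<close> is
  used too, where it gives monotonicity.\<close>

lemma decaying_solution:
 fixes N N' q :: "real => real"
 assumes N: "\<And>t. (N has_real_derivative N' t) (at t)" "\<And>t. (N' has_real_derivative q t * N t) (at t)"
  and q: "\<And>t. t \<in> {a..d} ==> q t \<ge> k^2" and k: "k \<ge> 0" and ad: "a < d"
  and nn: "\<And>t. t \<in> {a..d} ==> N t \<ge> 0" and "N d = 0"
 shows "\<And>t. t \<in> {a..d} ==> N' t \<le> - k * N t"
  and "\<And>s t. a \<le> s ==> s \<le> t ==> t \<le> d ==> N t \<le> N s * exp (- k * (t - s))"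
  and "\<And>s t. a \<le> s ==> s \<le> t ==> t \<le> d ==> (t - s) * \<bar>N' t\<bar> \<le> N s"
proof -
 have N'd: "N' d \<le> 0"
 proof (rule ccontr)
  assume "\<not> N' d \<le> 0"
  then obtain r where r: "r > 0" "\<And>h. 0 < h ==> h < r ==> N (d - h) < N d"
   using DERIV_pos_inc_left[OF N(1)[of d]] by auto
  define h where "h = min (r / 2) ((d - a) / 2)"
  have h: "0 < h" "h < r" "a \<le> d - h" "d - h \<le> d"
   using r(1) ad by (auto simp: h_def min_def field_simps)
  have "N (d - h) < 0" using r(2)[OF h(1,2)] \<open>N d = 0\<close> by simp
  then show False using nn[of "d - h"] h by auto
 qed
 show d1: "N' t \<le> - k * N t" if t: "t \<in> {a..d}" for t
 proof -
  let ?u = "\<lambda>t. (N' t + k * N t) * exp (- k * t)"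
  have "?u t \<le> ?u d"
  proof (rule DERIV_nonneg_imp_nondecreasing[where f = "?u"])
   show "t \<le> d" using t by simp
   fix s assume s: "t \<le> s" "s \<le> d"
   have "DERIV ?u s :> (q s - k^2) * N s * exp (- k * s)"
    by (rule derivative_eq_intros refl N | simp add: algebra_simps power2_eq_square)+
   moreover have "0 \<le> (q s - k^2) * N s" using q[of s] nn[of s] s t by auto
   ultimately show "\<exists>y. DERIV ?u s :> y \<and> 0 \<le> y" by (meson exp_ge_zero mult_nonneg_nonneg)
  qed
  also have "?u d \<le> 0" using N'd \<open>N d = 0\<close> by (simp add: mult_le_0_iff)
  finally show ?thesis by (simp add: mult_le_0_iff)
 qed
 show "N t \<le> N s * exp (- k * (t - s))" if "a \<le> s" "s \<le> t" "t \<le> d" for s t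
 proof -
  let ?v = "\<lambda>t. N t * exp (k * t)"
  have "?v t \<le> ?v s"
  proof (rule DERIV_nonpos_imp_nonincreasing[where f = "?v"])
   show "s \<le> t" by fact
   fix x assume x: "s \<le> x" "x \<le> t"
   have "DERIV ?v x :> (N' x + k * N x) * exp (k * x)"
    by (rule derivative_eq_intros refl N | simp add: algebra_simps)+
   moreover have "N' x + k * N x \<le> 0" using d1[of x] x that by auto
   ultimately show "\<exists>y. DERIV ?v x :> y \<and> y \<le> 0" by (meson exp_ge_zero mult_nonpos_nonneg)
  qed
  then have "N t * exp (k * t) * exp (- k * t) \<le> N s * exp (k * s) * exp (- k * t)"
   by (intro mult_right_mono) auto
  then show ?thesis by (simp add: mult.assoc exp_add[symmetric] algebra_simps)
 qed
 show "(t - s) * \<bar>N' t\<bar> \<le> N s" if st: "a \<le> s" "s \<le> t" "t \<le> d" for s t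
 proof (cases "s = t")
  case False
  then have "s < t" using st by simp
  then obtain z where z: "s < z" "z < t" "N t - N s = (t - s) * N' z"
   using MVT2[of s t N N'] N(1) by blast
  have "N' z \<le> N' t"
  proof (rule DERIV_nonneg_imp_nondecreasing[where f = "N'"])
   show "z \<le> t" using z by simp
   fix x assume x: "z \<le> x" "x \<le> t"
   have "k^2 \<le> q x" using q[of x] x z st by auto
   then have "0 \<le> q x" by (meson order_trans zero_le_power2)
   moreover have "0 \<le> N x" using nn x z st by auto
   ultimately show "\<exists>y. DERIV N' x :> y \<and> 0 \<le> y"
    using N(2)[of x] by (meson mult_nonneg_nonneg)
  qed
  moreover have "N' t \<le> 0" using d1[of t] nn[of t] k st by (smt (verit) atLeastAtMost_iff mult_nonneg_nonneg mult_minus_left)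
  ultimately have "(t - s) * \<bar>N' t\<bar> \<le> (t - s) * (- N' z)" using st by (intro mult_left_mono) auto
  also have "... = N s - N t" using z(3) by simp
  also have "... \<le> N s" using nn[of t] st by auto
  finally show ?thesis .
 qed (use nn st in auto)
qed

text \<open>For every large odd multiple of \<open>\<pi>/2\<close> the two boundary conditions can be met simultaneously:
 the first zero of \<open>N\<close> is at \<open>\<delta>\<close>, and \<open>M\<close> vanishes at \<open>\<mu>\<close>.\<close>

lemma separated_eigenpair:
 fixes \<mu> \<delta> B :: real
 assumes mu: "0 < \<mu>" and d: "0 < \<delta>" "\<delta> < pi / 2"
 obtains K b N N' M M' where "K > B" "K > 0" "0 \<le> b" "b \<le> (sin (\<delta> / 4))^2"
  "\<And>t. (N has_real_derivative N' t) (at t)"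
  "\<And>t. (N' has_real_derivative K\<^sup>2 * ((sin t)^2 - b) * N t) (at t)"
  "\<And>t. N (- t) = N t" "\<And>t. N' (- t) = - N' t" "N \<delta> = 0" "\<And>t. t \<in> {0..<\<delta>} ==> N t > 0"
  "\<And>t. (M has_real_derivative M' t) (at t)"
  "\<And>t. (M' has_real_derivative - K\<^sup>2 * ((cosh t)^2 - b) * M t) (at t)"
  "\<And>t. M (- t) = M t" "\<And>t. M' (- t) = - M' t" "M \<mu> = 0" "M 0 = 1" "M' 0 = 0"
proof -
 \<comment> \<open>For \<open>b \<le> b1\<close> the turning point, where the angular coefficient
   changes sign, lies within \<open>\<delta> / 4\<close> of the axis; beyond it the angular solution
   can only decay.\<close>
 define b1 where "b1 = (sin (\<delta> / 4))^2"
 have s8: "0 < sin (\<delta> / 8)" "sin (\<delta> / 8) < sin (\<delta> / 4)"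
  using d by (auto intro!: sin_gt_zero sin_monotone_2pi)
 have s8': "(sin (\<delta> / 8))^2 < b1" unfolding b1_def using s8 by (intro power_strict_mono) auto
 have b1: "0 < b1" "b1 \<le> 1 / 2"
 proof -
  show "0 < b1" using s8' by (smt (verit) zero_le_power2)
  have "sin (\<delta> / 4) \<le> sin (pi / 4)" using d by (intro sin_monotone_2pi_le) auto
  then have "b1 \<le> (sin (pi / 4))^2" unfolding b1_def using s8 by (intro power_mono) auto
  also have "... = 1 / 2" by (simp add: sin_45 power2_eq_square)
  finally show "b1 \<le> 1 / 2" .
 qed
 \<comment> \<open>For \<open>b = b1\<close> the solution \<open>N\<close> oscillates on
   \<open>{0..\<delta>/8}\<close> with frequency at least \<open>K * k0\<close>.\<close>
 define k0 where "k0 = sqrt (b1 - (sin (\<delta> / 8))^2)"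
 have k0: "k0 > 0" "k0^2 = b1 - (sin (\<delta> / 8))^2" using s8' by (auto simp: k0_def)
 define qN where "qN = (\<lambda>z::real \<times> real \<times> real. (fst (snd z))\<^sup>2 * ((sin (fst z))^2 - snd (snd z)))"
 define qM where "qM = (\<lambda>z::real \<times> real \<times> real. - (fst (snd z))\<^sup>2 * ((cosh (fst z))^2 - snd (snd z)))"
 have cq: "continuous_on UNIV qN" "continuous_on UNIV qM"
  unfolding qN_def qM_def by (auto intro!: continuous_intros)
 obtain N N' where N: "continuous_on UNIV N" "continuous_on UNIV N'"
  "\<And>p. N (0, p) = 1" "\<And>p. N' (0, p) = 0"
  "\<And>t p. ((\<lambda>t. N (t, p)) has_real_derivative N' (t, p)) (at t)"
  "\<And>t p. ((\<lambda>t. N' (t, p)) has_real_derivative qN (t, p) * N (t, p)) (at t)"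
  "\<And>t p. (\<And>s. qN (- s, p) = qN (s, p)) ==> N (- t, p) = N (t, p) \<and> N' (- t, p) = - N' (t, p)"
  using linear_ode_solution[OF cq(1)] by blast
 obtain M M' where M: "continuous_on UNIV M" "continuous_on UNIV M'"
  "\<And>p. M (0, p) = 1" "\<And>p. M' (0, p) = 0"
  "\<And>t p. ((\<lambda>t. M (t, p)) has_real_derivative M' (t, p)) (at t)"
  "\<And>t p. ((\<lambda>t. M' (t, p)) has_real_derivative qM (t, p) * M (t, p)) (at t)"
  "\<And>t p. (\<And>s. qM (- s, p) = qM (s, p)) ==> M (- t, p) = M (t, p) \<and> M' (- t, p) = - M' (t, p)"
  using linear_ode_solution[OF cq(2)] by blast
 define ch where "ch = (cosh \<mu>)^2"
 have ch: "ch \<ge> 1" unfolding ch_def using cosh_real_ge_1 by simp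
 have cosh_le: "(cosh t)^2 \<le> ch" if "t \<in> {0..\<mu>}" for t
  unfolding ch_def using that by (intro power_mono) (auto simp: cosh_real_nonneg_le_iff)
 \<comment> \<open>\<open>n\<close> is so large that the smallest admissible \<open>K\<close>
   exceeds \<open>B\<close> and 1, and that a quarter period of frequency \<open>K * k0\<close> fits
   into \<open>{0..\<delta>/8}\<close>.\<close>
 obtain n :: nat where n: "(real n + 1 / 2) * pi > max B (max 1 (pi / (k0 * (\<delta> / 4)))) * (ch * \<mu>)"
 proof -
  obtain n :: nat where n: "max B (max 1 (pi / (k0 * (\<delta> / 4)))) * (ch * \<mu>) / pi < real n"
   using reals_Archimedean2 by blast
  then have "max B (max 1 (pi / (k0 * (\<delta> / 4)))) * (ch * \<mu>) < real n * pi" by (simp add: field_simps)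
  also have "... \<le> (real n + 1 / 2) * pi" by (intro mult_right_mono) auto
  finally show thesis using that by blast
 qed
 \<comment> \<open>The prescribed Pruefer angle: the cosine vanishes at odd multiples of
   \<open>pi / 2\<close>, and there \<open>M\<close> has its zero.\<close>
 define A where "A = (real n + 1 / 2) * pi"
 \<comment> \<open>The angle grows at a rate between \<open>K * (1 - b)\<close> and
   \<open>K * ch\<close>, where \<open>1 - b \<ge> 1 / 2\<close>. So at \<open>\<mu>\<close> it is
   at most \<open>A\<close> for \<open>K = K1\<close> and at least \<open>A\<close> for
   \<open>K = K2\<close>.\<close>
 define K1 where "K1 = A / (ch * \<mu>)"
 define K2 where "K2 = 2 * A / \<mu>"
 have chmu: "ch * \<mu> > 0" using ch mu by simp
 have K1: "K1 > B" "K1 > 1" "K1 > pi / (k0 * (\<delta> / 4))"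
 proof -
  have "K1 > max B (max 1 (pi / (k0 * (\<delta> / 4))))"
   unfolding K1_def A_def using n by (simp only: pos_less_divide_eq[OF chmu])
  then show "K1 > B" "K1 > 1" "K1 > pi / (k0 * (\<delta> / 4))" by auto
 qed
 have A: "A > 0" unfolding A_def by simp
 have K12: "K1 \<le> K2"
 proof -
  have "K1 \<le> A / \<mu>" unfolding K1_def using ch mu A by (intro divide_left_mono) auto
  also have "... \<le> K2" unfolding K2_def using A mu by (intro divide_right_mono) auto
  finally show ?thesis .
 qed
 define P where "P z = M' z / fst (snd z)" for z
 define g where "g z = fst (snd z) * ((P z)^2 + ((cosh (fst z))^2 - snd (snd z)) * (M z)^2) / ((M z)^2 + (P z)^2)" for z
 have Mpos: "(M (t, K, b))^2 + (P (t, K, b))^2 > 0" if "K > 0" "t \<in> {0..\<mu>}" for t K b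
 proof -
  have c: "continuous_on {0..\<mu>} (\<lambda>t. qM (t, K, b))" unfolding qM_def by (auto intro!: continuous_intros)
  have "bounded ((\<lambda>t. qM (t, K, b)) ` {0..\<mu>})"
   using c by (intro compact_imp_bounded compact_continuous_image) auto
  then obtain Q where Q: "\<And>t. t \<in> {0..\<mu>} ==> \<bar>qM (t, K, b)\<bar> \<le> Q"
   unfolding bounded_iff real_norm_def by (metis imageI)
  have "(M (t, K, b))^2 + (M' (t, K, b))^2 > 0"
   by (rule linear_ode_energy_pos[where N = "\<lambda>t. M (t, K, b)" and q = "\<lambda>t. qM (t, K, b)" and T = \<mu> and Q = Q])
    (use M Q that in auto)
  then have "M (t, K, b) \<noteq> 0 \<or> M' (t, K, b) \<noteq> 0" by (auto simp: sum_power2_gt_zero_iff)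
  then show ?thesis using that by (auto simp: sum_power2_gt_zero_iff P_def)
 qed
 let ?S = "{K1..K2} \<times> {0..b1}"
 have cont_P: "continuous_on ({0..\<mu>} \<times> ?S) P" "continuous_on ({0..\<mu>} \<times> ?S) M"
  unfolding P_def using K1 by (auto intro!: continuous_intros continuous_on_subset[OF M(2)] continuous_on_subset[OF M(1)])
 have cont_g: "continuous_on ({0..\<mu>} \<times> ?S) g"
 proof -
  have "(M z)^2 + (P z)^2 \<noteq> 0" if "z \<in> {0..\<mu>} \<times> ?S" for z
  proof -
   obtain t K b where z: "z = (t, K, b)" using prod_cases3 by blast
   show ?thesis using Mpos[of K t b] that K1 by (auto simp: z sum_power2_gt_zero_iff)
  qed
  then show ?thesis unfolding g_def by (intro continuous_intros cont_P ballI; simp)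
 qed
 define f1 where "f1 p = integral {0..\<mu>} (\<lambda>t. g (t, p)) - A" for p
 define f2 where "f2 p = - Inf ((\<lambda>t. N (t, p)) ` {0..\<delta>})" for p
 have "continuous_on (?S \<times> cbox 0 \<mu>) (\<lambda>(p, t). g (t, p))"
  unfolding split_beta by (intro continuous_on_compose2[OF cont_g]) (auto intro!: continuous_intros)
 from integral_continuous_on_param[OF this]
 have c1: "continuous_on ?S f1" unfolding f1_def by (intro continuous_intros) simp
 have c2: "continuous_on ?S f2"
  unfolding f2_def using N(1) d
  by (intro continuous_on_minus continuous_on_Inf_param) (auto intro: continuous_on_subset compact_Times)
 have g_bounds: "K * (1 - b) \<le> g (t, K, b)" "g (t, K, b) \<le> K * ch"
  if Kb: "K \<in> {K1..K2}" "b \<in> {0..b1}" and t: "t \<in> {0..\<mu>}" for K b t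
 proof -
  define m where "m = (M (t, K, b))^2"
  define p where "p = (P (t, K, b))^2"
  define a where "a = (cosh t)^2 - b"
  have K: "K > 0" using Kb K1 by auto
  have nn: "m \<ge> 0" "p \<ge> 0" "m + p > 0" unfolding m_def p_def using Mpos[OF K t] by auto
  have "1 \<le> (cosh t)^2" using cosh_real_ge_1[of t] by simp
  then have a: "1 - b \<le> a" "a \<le> ch" unfolding a_def using cosh_le[OF t] Kb by auto
  have g: "g (t, K, b) = K * (p + a * m) / (m + p)" by (simp add: g_def m_def p_def a_def)
  have "(1 - b) * (m + p) \<le> p + a * m"
  proof -
   have "(1 - b) * p \<le> 1 * p" using Kb nn by (intro mult_right_mono) auto
   moreover have "(1 - b) * m \<le> a * m" using a nn by (intro mult_right_mono) auto
   ultimately show ?thesis by (simp add: algebra_simps)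
  qed
  then have "K * ((1 - b) * (m + p)) \<le> K * (p + a * m)" using K by (intro mult_left_mono) auto
  then show "K * (1 - b) \<le> g (t, K, b)" unfolding g using nn by (simp add: pos_le_divide_eq mult.assoc)
  have "p + a * m \<le> ch * (m + p)"
  proof -
   have "1 * p \<le> ch * p" using ch nn by (intro mult_right_mono) auto
   moreover have "a * m \<le> ch * m" using a nn by (intro mult_right_mono) auto
   ultimately show ?thesis by (simp add: algebra_simps)
  qed
  then have "K * (p + a * m) \<le> K * (ch * (m + p))" using K by (intro mult_left_mono) auto
  then show "g (t, K, b) \<le> K * ch" unfolding g using nn by (simp add: pos_divide_le_eq mult.assoc)
 qed
 have g_int: "(\<lambda>t. g (t, K, b)) integrable_on {0..\<mu>}" if "K \<in> {K1..K2}" "b \<in> {0..b1}" for K b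
  using that by (intro integrable_continuous_real continuous_on_compose2[OF cont_g]) (auto intro!: continuous_intros)
 obtain K b where Kb: "K \<in> {K1..K2}" "b \<in> {0..b1}" "f1 (K, b) = 0" "f2 (K, b) = 0"
 proof (rule poincare_miranda[OF K12 _ c1 c2])
  show "0 \<le> b1" using b1 by simp
  fix b assume b: "b \<in> {0..b1}"
  have "integral {0..\<mu>} (\<lambda>t. g (t, K1, b)) \<le> integral {0..\<mu>} (\<lambda>t. K1 * ch)"
   using b K12 by (intro integral_le g_int g_bounds) auto
  also have "... = A" using mu ch by (simp add: K1_def)
  finally have 1: "f1 (K1, b) \<le> 0" by (simp add: f1_def)
  have "integral {0..\<mu>} (\<lambda>t. K2 * (1 - b)) \<le> integral {0..\<mu>} (\<lambda>t. g (t, K2, b))"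
   using b K12 by (intro integral_le g_int g_bounds) auto
  moreover have "A \<le> integral {0..\<mu>} (\<lambda>t. K2 * (1 - b))"
  proof -
   have "2 * A * (1 / 2) \<le> 2 * A * (1 - b)" using b b1 A by (intro mult_left_mono) auto
   then show ?thesis using mu by (simp add: K2_def)
  qed
  ultimately show "f1 (K1, b) \<le> 0 \<and> 0 \<le> f1 (K2, b)" using 1 by (simp add: f1_def)
 next
  \<comment> \<open>At \<open>b = 0\<close> there is no oscillation and \<open>N\<close> stays
    nonnegative; at \<open>b = b1\<close> it oscillates fast enough near the axis to reach a
    nonpositive value.\<close>
  fix K assume K: "K \<in> {K1..K2}"
  have ne: "(\<lambda>t. N (t, K, b)) ` {0..\<delta>} \<noteq> {}" for b using d by auto
  have bdd: "bdd_below ((\<lambda>t. N (t, K, b)) ` {0..\<delta>})" for b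
  proof -
   have "compact ((\<lambda>t. N (t, K, b)) ` {0..\<delta>})"
    by (intro compact_continuous_image continuous_on_compose2[OF N(1)]) (auto intro!: continuous_intros)
   then show ?thesis by (meson bounded_imp_bdd_below compact_imp_bounded)
  qed
  have "0 \<le> N (t, K, 0)" if "t \<in> {0..\<delta>}" for t
   by (rule convex_solution_pos[OF N(5,6,3,4), where T = \<delta>]) (use that in \<open>auto simp: qN_def\<close>)
  then have "0 \<le> Inf ((\<lambda>t. N (t, K, 0)) ` {0..\<delta>})" using ne by (intro cInf_greatest) auto
  then have 1: "f2 (K, 0) \<le> 0" by (simp add: f2_def)
  have Kpos: "K > 0" using K K1 by auto
  have T: "pi / (2 * (K * k0)) \<le> \<delta> / 8"
  proof -
   have "pi / (k0 * (\<delta> / 4)) \<le> K" using K K1 by auto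
   then have "pi \<le> K * (k0 * (\<delta> / 4))" using k0 d by (simp add: pos_divide_le_eq)
   then show ?thesis using k0 Kpos by (simp add: field_simps)
  qed
  obtain t where t: "t \<in> {0..pi / (2 * (K * k0))}" "N (t, K, b1) \<le> 0"
  proof (rule sturm_zero[OF N(5,6,4)])
   show "0 < K * k0" using Kpos k0 by simp
   fix t assume t: "t \<in> {0..pi / (2 * (K * k0))}"
   have "sin t \<le> sin (\<delta> / 8)" "0 \<le> sin t" using t T d by (auto intro!: sin_monotone_2pi_le sin_ge_zero)
   then have "(sin t)^2 \<le> (sin (\<delta> / 8))^2" by (intro power_mono) auto
   then have "K^2 * ((sin t)^2 - b1) \<le> K^2 * (- k0\<^sup>2)" unfolding k0 by (intro mult_left_mono) auto
   then show "qN (t, K, b1) \<le> - (K * k0)\<^sup>2" by (simp add: qN_def power_mult_distrib)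
  qed
  have "Inf ((\<lambda>t. N (t, K, b1)) ` {0..\<delta>}) \<le> N (t, K, b1)"
   using t(1) T d by (intro cInf_lower bdd) auto
  then have "0 \<le> f2 (K, b1)" using t(2) by (simp add: f2_def)
  with 1 show "f2 (K, 0) \<le> 0 \<and> 0 \<le> f2 (K, b1)" by simp
 qed
 have K: "K > B" "K > 0" using Kb K1 by auto
 have inf0: "Inf ((\<lambda>t. N (t, K, b)) ` {0..\<delta>}) = 0" using Kb by (simp add: f2_def)
 have cN: "continuous_on S (\<lambda>t. N (t, K, b))" for S
  by (intro continuous_on_compose2[OF N(1)]) (auto intro!: continuous_intros)
 obtain ts where ts: "ts \<in> {0..\<delta>}" "\<And>t. t \<in> {0..\<delta>} ==> N (ts, K, b) \<le> N (t, K, b)"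
  using continuous_attains_inf[of "{0..\<delta>}" "\<lambda>t. N (t, K, b)"] cN d by auto
 have Nts: "N (ts, K, b) = 0"
 proof -
  have "Inf ((\<lambda>t. N (t, K, b)) ` {0..\<delta>}) = N (ts, K, b)"
   by (rule cInf_eq_minimum) (use ts in auto)
  then show ?thesis using inf0 by simp
 qed
 \<comment> \<open>The minimum of \<open>N\<close> is 0, so a zero before the end would be a
   critical point, and solution and derivative would vanish together.\<close>
 have zero_end: "s = \<delta>" if s: "s \<in> {0..\<delta>}" "N (s, K, b) = 0" for s
 proof (rule ccontr)
  assume "s \<noteq> \<delta>"
  then have s': "0 < s" "s < \<delta>" using s N(3)[of "(K, b)"] by (auto simp: less_le)
  have "N' (s, K, b) = 0"
  proof (rule DERIV_local_min[OF N(5)])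
   show "0 < min s (\<delta> - s)" using s' by simp
   show "\<forall>y. \<bar>s - y\<bar> < min s (\<delta> - s) --> N (s, K, b) \<le> N (y, K, b)"
    using ts Nts s(2) by (auto simp: abs_less_iff)
  qed
  moreover have "(N (s, K, b))^2 + (N' (s, K, b))^2 > 0"
  proof (rule linear_ode_energy_pos[OF N(5,6), where T = \<delta>])
   show "\<bar>qN (t, K, b)\<bar> \<le> K^2 * 1" if "t \<in> {0..\<delta>}" for t
   proof -
    have "(sin t)^2 \<le> 1" "0 \<le> (sin t)^2" by (simp_all add: abs_square_le_1)
    moreover have "0 \<le> b" "b \<le> 1 / 2" using Kb b1 by auto
    ultimately have "\<bar>(sin t)\<^sup>2 - b\<bar> \<le> 1" unfolding abs_le_iff by linarith
    then have "K^2 * \<bar>(sin t)\<^sup>2 - b\<bar> \<le> K^2 * 1" by (intro mult_left_mono) auto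
    then show ?thesis by (simp add: qN_def abs_mult)
   qed
  qed (use s N in auto)
  ultimately show False using s(2) by simp
 qed
 have qs: "qN (- s, K, b) = qN (s, K, b)" "qM (- s, K, b) = qM (s, K, b)" for s
  by (auto simp: qN_def qM_def)
 have "M (\<mu>, K, b) = 0"
 proof (rule pruefer_angle[where M = "\<lambda>t. M (t, K, b)" and T = \<mu> and K = K and P = "\<lambda>t. P (t, K, b)" and a = "\<lambda>t. (cosh t)\<^sup>2 - b"])
  show "DERIV (\<lambda>t. M (t, K, b)) t :> K * P (t, K, b)" for t
   using M(5)[where p = "(K, b)" and t = t] K by (simp add: P_def)
  show "DERIV (\<lambda>t. P (t, K, b)) t :> - K * ((cosh t)^2 - b) * M (t, K, b)" for t
   unfolding P_def fst_conv snd_conv using DERIV_cdivide[OF M(6)[where p = "(K, b)" and t = t], of K] K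
   by (simp add: qM_def power2_eq_square mult.assoc)
  show "continuous_on UNIV (\<lambda>t. (cosh t)\<^sup>2 - b)" by (auto intro!: continuous_intros)
  show "0 \<le> \<mu>" using mu by simp
  show "0 < (M (t, K, b))^2 + (P (t, K, b))^2" if "t \<in> {0..\<mu>}" for t using Mpos K that by blast
  show "P (0, K, b) = 0" by (simp add: P_def M)
  have "cos A = 0" unfolding A_def cos_zero_iff_int2 by (intro exI[of _ "int n"]) (simp add: algebra_simps)
  moreover have "integral {0..\<mu>} (\<lambda>t. g (t, K, b)) = A" using Kb(3) by (simp add: f1_def)
  ultimately show "cos (integral {0..\<mu>} (\<lambda>t. K * ((P (t, K, b))^2 + ((cosh t)^2 - b) * (M (t, K, b))^2) /
   ((M (t, K, b))^2 + (P (t, K, b))^2))) = 0"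
   by (simp add: g_def)
 qed
 moreover have "N (t, K, b) > 0" if "t \<in> {0..<\<delta>}" for t
  using zero_end[of t] ts(2)[of t] Nts that by force
 moreover have "N (\<delta>, K, b) = 0" using zero_end[of ts] ts Nts by auto
 ultimately show thesis
  using that[of K b "\<lambda>t. N (t, K, b)" "\<lambda>t. N' (t, K, b)" "\<lambda>t. M (t, K, b)" "\<lambda>t. M' (t, K, b)"]
   K Kb(2) N(3-6) M(3-6) N(7)[OF qs(1)] M(7)[OF qs(2)]
  by (auto simp: qN_def qM_def b1_def)
qed

lemma max_power_deriv:
 "((\<lambda>s. max 0 s ^ Suc (Suc n)) has_real_derivative real (Suc (Suc n)) * max 0 s ^ Suc n) (at s)"
proof -
 consider "s < 0" | "s > 0" | "s = 0" by linarith
 then show ?thesis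
 proof cases
  case 1
  have "DERIV (\<lambda>s. 0) s :> real (Suc (Suc n)) * max 0 s ^ Suc n" using 1 by simp
  then show ?thesis
   by (rule has_field_derivative_transform_within_open[where S = "{..<0}"]) (use 1 in auto)
 next
  case 2
  have "DERIV (\<lambda>s. s ^ Suc (Suc n)) s :> real (Suc (Suc n)) * max 0 s ^ Suc n"
   using 2 DERIV_pow[of "Suc (Suc n)" s] by simp
  then show ?thesis
   by (rule has_field_derivative_transform_within_open[where S = "{0<..}"]) (use 2 in auto)
 next
  case 3
  have "((\<lambda>h::real. max 0 h ^ Suc (Suc n) / h) \<longlongrightarrow> 0) (at 0)"
  proof (rule Lim_null_comparison)
   show "\<forall>\<^sub>F h in at 0. norm (max 0 h ^ Suc (Suc n) / h) \<le> \<bar>h\<bar> ^ Suc n" 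
   proof (intro always_eventually allI)
    fix h :: real
    show "norm (max 0 h ^ Suc (Suc n) / h) \<le> \<bar>h\<bar> ^ Suc n" 
    proof (cases "h > 0")
     case False
     then have z: "max 0 h ^ Suc (Suc n) = 0" by simp
     show ?thesis unfolding z by (simp del: power_Suc)
    qed (simp add: max_def)
   qed
   have "((\<lambda>h::real. \<bar>h\<bar> ^ Suc n) \<longlongrightarrow> \<bar>0\<bar> ^ Suc n) (at 0)" by (intro tendsto_intros)
   then show "((\<lambda>h::real. \<bar>h\<bar> ^ Suc n) \<longlongrightarrow> 0) (at 0)" by simp
  qed
  then show ?thesis using 3 by (simp add: has_field_derivative_iff)
 qed
qed

text \<open>The cutoff is differentiated at most twice, so class C2 is the right smoothness, and
  truncated cubes provide it explicitly.\<close>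

lemma cutoff_function:
 fixes a w :: real
 assumes a: "0 < a" and w: "0 < w"
 obtains \<psi> \<psi>' \<psi>'' C where "\<And>t. (\<psi> has_real_derivative \<psi>' t) (at t)"
  "\<And>t. (\<psi>' has_real_derivative \<psi>'' t) (at t)" "continuous_on UNIV \<psi>''"
  "\<And>t. \<bar>t\<bar> \<le> a ==> \<psi> t = 1" "\<And>t. \<bar>t\<bar> \<le> a ==> \<psi>' t = 0" "\<And>t. \<bar>t\<bar> \<le> a ==> \<psi>'' t = 0"
  "\<And>t. \<bar>t\<bar> \<ge> a + w ==> \<psi> t = 0" "C > 0"
  "\<And>t. \<bar>t\<bar> \<le> a + w ==> \<bar>\<psi>' t\<bar> \<le> C \<and> \<bar>\<psi>'' t\<bar> \<le> C"
proof -
 let ?m = "\<lambda>s::real. max 0 s"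
 \<comment> \<open>\<open>A\<close> vanishes for \<open>\<bar>t\<bar> \<le> a\<close> and is at
   least 1 for \<open>\<bar>t\<bar> \<ge> a + w\<close>, so the cube of the positive part of
   \<open>1 - A\<close> cuts off as desired.\<close>
 define A where "A t = (?m (t - a) ^ 3 + ?m (- t - a) ^ 3) / w ^ 3" for t
 define A1 where "A1 t = 3 * (?m (t - a) ^ 2 - ?m (- t - a) ^ 2) / w ^ 3" for t
 define A2 where "A2 t = 6 * (?m (t - a) + ?m (- t - a)) / w ^ 3" for t
 define \<psi> where "\<psi> t = ?m (1 - A t) ^ 3" for t
 define \<psi>1 where "\<psi>1 t = - 3 * ?m (1 - A t) ^ 2 * A1 t" for t
 define \<psi>2 where "\<psi>2 t = 6 * ?m (1 - A t) * (A1 t)^2 - 3 * ?m (1 - A t) ^ 2 * A2 t" for t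
 have m3: "DERIV (\<lambda>s. ?m s ^ 3) s :> 3 * ?m s ^ 2" for s
  using max_power_deriv[of 1 s] by (simp add: eval_nat_numeral)
 have m2: "DERIV (\<lambda>s. ?m s ^ 2) s :> 2 * ?m s" for s
  using max_power_deriv[of 0 s] by (simp add: eval_nat_numeral)
 have m3': "DERIV (\<lambda>t. ?m (f t) ^ 3) t :> 3 * ?m (f t) ^ 2 * f'"
  and m2': "((\<lambda>t. ?m (f t) ^ 2) has_real_derivative 2 * ?m (f t) * f') (at t)"
  if "(f has_real_derivative f') (at t)" for f f' t
  using DERIV_chain2[OF m3 that] DERIV_chain2[OF m2 that] by simp_all
 have dA: "DERIV A t :> A1 t" "DERIV A1 t :> A2 t" for t
 proof -
  have *: "DERIV (\<lambda>t. t - a) t :> 1" "DERIV (\<lambda>t. - t - a) t :> -1"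
   by (auto intro!: derivative_eq_intros)
  show "DERIV A t :> A1 t"
   using DERIV_cdivide[OF DERIV_add[OF m3'[OF *(1)] m3'[OF *(2)]], of "w ^ 3"]
   unfolding A_def [abs_def] A1_def by (simp add: algebra_simps)
  show "DERIV A1 t :> A2 t"
   using DERIV_cdivide[OF DERIV_cmult[OF DERIV_diff[OF m2'[OF *(1)] m2'[OF *(2)]], of 3], of "w ^ 3"]
   unfolding A1_def [abs_def] A2_def by (simp add: algebra_simps)
 qed
 have d1: "DERIV \<psi> t :> \<psi>1 t" for t
  using m3'[OF DERIV_diff[OF DERIV_const[of 1] dA(1)]] unfolding \<psi>_def [abs_def] \<psi>1_def by simp
 have d2: "DERIV (\<psi>1) t :> \<psi>2 t" for t
  using DERIV_mult[OF DERIV_cmult[OF m2'[OF DERIV_diff[OF DERIV_const[of 1] dA(1)]], of "-3"] dA(2)]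
  unfolding \<psi>1_def [abs_def] \<psi>2_def by (simp add: algebra_simps power2_eq_square)
 have c1: "continuous_on UNIV \<psi>1" using d2 DERIV_isCont by (blast intro: continuous_at_imp_continuous_on)
 have c2: "continuous_on UNIV \<psi>2"
  unfolding \<psi>2_def A_def A1_def A2_def using w by (intro continuous_intros) auto
 have in0: "A t = 0" "A1 t = 0" "A2 t = 0" if "\<bar>t\<bar> \<le> a" for t
  using that by (auto simp: A_def A1_def A2_def max_def abs_le_iff)
 have big: "A t \<ge> 1" if "\<bar>t\<bar> \<ge> a + w" for t
 proof -
  have "w \<le> max (?m (t - a)) (?m (- t - a))" using that by (auto simp: abs_if split: if_splits)
  then have "w ^ 3 \<le> max (?m (t - a)) (?m (- t - a)) ^ 3" using w by (intro power_mono) auto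
  also have "... \<le> ?m (t - a) ^ 3 + ?m (- t - a) ^ 3" by (auto simp: max_def)
  finally show ?thesis unfolding A_def using w by simp
 qed
 have bdd: "\<exists>B. \<forall>t\<in>{-(a+w)..a+w}. \<bar>f t\<bar> \<le> B" if "continuous_on UNIV f" for f :: "real => real"
 proof -
  have "bounded (f ` {-(a+w)..a+w})"
   using that by (intro compact_imp_bounded compact_continuous_image) (auto intro: continuous_on_subset)
  then show ?thesis unfolding bounded_iff real_norm_def by blast
 qed
 obtain B1 B2 where B: "\<And>t. t \<in> {-(a+w)..a+w} ==> \<bar>\<psi>1 t\<bar> \<le> B1" "\<And>t. t \<in> {-(a+w)..a+w} ==> \<bar>\<psi>2 t\<bar> \<le> B2"
  using bdd[OF c1] bdd[OF c2] by blast
 show thesis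
 proof (rule that[of \<psi> \<psi>1 \<psi>2 "max 1 (max B1 B2)"])
  show "DERIV \<psi> t :> \<psi>1 t" "DERIV (\<psi>1) t :> \<psi>2 t" for t by (fact d1 d2)+
  show "continuous_on UNIV \<psi>2" by (fact c2)
  show "\<bar>t\<bar> \<le> a ==> \<psi> t = 1" "\<bar>t\<bar> \<le> a ==> \<psi>1 t = 0" "\<bar>t\<bar> \<le> a ==> \<psi>2 t = 0" for t
   using in0[of t] by (auto simp: \<psi>_def \<psi>1_def \<psi>2_def)
  show "\<bar>t\<bar> \<ge> a + w ==> \<psi> t = 0" for t using big[of t] by (simp add: \<psi>_def)
  show "max 1 (max B1 B2) > 0" by simp
  show "\<bar>\<psi>1 t\<bar> \<le> max 1 (max B1 B2) \<and> \<bar>\<psi>2 t\<bar> \<le> max 1 (max B1 B2)" if "\<bar>t\<bar> \<le> a + w" for t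
   using B[of t] that by (auto simp: abs_le_iff le_max_iff_disj)
 qed
qed

text \<open>Multiplying the angular solution by a cutoff leaves a residual that lives where the solution
 has already decayed exponentially.\<close>

definition is_quasimode :: "real => real => real => real => real => (real => real) => (real => real) => (real => real)
  => (real => real) => (real => real) => bool" where
 "is_quasimode \<mu> \<delta> \<epsilon> K b \<rho> \<rho>' \<rho>'' M M' \<longleftrightarrow>
  (\<forall>t. (\<rho> has_real_derivative \<rho>' t) (at t)) \<and> (\<forall>t. (\<rho>' has_real_derivative \<rho>'' t) (at t)) \<and>
  continuous_on UNIV \<rho>'' \<and> (\<forall>t. \<delta> \<le> \<bar>t\<bar> --> \<rho> t = 0) \<and> ((\<lambda>t. (\<rho> t)\<^sup>2) has_integral 1) {-\<delta>..\<delta>} \<and>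
  (\<forall>t. (M has_real_derivative M' t) (at t)) \<and>
  (\<forall>t. (M' has_real_derivative - K\<^sup>2 * ((cosh t)^2 - b) * M t) (at t)) \<and>
  M \<mu> = 0 \<and> M (- \<mu>) = 0 \<and> M' \<mu> = 1 \<and> M' (- \<mu>) = -1 \<and> (\<forall>t\<in>{-\<mu>..\<mu>}. \<bar>M t\<bar> \<le> 1) \<and>
  (\<forall>t\<in>{-\<delta>..\<delta>}. \<bar>\<rho>'' t - K^2 * ((sin t)^2 - b) * \<rho> t\<bar> \<le> \<epsilon>)"

text \<open>For \<open>t \<ge> 0\<close> the coefficient increases and the energy \<open>E\<close>
  with it. At the zero \<open>\<mu>\<close> the energy is \<open>(M' \<mu>)^2\<close>, and since the
  coefficient is at least 1 this bounds \<open>M\<close> everywhere. It justifies the normalisation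
  \<open>M' \<mu> = 1\<close>.\<close>

lemma radial_energy:
 fixes M M' :: "real => real"
 assumes M: "\<And>t. (M has_real_derivative M' t) (at t)"
  "\<And>t. (M' has_real_derivative - K\<^sup>2 * ((cosh t)^2 - b) * M t) (at t)"
  and even: "\<And>t. M (- t) = M t" and "M \<mu> = 0" "M 0 = 1" "M' 0 = 0" and K: "K \<ge> 2" and b: "b \<le> 1 / 2" and mu: "0 < \<mu>"
 shows "M' \<mu> \<noteq> 0" "t \<in> {-\<mu>..\<mu>} ==> \<bar>M t\<bar> \<le> \<bar>M' \<mu>\<bar>"
proof -
 define E where "E t = (M' t)^2 + K^2 * ((cosh t)^2 - b) * (M t)^2" for t
 have mono: "E s \<le> E t" if "0 \<le> s" "s \<le> t" for s t
 proof (rule DERIV_nonneg_imp_nondecreasing[where f = E])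
  show "s \<le> t" by fact
  fix x assume x: "s \<le> x" "x \<le> t"
  have "DERIV E x :> 2 * K^2 * (cosh x * sinh x) * (M x)^2"
   unfolding E_def [abs_def]
   by (rule derivative_eq_intros M refl | simp add: algebra_simps power2_eq_square)+
  moreover have "0 \<le> 2 * K^2 * (cosh x * sinh x) * (M x)^2"
   using x that by (intro mult_nonneg_nonneg) (auto simp: cosh_real_nonneg)
  ultimately show "\<exists>y. DERIV E x :> y \<and> 0 \<le> y" by blast
 qed
 have K2: "K^2 \<ge> 4" using power_mono[OF K, of 2] by simp
 have c: "1 \<le> K^2 * ((cosh t)^2 - b)" for t
 proof -
  have "1 \<le> (cosh t)^2" using cosh_real_ge_1[of t] by simp
  then have "4 * (1 / 2) \<le> K^2 * ((cosh t)^2 - b)" using K2 b by (intro mult_mono) auto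
  then show ?thesis by simp
 qed
 have Emu: "E \<mu> = (M' \<mu>)^2" using \<open>M \<mu> = 0\<close> by (simp add: E_def)
 have "E 0 \<ge> 1" using c[of 0] assms by (simp add: E_def)
 then have "(M' \<mu>)^2 \<ge> 1" using mono[of 0 \<mu>] mu Emu by simp
 then show "M' \<mu> \<noteq> 0" by auto
 have pos: "\<bar>M t\<bar> \<le> \<bar>M' \<mu>\<bar>" if "t \<in> {0..\<mu>}" for t
 proof -
  have "(M t)^2 \<le> K^2 * ((cosh t)^2 - b) * (M t)^2" using mult_right_mono[OF c[of t], of "(M t)^2"] by simp
  also have "... \<le> E t" by (simp add: E_def)
  also have "... \<le> (M' \<mu>)^2" using mono[of t \<mu>] that Emu by simp
  finally show ?thesis by (simp add: abs_le_square_iff)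
 qed
 show "\<bar>M t\<bar> \<le> \<bar>M' \<mu>\<bar>" if "t \<in> {-\<mu>..\<mu>}"
  using pos[of t] pos[of "- t"] even[of t] that by (cases "t \<ge> 0") auto
qed

text \<open>Before the cutoff sets in, \<open>N\<close> loses a factor
  \<open>exp (- \<gamma> * K)\<close> between \<open>3 * \<delta> / 8\<close> and
  \<open>5 * \<delta> / 8\<close>. On the other hand \<open>N\<close> is nonincreasing from
  \<open>\<delta> / 4\<close> on, so its values on \<open>{\<delta>/4..3 * \<delta>/8}\<close> keep
  the norm of \<open>\<rho>\<close> above a constant times \<open>N (3 * \<delta> / 8)\<close>. The
  quotient is the exponentially small residual.\<close>

lemma quasimodes_exist:
 fixes \<mu> \<delta> :: real
 assumes mu: "0 < \<mu>" and d: "0 < \<delta>" "\<delta> < pi / 2"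
 obtains \<gamma> C where "\<gamma> > 0" "C > 0"
  "\<And>B. \<exists>K>B. \<exists>b \<rho> \<rho>' \<rho>'' M M'. is_quasimode \<mu> \<delta> (C * exp (- \<gamma> * K)) K b \<rho> \<rho>' \<rho>'' M M'"
proof -
 define a0 where "a0 = 3 * \<delta> / 8"
 define b1 where "b1 = (sin (\<delta> / 4))^2"
 have sa: "0 < sin (\<delta> / 4)" "sin (\<delta> / 4) < sin a0"
  unfolding a0_def using d by (auto intro!: sin_gt_zero sin_monotone_2pi)
 have sb: "b1 < (sin a0)^2" unfolding b1_def using sa by (intro power_strict_mono) auto
 define k1 where "k1 = sqrt ((sin a0)^2 - b1)"
 have k1: "k1 > 0" "k1^2 = (sin a0)^2 - b1" using sb by (auto simp: k1_def)
 have b1: "b1 \<le> 1 / 2"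
 proof -
  have "sin (\<delta> / 4) \<le> sin (pi / 4)" using d by (intro sin_monotone_2pi_le) auto
  then have "b1 \<le> (sin (pi / 4))^2" unfolding b1_def using sa by (intro power_mono) auto
  also have "... = 1 / 2" by (simp add: sin_45 power2_eq_square)
  finally show ?thesis .
 qed
 have ca: "0 < 3 * \<delta> / 4" "0 < \<delta> / 8" using d by auto
 obtain \<psi> \<psi>' \<psi>'' Cx where x: "\<And>t. (\<psi> has_real_derivative \<psi>' t) (at t)"
  "\<And>t. (\<psi>' has_real_derivative \<psi>'' t) (at t)" "continuous_on UNIV \<psi>''"
  and x1: "\<And>t. \<bar>t\<bar> \<le> 3 * \<delta> / 4 ==> \<psi> t = 1" "\<And>t. \<bar>t\<bar> \<le> 3 * \<delta> / 4 ==> \<psi>' t = 0" "\<And>t. \<bar>t\<bar> \<le> 3 * \<delta> / 4 ==> \<psi>'' t = 0"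
  and x0: "\<And>t. \<bar>t\<bar> \<ge> 3 * \<delta> / 4 + \<delta> / 8 ==> \<psi> t = 0" and Cx: "Cx > 0"
  "\<And>t. \<bar>t\<bar> \<le> 3 * \<delta> / 4 + \<delta> / 8 ==> \<bar>\<psi>' t\<bar> \<le> Cx \<and> \<bar>\<psi>'' t\<bar> \<le> Cx"
  using cutoff_function[OF ca] by blast
 \<comment> \<open>The derivatives are bounded by \<open>Cx\<close> only up to the end of the
   transition zone; beyond it they vanish, as \<open>\<psi>\<close> is 0 on an open set.\<close>
 have x_out: "\<psi>' t = 0 \<and> \<psi>'' t = 0" if "\<bar>t\<bar> > 3 * \<delta> / 4 + \<delta> / 8" for t
 proof -
  have op: "open {t::real. \<bar>t\<bar> > 3 * \<delta> / 4 + \<delta> / 8}" by (intro open_Collect_less continuous_intros)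
  have z: "\<psi>' s = 0" if "\<bar>s\<bar> > 3 * \<delta> / 4 + \<delta> / 8" for s
  proof -
   have "DERIV (\<lambda>s. 0) s :> \<psi>' s"
    by (rule has_field_derivative_transform_within_open[OF x(1) op]) (use that x0 in auto)
   then show ?thesis using DERIV_unique DERIV_const by blast
  qed
  have "DERIV (\<lambda>s. 0) t :> \<psi>'' t"
   by (rule has_field_derivative_transform_within_open[OF x(2) op]) (use that z in auto)
  then show ?thesis using z[OF that] DERIV_unique DERIV_const by blast
 qed
 have Cxall: "\<bar>\<psi>' t\<bar> \<le> Cx \<and> \<bar>\<psi>'' t\<bar> \<le> Cx" for t
  using Cx x_out[of t] by (cases "\<bar>t\<bar> \<le> 3 * \<delta> / 4 + \<delta> / 8") auto
 \<comment> \<open>\<open>K * k1\<close> is the decay rate on \<open>{a0..\<delta>}\<close>, and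
   \<open>\<delta> / 4\<close> the distance from \<open>a0\<close> to
   \<open>5 * \<delta> / 8\<close>.\<close>
 define \<gamma> where "\<gamma> = k1 * (\<delta> / 4)"
 \<comment> \<open>The residual is \<open>\<psi>'' N + 2 \<psi>' N'\<close>, where \<open>N'\<close>
   is at most \<open>8 / \<delta>\<close> times the bound for \<open>N\<close>; the square root is
   the norm of the constant 1 over an interval of length \<open>\<delta> / 8\<close>.\<close>
 define C where "C = Cx * (16 / \<delta> + 1) / sqrt (\<delta> / 8)"
 show thesis
 proof (rule that)
  show "\<gamma> > 0" using k1 d by (simp add: \<gamma>_def)
  show "C > 0" using Cx d by (simp add: C_def add_pos_pos)
  fix B :: real
  obtain K b N N' M M' where Kb: "K > max B 2" "K > 0" "0 \<le> b" "b \<le> (sin (\<delta> / 4))^2"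
   and N: "\<And>t. (N has_real_derivative N' t) (at t)"
   "\<And>t. (N' has_real_derivative K\<^sup>2 * ((sin t)^2 - b) * N t) (at t)"
   "\<And>t. N (- t) = N t" "\<And>t. N' (- t) = - N' t" "N \<delta> = 0" "\<And>t. t \<in> {0..<\<delta>} ==> N t > 0"
   and M: "\<And>t. (M has_real_derivative M' t) (at t)"
   "\<And>t. (M' has_real_derivative - K\<^sup>2 * ((cosh t)^2 - b) * M t) (at t)"
   "\<And>t. M (- t) = M t" "\<And>t. M' (- t) = - M' t" "M \<mu> = 0" "M 0 = 1" "M' 0 = 0"
   using separated_eigenpair[OF mu d, of "max B 2"] by blast
  define \<kappa> where "\<kappa> = K * k1"
  have \<kappa>: "\<kappa> > 0" using Kb k1 by (simp add: \<kappa>_def)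
  have sin_ge: "sin s \<le> sin t" "0 \<le> sin s" if "0 \<le> s" "s \<le> t" "t \<le> \<delta>" for s t
   using that d by (auto intro!: sin_monotone_2pi_le sin_ge_zero)
  have Nnn: "N t \<ge> 0" if "t \<in> {0..\<delta>}" for t
   using N(5) N(6)[of t] that by (cases "t = \<delta>") (auto simp: less_imp_le)
  have q1: "K^2 * ((sin t)^2 - b) \<ge> \<kappa>^2" if "t \<in> {a0..\<delta>}" for t
  proof -
   have "(sin a0)^2 \<le> (sin t)^2" using that d by (intro power_mono sin_ge) (auto simp: a0_def)
   then have "k1^2 \<le> (sin t)^2 - b" using Kb k1 by (simp add: b1_def)
   then show ?thesis unfolding \<kappa>_def power_mult_distrib by (intro mult_left_mono) auto
  qed
  have q0: "K^2 * ((sin t)^2 - b) \<ge> 0^2" if "t \<in> {\<delta>/4..\<delta>}" for t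
  proof -
   have "(sin (\<delta>/4))^2 \<le> (sin t)^2" using that d by (intro power_mono sin_ge) auto
   then show ?thesis using Kb by auto
  qed
  have a0d: "a0 < \<delta>" "\<delta> / 4 < \<delta>" "0 < a0" using d by (auto simp: a0_def)
  note dec1 = decaying_solution[OF N(1,2) q1 less_imp_le[OF \<kappa>] a0d(1) _ N(5)]
  note dec0 = decaying_solution[OF N(1,2) q0 order_refl a0d(2) _ N(5)]
  define m where "m = N a0"
  have m: "m > 0" unfolding m_def using N(6) a0d by auto
  define ex where "ex = exp (- \<gamma> * K) * m"
  have N58: "N (5 * \<delta> / 8) \<le> ex"
  proof -
   have "N (5 * \<delta> / 8) \<le> N a0 * exp (- \<kappa> * (5 * \<delta> / 8 - a0))"
    by (rule dec1(2)) (use Nnn d in \<open>auto simp: a0_def\<close>)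
   also have "\<kappa> * (5 * \<delta> / 8 - a0) = \<gamma> * K" by (simp add: \<kappa>_def a0_def \<gamma>_def algebra_simps)
   then have "- \<kappa> * (5 * \<delta> / 8 - a0) = - \<gamma> * K" by simp
   finally show ?thesis by (simp add: ex_def m_def mult.commute)
  qed
  have Nfar: "\<bar>N t\<bar> \<le> ex" "\<bar>N' t\<bar> \<le> 8 / \<delta> * ex" if t: "3 * \<delta> / 4 \<le> t" "t \<le> \<delta>" for t
  proof -
   have "N t \<le> N (5 * \<delta> / 8) * exp (- 0 * (t - 5 * \<delta> / 8))"
    by (rule dec0(2)) (use Nnn d t in auto)
   then show "\<bar>N t\<bar> \<le> ex" using N58 Nnn[of t] t d by simp
   have "(t - 5 * \<delta> / 8) * \<bar>N' t\<bar> \<le> N (5 * \<delta> / 8)"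
    by (rule dec0(3)) (use Nnn d t in auto)
   moreover have "\<delta> / 8 * \<bar>N' t\<bar> \<le> (t - 5 * \<delta> / 8) * \<bar>N' t\<bar>" using t by (intro mult_right_mono) auto
   ultimately have "\<delta> / 8 * \<bar>N' t\<bar> \<le> ex" using N58 by linarith
   then show "\<bar>N' t\<bar> \<le> 8 / \<delta> * ex" using d by (simp add: field_simps)
  qed
  have Nfar': "\<bar>N t\<bar> \<le> ex" "\<bar>N' t\<bar> \<le> 8 / \<delta> * ex" if t: "3 * \<delta> / 4 \<le> \<bar>t\<bar>" "\<bar>t\<bar> \<le> \<delta>" for t
   using Nfar[of "\<bar>t\<bar>"] t N(3,4)[of t] by (cases "t \<ge> 0"; simp)+
  define \<rho> where "\<rho> t = \<psi> t * N t" for t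
  define \<rho>1 where "\<rho>1 t = \<psi>' t * N t + \<psi> t * N' t" for t
  define \<rho>2 where "\<rho>2 t = \<psi>'' t * N t + 2 * \<psi>' t * N' t + \<psi> t * (K^2 * ((sin t)^2 - b) * N t)" for t
  have dr: "DERIV \<rho> t :> \<rho>1 t" "DERIV (\<rho>1) t :> \<rho>2 t" for t
   unfolding \<rho>_def [abs_def] \<rho>1_def [abs_def] \<rho>2_def
   by (rule derivative_eq_intros x N refl | simp)+
  have cont: "continuous_on S N" "continuous_on S N'" "continuous_on S \<psi>" "continuous_on S \<psi>'" "continuous_on S \<rho>" for S
   using N(1,2) x(1,2) dr(1) DERIV_isCont by (blast intro: continuous_at_imp_continuous_on)+
  have c2: "continuous_on UNIV \<rho>2"
   unfolding \<rho>2_def using x(3) by (intro continuous_intros cont)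
  define R2 where "R2 = integral {-\<delta>..\<delta>} (\<lambda>t. (\<rho> t)\<^sup>2)"
  have R2int: "((\<lambda>t. (\<rho> t)\<^sup>2) has_integral R2) {-\<delta>..\<delta>}"
   unfolding R2_def by (intro integrable_integral integrable_continuous_real continuous_intros cont)
  have R2: "R2 \<ge> \<delta> / 8 * m^2"
  proof -
   have i: "((\<lambda>t. m\<^sup>2) has_integral (\<delta> / 8 * m^2)) {\<delta>/4..a0}"
    using has_integral_const_real[of "m^2" "\<delta>/4" a0] d by (simp add: a0_def)
   have sub: "(\<lambda>t. (\<rho> t)\<^sup>2) integrable_on {\<delta>/4..a0}"
    by (intro integrable_continuous_real continuous_intros cont)
   have "\<delta> / 8 * m^2 \<le> integral {\<delta>/4..a0} (\<lambda>t. (\<rho> t)\<^sup>2)"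
   proof (rule has_integral_le[OF i integrable_integral[OF sub]])
    fix t assume t: "t \<in> {\<delta>/4..a0}"
    have "N a0 \<le> N t * exp (- 0 * (a0 - t))"
     by (rule dec0(2)) (use Nnn d t a0d in auto)
    then have "m \<le> N t" by (simp add: m_def)
    moreover have "\<psi> t = 1" using t d by (intro x1) (auto simp: a0_def)
    ultimately show "m^2 \<le> (\<rho> t)^2" unfolding \<rho>_def using m by (intro power_mono) auto
   qed
   also have "... \<le> R2" unfolding R2_def
    by (rule integral_subset_le) (use d R2int sub in \<open>auto simp: a0_def\<close>)
   finally show ?thesis .
  qed
  have R2pos: "R2 > 0" using R2 m d by (smt (verit) divide_pos_pos mult_pos_pos zero_less_power)
  define R where "R = sqrt R2"
  have R: "R > 0" "R^2 = R2" "sqrt (\<delta> / 8) * m \<le> R"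
  proof -
   show "R > 0" "R^2 = R2" using R2pos by (auto simp: R_def)
   have "sqrt (\<delta> / 8 * m^2) \<le> R" unfolding R_def using R2 by (rule real_sqrt_le_mono)
   then show "sqrt (\<delta> / 8) * m \<le> R" using m by (simp only: real_sqrt_mult real_sqrt_abs abs_of_pos)
  qed
  have res: "\<bar>\<rho>2 t - K^2 * ((sin t)^2 - b) * \<rho> t\<bar> \<le> Cx * (16 / \<delta> + 1) * ex" if t: "t \<in> {-\<delta>..\<delta>}" for t
  proof (cases "\<bar>t\<bar> \<le> 3 * \<delta> / 4")
   case True
   have "0 \<le> Cx * (16 / \<delta> + 1) * ex" using Cx d m by (auto simp: ex_def intro!: mult_nonneg_nonneg add_nonneg_nonneg)
   then show ?thesis using x1[OF True] by (simp add: \<rho>2_def \<rho>_def)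
  next
   case False
   have e: "\<rho>2 t - K^2 * ((sin t)^2 - b) * \<rho> t = \<psi>'' t * N t + 2 * (\<psi>' t * N' t)"
    by (simp add: \<rho>2_def \<rho>_def)
   have "\<bar>\<psi>'' t\<bar> * \<bar>N t\<bar> \<le> Cx * ex"
    using Cxall[of t] Nfar'[of t] False t by (intro mult_mono) auto
   moreover have "\<bar>\<psi>' t\<bar> * \<bar>N' t\<bar> \<le> Cx * (8 / \<delta> * ex)"
    using Cxall[of t] Nfar'[of t] False t by (intro mult_mono) auto
   ultimately have "\<bar>\<psi>'' t\<bar> * \<bar>N t\<bar> + 2 * (\<bar>\<psi>' t\<bar> * \<bar>N' t\<bar>) \<le> Cx * ex + 2 * (Cx * (8 / \<delta> * ex))" by linarith
   also have "... = Cx * (16 / \<delta> + 1) * ex" by (simp add: algebra_simps)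
   finally show ?thesis unfolding e using abs_triangle_ineq[of "\<psi>'' t * N t" "2 * (\<psi>' t * N' t)"]
    by (simp only: abs_mult abs_numeral)
  qed
  define s where "s = M' \<mu>"
  have s: "s \<noteq> 0" "\<And>t. t \<in> {-\<mu>..\<mu>} ==> \<bar>M t\<bar> \<le> \<bar>s\<bar>"
   unfolding s_def by (rule radial_energy[OF M(1,2,3,5,6,7)]; use Kb b1 mu in \<open>auto simp: b1_def\<close>)+
  have "is_quasimode \<mu> \<delta> (C * exp (- \<gamma> * K)) K b (\<lambda>t. \<rho> t / R) (\<lambda>t. \<rho>1 t / R) (\<lambda>t. \<rho>2 t / R) (\<lambda>t. M t / s) (\<lambda>t. M' t / s)"
   unfolding is_quasimode_def
  proof (intro conjI allI ballI impI)
   show "DERIV (\<lambda>t. \<rho> t / R) t :> \<rho>1 t / R" "DERIV (\<lambda>t. \<rho>1 t / R) t :> \<rho>2 t / R"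
    "((\<lambda>t. M t / s) has_real_derivative M' t / s) (at t)" for t
    by (intro DERIV_cdivide dr M)+
   show "continuous_on UNIV (\<lambda>t. \<rho>2 t / R)" using c2 R by (intro continuous_intros) auto
   show "\<rho> t / R = 0" if "\<delta> \<le> \<bar>t\<bar>" for t using x0[of t] that d by (simp add: \<rho>_def)
   have "((\<lambda>t. inverse (R^2) * (\<rho> t)^2) has_integral (inverse (R^2) * R2)) {-\<delta>..\<delta>}"
    by (rule has_integral_mult_right[OF R2int])
   then show "((\<lambda>t. (\<rho> t / R)\<^sup>2) has_integral 1) {-\<delta>..\<delta>}"
    using R(2) R2pos by (simp add: power_divide divide_inverse mult.commute power_mult_distrib power_inverse)
   show "DERIV (\<lambda>t. M' t / s) t :> - K\<^sup>2 * ((cosh t)^2 - b) * (M t / s)" for t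
    using DERIV_cdivide[OF M(2)[of t], of s] by simp
   show "M \<mu> / s = 0" "M (- \<mu>) / s = 0" "M' \<mu> / s = 1" "M' (- \<mu>) / s = - 1"
    using M(3-5) s(1) by (auto simp: s_def)
   show "\<bar>M t / s\<bar> \<le> 1" if "t \<in> {-\<mu>..\<mu>}" for t using s(1) s(2)[OF that] by (simp add: abs_divide divide_le_eq)
   fix t assume t: "t \<in> {-\<delta>..\<delta>}"
   have "\<rho>2 t / R - K^2 * ((sin t)^2 - b) * (\<rho> t / R) = (\<rho>2 t - K^2 * ((sin t)^2 - b) * \<rho> t) / R"
    by (simp add: diff_divide_distrib)
   also have "\<bar>...\<bar> = \<bar>\<rho>2 t - K^2 * ((sin t)^2 - b) * \<rho> t\<bar> / R" using R by (simp only: abs_divide abs_of_pos)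
   also have "... \<le> Cx * (16 / \<delta> + 1) * ex / R" using res[OF t] R by (intro divide_right_mono) auto
   also have "... \<le> Cx * (16 / \<delta> + 1) * ex / (sqrt (\<delta> / 8) * m)"
    using R m d Cx by (intro divide_left_mono mult_nonneg_nonneg) (auto simp: ex_def)
   also have "... = C * exp (- \<gamma> * K)" using m by (simp add: C_def ex_def)
   finally show "\<bar>\<rho>2 t / R - K^2 * ((sin t)^2 - b) * (\<rho> t / R)\<bar> \<le> C * exp (- \<gamma> * K)" .
  qed
  moreover have "K > B" using Kb(1) by simp
  ultimately show "\<exists>K>B. \<exists>b \<rho> \<rho>' \<rho>'' M M'. is_quasimode \<mu> \<delta> (C * exp (- \<gamma> * K)) K b \<rho> \<rho>' \<rho>'' M M'"
   by blast
 qed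
qed

section \<open>Layer potentials of a quasimode\<close>

text \<open>One-sided limits supply the end points themselves: in Green's identity both
  \<open>\<rho>\<close> and \<open>\<rho>'\<close> have to vanish at \<open>\<delta>\<close> and
  \<open>- \<delta>\<close>.\<close>

lemma vanishing_derivative:
 assumes "\<And>t. (f has_real_derivative f' t) (at t)" "continuous_on UNIV f'" "\<And>t. d \<le> \<bar>t\<bar> ==> f t = 0"
 shows "d \<le> \<bar>t\<bar> ==> f' t = 0"
proof -
 have op: "open {t::real. d < \<bar>t\<bar>}" by (intro open_Collect_less continuous_intros)
 have z: "f' s = 0" if "d < \<bar>s\<bar>" for s
 proof -
  have "DERIV (\<lambda>s. 0) s :> f' s"
   by (rule has_field_derivative_transform_within_open[OF assms(1) op]) (use that assms in auto)
  then show ?thesis using DERIV_unique DERIV_const by blast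
 qed
 assume d: "d \<le> \<bar>t\<bar>"
 define e where "e = (if t \<ge> 0 then 1 else -1 :: real)"
 have lim: "((\<lambda>h. f' (t + e * h)) \<longlongrightarrow> f' (t + e * 0)) (at_right 0)"
 proof -
  have "isCont f' (t + e * 0)" using assms(2) by (simp add: continuous_on_eq_continuous_at)
  then show ?thesis by (rule isCont_tendsto_compose) (intro tendsto_intros)
 qed
 have "\<forall>\<^sub>F h in at_right 0. f' (t + e * h) = 0"
  unfolding eventually_at_right_field
 proof (intro exI[of _ 1] conjI allI impI)
  fix h :: real assume "0 < h" "h < 1"
  then have "d < \<bar>t + e * h\<bar>" using d by (auto simp: e_def abs_if)
  then show "f' (t + e * h) = 0" by (rule z)
 qed simp
 then have "((\<lambda>h. f' (t + e * h)) \<longlongrightarrow> 0) (at_right (0::real))" by (rule tendsto_eventually)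
 then show "f' t = 0" using tendsto_unique[OF _ lim] by simp
qed

text \<open>Green's second identity on the rectangle, in elliptic coordinates, for a solution \<open>H\<close> of the
 transformed Helmholtz equation and the quasimode \<open>\<rho>(\<phi>) M(\<mu>)\<close>.\<close>

lemma green_rectangle:
 fixes H H\<phi> H\<phi>\<phi> H\<mu> H\<mu>\<mu> :: "real => real => real"
 assumes qm: "is_quasimode m \<delta> \<epsilon> K b \<rho> \<rho>' \<rho>'' M M'" and pos: "0 < \<delta>" "0 < m"
  and H: "\<And>x y. x \<in> {-\<delta>..\<delta>} ==> y \<in> {-m..m} ==> ((\<lambda>x. H x y) has_real_derivative H\<phi> x y) (at x)"
   "\<And>x y. x \<in> {-\<delta>..\<delta>} ==> y \<in> {-m..m} ==> ((\<lambda>x. H\<phi> x y) has_real_derivative H\<phi>\<phi> x y) (at x)"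
   "\<And>x y. x \<in> {-\<delta>..\<delta>} ==> y \<in> {-m..m} ==> ((\<lambda>y. H x y) has_real_derivative H\<mu> x y) (at y)"
   "\<And>x y. x \<in> {-\<delta>..\<delta>} ==> y \<in> {-m..m} ==> ((\<lambda>y. H\<mu> x y) has_real_derivative H\<mu>\<mu> x y) (at y)"
  and cont: "continuous_on (cbox (-\<delta>, -m) (\<delta>, m)) (\<lambda>(x, y). H x y)"
   "continuous_on (cbox (-\<delta>, -m) (\<delta>, m)) (\<lambda>(x, y). H\<phi>\<phi> x y)"
   "continuous_on (cbox (-\<delta>, -m) (\<delta>, m)) (\<lambda>(x, y). H\<mu>\<mu> x y)"
  and pde: "\<And>x y. x \<in> {-\<delta>..\<delta>} ==> y \<in> {-m..m} ==>
   H\<phi>\<phi> x y + H\<mu>\<mu> x y + K^2 * ((cosh y)^2 - (sin x)^2) * H x y = 0"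
 shows "integral {-\<delta>..\<delta>} (\<lambda>x. (H x m + H x (-m)) * \<rho> x)
  = integral (cbox (-\<delta>, -m) (\<delta>, m)) (\<lambda>(x, y). H x y * ((\<rho>'' x - K^2 * ((sin x)^2 - b) * \<rho> x) * M y))"
proof -
 have q: "\<And>t. DERIV \<rho> t :> \<rho>' t" "\<And>t. DERIV \<rho>' t :> \<rho>'' t"
  "continuous_on UNIV \<rho>''" "\<And>t. \<delta> \<le> \<bar>t\<bar> ==> \<rho> t = 0"
  "\<And>t. (M has_real_derivative M' t) (at t)" "\<And>t. (M' has_real_derivative - K\<^sup>2 * ((cosh t)^2 - b) * M t) (at t)"
  "M m = 0" "M (- m) = 0" "M' m = 1" "M' (- m) = -1"
  using qm unfolding is_quasimode_def by blast+
 have cont1: "continuous_on S \<rho>" "continuous_on S \<rho>'" "continuous_on S M" "continuous_on S M'" for S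
  using q(1,2,5,6) DERIV_isCont by (blast intro: continuous_at_imp_continuous_on)+
 have c\<rho>'': "continuous_on S \<rho>''" for S using q(3) continuous_on_subset by blast
 have \<rho>'0: "\<rho>' t = 0" if "\<delta> \<le> \<bar>t\<bar>" for t
  by (rule vanishing_derivative[OF q(1) cont1(2) q(4) that])
 let ?C = "cbox (-\<delta>, -m) (\<delta>, m)"
 \<comment> \<open>\<open>?A\<close> is an exact derivative in the angle, \<open>?B\<close> one in
   the radial variable. The angular boundary terms vanish; of the radial ones only those with
   \<open>M' m = 1\<close> and \<open>M' (- m) = - 1\<close> survive. In the sum the separation
   constant joins the residual of \<open>\<rho>\<close>.\<close>
 let ?A = "\<lambda>x y. H x y * (\<rho>'' x * M y) - \<rho> x * M y * H\<phi>\<phi> x y"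
 let ?B = "\<lambda>x y. H x y * (\<rho> x * (- K\<^sup>2 * ((cosh y)^2 - b) * M y)) - \<rho> x * M y * H\<mu>\<mu> x y"
 have comp: "continuous_on ?C (\<lambda>z. f (fst z))" if "continuous_on UNIV f" for f :: "real => real"
  by (intro continuous_on_compose2[OF that]) (auto intro!: continuous_intros)
 have comp': "continuous_on ?C (\<lambda>z. f (snd z))" if "continuous_on UNIV f" for f :: "real => real"
  by (intro continuous_on_compose2[OF that]) (auto intro!: continuous_intros)
 note cc = cont[unfolded split_beta] comp[OF c\<rho>''] comp[OF cont1(1)] comp'[OF cont1(3)]
 have cA: "continuous_on ?C (\<lambda>(x, y). ?A x y)" and cB: "continuous_on ?C (\<lambda>(x, y). ?B x y)"
  unfolding split_beta by (intro continuous_intros cc)+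
 have A0: "integral ?C (\<lambda>(x, y). ?A x y) = 0"
 proof -
  have "integral {-\<delta>..\<delta>} (\<lambda>x. ?A x y) = 0" if y: "y \<in> {-m..m}" for y
  proof -
   have "((\<lambda>x. ?A x y) has_integral
     ((H \<delta> y * (\<rho>' \<delta> * M y) - \<rho> \<delta> * M y * H\<phi> \<delta> y) -
     (H (-\<delta>) y * (\<rho>' (-\<delta>) * M y) - \<rho> (-\<delta>) * M y * H\<phi> (-\<delta>) y))) {-\<delta>..\<delta>}"
   proof (rule fundamental_theorem_of_calculus)
    show "- \<delta> \<le> \<delta>" using pos by simp
    fix x assume x: "x \<in> {-\<delta>..\<delta>}"
    have "DERIV (\<lambda>x. H x y * (\<rho>' x * M y) - \<rho> x * M y * H\<phi> x y) x :> ?A x y"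
     by (rule derivative_eq_intros H(1,2)[OF x y] q refl | simp add: algebra_simps)+
    then show "((\<lambda>x. H x y * (\<rho>' x * M y) - \<rho> x * M y * H\<phi> x y) has_vector_derivative ?A x y) (at x within {-\<delta>..\<delta>})"
     by (simp add: has_real_derivative_iff_has_vector_derivative has_vector_derivative_at_within)
   qed
   then show ?thesis using q(4) \<rho>'0 pos by (simp add: integral_unique)
  qed
  then have "integral (cbox (-m) m) (\<lambda>y. integral (cbox (-\<delta>) \<delta>) (\<lambda>x. ?A x y)) = integral (cbox (-m) m) (\<lambda>y. 0)"
   by (intro integral_cong) simp
  then show ?thesis
   using integral_prod_continuous[OF cA] integral_swap_continuous[OF cA] by simp
 qed
 have B0: "integral ?C (\<lambda>(x, y). ?B x y) = integral {-\<delta>..\<delta>} (\<lambda>x. (H x m + H x (-m)) * \<rho> x)"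
 proof -
  have "integral {-m..m} (\<lambda>y. ?B x y) = (H x m + H x (-m)) * \<rho> x" if x: "x \<in> {-\<delta>..\<delta>}" for x
  proof -
   have "((\<lambda>y. ?B x y) has_integral
     ((H x m * (\<rho> x * M' m) - \<rho> x * M m * H\<mu> x m) -
     (H x (-m) * (\<rho> x * M' (-m)) - \<rho> x * M (-m) * H\<mu> x (-m)))) {-m..m}"
   proof (rule fundamental_theorem_of_calculus)
    show "- m \<le> m" using pos by simp
    fix y assume y: "y \<in> {-m..m}"
    have "DERIV (\<lambda>y. H x y * (\<rho> x * M' y) - \<rho> x * M y * H\<mu> x y) y :> ?B x y"
     by (rule derivative_eq_intros H(3,4)[OF x y] q(5,6) refl | simp add: algebra_simps)+
    then show "((\<lambda>y. H x y * (\<rho> x * M' y) - \<rho> x * M y * H\<mu> x y) has_vector_derivative ?B x y) (at y within {-m..m})"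
     by (simp add: has_real_derivative_iff_has_vector_derivative has_vector_derivative_at_within)
   qed
   then show ?thesis using q by (simp add: integral_unique algebra_simps)
  qed
  then have "integral (cbox (-\<delta>) \<delta>) (\<lambda>x. integral (cbox (-m) m) (\<lambda>y. ?B x y)) = integral {-\<delta>..\<delta>} (\<lambda>x. (H x m + H x (-m)) * \<rho> x)"
   unfolding cbox_interval by (intro integral_cong) blast
  then show ?thesis using integral_prod_continuous[OF cB] by simp
 qed
 have "integral ?C (\<lambda>(x, y). H x y * ((\<rho>'' x - K^2 * ((sin x)^2 - b) * \<rho> x) * M y))
   = integral ?C (\<lambda>z. (\<lambda>(x, y). ?A x y) z + (\<lambda>(x, y). ?B x y) z)"
 proof (rule integral_cong)
  fix z assume "z \<in> ?C"
  then obtain x y where z: "z = (x, y)" "x \<in> {-\<delta>..\<delta>}" "y \<in> {-m..m}" by (cases z) (auto simp: mem_box cbox_Pair_eq)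
  have eq: "H\<phi>\<phi> x y = - H\<mu>\<mu> x y - K^2 * ((cosh y)^2 - (sin x)^2) * H x y" using pde[OF z(2,3)] by linarith
  show "(\<lambda>(x, y). H x y * ((\<rho>'' x - K^2 * ((sin x)^2 - b) * \<rho> x) * M y)) z = (\<lambda>(x, y). ?A x y) z + (\<lambda>(x, y). ?B x y) z"
   unfolding z(1) split eq by (simp add: algebra_simps)
 qed
 also have "... = integral {-\<delta>..\<delta>} (\<lambda>x. (H x m + H x (-m)) * \<rho> x)"
  using integral_add[OF integrable_continuous[OF cA] integrable_continuous[OF cB]] A0 B0 by simp
 finally show ?thesis by simp
qed

text \<open>One interface for both parts of the Hankel function: \<open>\<beta>\<close> is the
  coefficient of the pole of \<open>w'\<close>, 0 for the regular solution and \<open>1 / pi\<close>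
  for the logarithmic one. It will be the strength of the jump.\<close>

locale bessel_solution =
 fixes w w' w'' :: "real => real" and \<beta> Cw :: real
 assumes w: "\<And>s. s > 0 ==> (w has_real_derivative w' s) (at s)"
   "\<And>s. s > 0 ==> (w' has_real_derivative w'' s) (at s)"
  and ode: "\<And>s. s > 0 ==> s * w'' s + w' s + w s = 0"
  and w_bounds: "\<And>s. s > 0 ==> \<bar>w s\<bar> \<le> Cw * (1 + s powr (-1/4))"
   "\<And>s. s > 0 ==> \<bar>w' s - \<beta> / s\<bar> \<le> Cw / sqrt s"
  and Cw: "Cw > 0"
  and w_measurable [measurable]: "w \<in> borel_measurable borel" "w' \<in> borel_measurable borel"
begin

lemma cont_w:
 "continuous_on {0<..} w" "continuous_on {0<..} w'" "continuous_on {0<..} w''"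
proof -
 show c: "continuous_on {0<..} w" "continuous_on {0<..} w'"
  by (auto intro!: continuous_at_imp_continuous_on DERIV_isCont w)
 have "continuous_on {0<..} (\<lambda>s. - (w' s + w s) / s)"
  using c by (intro continuous_intros) auto
 then show "continuous_on {0<..} w''"
 proof (rule continuous_on_eq)
  fix s :: real assume "s \<in> {0<..}"
  then show "- (w' s + w s) / s = w'' s" using ode[of s] by (simp add: field_simps)
 qed
qed

end

text \<open>The comparison function \<open>1 / sqrt \<bar>x - x0\<bar>\<close> takes the value 0 at
  \<open>x0\<close>, so that the pointwise estimate may fail at this one point.\<close>

lemma integral_le_except:
 fixes f g :: "real => real"
 assumes "f integrable_on {a..b}" "(g has_integral I) {a..b}"
  and "\<And>x. x \<in> {a..b} ==> x \<noteq> e ==> f x \<le> g x"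
 shows "integral {a..b} f \<le> I"
proof -
 have "((\<lambda>x. if x = e then max (f x) (g x) else g x) has_integral I) {a..b}"
  by (rule has_integral_spike_finite[OF _ _ assms(2), of "{e}"]) auto
 then show ?thesis
  by (rule has_integral_le[OF integrable_integral[OF assms(1)]]) (use assms(3) in auto)
qed

lemma inverse_sqrt_integral:
 fixes a b x0 :: real
 assumes "x0 \<in> {a..b}"
 shows "((\<lambda>x. 1 / sqrt \<bar>x - x0\<bar>) has_integral (2 * sqrt (b - x0) + 2 * sqrt (x0 - a))) {a..b}"
proof -
 let ?G = "\<lambda>x. 2 * (x - x0) / sqrt \<bar>x - x0\<bar>"
 have G: "?G x = 2 * sgn (x - x0) * sqrt \<bar>x - x0\<bar>" for x
 proof (cases "x = x0")
  case False
  have "x - x0 = sgn (x - x0) * (sqrt \<bar>x - x0\<bar> * sqrt \<bar>x - x0\<bar>)" by (simp add: sgn_mult_abs)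
  then show ?thesis using False by (simp add: field_simps)
 qed simp
 have "((\<lambda>x. 1 / sqrt \<bar>x - x0\<bar>) has_integral (2 * sgn (b - x0) * sqrt \<bar>b - x0\<bar> - 2 * sgn (a - x0) * sqrt \<bar>a - x0\<bar>)) {a..b}"
 proof (rule fundamental_theorem_of_calculus_strong[where S = "{x0}"])
  show "a \<le> b" using assms by auto
  show "continuous_on {a..b} (\<lambda>x. 2 * sgn (x - x0) * sqrt \<bar>x - x0\<bar>)"
  proof -
   have "isCont (\<lambda>x. 2 * sgn (x - x0) * sqrt \<bar>x - x0\<bar>) x" for x
   proof (cases "x = x0")
    case True
    have "((\<lambda>x. 2 * sgn (x - x0) * sqrt \<bar>x - x0\<bar>) \<longlongrightarrow> 0) (at x0)"
    proof (rule Lim_null_comparison)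
     show "\<forall>\<^sub>F x in at x0. norm (2 * sgn (x - x0) * sqrt \<bar>x - x0\<bar>) \<le> 2 * sqrt \<bar>x - x0\<bar>"
      by (rule always_eventually) (auto simp: abs_mult abs_sgn_eq)
     have "((\<lambda>x. 2 * sqrt \<bar>x - x0\<bar>) \<longlongrightarrow> 2 * sqrt \<bar>x0 - x0\<bar>) (at x0)" by (intro tendsto_intros)
     then show "((\<lambda>x. 2 * sqrt \<bar>x - x0\<bar>) \<longlongrightarrow> 0) (at x0)" by simp
    qed
    then show ?thesis using True by (simp add: isCont_def)
   next
    case False
    then show ?thesis by (intro continuous_intros) auto
   qed
   then show ?thesis by (simp add: continuous_at_imp_continuous_on)
  qed
  fix x assume x: "x \<in> {a..b} - {x0}"
  have "DERIV (\<lambda>x. 2 * sgn (x - x0) * sqrt \<bar>x - x0\<bar>) x :> 1 / sqrt \<bar>x - x0\<bar>"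
  proof (cases "x > x0")
   case True
   have "DERIV (\<lambda>x. 2 * sqrt (x - x0)) x :> 1 / sqrt \<bar>x - x0\<bar>"
    using True by (auto intro!: derivative_eq_intros simp: field_simps)
   then show ?thesis
    by (rule has_field_derivative_transform_within_open[where S = "{x0<..}"]) (use True in auto)
  next
   case False
   then have l: "x < x0" using x by auto
   have "DERIV (\<lambda>x. - 2 * sqrt (x0 - x)) x :> 1 / sqrt \<bar>x - x0\<bar>"
    using l by (auto intro!: derivative_eq_intros simp: field_simps)
   then show ?thesis
    by (rule has_field_derivative_transform_within_open[where S = "{..<x0}"]) (use l in auto)
  qed
  then show "((\<lambda>x. 2 * sgn (x - x0) * sqrt \<bar>x - x0\<bar>) has_vector_derivative 1 / sqrt \<bar>x - x0\<bar>) (at x)"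
   by (simp add: has_real_derivative_iff_has_vector_derivative)
 qed simp
 moreover have "2 * sgn (b - x0) * sqrt \<bar>b - x0\<bar> - 2 * sgn (a - x0) * sqrt \<bar>a - x0\<bar> = 2 * sqrt (b - x0) + 2 * sqrt (x0 - a)"
  using assms by (auto simp: sgn_if)
 ultimately show ?thesis by simp
qed

text \<open>The complex number \<open>c * sin (\<phi> + \<i> \<mu>)\<close> read as a vector. With
  \<open>\<mu>\<close> of either sign and \<open>\<phi>\<close> near 0 it parametrises a
  neighbourhood of the minor axis without a seam along the focal segment.\<close>

definition epoint :: "real => real => real => real ^ 2" where
 "epoint c \<phi> \<mu> = vector [c * cosh \<mu> * sin \<phi>, c * sinh \<mu> * cos \<phi>]"

lemma epoint_nth [simp]: "epoint c \<phi> \<mu> $ 1 = c * cosh \<mu> * sin \<phi>" "epoint c \<phi> \<mu> $ 2 = c * sinh \<mu> * cos \<phi>"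
 by (simp_all add: epoint_def)

lemma epoint_axis: "epoint c x y = (c * cosh y * sin x) *\<^sub>R axis 1 1 + (c * sinh y * cos x) *\<^sub>R axis 2 1"
 by (simp add: vec_eq_iff forall_2 axis_def)

lemma continuous_on_epoint: "continuous_on S (\<lambda>z. epoint c (fst z) (snd z))"
 unfolding epoint_axis by (intro continuous_intros)

lemma continuous_on_epoint_arc: "continuous_on S (\<lambda>x. epoint c x y)"
 unfolding epoint_axis by (intro continuous_intros)

lemma epoint_measurable [measurable]: "(\<lambda>x. epoint c x y) \<in> borel_measurable borel"
 by (rule borel_measurable_continuous_onI[OF continuous_on_epoint_arc])

lemma norm_sq_2: "(norm (v :: real ^ 2))^2 = (v $ 1)^2 + (v $ 2)^2"
 unfolding power2_norm_eq_inner inner_vec_def by (simp add: sum_2 power2_eq_square)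

lemma inner_2: "(v :: real ^ 2) \<bullet> u = v $ 1 * u $ 1 + v $ 2 * u $ 2"
 by (simp add: inner_vec_def sum_2)

lemma norm_epoint_diff:
 "norm (epoint c \<phi> \<mu> - epoint c \<phi>' \<mu>') = \<bar>c\<bar> * cmod (sin (Complex \<phi> \<mu>) - sin (Complex \<phi>' \<mu>'))"
proof -
 have re: "Re (sin (Complex x y)) = cosh y * sin x" "Im (sin (Complex x y)) = sinh y * cos x" for x y
  by (simp_all add: Re_sin Im_sin cosh_field_def sinh_field_def)
 have "(norm (epoint c \<phi> \<mu> - epoint c \<phi>' \<mu>'))^2 = (\<bar>c\<bar> * cmod (sin (Complex \<phi> \<mu>) - sin (Complex \<phi>' \<mu>')))^2"
  unfolding norm_sq_2 power_mult_distrib cmod_power2 by (simp add: re algebra_simps power2_eq_square)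
 then show ?thesis by (metis abs_ge_zero mult_nonneg_nonneg norm_ge_zero power2_eq_imp_eq)
qed

lemma half_le_abs_sin:
 assumes "\<bar>x\<bar> \<le> (1::real)"
 shows "\<bar>x\<bar> / 2 \<le> \<bar>sin x\<bar>"
proof -
 have pos: "x / 2 \<le> sin x" if x: "0 \<le> x" "x \<le> 1" for x :: real
 proof -
  have "(\<lambda>x. sin x - x / 2) 0 \<le> (\<lambda>x. sin x - x / 2) x"
  proof (rule DERIV_nonneg_imp_nondecreasing[where f = "\<lambda>x. sin x - x / 2"])
   fix t assume t: "0 \<le> t" "t \<le> x"
   have "cos (pi / 3) \<le> cos t" using t x pi_gt3 by (intro cos_monotone_0_pi_le) auto
   then have "0 \<le> cos t - 1 / 2" by (simp add: cos_60)
   moreover have "DERIV (\<lambda>x. sin x - x / 2) t :> cos t - 1 / 2"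
    by (auto intro!: derivative_eq_intros)
   ultimately show "\<exists>y. DERIV (\<lambda>x. sin x - x / 2) t :> y \<and> 0 \<le> y" by blast
  qed (use x in auto)
  then show ?thesis by simp
 qed
 show ?thesis
 proof (cases "x \<ge> 0")
  case True then show ?thesis using pos[of x] assms by auto
 next
  case False then show ?thesis using pos[of "-x"] assms by auto
 qed
qed

lemma abs_le_abs_sinh: "\<bar>x\<bar> \<le> \<bar>sinh (x::real)\<bar>"
proof -
 have pos: "x \<le> sinh x" if x: "0 \<le> x" for x :: real
 proof -
  have "(\<lambda>x. sinh x - x) 0 \<le> (\<lambda>x. sinh x - x) x"
  proof (rule DERIV_nonneg_imp_nondecreasing[where f = "\<lambda>x. sinh x - x"])
   fix t :: real
   have "DERIV (\<lambda>x. sinh x - x) t :> cosh t - 1" by (auto intro!: derivative_eq_intros)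
   then show "\<exists>y. DERIV (\<lambda>x. sinh x - x) t :> y \<and> 0 \<le> y" using cosh_real_ge_1[of t] by fastforce
  qed (use x in auto)
  then show ?thesis by simp
 qed
 show ?thesis using pos[of "\<bar>x\<bar>"] by (cases "x \<ge> 0") auto
qed

text \<open>The squared modulus of the sine at \<open>u + \<i> v\<close> is
  \<open>sin u ^ 2 + sinh v ^ 2\<close>.\<close>

lemma norm_sin_complex_ge:
 assumes "\<bar>u\<bar> \<le> 1"
 shows "sqrt (u^2 + v^2) / 2 \<le> cmod (sin (Complex u v))"
proof -
 have "(cmod (sin (Complex u v)))^2 = (sin u)^2 * (cosh v)^2 + (sinh v)^2 * (cos u)^2"
  unfolding cmod_power2 by (simp add: Re_sin Im_sin cosh_field_def sinh_field_def power_mult_distrib power_divide)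
 also have "... = (sin u)^2 + (sinh v)^2"
  by (simp add: cosh_square_eq cos_squared_eq algebra_simps)
 finally have e: "(cmod (sin (Complex u v)))^2 = (sin u)^2 + (sinh v)^2" .
 have "(\<bar>u\<bar> / 2)^2 \<le> \<bar>sin u\<bar>\<^sup>2" using half_le_abs_sin[OF assms] by (intro power_mono) auto
 then have 1: "u^2 / 4 \<le> (sin u)^2" by (simp add: power_divide)
 have "\<bar>v\<bar>\<^sup>2 \<le> \<bar>sinh v\<bar>\<^sup>2" using abs_le_abs_sinh[of v] by (intro power_mono) auto
 then have 2: "v^2 \<le> (sinh v)^2" by simp
 have 3: "v^2 / 4 \<le> v^2" by simp
 have "(u^2 + v^2) / 4 \<le> (cmod (sin (Complex u v)))^2"
  unfolding e add_divide_distrib using add_mono[OF 1 order_trans[OF 3 2]] .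
 then have "sqrt ((u^2 + v^2) / 4) \<le> cmod (sin (Complex u v))" by (intro real_le_lsqrt) auto
 then show ?thesis by (simp add: real_sqrt_divide)
qed

lemma norm_cos_complex_ge: "\<bar>cos u\<bar> \<le> cmod (cos (Complex u v))"
proof -
 have "\<bar>cos u\<bar>\<^sup>2 \<le> (cmod (cos (Complex u v)))^2" unfolding norm_cos_squared by simp
 then show ?thesis by (rule power2_le_imp_le) simp
qed

section \<open>Geometry of the rectangle in elliptic coordinates\<close>

locale ellipse_rect =
 fixes c m \<delta> :: real
 assumes c: "c > 0" and m: "m > 0" and \<delta>: "0 < \<delta>" "\<delta> \<le> 1"
begin

abbreviation "J \<equiv> {-\<delta>..\<delta>}"

definition R where "R = cbox (-\<delta>, -m) (\<delta>, m)"

definition c0 where "c0 = c * cos \<delta> / 4"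

lemma R_iff: "(x, y) \<in> R \<longleftrightarrow> x \<in> J \<and> y \<in> {-m..m}"
 by (auto simp: R_def cbox_Pair_eq)

lemma cos\<delta>: "cos \<delta> > 0"
 using \<delta> pi_gt3 by (intro cos_gt_zero) auto

lemma c0: "c0 > 0"
 using c cos\<delta> by (simp add: c0_def)

text \<open>A difference of sines is twice the sine of half the difference times the cosine of half
  the sum. The first factor is at least a quarter of the distance of the arguments, the second at
  least \<open>cos \<delta>\<close>.\<close>

lemma epoint_bilipschitz:
 assumes "x \<in> J" "x' \<in> J"
 shows "2 * c0 * sqrt ((x - x')^2 + (y - y')^2) \<le> norm (epoint c x y - epoint c x' y')"
proof -
 let ?z = "Complex x y" and ?z' = "Complex x' y'"
 have "sin ?z - sin ?z' = 2 * sin ((?z - ?z') / 2) * cos ((?z + ?z') / 2)" by (rule sin_diff_sin)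
 moreover have "(?z - ?z') / 2 = Complex ((x - x') / 2) ((y - y') / 2)" "(?z + ?z') / 2 = Complex ((x + x') / 2) ((y + y') / 2)"
  by (simp_all add: complex_eq_iff)
 ultimately have e: "cmod (sin ?z - sin ?z') = 2 * cmod (sin (Complex ((x - x') / 2) ((y - y') / 2))) * cmod (cos (Complex ((x + x') / 2) ((y + y') / 2)))"
  by (simp add: norm_mult)
 have 1: "sqrt ((x - x')^2 + (y - y')^2) / 4 \<le> cmod (sin (Complex ((x - x') / 2) ((y - y') / 2)))"
 proof -
  have "\<bar>(x - x') / 2\<bar> \<le> 1" using assms \<delta> by auto
  from norm_sin_complex_ge[OF this, of "(y - y') / 2"]
  have "sqrt (((x - x') / 2)^2 + ((y - y') / 2)^2) / 2 \<le> cmod (sin (Complex ((x - x') / 2) ((y - y') / 2)))" .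
  moreover have "sqrt (((x - x') / 2)^2 + ((y - y') / 2)^2) = sqrt ((x - x')^2 + (y - y')^2) / 2"
   by (simp add: power_divide add_divide_distrib[symmetric] real_sqrt_divide)
  ultimately show ?thesis by simp
 qed
 have 2: "cos \<delta> \<le> cmod (cos (Complex ((x + x') / 2) ((y + y') / 2)))"
 proof -
  have "cos \<delta> \<le> cos \<bar>(x + x') / 2\<bar>" using assms \<delta> pi_gt3 by (intro cos_monotone_0_pi_le) auto
  also have "... \<le> \<bar>cos ((x + x') / 2)\<bar>" by (simp only: cos_abs_real abs_ge_self)
  also have "... \<le> cmod (cos (Complex ((x + x') / 2) ((y + y') / 2)))" by (rule norm_cos_complex_ge)
  finally show ?thesis .
 qed
 have "2 * c0 * sqrt ((x - x')^2 + (y - y')^2) = c * (2 * (sqrt ((x - x')^2 + (y - y')^2) / 4) * cos \<delta>)"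
  by (simp add: c0_def)
 also have "... \<le> c * cmod (sin ?z - sin ?z')"
  unfolding e using 1 2 cos\<delta> c by (intro mult_left_mono mult_mono) auto
 finally show ?thesis using c by (simp add: norm_epoint_diff)
qed

text \<open>Compare an arbitrary \<open>a\<close> with the point of the image nearest to it; the
  triangle inequality costs the factor 2 that separates \<open>c0\<close> from the constant before.
  The estimate is uniform in \<open>a\<close>, near or far, as the passage to the boundary
  requires.\<close>

lemma nearest_point_bound:
 obtains x0 y0 where "(x0, y0) \<in> R"
  "\<And>x y. (x, y) \<in> R ==> c0 * sqrt ((x - x0)^2 + (y - y0)^2) \<le> norm (epoint c x y - a)"
proof -
 have cR: "compact R" "R \<noteq> {}" unfolding R_def using \<delta> m by (simp_all only: compact_cbox) (simp add: cbox_Pair_eq)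
 have "continuous_on R (\<lambda>z. norm (epoint c (fst z) (snd z) - a))"
  by (intro continuous_intros continuous_on_epoint)
 from continuous_attains_inf[OF cR this] obtain z where z: "z \<in> R" "\<And>z'. z' \<in> R ==> norm (epoint c (fst z) (snd z) - a) \<le> norm (epoint c (fst z') (snd z') - a)"
  by blast
 obtain x0 y0 where z0: "z = (x0, y0)" by fastforce
 show thesis
 proof (rule that)
  show "(x0, y0) \<in> R" using z z0 by simp
  fix x y assume xy: "(x, y) \<in> R"
  have "2 * c0 * sqrt ((x - x0)^2 + (y - y0)^2) \<le> norm (epoint c x y - epoint c x0 y0)"
   using xy z z0 by (intro epoint_bilipschitz) (auto simp: R_iff)
  also have "... \<le> norm (epoint c x y - a) + norm (epoint c x0 y0 - a)"
   using norm_triangle_ineq4[of "epoint c x y - a" "epoint c x0 y0 - a"] by simp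
  also have "... \<le> norm (epoint c x y - a) + norm (epoint c x y - a)"
   using z(2)[OF xy] z0 by simp
  finally show "c0 * sqrt ((x - x0)^2 + (y - y0)^2) \<le> norm (epoint c x y - a)" by simp
 qed
qed

definition Crect where "Crect = (4 * sqrt (2 * \<delta>)) * (4 * sqrt (2 * m)) / c0"

abbreviation "area \<equiv> 4 * \<delta> * m + Crect"

text \<open>By the inequality of arithmetic and geometric means the planar singularity is dominated
  by a product of two one-dimensional inverse square roots, and the bound \<open>Crect\<close> does
  not involve \<open>a\<close>.\<close>

lemma inverse_distance_integral:
 assumes a: "\<And>x y. (x, y) \<in> R ==> epoint c x y \<noteq> a"
 shows "integral R (\<lambda>(x, y). 1 / norm (epoint c x y - a)) \<le> Crect"
proof -
 obtain x0 y0 where z0: "(x0, y0) \<in> R"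
  and nb: "\<And>x y. (x, y) \<in> R ==> c0 * sqrt ((x - x0)^2 + (y - y0)^2) \<le> norm (epoint c x y - a)"
  using nearest_point_bound[of a] by blast
 have "continuous_on R (\<lambda>z. 1 / norm (epoint c (fst z) (snd z) - a))"
  using a by (intro continuous_intros continuous_on_epoint) auto
 then have cont: "continuous_on R (\<lambda>(x, y). 1 / norm (epoint c x y - a))" by (simp add: split_beta)
 have pt: "1 / norm (epoint c x y - a) \<le> 1 / c0 * (1 / sqrt \<bar>x - x0\<bar>) * (1 / sqrt \<bar>y - y0\<bar>)"
  if "(x, y) \<in> R" "x \<noteq> x0" "y \<noteq> y0" for x y
 proof -
  have "\<bar>x - x0\<bar> * \<bar>y - y0\<bar> \<le> (x - x0)^2 + (y - y0)^2"
  proof -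
   have "2 * (\<bar>x - x0\<bar> * \<bar>y - y0\<bar>) \<le> (x - x0)^2 + (y - y0)^2"
    using sum_squares_bound[of "\<bar>x - x0\<bar>" "\<bar>y - y0\<bar>"] by (simp add: mult.assoc)
   moreover have "0 \<le> \<bar>x - x0\<bar> * \<bar>y - y0\<bar>" by simp
   ultimately show ?thesis by linarith
  qed
  then have "sqrt \<bar>x - x0\<bar> * sqrt \<bar>y - y0\<bar> \<le> sqrt ((x - x0)^2 + (y - y0)^2)"
   unfolding real_sqrt_mult[symmetric] by (rule real_sqrt_le_mono)
  then have "c0 * (sqrt \<bar>x - x0\<bar> * sqrt \<bar>y - y0\<bar>) \<le> norm (epoint c x y - a)"
   using nb[OF that(1)] c0 by (meson mult_left_mono order_trans less_imp_le)
  moreover have *: "0 < c0 * (sqrt \<bar>x - x0\<bar> * sqrt \<bar>y - y0\<bar>)" using that c0 by simp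
  ultimately have "1 / norm (epoint c x y - a) \<le> 1 / (c0 * (sqrt \<bar>x - x0\<bar> * sqrt \<bar>y - y0\<bar>))"
   by (intro divide_left_mono mult_pos_pos[OF less_le_trans[OF *] *]) auto
  then show ?thesis by simp
 qed
 let ?I = "2 * sqrt (m - y0) + 2 * sqrt (y0 - (-m))"
 let ?J = "2 * sqrt (\<delta> - x0) + 2 * sqrt (x0 - (-\<delta>))"
 have I: "((\<lambda>y. 1 / sqrt \<bar>y - y0\<bar>) has_integral ?I) {-m..m}" "((\<lambda>x. 1 / sqrt \<bar>x - x0\<bar>) has_integral ?J) J"
  using z0 unfolding R_iff by (blast intro: inverse_sqrt_integral)+
 have inner: "integral {-m..m} (\<lambda>y. 1 / norm (epoint c x y - a)) \<le> 1 / c0 * (1 / sqrt \<bar>x - x0\<bar>) * ?I"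
  if "x \<in> J" "x \<noteq> x0" for x
 proof (rule integral_le_except[where e = y0])
  show "(\<lambda>y. 1 / norm (epoint c x y - a)) integrable_on {-m..m}"
   by (intro integrable_continuous_real continuous_on_compose2[OF cont, where f = "\<lambda>y. (x, y)", simplified])
    (use that in \<open>auto simp: R_iff intro!: continuous_intros\<close>)
  show "((\<lambda>y. 1 / c0 * (1 / sqrt \<bar>x - x0\<bar>) * (1 / sqrt \<bar>y - y0\<bar>)) has_integral 1 / c0 * (1 / sqrt \<bar>x - x0\<bar>) * ?I) {-m..m}"
   by (rule has_integral_mult_right[OF I(1)])
  fix y assume "y \<in> {-m..m}" "y \<noteq> y0"
  then show "1 / norm (epoint c x y - a) \<le> 1 / c0 * (1 / sqrt \<bar>x - x0\<bar>) * (1 / sqrt \<bar>y - y0\<bar>)"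
   using that by (intro pt) (auto simp: R_iff)
 qed
 have "integral R (\<lambda>(x, y). 1 / norm (epoint c x y - a)) = integral J (\<lambda>x. integral {-m..m} (\<lambda>y. 1 / norm (epoint c x y - a)))"
  using integral_prod_continuous[OF cont[unfolded R_def]] by (simp add: R_def)
 also have "... \<le> ?I / c0 * ?J"
 proof (rule integral_le_except[where e = x0])
  show "(\<lambda>x. integral {-m..m} (\<lambda>y. 1 / norm (epoint c x y - a))) integrable_on J"
   using integral_integrable_2dim[OF cont[unfolded R_def]] by simp
  show "((\<lambda>x. ?I / c0 * (1 / sqrt \<bar>x - x0\<bar>)) has_integral ?I / c0 * ?J) J"
   by (rule has_integral_mult_right[OF I(2)])
  fix x assume "x \<in> J" "x \<noteq> x0"
  from inner[OF this] show "integral {-m..m} (\<lambda>y. 1 / norm (epoint c x y - a)) \<le> ?I / c0 * (1 / sqrt \<bar>x - x0\<bar>)"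
   by (simp add: mult.commute)
 qed
 also have "... \<le> (4 * sqrt (2 * m)) / c0 * (4 * sqrt (2 * \<delta>))"
 proof -
  have "sqrt (m - y0) \<le> sqrt (2 * m)" "sqrt (y0 - (-m)) \<le> sqrt (2 * m)"
   "sqrt (\<delta> - x0) \<le> sqrt (2 * \<delta>)" "sqrt (x0 - (-\<delta>)) \<le> sqrt (2 * \<delta>)"
   using z0 by (auto simp: R_iff intro!: real_sqrt_le_mono)
  then have "?I \<le> 4 * sqrt (2 * m)" "?J \<le> 4 * sqrt (2 * \<delta>)" by linarith+
  moreover have "0 \<le> ?J" using z0 by (intro add_nonneg_nonneg) (auto simp: R_iff)
  ultimately show ?thesis using c0 m by (intro mult_mono divide_right_mono) auto
 qed
 finally show ?thesis by (simp add: Crect_def mult.commute)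
qed

end

section \<open>Potential kernels on the rectangle and Green's identity\<close>

locale layer_kernel = ellipse_rect c m \<delta> + bessel_solution w w' w'' \<beta> Cw
 for c m \<delta> :: real and w w' w'' :: "real => real" and \<beta> Cw :: real +
 fixes \<kappa> :: real
 assumes \<kappa>: "1 \<le> \<kappa>"
begin

text \<open>The pole of \<open>w'\<close> contributes the first summand, the remainder
  \<open>Cw / sqrt s\<close> the second. With \<open>\<kappa> = k^2 / 4\<close> the second is of
  order \<open>k\<close>.\<close>

abbreviation "wsup \<equiv> 2 * \<bar>\<beta>\<bar> + 2 * Cw * sqrt \<kappa>"

definition sq :: "real ^ 2 => real => real => real" where
 "sq a x y = \<kappa> * (norm (epoint c x y - a))^2"

definition ker :: "real ^ 2 => real => real => real" where
 "ker a x y = w (sq a x y)"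

text \<open>The derivative in the observation point \<open>a\<close>, not in the integration point:
  this is the kernel of the transposed double layer operator.\<close>

definition dker :: "real ^ 2 => real ^ 2 => real => real => real" where
 "dker a n x y = 2 * \<kappa> * w' (sq a x y) * ((a - epoint c x y) \<bullet> n)"

lemma sq_pos: "epoint c x y \<noteq> a ==> sq a x y > 0"
 using \<kappa> by (simp add: sq_def)

lemma sq_expand: "sq a x y = \<kappa> * ((c * cosh y * sin x - a $ 1)^2 + (c * sinh y * cos x - a $ 2)^2)"
 by (simp add: sq_def norm_sq_2)

lemma continuous_on_sq: "continuous_on S (\<lambda>z. sq a (fst z) (snd z))"
 unfolding sq_def by (intro continuous_intros continuous_on_epoint)

text \<open>The coordinates are conformal, so a kernel that solves the Helmholtz equation away from
  \<open>a\<close> solves the transformed equation on the rectangle, with \<open>K\<close> equal to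
  \<open>c\<close> times the wave number.\<close>

lemma green_ker:
 assumes a: "\<And>x y. (x, y) \<in> R ==> epoint c x y \<noteq> a"
  and qm: "is_quasimode m \<delta> \<epsilon> K b \<rho> \<rho>' \<rho>'' M M'" and K: "K^2 = 4 * \<kappa> * c^2"
 shows "integral J (\<lambda>x. (ker a x m + ker a x (-m)) * \<rho> x)
  = integral R (\<lambda>(x, y). ker a x y * ((\<rho>'' x - K^2 * ((sin x)^2 - b) * \<rho> x) * M y))"
proof -
 define X where "X x y = c * cosh y * sin x - a $ 1" for x y
 define Y where "Y x y = c * sinh y * cos x - a $ 2" for x y
 define s where "s x y = \<kappa> * ((X x y)^2 + (Y x y)^2)" for x y
 define s1 where "s1 x y = 2 * \<kappa> * (X x y * (c * cosh y * cos x) - Y x y * (c * sinh y * sin x))" for x y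
 define s2 where "s2 x y = 2 * \<kappa> * (X x y * (c * sinh y * sin x) + Y x y * (c * cosh y * cos x))" for x y
 define g where "g x y = (c * cosh y * cos x)^2 + (c * sinh y * sin x)^2" for x y
 define h where "h x y = X x y * (c * cosh y * sin x) + Y x y * (c * sinh y * cos x)" for x y
 have dX: "DERIV (\<lambda>x. X x y) x :> c * cosh y * cos x"
  "((\<lambda>y. X x y) has_real_derivative c * sinh y * sin x) (at y)"
  "((\<lambda>x. Y x y) has_real_derivative - (c * sinh y * sin x)) (at x)"
  "((\<lambda>y. Y x y) has_real_derivative c * cosh y * cos x) (at y)" for x y
  unfolding X_def Y_def by (auto intro!: derivative_eq_intros)
 have ds: "DERIV (\<lambda>x. s x y) x :> s1 x y"
  "((\<lambda>y. s x y) has_real_derivative s2 x y) (at y)" for x y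
  unfolding s_def s1_def s2_def by (rule derivative_eq_intros dX refl | simp)+
 have ds1: "DERIV (\<lambda>x. s1 x y) x :> 2 * \<kappa> * (g x y - h x y)"
  "((\<lambda>y. s2 x y) has_real_derivative 2 * \<kappa> * (g x y + h x y)) (at y)" for x y
  unfolding s1_def s2_def g_def h_def
  by (rule derivative_eq_intros dX refl | simp add: algebra_simps power2_eq_square)+
 have sq: "sq a x y = s x y" for x y by (simp add: sq_expand s_def X_def Y_def)
 have pos: "s x y > 0" if "x \<in> J" "y \<in> {-m..m}" for x y
  using sq_pos[OF a] that by (simp add: sq R_iff)
 have cont: "continuous_on R (\<lambda>z. s (fst z) (snd z))" "continuous_on R (\<lambda>z. s1 (fst z) (snd z))"
  "continuous_on R (\<lambda>z. s2 (fst z) (snd z))" "continuous_on R (\<lambda>z. g (fst z) (snd z))" "continuous_on R (\<lambda>z. h (fst z) (snd z))"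
  unfolding s_def s1_def s2_def g_def h_def X_def Y_def by (intro continuous_intros)+
 have wc: "continuous_on R (\<lambda>z. f (s (fst z) (snd z)))" if "continuous_on {0<..} f" for f :: "real => real"
  by (rule continuous_on_compose2[OF that cont(1)]) (use pos in \<open>auto simp: R_iff\<close>)
 note wcs = wc[OF cont_w(1)] wc[OF cont_w(2)] wc[OF cont_w(3)]
 \<comment> \<open>With the Jacobian \<open>g\<close>, the squared gradient of \<open>s\<close> is
   \<open>4 * \<kappa> * s * g\<close> and its Laplacian \<open>4 * \<kappa> * g\<close>; the terms
   \<open>h\<close> cancel because the coordinate functions are harmonic. What remains is
   \<open>4 * \<kappa> * g\<close> times the Bessel equation.\<close>
 have key: "w'' (s x y) * ((s1 x y)^2 + (s2 x y)^2) + w' (s x y) * (4 * \<kappa> * g x y)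
   + K^2 * ((cosh y)^2 - (sin x)^2) * w (s x y) = 0" if "x \<in> J" "y \<in> {-m..m}" for x y
 proof -
  have g: "g x y = c^2 * ((cosh y)^2 - (sin x)^2)"
   unfolding g_def power_mult_distrib cosh_square_eq cos_squared_eq by (simp add: algebra_simps)
  have s12: "(s1 x y)^2 + (s2 x y)^2 = 4 * \<kappa> * s x y * g x y"
   unfolding s1_def s2_def s_def g_def by (simp add: algebra_simps power2_eq_square)
  have "w'' (s x y) * (4 * \<kappa> * s x y * g x y) + w' (s x y) * (4 * \<kappa> * g x y) + 4 * \<kappa> * g x y * w (s x y)
    = 4 * \<kappa> * g x y * (s x y * w'' (s x y) + w' (s x y) + w (s x y))" by (simp add: algebra_simps)
  also have "... = 0" using ode[OF pos[OF that]] by simp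
  finally have "w'' (s x y) * (4 * \<kappa> * s x y * g x y) + w' (s x y) * (4 * \<kappa> * g x y) + 4 * \<kappa> * g x y * w (s x y) = 0" .
  moreover have "K^2 * ((cosh y)^2 - (sin x)^2) = 4 * \<kappa> * g x y" unfolding K g by simp
  ultimately show ?thesis unfolding s12 by simp
 qed
 have chain: "DERIV (\<lambda>t. w (f t)) t :> w' (f t) * f'"
  "((\<lambda>t. w' (f t)) has_real_derivative w'' (f t) * f') (at t)"
  if "(f has_real_derivative f') (at t)" "f t > 0" for f f' t
  using DERIV_chain2[OF w(1)[OF that(2)] that(1)] DERIV_chain2[OF w(2)[OF that(2)] that(1)] by simp_all
 have "integral J (\<lambda>x. (w (s x m) + w (s x (-m))) * \<rho> x)
  = integral (cbox (-\<delta>, -m) (\<delta>, m)) (\<lambda>(x, y). w (s x y) * ((\<rho>'' x - K^2 * ((sin x)^2 - b) * \<rho> x) * M y))"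
 proof (rule green_rectangle[OF qm \<delta>(1) m,
   where H\<phi> = "\<lambda>x y. w' (s x y) * s1 x y" and H\<mu> = "\<lambda>x y. w' (s x y) * s2 x y"
    and H\<phi>\<phi> = "\<lambda>x y. w'' (s x y) * (s1 x y)^2 + w' (s x y) * (2 * \<kappa> * (g x y - h x y))"
    and H\<mu>\<mu> = "\<lambda>x y. w'' (s x y) * (s2 x y)^2 + w' (s x y) * (2 * \<kappa> * (g x y + h x y))"])
  fix x y assume xy: "x \<in> J" "y \<in> {-m..m}"
  show "DERIV (\<lambda>x. w (s x y)) x :> w' (s x y) * s1 x y"
   "((\<lambda>y. w (s x y)) has_real_derivative w' (s x y) * s2 x y) (at y)"
   by (intro chain ds pos xy)+
  have "DERIV (\<lambda>x. w' (s x y) * s1 x y) x :> (w'' (s x y) * s1 x y) * s1 x y + 2 * \<kappa> * (g x y - h x y) * w' (s x y)"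
   by (intro DERIV_mult chain ds ds1 pos xy)
  then show "DERIV (\<lambda>x. w' (s x y) * s1 x y) x :> w'' (s x y) * (s1 x y)^2 + w' (s x y) * (2 * \<kappa> * (g x y - h x y))"
   by (simp add: power2_eq_square mult.commute mult.left_commute)
  have "DERIV (\<lambda>y. w' (s x y) * s2 x y) y :> (w'' (s x y) * s2 x y) * s2 x y + 2 * \<kappa> * (g x y + h x y) * w' (s x y)"
   by (intro DERIV_mult chain ds ds1 pos xy)
  then show "DERIV (\<lambda>y. w' (s x y) * s2 x y) y :> w'' (s x y) * (s2 x y)^2 + w' (s x y) * (2 * \<kappa> * (g x y + h x y))"
   by (simp add: power2_eq_square mult.commute mult.left_commute)
  show "w'' (s x y) * (s1 x y)^2 + w' (s x y) * (2 * \<kappa> * (g x y - h x y)) + (w'' (s x y) * (s2 x y)^2 + w' (s x y) * (2 * \<kappa> * (g x y + h x y)))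
    + K^2 * ((cosh y)^2 - (sin x)^2) * w (s x y) = 0"
   using key[OF xy] by (simp add: algebra_simps)
 qed (unfold split_beta, fold R_def, (intro continuous_intros wcs cont)+)
 then show ?thesis by (simp add: ker_def sq R_def)
qed

lemma continuous_on_residual:
 assumes qm: "is_quasimode m \<delta> \<epsilon> K b \<rho> \<rho>' \<rho>'' M M'"
 shows "continuous_on S \<rho>" "continuous_on S' (\<lambda>z. (\<rho>'' (fst z) - K^2 * ((sin (fst z))^2 - b) * \<rho> (fst z)) * M (snd z))"
proof -
 have q: "\<And>t. DERIV \<rho> t :> \<rho>' t" "continuous_on UNIV \<rho>''"
  "\<And>t. (M has_real_derivative M' t) (at t)"
  using qm unfolding is_quasimode_def by blast+
 have c: "continuous_on UNIV \<rho>" "continuous_on UNIV M"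
  using q(1,3) DERIV_isCont by (blast intro: continuous_at_imp_continuous_on)+
 show "continuous_on S \<rho>" using c(1) continuous_on_subset by blast
 have "continuous_on S' (\<lambda>z. \<rho>'' (fst z))" "continuous_on S' (\<lambda>z. \<rho> (fst z))" "continuous_on S' (\<lambda>z. M (snd z))"
  by (rule continuous_on_compose2[OF q(2)] continuous_on_compose2[OF c(1)] continuous_on_compose2[OF c(2)];
    auto intro!: continuous_intros)+
 then show "continuous_on S' (\<lambda>z. (\<rho>'' (fst z) - K^2 * ((sin (fst z))^2 - b) * \<rho> (fst z)) * M (snd z))"
  by (intro continuous_intros)
qed

lemma closed_epoint_image: "closed ((\<lambda>z. epoint c (fst z) (snd z)) ` R)"
proof -
 have "compact R" unfolding R_def by (rule compact_cbox)
 then show ?thesis by (intro compact_imp_closed compact_continuous_image continuous_on_epoint)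
qed

text \<open>Differentiate both sides of \<open>green_ker\<close> along \<open>a + t n\<close> under
  the integral signs; the image of the rectangle is closed, so nearby points stay off it as
  well.\<close>

lemma green_dker:
 assumes a: "\<And>x y. (x, y) \<in> R ==> epoint c x y \<noteq> a"
  and qm: "is_quasimode m \<delta> \<epsilon> K b \<rho> \<rho>' \<rho>'' M M'" and K: "K^2 = 4 * \<kappa> * c^2"
 shows "integral J (\<lambda>x. (dker a n x m + dker a n x (-m)) * \<rho> x)
  = integral R (\<lambda>(x, y). dker a n x y * ((\<rho>'' x - K^2 * ((sin x)^2 - b) * \<rho> x) * M y))"
proof -
 define f where "f z = (\<rho>'' (fst z) - K^2 * ((sin (fst z))^2 - b) * \<rho> (fst z)) * M (snd z)" for z
 have "open (- ((\<lambda>z. epoint c (fst z) (snd z)) ` R))" using closed_epoint_image by (simp add: open_Compl)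
 moreover have "a \<in> - ((\<lambda>z. epoint c (fst z) (snd z)) ` R)" using a by force
 ultimately obtain r where r: "r > 0" "ball a r \<subseteq> - ((\<lambda>z. epoint c (fst z) (snd z)) ` R)"
  by (meson open_contains_ball)
 \<comment> \<open>The summand 1 covers every vector \<open>n\<close>. No length is assumed here, as
   the unit normal is an unspecified vector at points without a tangent.\<close>
 define e where "e = r / (norm n + 1)"
 have e: "e > 0" using r by (simp add: e_def add_nonneg_pos)
 define U where "U = {-e<..<e}"
 have U: "convex U" "0 \<in> U" "0 \<in> interior U" using e by (auto simp: U_def)
 have off: "epoint c x y \<noteq> a + t *\<^sub>R n" if "t \<in> U" "(x, y) \<in> R" for t x y
 proof -
  have "\<bar>t\<bar> * norm n \<le> e * norm n" using that(1) by (intro mult_right_mono) (auto simp: U_def)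
  also have "... < e * (norm n + 1)" using e by simp
  also have "... = r" unfolding e_def using norm_ge_zero[of n] by (simp add: add_nonneg_eq_0_iff)
  finally have "a + t *\<^sub>R n \<in> ball a r" by (simp add: dist_norm)
  then show ?thesis using r(2) that(2) by force
 qed
 have sq_t: "((\<lambda>t. sq (a + t *\<^sub>R n) x y) has_real_derivative 2 * \<kappa> * ((a + t *\<^sub>R n - epoint c x y) \<bullet> n)) (at t within U)" for t x y
  unfolding sq_expand by (auto intro!: derivative_eq_intros simp: inner_2 algebra_simps)
 have ker_t: "((\<lambda>t. ker (a + t *\<^sub>R n) x y) has_real_derivative dker (a + t *\<^sub>R n) n x y) (at t within U)"
  if "t \<in> U" "(x, y) \<in> R" for t x y
  using DERIV_chain2[OF w(1)[OF sq_pos[OF off[OF that]]] sq_t]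
  unfolding ker_def dker_def by (simp add: mult.commute mult.left_commute)
 have csq: "continuous_on S (\<lambda>z. sq (a + fst z *\<^sub>R n) (f (snd z)) (g (snd z)))"
  if "continuous_on S (\<lambda>z. f (snd z))" "continuous_on S (\<lambda>z. g (snd z))" for S :: "(real \<times> 'z::metric_space) set" and f g :: "'z => real"
  unfolding sq_expand using that by (intro continuous_intros)
 have cdker: "continuous_on S (\<lambda>z. dker (a + fst z *\<^sub>R n) n (f (snd z)) (g (snd z)))"
  "continuous_on S (\<lambda>z. ker (a + fst z *\<^sub>R n) (f (snd z)) (g (snd z)))"
  if fg: "continuous_on S (\<lambda>z. f (snd z))" "continuous_on S (\<lambda>z. g (snd z))"
   and "\<And>z. z \<in> S ==> fst z \<in> U \<and> (f (snd z), g (snd z)) \<in> R"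
  for S :: "(real \<times> 'z::metric_space) set" and f g :: "'z => real"
 proof -
  have pos: "sq (a + fst z *\<^sub>R n) (f (snd z)) (g (snd z)) \<in> {0<..}" if "z \<in> S" for z
   using sq_pos[OF off] \<open>\<And>z. z \<in> S ==> fst z \<in> U \<and> (f (snd z), g (snd z)) \<in> R\<close>[OF that] by auto
  have ce: "continuous_on S (\<lambda>z. epoint c (f (snd z)) (g (snd z)))"
   using continuous_on_compose2[OF continuous_on_epoint[of UNIV], of S "\<lambda>z. (f (snd z), g (snd z))"] fg
   by (simp add: continuous_on_Pair)
  show "continuous_on S (\<lambda>z. ker (a + fst z *\<^sub>R n) (f (snd z)) (g (snd z)))"
   unfolding ker_def by (rule continuous_on_compose2[OF cont_w(1) csq[OF fg]]) (use pos in auto)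
  have "continuous_on S (\<lambda>z. w' (sq (a + fst z *\<^sub>R n) (f (snd z)) (g (snd z))))"
   by (rule continuous_on_compose2[OF cont_w(2) csq[OF fg]]) (use pos in auto)
  then show "continuous_on S (\<lambda>z. dker (a + fst z *\<^sub>R n) n (f (snd z)) (g (snd z)))"
   unfolding dker_def by (intro continuous_intros ce)
 qed
 note c\<rho> = continuous_on_residual(1)[OF qm]
 note cf = continuous_on_residual(2)[OF qm, folded f_def]
 let ?L = "\<lambda>t. integral (cbox (-\<delta>) \<delta>) (\<lambda>x. (ker (a + t *\<^sub>R n) x m + ker (a + t *\<^sub>R n) x (-m)) * \<rho> x)"
 let ?Rh = "\<lambda>t. integral (cbox (-\<delta>, -m) (\<delta>, m)) (\<lambda>z. ker (a + t *\<^sub>R n) (fst z) (snd z) * f z)"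
 have c\<rho>snd: "continuous_on S (\<lambda>z::real \<times> real. \<rho> (snd z))" for S
  by (rule continuous_on_compose2[OF c\<rho>[of UNIV]]) (auto intro!: continuous_intros)
 have cfsnd: "continuous_on S (\<lambda>z::real \<times> real \<times> real. f (snd z))" for S
  by (rule continuous_on_compose2[OF cf[of UNIV]]) (auto intro!: continuous_intros)
 have cpair: "continuous_on S (\<lambda>x. (t, x))" for S t by (intro continuous_intros)
 have mpm: "(x, m) \<in> R" "(x, - m) \<in> R" if "x \<in> cbox (-\<delta>) \<delta>" for x using that m by (auto simp: R_iff)
 have L1: "continuous_on (U \<times> cbox (-\<delta>) \<delta>) (\<lambda>z. (ker (a + fst z *\<^sub>R n) (snd z) m + ker (a + fst z *\<^sub>R n) (snd z) (-m)) * \<rho> (snd z))"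
  "continuous_on (U \<times> cbox (-\<delta>) \<delta>) (\<lambda>z. (dker (a + fst z *\<^sub>R n) n (snd z) m + dker (a + fst z *\<^sub>R n) n (snd z) (-m)) * \<rho> (snd z))"
  by (intro continuous_intros cdker c\<rho>snd; use mpm in auto)+
 have R1: "continuous_on (U \<times> cbox (-\<delta>, -m) (\<delta>, m)) (\<lambda>z. ker (a + fst z *\<^sub>R n) (fst (snd z)) (snd (snd z)) * f (snd z))"
  "continuous_on (U \<times> cbox (-\<delta>, -m) (\<delta>, m)) (\<lambda>z. dker (a + fst z *\<^sub>R n) n (fst (snd z)) (snd (snd z)) * f (snd z))"
  by (intro continuous_intros cdker cfsnd; auto simp: R_def)+
 have dL: "(?L has_field_derivative integral (cbox (-\<delta>) \<delta>) (\<lambda>x. (dker (a + 0 *\<^sub>R n) n x m + dker (a + 0 *\<^sub>R n) n x (-m)) * \<rho> x)) (at 0 within U)"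
 proof (rule leibniz_rule_field_derivative[where fx = "\<lambda>t x. (dker (a + t *\<^sub>R n) n x m + dker (a + t *\<^sub>R n) n x (-m)) * \<rho> x"])
  fix t x assume t: "t \<in> U" and x: "x \<in> cbox (-\<delta>) \<delta>"
  show "((\<lambda>t. (ker (a + t *\<^sub>R n) x m + ker (a + t *\<^sub>R n) x (- m)) * \<rho> x) has_field_derivative
   (dker (a + t *\<^sub>R n) n x m + dker (a + t *\<^sub>R n) n x (- m)) * \<rho> x) (at t within U)"
   by (intro DERIV_cmult_right DERIV_add ker_t t mpm x)
 next
  fix t assume t: "t \<in> U"
  show "(\<lambda>x. (ker (a + t *\<^sub>R n) x m + ker (a + t *\<^sub>R n) x (- m)) * \<rho> x) integrable_on cbox (- \<delta>) \<delta>"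
   using continuous_on_compose2[OF L1(1) cpair[of _ t]] t by (intro integrable_continuous) auto
 qed (use L1 U in \<open>auto simp: split_beta\<close>)
 have dR: "(?Rh has_field_derivative integral (cbox (-\<delta>, -m) (\<delta>, m)) (\<lambda>z. dker (a + 0 *\<^sub>R n) n (fst z) (snd z) * f z)) (at 0 within U)"
 proof (rule leibniz_rule_field_derivative[where fx = "\<lambda>t z. dker (a + t *\<^sub>R n) n (fst z) (snd z) * f z"])
  fix t and z :: "real \<times> real" assume t: "t \<in> U" and z: "z \<in> cbox (-\<delta>, -m) (\<delta>, m)"
  show "((\<lambda>t. ker (a + t *\<^sub>R n) (fst z) (snd z) * f z) has_field_derivative dker (a + t *\<^sub>R n) n (fst z) (snd z) * f z) (at t within U)"
   by (intro DERIV_cmult_right ker_t t) (use z in \<open>simp add: R_def\<close>)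
 next
  fix t assume t: "t \<in> U"
  show "(\<lambda>z. ker (a + t *\<^sub>R n) (fst z) (snd z) * f z) integrable_on cbox (- \<delta>, - m) (\<delta>, m)"
   using continuous_on_compose2[OF R1(1) cpair[of _ t]] t by (intro integrable_continuous) auto
 qed (use R1 U in \<open>auto simp: split_beta\<close>)
 have eq: "?L t = ?Rh t" if "t \<in> U" for t
  using green_ker[OF off[OF that] qm K] by (simp add: R_def case_prod_unfold f_def)
 have "(?Rh has_field_derivative integral (cbox (-\<delta>) \<delta>) (\<lambda>x. (dker (a + 0 *\<^sub>R n) n x m + dker (a + 0 *\<^sub>R n) n x (-m)) * \<rho> x)) (at 0 within U)"
  by (rule has_field_derivative_transform_within[OF dL e U(2)]) (rule eq)
 then show ?thesis
  using dR DERIV_unique by (simp add: at_within_interior[OF U(3)] R_def case_prod_unfold f_def) blast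
qed

text \<open>With \<open>r\<close> the distance to \<open>a\<close>, both the inverse square root in
  the kernel and the pole in its derivative are absorbed by \<open>1 + 1 / r\<close>. The number
  \<open>\<Lambda>\<close> allows for normals that are not of unit length.\<close>

lemma kernel_bounds:
 assumes ne: "epoint c x y \<noteq> a" and n: "norm n \<le> \<Lambda>" and \<Lambda>: "1 \<le> \<Lambda>"
 shows "\<bar>ker a x y\<bar> \<le> \<Lambda> * wsup * (1 + 1 / norm (epoint c x y - a))"
  and "\<bar>dker a n x y\<bar> \<le> \<Lambda> * wsup * (1 + 1 / norm (epoint c x y - a))"
proof -
 define r where "r = norm (epoint c x y - a)"
 have r: "r > 0" using ne by (simp add: r_def)
 have s: "sq a x y = \<kappa> * r^2" by (simp add: sq_def r_def)
 have spos: "sq a x y > 0" using sq_pos[OF ne] .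
 have k1: "1 \<le> sqrt \<kappa>" using \<kappa> by simp
 have "(sq a x y) powr (-1/4) \<le> (r^2) powr (-1/4)"
  unfolding s using \<kappa> r by (intro powr_mono2') (auto simp: mult_ge1_I field_simps)
 also have "(r^2) powr (-1/4) = r powr (-1/2)" using r by (simp add: powr_powr flip: powr_numeral)
 also have "... \<le> 1 + 1 / r"
 proof (cases "r \<le> 1")
  case True
  have "r powr (-1/2) \<le> r powr (-1)" using r True by (intro powr_mono') auto
  then show ?thesis using r by (simp add: powr_minus_divide)
 next
  case False
  have "r powr (-1/2) \<le> r powr 0" using False by (intro powr_mono) auto
  then show ?thesis using r by (simp add: add_increasing2)
 qed
 finally have "(sq a x y) powr (-1/4) \<le> 1 + 1 / r" .
 moreover have "1 \<le> 1 + 1 / r" using r by simp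
 ultimately have p: "1 + (sq a x y) powr (-1/4) \<le> 2 * (1 + 1 / r)" unfolding mult_2 by (rule add_mono[rotated])
 have "\<bar>ker a x y\<bar> \<le> Cw * (2 * (1 + 1 / r))"
  using w_bounds(1)[OF spos] mult_left_mono[OF p, of Cw] Cw unfolding ker_def by linarith
 also have "... = (2 * Cw) * (1 + 1 / r)" by simp
 also have "... \<le> (\<Lambda> * wsup) * (1 + 1 / r)"
 proof (rule mult_right_mono)
  have "2 * Cw * 1 \<le> 2 * Cw * sqrt \<kappa>" using k1 Cw by (intro mult_left_mono) auto
  then have "2 * Cw \<le> 2 * \<bar>\<beta>\<bar> + 2 * Cw * sqrt \<kappa>" by simp
  also have "... = 1 * wsup" by simp
  also have "... \<le> \<Lambda> * wsup" using \<Lambda> Cw k1 by (intro mult_right_mono) auto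
  finally show "2 * Cw \<le> \<Lambda> * wsup" .
 qed (use r in auto)
 finally show "\<bar>ker a x y\<bar> \<le> \<Lambda> * wsup * (1 + 1 / norm (epoint c x y - a))" by (simp add: r_def)
 have ip: "\<bar>(a - epoint c x y) \<bullet> n\<bar> \<le> r * \<Lambda>"
 proof -
  have "\<bar>(a - epoint c x y) \<bullet> n\<bar> \<le> norm (a - epoint c x y) * norm n" by (rule Cauchy_Schwarz_ineq2)
  also have "... \<le> r * \<Lambda>" unfolding r_def norm_minus_commute[of a] using n by (intro mult_left_mono) auto
  finally show ?thesis .
 qed
 have "\<bar>w' (sq a x y)\<bar> \<le> \<bar>\<beta>\<bar> / sq a x y + Cw / sqrt (sq a x y)"
 proof -
  have "\<bar>\<beta> / sq a x y\<bar> = \<bar>\<beta>\<bar> / sq a x y" using spos by (simp add: abs_divide)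
  moreover have "\<bar>w' (sq a x y)\<bar> \<le> \<bar>\<beta> / sq a x y\<bar> + \<bar>w' (sq a x y) - \<beta> / sq a x y\<bar>"
   by (metis abs_triangle_ineq add.commute diff_add_cancel)
  ultimately show ?thesis using w_bounds(2)[OF spos] by linarith
 qed
 then have "\<bar>dker a n x y\<bar> \<le> 2 * \<kappa> * (\<bar>\<beta>\<bar> / sq a x y + Cw / sqrt (sq a x y)) * (r * \<Lambda>)"
  unfolding dker_def abs_mult using \<kappa> ip spos Cw by (intro mult_mono) auto
 also have "... = \<Lambda> * (2 * \<bar>\<beta>\<bar> * (1 / r) + 2 * Cw * sqrt \<kappa>)"
 proof -
  have "sqrt (sq a x y) = sqrt \<kappa> * r" unfolding s using r by (simp add: real_sqrt_mult)
  moreover have "\<kappa> = sqrt \<kappa> * sqrt \<kappa>" using \<kappa> by simp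
  ultimately show ?thesis unfolding s using r k1 \<kappa> by (simp add: field_simps power2_eq_square)
 qed
 also have "... \<le> \<Lambda> * (wsup * (1 + 1 / r))"
 proof (rule mult_left_mono)
  have "0 \<le> 2 * \<bar>\<beta>\<bar> + 2 * Cw * sqrt \<kappa> * (1 / r)" using r Cw k1 by (intro add_nonneg_nonneg mult_nonneg_nonneg) auto
  then show "2 * \<bar>\<beta>\<bar> * (1 / r) + 2 * Cw * sqrt \<kappa> \<le> wsup * (1 + 1 / r)"
   by (simp add: algebra_simps)
 qed (use \<Lambda> in auto)
 finally show "\<bar>dker a n x y\<bar> \<le> \<Lambda> * wsup * (1 + 1 / norm (epoint c x y - a))" by (simp add: r_def)
qed

text \<open>In Green's identity the residual is at most \<open>\<epsilon>\<close>, and the kernels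
  are integrable over the rectangle uniformly in \<open>a\<close>. So the bound does not deteriorate
  as \<open>a\<close> approaches the ellipse.\<close>

lemma outside_bounds:
 assumes a: "\<And>x y. (x, y) \<in> R ==> epoint c x y \<noteq> a"
  and qm: "is_quasimode m \<delta> \<epsilon> K b \<rho> \<rho>' \<rho>'' M M'" and K: "K^2 = 4 * \<kappa> * c^2" and n: "norm n \<le> \<Lambda>" and \<Lambda>: "1 \<le> \<Lambda>"
 shows "\<bar>integral J (\<lambda>x. (ker a x m + ker a x (-m)) * \<rho> x)\<bar>
   \<le> \<epsilon> * (\<Lambda> * wsup * area)"
  and "\<bar>integral J (\<lambda>x. (dker a n x m + dker a n x (-m)) * \<rho> x)\<bar>
   \<le> \<epsilon> * (\<Lambda> * wsup * area)"
proof -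
 let ?B = "\<Lambda> * wsup"
 have B: "?B \<ge> 0" using \<Lambda> Cw \<kappa> by (intro mult_nonneg_nonneg add_nonneg_nonneg) auto
 let ?f = "\<lambda>z. (\<rho>'' (fst z) - K^2 * ((sin (fst z))^2 - b) * \<rho> (fst z)) * M (snd z)"
 have f: "\<bar>?f z\<bar> \<le> \<epsilon>" if "z \<in> R" for z
 proof -
  obtain x y where z: "z = (x, y)" by fastforce
  have "\<bar>\<rho>'' x - K^2 * ((sin x)^2 - b) * \<rho> x\<bar> \<le> \<epsilon>" "\<bar>M y\<bar> \<le> 1"
   using qm that unfolding z R_iff is_quasimode_def by blast+
  then have "\<bar>\<rho>'' x - K^2 * ((sin x)^2 - b) * \<rho> x\<bar> * \<bar>M y\<bar> \<le> \<epsilon> * 1" by (intro mult_mono) auto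
  then show ?thesis by (simp add: z abs_mult)
 qed
 have e0: "\<epsilon> \<ge> 0"
  using f[of "(0, 0)"] m \<delta> by (simp add: R_iff) 
 have cr: "continuous_on R (\<lambda>z. 1 / norm (epoint c (fst z) (snd z) - a))"
  using a by (intro continuous_intros continuous_on_epoint) auto
 have "integral R (\<lambda>z. \<epsilon> * ?B * (1 + 1 / norm (epoint c (fst z) (snd z) - a)))
   = \<epsilon> * ?B * (integral R (\<lambda>z. 1) + integral R (\<lambda>z. 1 / norm (epoint c (fst z) (snd z) - a)))"
  using cr by (simp add: R_def integral_add integrable_continuous)
 also have "integral R (\<lambda>z. 1) = 4 * \<delta> * m"
  using m \<delta> by (simp add: R_def content_Pair)
 also have "\<epsilon> * ?B * (4 * \<delta> * m + integral R (\<lambda>z. 1 / norm (epoint c (fst z) (snd z) - a))) \<le> \<epsilon> * ?B * area"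
  using inverse_distance_integral[OF a] e0 B by (intro mult_left_mono add_left_mono) (auto simp: case_prod_unfold)
 finally have I: "integral R (\<lambda>z. \<epsilon> * ?B * (1 + 1 / norm (epoint c (fst z) (snd z) - a))) \<le> \<epsilon> * (?B * area)"
  by (simp add: mult.assoc)
 have main: "\<bar>integral R (\<lambda>z. k (fst z) (snd z) * ?f z)\<bar> \<le> \<epsilon> * (?B * area)"
  if k: "continuous_on R (\<lambda>z. k (fst z) (snd z))"
   "\<And>x y. (x, y) \<in> R ==> \<bar>k x y\<bar> \<le> ?B * (1 + 1 / norm (epoint c x y - a))" for k
 proof -
  have "norm (integral R (\<lambda>z. k (fst z) (snd z) * ?f z)) \<le> integral R (\<lambda>z. \<epsilon> * ?B * (1 + 1 / norm (epoint c (fst z) (snd z) - a)))"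
  proof (rule integral_norm_bound_integral)
   show "(\<lambda>z. k (fst z) (snd z) * ?f z) integrable_on R"
    unfolding R_def by (intro integrable_continuous continuous_on_mult k(1)[unfolded R_def] continuous_on_residual(2)[OF qm])
   show "(\<lambda>z. \<epsilon> * ?B * (1 + 1 / norm (epoint c (fst z) (snd z) - a))) integrable_on R"
    unfolding R_def by (intro integrable_continuous continuous_intros cr[unfolded R_def])
   fix z assume z: "z \<in> R"
   have "\<bar>k (fst z) (snd z)\<bar> * \<bar>?f z\<bar> \<le> (?B * (1 + 1 / norm (epoint c (fst z) (snd z) - a))) * \<epsilon>"
    using k(2)[of "fst z" "snd z"] f[OF z] z B by (intro mult_mono) auto
   then show "norm (k (fst z) (snd z) * ?f z) \<le> \<epsilon> * ?B * (1 + 1 / norm (epoint c (fst z) (snd z) - a))"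
    by (simp add: abs_mult mult.commute mult.left_commute)
  qed
  then show ?thesis using I by simp
 qed
 have cs: "sq a (fst z) (snd z) \<in> {0<..}" if "z \<in> R" for z using sq_pos[OF a] that by auto
 have ck: "continuous_on R (\<lambda>z. ker a (fst z) (snd z))"
  unfolding ker_def by (rule continuous_on_compose2[OF cont_w(1) continuous_on_sq]) (use cs in auto)
 have "continuous_on R (\<lambda>z. w' (sq a (fst z) (snd z)))"
  by (rule continuous_on_compose2[OF cont_w(2) continuous_on_sq]) (use cs in auto)
 then have cd: "continuous_on R (\<lambda>z. dker a n (fst z) (snd z))"
  unfolding dker_def by (intro continuous_intros continuous_on_epoint)
 show "\<bar>integral J (\<lambda>x. (ker a x m + ker a x (-m)) * \<rho> x)\<bar> \<le> \<epsilon> * (?B * area)"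
  using main[OF ck kernel_bounds(1)[OF a n \<Lambda>]] green_ker[OF a qm K] by (simp add: case_prod_unfold)
 show "\<bar>integral J (\<lambda>x. (dker a n x m + dker a n x (-m)) * \<rho> x)\<bar> \<le> \<epsilon> * (?B * area)"
  using main[OF cd kernel_bounds(2)[OF a n \<Lambda>]] green_dker[OF a qm K] by (simp add: case_prod_unfold)
qed

end

section \<open>Lebesgue integrals for the limit at the boundary\<close>

lemma inverse_sqrt_set_integrable:
 fixes a b x0 :: real
 assumes "x0 \<in> {a..b}"
 shows "set_integrable lborel {a..b} (\<lambda>x. 1 / sqrt \<bar>x - x0\<bar>)"
  and "(LINT x:{a..b}|lborel. 1 / sqrt \<bar>x - x0\<bar>) \<le> 4 * sqrt (b - a)"
proof -
 note I = inverse_sqrt_integral[OF assms]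
 have "(\<lambda>x. 1 / sqrt \<bar>x - x0\<bar>) absolutely_integrable_on {a..b}"
  by (rule nonnegative_absolutely_integrable_1) (use I in auto)
 then show *: "set_integrable lborel {a..b} (\<lambda>x. 1 / sqrt \<bar>x - x0\<bar>)"
  unfolding set_integrable_def by (subst (asm) integrable_completion) auto
 have "sqrt (b - x0) \<le> sqrt (b - a)" "sqrt (x0 - a) \<le> sqrt (b - a)"
  using assms by (auto intro!: real_sqrt_le_mono)
 then have "2 * sqrt (b - x0) + 2 * sqrt (x0 - a) \<le> 4 * sqrt (b - a)" by linarith
 then show "(LINT x:{a..b}|lborel. 1 / sqrt \<bar>x - x0\<bar>) \<le> 4 * sqrt (b - a)"
  using set_borel_integral_eq_integral(2)[OF *] integral_unique[OF I] by simp
qed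

lemma integral_inverse_1_plus_square:
 "integrable lborel (\<lambda>x::real. inverse (1 + x^2))" "(LINT x|lborel. inverse (1 + (x::real)^2)) = pi"
 using integrable_inverse_1_plus_square LBINT_inverse_1_plus_square
 by (auto simp: set_integrable_def interval_lebesgue_integral_def set_lebesgue_integral_def)

lemma integral_inverse_1_plus_scaled_square:
 fixes v :: real
 assumes "v > 0"
 shows "integrable lborel (\<lambda>x::real. 1 / (1 + v * x^2))" "(LINT x|lborel. 1 / (1 + v * (x::real)^2)) = pi / sqrt v"
proof -
 let ?f = "\<lambda>x::real. inverse (1 + x^2)"
 have sv: "sqrt v \<noteq> 0" using assms by simp
 have e: "?f (0 + sqrt v * x) = 1 / (1 + v * x^2)" for x
  using assms by (simp add: power_mult_distrib inverse_eq_divide)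
 show "integrable lborel (\<lambda>x::real. 1 / (1 + v * x^2))"
  using lborel_integrable_real_affine[OF integral_inverse_1_plus_square(1) sv, of 0] unfolding e .
 have "pi = sqrt v * (LINT x|lborel. 1 / (1 + v * (x::real)^2))"
  using lborel_integral_real_affine[OF sv, of ?f 0] integral_inverse_1_plus_square(2) assms unfolding e by simp
 then show "(LINT x|lborel. 1 / (1 + v * (x::real)^2)) = pi / sqrt v" using sv by (simp add: field_simps)
qed

text \<open>\<open>t / (D + 2 t m + t^2)\<close> is an approximate identity at the zero \<open>x0\<close> of \<open>D\<close>: rescaling by \<open>t\<close> turns
 it into \<open>1 / (1 + v \<sigma>\<^sup>2)\<close> in the limit.\<close>

lemma poisson_limit:
 fixes D mm \<rho> :: "real => real" and t :: "nat => real"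
 assumes [measurable]: "D \<in> borel_measurable borel" "mm \<in> borel_measurable borel" "\<rho> \<in> borel_measurable borel"
  and \<rho>: "isCont \<rho> x0" "\<And>x. \<bar>\<rho> x\<bar> \<le> B" and c1: "c1 > 0"
  and D: "\<And>x. \<rho> x \<noteq> 0 ==> c1 * (x - x0)^2 \<le> D x" "D x0 = 0" "((\<lambda>x. D x / (x - x0)^2) \<longlongrightarrow> v) (at x0)" and v: "v > 0"
  and mm: "\<And>x. 0 \<le> mm x" "\<And>x. mm x \<le> C * D x"
  and t: "\<And>j. t j > 0" "t \<longlonglongrightarrow> 0"
 shows "(\<lambda>j. LINT x|lborel. t j / (D x + 2 * t j * mm x + (t j)^2) * \<rho> x) \<longlonglongrightarrow> pi * \<rho> x0 / sqrt v"
proof -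
 \<comment> \<open>The integrand after the substitution \<open>x = x0 + t j * s\<close>, with
   numerator and denominator divided by \<open>(t j)^2\<close>.\<close>
 define h where "h j s = \<rho> (x0 + t j * s) / (D (x0 + t j * s) / (t j)^2 + 2 * (mm (x0 + t j * s) / t j) + 1)" for j s
 have B: "B \<ge> 0" using \<rho>(2)[of 0] by linarith
 have subst: "(LINT x|lborel. t j / (D x + 2 * t j * mm x + (t j)^2) * \<rho> x) = (LINT s|lborel. h j s)" for j
 proof -
  have nz: "t j \<noteq> 0" using t(1)[of j] by simp
  have "(LINT x|lborel. t j / (D x + 2 * t j * mm x + (t j)^2) * \<rho> x)
   = t j * (LINT s|lborel. t j / (D (x0 + t j * s) + 2 * t j * mm (x0 + t j * s) + (t j)^2) * \<rho> (x0 + t j * s))"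
   using lborel_integral_real_affine[OF nz, of "\<lambda>x. t j / (D x + 2 * t j * mm x + (t j)^2) * \<rho> x" x0] t(1)[of j] by simp
  also have "... = (LINT s|lborel. t j * (t j / (D (x0 + t j * s) + 2 * t j * mm (x0 + t j * s) + (t j)^2) * \<rho> (x0 + t j * s)))"
   by (rule integral_mult_right_zero[symmetric])
  also have "... = (LINT s|lborel. h j s)"
  proof (rule Bochner_Integration.integral_cong)
   fix s
   have "D (x0 + t j * s) / (t j)^2 + 2 * (mm (x0 + t j * s) / t j) + 1
    = (D (x0 + t j * s) + 2 * t j * mm (x0 + t j * s) + (t j)^2) / (t j)^2"
    using nz by (simp add: field_simps power2_eq_square)
   then show "t j * (t j / (D (x0 + t j * s) + 2 * t j * mm (x0 + t j * s) + (t j)^2) * \<rho> (x0 + t j * s)) = h j s"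
    unfolding h_def using nz by (simp add: power2_eq_square)
  qed simp
  finally show ?thesis .
 qed
 have pt: "(\<lambda>j. h j s) \<longlonglongrightarrow> \<rho> x0 * (1 / (1 + v * s^2))" for s
 proof -
  have lim0: "(\<lambda>j. x0 + t j * s) \<longlonglongrightarrow> x0" using t(2) by (auto intro!: tendsto_eq_intros)
  have r: "(\<lambda>j. \<rho> (x0 + t j * s)) \<longlonglongrightarrow> \<rho> x0" using isCont_tendsto_compose[OF \<rho>(1) lim0] .
  have d: "(\<lambda>j. D (x0 + t j * s) / (t j)^2) \<longlonglongrightarrow> v * s^2"
  proof (cases "s = 0")
   case False
   have "filterlim (\<lambda>j. x0 + t j * s) (at x0) sequentially"
    using lim0 False t(1) by (auto simp: filterlim_at less_imp_neq[OF t(1), symmetric])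
   then have "(\<lambda>j. D (x0 + t j * s) / (x0 + t j * s - x0)^2) \<longlonglongrightarrow> v"
    using filterlim_compose[OF D(3)] by blast
   then have "(\<lambda>j. D (x0 + t j * s) / (t j * s)^2 * s^2) \<longlonglongrightarrow> v * s^2" by (intro tendsto_mult) auto
   moreover have "D (x0 + t j * s) / (t j * s)^2 * s^2 = D (x0 + t j * s) / (t j)^2" for j
    using False by (simp add: power_mult_distrib)
   ultimately show ?thesis by simp
  qed (simp add: D)
  have "(\<lambda>j. mm (x0 + t j * s) / t j) \<longlonglongrightarrow> 0"
  proof (rule tendsto_sandwich)
   show "\<forall>\<^sub>F j in sequentially. 0 \<le> mm (x0 + t j * s) / t j"
    using mm(1) t(1) by (intro always_eventually) (simp add: less_imp_le)
   show "\<forall>\<^sub>F j in sequentially. mm (x0 + t j * s) / t j \<le> C * t j * (D (x0 + t j * s) / (t j)^2)"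
   proof (intro always_eventually allI)
    fix j
    have "mm (x0 + t j * s) / t j \<le> C * D (x0 + t j * s) / t j"
     using mm(2) t(1)[of j] by (intro divide_right_mono) (auto simp: less_imp_le)
    also have "... = C * t j * (D (x0 + t j * s) / (t j)^2)" using t(1)[of j] by (simp add: power2_eq_square)
    finally show "mm (x0 + t j * s) / t j \<le> C * t j * (D (x0 + t j * s) / (t j)^2)" .
   qed
   have "(\<lambda>j. C * t j * (D (x0 + t j * s) / (t j)^2)) \<longlonglongrightarrow> C * 0 * (v * s^2)"
    by (intro tendsto_intros t d)
   then show "(\<lambda>j. C * t j * (D (x0 + t j * s) / (t j)^2)) \<longlonglongrightarrow> 0" by simp
  qed simp
  then have "(\<lambda>j. h j s) \<longlonglongrightarrow> \<rho> x0 / (v * s^2 + 2 * 0 + 1)"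
   unfolding h_def using v by (intro tendsto_intros r d) (auto simp: add_nonneg_eq_0_iff)
  then show ?thesis by (simp add: add.commute)
 qed
 have "(\<lambda>j. LINT s|lborel. h j s) \<longlonglongrightarrow> (LINT s|lborel. \<rho> x0 * (1 / (1 + v * s^2)))"
 \<comment> \<open>Since \<open>mm\<close> is nonnegative and \<open>D\<close> has a quadratic lower
   bound on the support of \<open>\<rho>\<close>, this majorant serves all \<open>j\<close>.\<close>
 proof (rule integral_dominated_convergence[where w = "\<lambda>s. B * (1 / (1 + c1 * s^2))"])
  show "integrable lborel (\<lambda>s. B * (1 / (1 + c1 * s^2)))"
   by (intro integrable_mult_right integral_inverse_1_plus_scaled_square c1)
  show "AE s in lborel. (\<lambda>j. h j s) \<longlonglongrightarrow> \<rho> x0 * (1 / (1 + v * s^2))" using pt by simp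
  show "AE s in lborel. norm (h j s) \<le> B * (1 / (1 + c1 * s^2))" for j
  proof (rule AE_I2)
   fix s
   show "norm (h j s) \<le> B * (1 / (1 + c1 * s^2))"
   proof (cases "\<rho> (x0 + t j * s) = 0")
    case True
    then show ?thesis using B c1 by (simp add: h_def)
   next
    case False
    have tj: "t j > 0" using t(1) .
    have "c1 * (t j * s)^2 \<le> D (x0 + t j * s)" using D(1)[OF False] by simp
    then have "c1 * s^2 \<le> D (x0 + t j * s) / (t j)^2"
     using tj by (simp add: pos_le_divide_eq power_mult_distrib mult.commute mult.left_commute)
    moreover have "0 \<le> mm (x0 + t j * s) / t j" using mm(1) tj by (simp add: less_imp_le)
    ultimately have den: "1 + c1 * s^2 \<le> D (x0 + t j * s) / (t j)^2 + 2 * (mm (x0 + t j * s) / t j) + 1" by simp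
    have p: "0 < 1 + c1 * s^2" using c1 by (simp add: add_pos_nonneg)
    have "norm (h j s) = \<bar>\<rho> (x0 + t j * s)\<bar> / (D (x0 + t j * s) / (t j)^2 + 2 * (mm (x0 + t j * s) / t j) + 1)"
     unfolding h_def real_norm_def abs_divide using den p by (simp only: abs_of_pos)
    also have "... \<le> B / (1 + c1 * s^2)" by (rule frac_le) (use B \<rho> p den in auto)
    finally show ?thesis by simp
   qed
  qed
 qed (auto simp: h_def)
 then show ?thesis
  unfolding subst integral_mult_right_zero integral_inverse_1_plus_scaled_square(2)[OF v] by (simp add: mult.commute)
qed

section \<open>The quadratic form of the ellipse and its inner normal\<close>

definition ellipse_form :: "real => real => real ^ 2 => real" where
 "ellipse_form a1 a2 x = (x $ 1 / a1)^2 + (x $ 2 / a2)^2"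

text \<open>Half the gradient of \<open>ellipse_form\<close>.\<close>

definition ellipse_grad :: "real => real => real ^ 2 => real ^ 2" where
 "ellipse_grad a1 a2 y = vector [y $ 1 / a1^2, y $ 2 / a2^2]"

text \<open>It points into the ellipse, hence away from the scatterer, in agreement with the
  orientation of \<open>unit_normal\<close>.\<close>

definition inner_normal :: "real => real => real ^ 2 => real ^ 2" where
 "inner_normal a1 a2 y = - (ellipse_grad a1 a2 y /\<^sub>R norm (ellipse_grad a1 a2 y))"

lemma ellipse_form_add:
 "ellipse_form a1 a2 (x + t *\<^sub>R y) = ellipse_form a1 a2 x + 2 * t * (ellipse_grad a1 a2 x \<bullet> y) + t^2 * ellipse_form a1 a2 y"
 unfolding ellipse_form_def ellipse_grad_def inner_2
 by (simp add: power_divide power2_eq_square add_divide_distrib algebra_simps)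

context
 fixes a1 a2 :: real
 assumes a12: "0 < a2" "a2 \<le> a1"
begin

lemma ellipse_form_nonneg: "0 \<le> ellipse_form a1 a2 x"
 by (simp add: ellipse_form_def)

lemma ellipse_form_le: "ellipse_form a1 a2 x \<le> (norm x)^2 / a2^2"
proof -
 have "(x $ 1)^2 / a1^2 \<le> (x $ 1)^2 / a2^2" using a12 by (intro divide_left_mono power_mono) auto
 then show ?thesis by (simp add: ellipse_form_def norm_sq_2 power_divide add_divide_distrib)
qed

lemma norm_grad_ge: 
 assumes "ellipse_form a1 a2 y = 1"
 shows "1 / a1 \<le> norm (ellipse_grad a1 a2 y)"
proof -
 have "(1 / a1)^2 = (1 / a1)^2 * ellipse_form a1 a2 y" using assms by simp
 also have "... = (y $ 1)^2 / (a1^2 * a1^2) + (y $ 2)^2 / (a1^2 * a2^2)"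
  by (simp add: ellipse_form_def power_divide distrib_left)
 also have "(y $ 2)^2 / (a1^2 * a2^2) \<le> (y $ 2)^2 / (a2^2 * a2^2)"
  using a12 by (intro divide_left_mono mult_right_mono power_mono mult_pos_pos) auto
 finally have "(1 / a1)^2 \<le> (norm (ellipse_grad a1 a2 y))^2"
  unfolding norm_sq_2 ellipse_grad_def by (simp add: power_divide power2_eq_square)
 then show ?thesis by (rule power2_le_imp_le) simp
qed

text \<open>If the quadratic form is 1 at both \<open>x\<close> and \<open>y\<close>, its expansion
  at \<open>y\<close> shows that the normal component of \<open>x - y\<close> equals the form of
  \<open>x - y\<close> divided by \<open>2 * norm ?g\<close>. It is therefore nonnegative and
  quadratically small.\<close>

lemma inner_normal_facts:
 assumes y: "ellipse_form a1 a2 y = 1"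
 shows "norm (inner_normal a1 a2 y) = 1"
  and "ellipse_form a1 a2 x = 1 ==> 0 \<le> (x - y) \<bullet> inner_normal a1 a2 y"
  and "ellipse_form a1 a2 x = 1 ==> (x - y) \<bullet> inner_normal a1 a2 y \<le> a1 / (2 * a2^2) * (norm (x - y))^2"
  and "t > 0 ==> 1 < ellipse_form a1 a2 (y - t *\<^sub>R inner_normal a1 a2 y)"
  and "\<forall>\<^sub>F t in at_right 0. ellipse_form a1 a2 (y + t *\<^sub>R inner_normal a1 a2 y) < 1"
proof -
 let ?g = "ellipse_grad a1 a2 y"
 let ?n = "inner_normal a1 a2 y"
 have g: "1 / a1 \<le> norm ?g" using norm_grad_ge[OF y] .
 have gpos: "0 < norm ?g" using g a12 by (smt (verit) divide_pos_pos)
 show n1: "norm ?n = 1" using gpos by (simp add: inner_normal_def)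
 have gn: "?g \<bullet> ?n = - norm ?g"
  using gpos by (simp add: inner_normal_def dot_square_norm power2_eq_square)
 have eq: "(x - y) \<bullet> ?n = ellipse_form a1 a2 (x - y) / (2 * norm ?g)" if x: "ellipse_form a1 a2 x = 1" for x
 proof -
  have "ellipse_form a1 a2 (y + 1 *\<^sub>R (x - y)) = 1" using x by simp
  then have "2 * (?g \<bullet> (x - y)) = - ellipse_form a1 a2 (x - y)"
   unfolding ellipse_form_add using y by simp
  then have "?g \<bullet> (x - y) = - ellipse_form a1 a2 (x - y) / 2" by simp
  moreover have "(x - y) \<bullet> ?n = - (?g \<bullet> (x - y)) / norm ?g"
   unfolding inner_normal_def inner_minus_right inner_scaleR_right inner_commute[of "x - y" ?g]
   by (simp add: divide_inverse)
  ultimately show ?thesis by simp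
 qed
 show "0 \<le> (x - y) \<bullet> ?n" if x: "ellipse_form a1 a2 x = 1" for x
  unfolding eq[OF that] using ellipse_form_nonneg gpos by simp
 show "(x - y) \<bullet> ?n \<le> a1 / (2 * a2^2) * (norm (x - y))^2" if x: "ellipse_form a1 a2 x = 1" for x
 proof -
  have "ellipse_form a1 a2 (x - y) / (2 * norm ?g) \<le> ((norm (x - y))^2 / a2^2) / (2 * (1 / a1))"
   using ellipse_form_le ellipse_form_nonneg g gpos a12 by (intro frac_le) auto
  then show ?thesis unfolding eq[OF that] by (simp add: mult.commute)
 qed
 have q: "ellipse_form a1 a2 (y + t *\<^sub>R ?n) = 1 - 2 * t * norm ?g + t^2 * ellipse_form a1 a2 ?n" for t
  unfolding ellipse_form_add gn using y by simp
 show "1 < ellipse_form a1 a2 (y - t *\<^sub>R ?n)" if "t > 0"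
 proof -
  have "0 < t * norm ?g" using that gpos by simp
  moreover have "0 \<le> t^2 * ellipse_form a1 a2 ?n" using ellipse_form_nonneg by simp
  ultimately show ?thesis using q[of "-t"] by simp
 qed
 have "((\<lambda>t. t * ellipse_form a1 a2 ?n) \<longlongrightarrow> 0 * ellipse_form a1 a2 ?n) (at_right 0)" by (intro tendsto_intros)
 then have "\<forall>\<^sub>F t in at_right 0. t * ellipse_form a1 a2 ?n < 2 * norm ?g"
  using gpos by (intro order_tendstoD(2)[of _ 0]) auto
 then show "\<forall>\<^sub>F t in at_right 0. ellipse_form a1 a2 (y + t *\<^sub>R ?n) < 1"
  using eventually_at_right_less[of 0]
 proof eventually_elim
  case (elim t)
  then have "t * (t * ellipse_form a1 a2 ?n) < t * (2 * norm ?g)" by (intro mult_strict_left_mono)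
  then show ?case unfolding q by (simp add: power2_eq_square)
 qed
qed

end

context ellipse_rect
begin

definition a1 where "a1 = c * cosh m"
definition a2 where "a2 = c * sinh m"

lemma a12: "0 < a2" "a2 \<le> a1"
 using c m by (auto simp: a1_def a2_def cosh_def sinh_def)

lemma ellipse_form_epoint_le:
 assumes "y \<in> {-m..m}"
 shows "ellipse_form a1 a2 (epoint c x y) \<le> 1"
proof -
 have "\<bar>sinh y\<bar> \<le> sinh m" "cosh y \<le> cosh m"
 proof -
  have "sinh y \<le> sinh m" "sinh (- m) \<le> sinh y" using assms by (auto simp only: sinh_real_le_iff atLeastAtMost_iff)
  then show "\<bar>sinh y\<bar> \<le> sinh m" by (simp only: abs_le_iff sinh_minus minus_le_iff)
  have "cosh \<bar>y\<bar> \<le> cosh m" using assms by (subst cosh_real_nonneg_le_iff) auto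
  then show "cosh y \<le> cosh m" by simp
 qed
 then have "(cosh y / cosh m)^2 \<le> 1" "(sinh y / sinh m)^2 \<le> 1"
  using m by (auto simp: abs_square_le_1 abs_divide divide_le_eq cosh_real_nonneg abs_of_nonneg)
 then have "(cosh y / cosh m)^2 * (sin x)^2 + (sinh y / sinh m)^2 * (cos x)^2 \<le> 1 * (sin x)^2 + 1 * (cos x)^2"
  by (intro add_mono mult_right_mono) auto
 moreover have "ellipse_form a1 a2 (epoint c x y) = (cosh y / cosh m)^2 * (sin x)^2 + (sinh y / sinh m)^2 * (cos x)^2"
  using c by (simp add: ellipse_form_def a1_def a2_def power_divide power_mult_distrib)
 ultimately show ?thesis by simp
qed

lemma ellipse_form_epoint_eq:
 assumes "y = m \<or> y = -m"
 shows "ellipse_form a1 a2 (epoint c x y) = 1"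
 using assms c m by (auto simp: ellipse_form_def a1_def a2_def power_divide power_mult_distrib)

text \<open>Length of the tangent vector of the two arcs \<open>\<mu> = m\<close> and
  \<open>\<mu> = - m\<close>, which is the same on both.\<close>

definition speed where "speed x = c * sqrt ((cosh m)^2 - (sin x)^2)"

lemma speed_pos: "speed x > 0" and speed_sq: "(speed x)^2 = (c * cosh m * cos x)^2 + (c * sinh m * sin x)^2"
proof -
 have "1 < (cosh m)^2" using m by (simp add: cosh_square_eq)
 moreover have "(sin x)^2 \<le> 1" by (simp add: abs_square_le_1)
 ultimately have p: "(cosh m)^2 - (sin x)^2 > 0" by linarith
 then show "speed x > 0" using c by (simp add: speed_def)
 have "(speed x)^2 = c^2 * ((cosh m)^2 - (sin x)^2)" using p by (simp add: speed_def power_mult_distrib)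
 then show "(speed x)^2 = (c * cosh m * cos x)^2 + (c * sinh m * sin x)^2"
  by (simp add: power_mult_distrib cosh_square_eq cos_squared_eq algebra_simps)
qed

lemma arc_distance_quotient:
 assumes "y = m \<or> y = -m"
 shows "((\<lambda>x. (norm (epoint c x y - epoint c x0 y))\<^sup>2 / (x - x0)^2) \<longlongrightarrow> (speed x0)\<^sup>2) (at x0)"
proof -
 have 1: "((\<lambda>x. (c * cosh y * sin x - c * cosh y * sin x0) / (x - x0)) \<longlongrightarrow> c * cosh y * cos x0) (at x0)"
  and 2: "((\<lambda>x. (c * sinh y * cos x - c * sinh y * cos x0) / (x - x0)) \<longlongrightarrow> - (c * sinh y * sin x0)) (at x0)"
 proof -
  have "DERIV (\<lambda>x. c * cosh y * sin x) x0 :> c * cosh y * cos x0"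
   "((\<lambda>x. c * sinh y * cos x) has_real_derivative - (c * sinh y * sin x0)) (at x0)"
   by (auto intro!: derivative_eq_intros)
  then show "((\<lambda>x. (c * cosh y * sin x - c * cosh y * sin x0) / (x - x0)) \<longlongrightarrow> c * cosh y * cos x0) (at x0)"
   "((\<lambda>x. (c * sinh y * cos x - c * sinh y * cos x0) / (x - x0)) \<longlongrightarrow> - (c * sinh y * sin x0)) (at x0)"
   by (auto simp: has_field_derivative_iff)
 qed
 have "((\<lambda>x. ((c * cosh y * sin x - c * cosh y * sin x0) / (x - x0))\<^sup>2 + ((c * sinh y * cos x - c * sinh y * cos x0) / (x - x0))^2)
   \<longlongrightarrow> (c * cosh y * cos x0)\<^sup>2 + (- (c * sinh y * sin x0))^2) (at x0)"
  by (intro tendsto_intros 1 2)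
 moreover have "(c * cosh y * cos x0)^2 + (- (c * sinh y * sin x0))^2 = (speed x0)^2"
  using assms unfolding speed_sq by auto
 moreover have "((c * cosh y * sin x - c * cosh y * sin x0) / (x - x0))^2 + ((c * sinh y * cos x - c * sinh y * cos x0) / (x - x0))^2
  = (norm (epoint c x y - epoint c x0 y))^2 / (x - x0)^2" for x
  by (simp add: norm_sq_2 power_divide add_divide_distrib)
 ultimately show ?thesis by simp
qed

end

section \<open>Boundary limits and the jump relation\<close>

context layer_kernel
begin

text \<open>Layer potentials over both arcs, written in the angle. The density is
  \<open>\<rho>\<close> divided by the speed, which is why no arc length factor appears.\<close>

definition single_int where
 "single_int \<rho> a = (LINT x|lborel. (ker a x m + ker a x (-m)) * \<rho> x)"

definition double_int where
 "double_int \<rho> a n = (LINT x|lborel. (dker a n x m + dker a n x (-m)) * \<rho> x)"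

lemma ker_measurable [measurable]:
 "(\<lambda>x. ker a x y) \<in> borel_measurable borel" "(\<lambda>x. dker a n x y) \<in> borel_measurable borel"
 unfolding ker_def dker_def sq_def by measurable

lemma supported_integral_eq:
 fixes f \<rho> :: "real => real"
 assumes "continuous_on J f" "continuous_on UNIV \<rho>" "\<And>t. \<delta> \<le> \<bar>t\<bar> ==> \<rho> t = 0"
 shows "integrable lborel (\<lambda>x. f x * \<rho> x)" "(LINT x|lborel. f x * \<rho> x) = integral J (\<lambda>x. f x * \<rho> x)"
proof -
 have c: "continuous_on J (\<lambda>x. f x * \<rho> x)"
  using assms continuous_on_subset[OF assms(2)] by (intro continuous_intros) auto
 have e: "(\<lambda>x. indicator J x *\<^sub>R (f x * \<rho> x)) = (\<lambda>x. f x * \<rho> x)"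
 proof
  fix x show "indicator J x *\<^sub>R (f x * \<rho> x) = f x * \<rho> x"
  proof (cases "x \<in> J")
   case False
   then have "\<delta> \<le> \<bar>x\<bar>" by auto
   then show ?thesis using assms(3) by simp
  qed simp
 qed
 show "integrable lborel (\<lambda>x. f x * \<rho> x)"
  using borel_integrable_atLeastAtMost'[OF c] unfolding set_integrable_def e .
 show "(LINT x|lborel. f x * \<rho> x) = integral J (\<lambda>x. f x * \<rho> x)"
  using set_borel_integral_eq_integral(2)[OF borel_integrable_atLeastAtMost'[OF c]]
  unfolding set_lebesgue_integral_def e .
qed

lemma off_rect_continuous:
 assumes a: "\<And>x y. (x, y) \<in> R ==> epoint c x y \<noteq> a" and y: "y \<in> {-m..m}"
 shows "continuous_on J (\<lambda>x. ker a x y)" "continuous_on J (\<lambda>x. dker a n x y)"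
proof -
 have s: "continuous_on J (\<lambda>x. sq a x y)" "continuous_on J (\<lambda>x. epoint c x y)"
  using continuous_on_compose2[OF continuous_on_sq[of UNIV], of "J" "\<lambda>x. (x, y)"]
   continuous_on_compose2[OF continuous_on_epoint[of UNIV], of "J" "\<lambda>x. (x, y)"]
  by (simp_all add: continuous_on_Pair)
 have p: "(\<lambda>x. sq a x y) ` J \<subseteq> {0<..}"
  using sq_pos[OF a] y by (auto simp: R_iff)
 show "continuous_on J (\<lambda>x. ker a x y)"
  unfolding ker_def by (rule continuous_on_compose2[OF cont_w(1) s(1) p])
 have "continuous_on J (\<lambda>x. w' (sq a x y))" by (rule continuous_on_compose2[OF cont_w(2) s(1) p])
 then show "continuous_on J (\<lambda>x. dker a n x y)" unfolding dker_def by (intro continuous_intros s)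
qed

lemma quasimode_facts:
 assumes "is_quasimode m \<delta> \<epsilon> K b \<rho> \<rho>' \<rho>'' M M'"
 shows "continuous_on UNIV \<rho>" "\<And>t. \<delta> \<le> \<bar>t\<bar> ==> \<rho> t = 0" "\<rho> \<in> borel_measurable borel"
  "\<exists>B. \<forall>x. \<bar>\<rho> x\<bar> \<le> B" "integrable lborel \<rho>"
proof -
 show c: "continuous_on UNIV \<rho>" by (rule continuous_on_residual(1)[OF assms])
 show z: "\<And>t. \<delta> \<le> \<bar>t\<bar> ==> \<rho> t = 0" using assms by (simp add: is_quasimode_def)
 show "\<rho> \<in> borel_measurable borel" using c by (rule borel_measurable_continuous_onI)
 have "bounded (\<rho> ` J)"
  by (intro compact_imp_bounded compact_continuous_image continuous_on_subset[OF c]) auto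
 then obtain B where B: "\<And>x. x \<in> J ==> \<bar>\<rho> x\<bar> \<le> B" unfolding bounded_iff real_norm_def by blast
 show "\<exists>B. \<forall>x. \<bar>\<rho> x\<bar> \<le> B"
 proof (intro exI allI)
  fix x show "\<bar>\<rho> x\<bar> \<le> max B 0"
  proof (cases "x \<in> J")
   case True
   then show ?thesis using B[of x] by simp
  next
   case False
   then have "\<delta> \<le> \<bar>x\<bar>" by auto
   then show ?thesis using z by simp
  qed
 qed
 show "integrable lborel \<rho>" using supported_integral_eq(1)[of "\<lambda>x. 1" \<rho>] c z by simp
qed

lemma outside_bounds_lebesgue:
 assumes a: "\<And>x y. (x, y) \<in> R ==> epoint c x y \<noteq> a"
  and qm: "is_quasimode m \<delta> \<epsilon> K b \<rho> \<rho>' \<rho>'' M M'" and K: "K^2 = 4 * \<kappa> * c^2" and n: "norm n \<le> \<Lambda>" and \<Lambda>: "1 \<le> \<Lambda>"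
 shows "\<bar>single_int \<rho> a\<bar> \<le> \<epsilon> * (\<Lambda> * wsup * area)"
  and "\<bar>double_int \<rho> a n\<bar> \<le> \<epsilon> * (\<Lambda> * wsup * area)"
proof -
 have mm: "m \<in> {-m..m}" "-m \<in> {-m..m}" using m by auto
 note cont = off_rect_continuous[OF a mm(1)] off_rect_continuous[OF a mm(2)]
 show "\<bar>single_int \<rho> a\<bar> \<le> \<epsilon> * (\<Lambda> * wsup * area)"
  unfolding single_int_def
  by (subst supported_integral_eq(2)) (use outside_bounds(1)[OF a qm K n \<Lambda>] cont quasimode_facts[OF qm] in \<open>auto intro!: continuous_on_add\<close>)
 show "\<bar>double_int \<rho> a n\<bar> \<le> \<epsilon> * (\<Lambda> * wsup * area)"
  unfolding double_int_def
  by (subst supported_integral_eq(2)) (use outside_bounds(2)[OF a qm K n \<Lambda>] cont quasimode_facts[OF qm] in \<open>auto intro!: continuous_on_add\<close>)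
qed

text \<open>On the ellipse the double layer kernel is bounded, because the normal component of \<open>x - a\<close>
 is quadratically small.\<close>

context
 fixes a n :: "real ^ 2"
 assumes a: "ellipse_form a1 a2 a = 1" and n_def: "n = inner_normal a1 a2 a"
begin

lemma normal_facts: "norm n = 1" "ellipse_form a1 a2 x = 1 ==> 0 \<le> (x - a) \<bullet> n"
 "ellipse_form a1 a2 x = 1 ==> (x - a) \<bullet> n \<le> a1 / (2 * a2^2) * (norm (x - a))^2"
 unfolding n_def using inner_normal_facts[OF a12 a] by blast+

lemma shifted_distance:
 assumes x: "ellipse_form a1 a2 x = 1" and t: "0 \<le> t"
 shows "(norm (x - (a - t *\<^sub>R n)))^2 = (norm (x - a))^2 + 2 * t * ((x - a) \<bullet> n) + t^2"
  and "norm (x - a) \<le> norm (x - (a - t *\<^sub>R n))"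
  and "(a - t *\<^sub>R n - x) \<bullet> n = - ((x - a) \<bullet> n + t)"
proof -
 have nn: "n \<bullet> n = 1" using normal_facts(1) by (simp add: dot_square_norm)
 have "x - (a - t *\<^sub>R n) = (x - a) + t *\<^sub>R n" by simp
 then have "(norm (x - (a - t *\<^sub>R n)))^2 = ((x - a) + t *\<^sub>R n) \<bullet> ((x - a) + t *\<^sub>R n)"
  by (simp only: power2_norm_eq_inner)
 also have "... = (norm (x - a))^2 + 2 * t * ((x - a) \<bullet> n) + t^2"
  unfolding power2_norm_eq_inner inner_add_left inner_add_right inner_scaleR_left inner_scaleR_right nn inner_commute[of n "x - a"]
  by (simp add: power2_eq_square distrib_left)
 finally show e: "(norm (x - (a - t *\<^sub>R n)))^2 = (norm (x - a))^2 + 2 * t * ((x - a) \<bullet> n) + t^2" .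
 have "0 \<le> 2 * t * ((x - a) \<bullet> n) + t^2" using normal_facts(2)[OF x] t by (intro add_nonneg_nonneg mult_nonneg_nonneg) auto
 then have "(norm (x - a))^2 \<le> (norm (x - (a - t *\<^sub>R n)))^2" unfolding e by linarith
 then show "norm (x - a) \<le> norm (x - (a - t *\<^sub>R n))" by (rule power2_le_imp_le) simp
 show "(a - t *\<^sub>R n - x) \<bullet> n = - ((x - a) \<bullet> n + t)"
  by (simp add: inner_diff_left nn)
qed

text \<open>The pole of \<open>w'\<close> is multiplied by \<open>mu + t\<close>, with
  \<open>mu\<close> the normal component of \<open>x - a\<close>. The part with \<open>mu\<close> is
  bounded, \<open>mu\<close> being quadratically small; the part with \<open>t\<close> is
  \<open>- 2 * \<beta> * (t / r2)\<close>, which is added back here.\<close>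

lemma dker_minus_poisson_bound:
 assumes y: "y = m \<or> y = -m" and ne: "epoint c x y \<noteq> a" and t: "0 \<le> t"
 defines "r2 \<equiv> (norm (epoint c x y - (a - t *\<^sub>R n)))\<^sup>2"
 shows "\<bar>dker (a - t *\<^sub>R n) n x y + 2 * \<beta> * (t / r2)\<bar> \<le> 2 * Cw * sqrt \<kappa> + \<bar>\<beta>\<bar> * a1 / a2^2"
proof -
 let ?x = "epoint c x y"
 have ex: "ellipse_form a1 a2 ?x = 1" by (rule ellipse_form_epoint_eq[OF y])
 define r where "r = norm (?x - (a - t *\<^sub>R n))"
 have r0: "0 < norm (?x - a)" using ne by simp
 have r: "r > 0" "norm (?x - a) \<le> r" using shifted_distance(2)[OF ex t] r0 unfolding r_def by linarith+
 have r2: "r2 = r^2" by (simp add: r2_def r_def)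
 define mu where "mu = (?x - a) \<bullet> n"
 have mu: "0 \<le> mu" "mu \<le> a1 / (2 * a2^2) * r^2"
 proof -
  show "0 \<le> mu" using normal_facts(2)[OF ex] by (simp add: mu_def)
  have "mu \<le> a1 / (2 * a2^2) * (norm (?x - a))^2" using normal_facts(3)[OF ex] by (simp add: mu_def)
  also have "... \<le> a1 / (2 * a2^2) * r^2"
   using r a12 by (intro mult_left_mono power_mono) auto
  finally show "mu \<le> a1 / (2 * a2^2) * r^2" .
 qed
 have s: "sq (a - t *\<^sub>R n) x y = \<kappa> * r^2" by (simp add: sq_def r_def)
 have k: "\<kappa> > 0" using \<kappa> by simp
 have sp: "\<kappa> * r^2 > 0" using k r by simp
 have inn: "(a - t *\<^sub>R n - ?x) \<bullet> n = - (mu + t)" using shifted_distance(3)[OF ex t] by (simp add: mu_def)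
 have mt: "mu + t \<le> r"
 proof -
  have "\<bar>(a - t *\<^sub>R n - ?x) \<bullet> n\<bar> \<le> norm (a - t *\<^sub>R n - ?x) * norm n" by (rule Cauchy_Schwarz_ineq2)
  then show ?thesis unfolding inn normal_facts(1) r_def using norm_minus_commute[of "a - t *\<^sub>R n" ?x] by simp
 qed
 have "dker (a - t *\<^sub>R n) n x y + 2 * \<beta> * (t / r2)
  = - (2 * \<kappa> * (w' (\<kappa> * r^2) - \<beta> / (\<kappa> * r^2)) * (mu + t)) - 2 * \<beta> * (mu / r^2)"
  unfolding dker_def s inn r2 using k r by (simp add: field_simps)
 also have "\<bar>...\<bar> \<le> 2 * \<kappa> * (Cw / sqrt (\<kappa> * r^2)) * r + 2 * \<bar>\<beta>\<bar> * (a1 / (2 * a2^2))"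
 proof -
  have "\<bar>2 * \<kappa> * (w' (\<kappa> * r^2) - \<beta> / (\<kappa> * r^2)) * (mu + t)\<bar> \<le> 2 * \<kappa> * (Cw / sqrt (\<kappa> * r^2)) * r"
   unfolding abs_mult using k mt mu t w_bounds(2)[OF sp] Cw r by (intro mult_mono) auto
  moreover have "\<bar>2 * \<beta> * (mu / r^2)\<bar> \<le> 2 * \<bar>\<beta>\<bar> * (a1 / (2 * a2^2))"
  proof -
   have "mu / r^2 \<le> a1 / (2 * a2^2)" using mu(2) r by (simp add: pos_divide_le_eq)
   then show ?thesis unfolding abs_mult using mu r by (intro mult_mono) (auto simp: abs_of_nonneg)
  qed
  ultimately show ?thesis by linarith
 qed
 also have "... = 2 * Cw * sqrt \<kappa> + \<bar>\<beta>\<bar> * a1 / a2^2"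
 proof -
  have "sqrt (\<kappa> * r^2) = sqrt \<kappa> * r" using r by (simp add: real_sqrt_mult)
  moreover have "\<kappa> = sqrt \<kappa> * sqrt \<kappa>" using k by simp
  ultimately show ?thesis using r k by (simp add: field_simps)
 qed
 finally show ?thesis .
qed

end

end

context layer_kernel
begin

context
 fixes x0 y0 :: real and a n :: "real ^ 2" and \<epsilon> K b :: real and \<rho> \<rho>' \<rho>'' M M' :: "real => real" and t :: "nat => real"
 assumes x0: "x0 \<in> J" and y0: "y0 = m \<or> y0 = -m" and a_def: "a = epoint c x0 y0"
  and n_def: "n = inner_normal a1 a2 a" and qm: "is_quasimode m \<delta> \<epsilon> K b \<rho> \<rho>' \<rho>'' M M'"
  and t: "\<And>j. t j > 0" "t \<longlonglongrightarrow> 0"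
begin

lemma a_form: "ellipse_form a1 a2 a = 1"
 unfolding a_def by (rule ellipse_form_epoint_eq[OF y0])

lemmas normal_facts' = normal_facts[OF a_form n_def]
lemmas shifted_distance' = shifted_distance[OF a_form n_def]

lemma [measurable]: "\<rho> \<in> borel_measurable borel"
 using quasimode_facts(3)[OF qm] .

lemma support: "\<rho> x \<noteq> 0 ==> x \<in> J"
proof (rule ccontr)
 assume "\<rho> x \<noteq> 0" "x \<notin> J"
 moreover from this have "\<delta> \<le> \<bar>x\<bar>" by auto
 ultimately show False using quasimode_facts(2)[OF qm] by blast
qed

lemma arc_distance: "x \<in> J ==> (2 * c0)^2 * ((x - x0)^2 + (y - y0)^2) \<le> (norm (epoint c x y - a))^2"
proof -
 assume x: "x \<in> J"
 have "(2 * c0 * sqrt ((x - x0)^2 + (y - y0)^2))^2 \<le> (norm (epoint c x y - a))^2"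
  unfolding a_def using epoint_bilipschitz[OF x x0] c0 by (intro power_mono) auto
 then show ?thesis by (simp add: power_mult_distrib)
qed

lemma arc_distance': "x \<in> J ==> 2 * c0 * \<bar>x - x0\<bar> \<le> norm (epoint c x y - a)"
proof -
 assume x: "x \<in> J"
 have "\<bar>x - x0\<bar> \<le> sqrt ((x - x0)^2 + (y - y0)^2)" using real_sqrt_sum_squares_ge1[of "\<bar>x - x0\<bar>" "y - y0"] by simp
 then have "2 * c0 * \<bar>x - x0\<bar> \<le> 2 * c0 * sqrt ((x - x0)^2 + (y - y0)^2)" using c0 by (intro mult_left_mono) auto
 also have "... \<le> norm (epoint c x y - a)" unfolding a_def by (rule epoint_bilipschitz[OF x x0])
 finally show ?thesis .
qed

lemma off_point: "x \<in> J ==> x \<noteq> x0 ==> epoint c x y \<noteq> a"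
 using arc_distance'[of x y] c0 by (auto simp: mult_le_0_iff)

text \<open>Moving along \<open>- n\<close> leaves the closed ellipse, and the image of the
  rectangle is contained in it.\<close>

lemma shifted_off: "0 < s ==> (x, y) \<in> R ==> epoint c x y \<noteq> a - s *\<^sub>R n"
 using inner_normal_facts(4)[OF a12 a_form, of s] ellipse_form_epoint_le[of y x]
 unfolding n_def[symmetric] R_iff by (metis not_le)

definition dist2 where "dist2 j x y = (norm (epoint c x y - (a - t j *\<^sub>R n)))^2"

abbreviation "rker j x y \<equiv> dker (a - t j *\<^sub>R n) n x y + 2 * \<beta> * (t j / dist2 j x y)"

lemma [measurable]: "(\<lambda>x. dist2 j x y) \<in> borel_measurable borel"
 unfolding dist2_def by measurable

lemma sq_tendsto: "(\<lambda>j. sq (a - t j *\<^sub>R n) x y) \<longlonglongrightarrow> sq a x y"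
proof -
 have "(\<lambda>j. sq (a - t j *\<^sub>R n) x y) \<longlonglongrightarrow> sq (a - 0 *\<^sub>R n) x y"
  unfolding sq_def by (intro tendsto_intros t)
 then show ?thesis by simp
qed

lemma regular_part_limit:
 assumes y: "y = m \<or> y = -m"
 shows "integrable lborel (\<lambda>x. rker j x y * \<rho> x)"
  and "integrable lborel (\<lambda>x. dker a n x y * \<rho> x)"
  and "(\<lambda>j. LINT x|lborel. rker j x y * \<rho> x)
   \<longlonglongrightarrow> (LINT x|lborel. dker a n x y * \<rho> x)"
proof -
 define C where "C = 2 * Cw * sqrt \<kappa> + \<bar>\<beta>\<bar> * a1 / a2^2"
 have iC: "integrable lborel (\<lambda>x. C * \<bar>\<rho> x\<bar>)" using quasimode_facts(5)[OF qm] by simp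
 have ae: "AE x in lborel. x \<noteq> x0" by (rule AE_lborel_singleton)
 have pw: "(\<lambda>j. rker j x y * \<rho> x) \<longlonglongrightarrow> dker a n x y * \<rho> x"
  if x: "x \<noteq> x0" for x
 proof (cases "\<rho> x = 0")
  case False
  have off: "epoint c x y \<noteq> a" using off_point[OF support[OF False] x] .
  have cw: "isCont w' (sq a x y)" using w(2)[OF sq_pos[OF off]] by (rule DERIV_isCont)
  have "(\<lambda>j. dker (a - t j *\<^sub>R n) n x y) \<longlonglongrightarrow> 2 * \<kappa> * w' (sq a x y) * ((a - 0 *\<^sub>R n - epoint c x y) \<bullet> n)"
   unfolding dker_def by (intro tendsto_intros isCont_tendsto_compose[OF cw] sq_tendsto t)
  then have 1: "(\<lambda>j. dker (a - t j *\<^sub>R n) n x y) \<longlonglongrightarrow> dker a n x y" by (simp add: dker_def)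
  have "(\<lambda>j. t j / dist2 j x y) \<longlonglongrightarrow> 0 / (norm (epoint c x y - (a - 0 *\<^sub>R n)))^2"
   unfolding dist2_def by (intro tendsto_intros t) (use off in simp)
  then have "(\<lambda>j. rker j x y * \<rho> x) \<longlonglongrightarrow> (dker a n x y + 2 * \<beta> * 0) * \<rho> x"
   by (intro tendsto_intros 1) simp
  then show ?thesis by simp
 qed simp
 have bd: "\<bar>(dker (a - s *\<^sub>R n) n x y + 2 * \<beta> * (s / (norm (epoint c x y - (a - s *\<^sub>R n)))^2)) * \<rho> x\<bar> \<le> C * \<bar>\<rho> x\<bar>"
  if x: "x \<noteq> x0" and s: "0 \<le> s" for x s
 proof (cases "\<rho> x = 0")
  case False
  show ?thesis unfolding abs_mult C_def
   using dker_minus_poisson_bound[OF a_form n_def y off_point[OF support[OF False] x] s] by (intro mult_right_mono) auto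
 qed simp
 have bdj: "AE x in lborel. norm (rker j x y * \<rho> x) \<le> C * \<bar>\<rho> x\<bar>" for j
  using ae by eventually_elim (use bd[OF _ less_imp_le[OF t(1)]] in \<open>simp add: dist2_def\<close>)
 show "(\<lambda>j. LINT x|lborel. rker j x y * \<rho> x)
   \<longlonglongrightarrow> (LINT x|lborel. dker a n x y * \<rho> x)"
 proof (rule integral_dominated_convergence[OF _ _ iC])
  show "AE x in lborel. (\<lambda>j. rker j x y * \<rho> x) \<longlonglongrightarrow> dker a n x y * \<rho> x"
   using ae by eventually_elim (rule pw)
 qed (use bdj in auto)
 show "integrable lborel (\<lambda>x. rker j x y * \<rho> x)"
  by (rule Bochner_Integration.integrable_bound[OF iC]) (use bdj[of j] in \<open>auto elim: eventually_mono intro: order_trans\<close>)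
 have "AE x in lborel. norm (dker a n x y * \<rho> x) \<le> norm (C * \<bar>\<rho> x\<bar>)"
  using ae
 proof eventually_elim
  case (elim x)
  then show ?case using bd[OF elim order_refl] by simp
 qed
 then show "integrable lborel (\<lambda>x. dker a n x y * \<rho> x)"
  by (intro Bochner_Integration.integrable_bound[OF iC]) auto
qed

text \<open>An instance of \<open>poisson_limit\<close> with the squared distance for
  \<open>D\<close>; its second-order coefficient at \<open>x0\<close> is the square of the
  speed.\<close>

lemma singular_part_limit:
 "(\<lambda>j. LINT x|lborel. t j / dist2 j x y0 * \<rho> x) \<longlonglongrightarrow> pi * \<rho> x0 / speed x0"
proof -
 obtain B where B: "\<And>x. \<bar>\<rho> x\<bar> \<le> B" using quasimode_facts(4)[OF qm] by blast
 have e: "dist2 j x y0 = (norm (epoint c x y0 - a))^2 + 2 * t j * ((epoint c x y0 - a) \<bullet> n) + (t j)^2" for j x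
  unfolding dist2_def by (rule shifted_distance'(1)[OF ellipse_form_epoint_eq[OF y0]]) (use t(1)[of j] in simp)
 have "(\<lambda>j. LINT x|lborel. t j / ((norm (epoint c x y0 - a))^2 + 2 * t j * ((epoint c x y0 - a) \<bullet> n) + (t j)^2) * \<rho> x)
   \<longlonglongrightarrow> pi * \<rho> x0 / sqrt ((speed x0)^2)"
 proof (rule poisson_limit[where ?c1.0 = "(2 * c0)^2" and C = "a1 / (2 * a2^2)" and B = B])
  show "isCont \<rho> x0" using quasimode_facts(1)[OF qm] by (simp add: continuous_on_eq_continuous_at)
  show "0 < (2 * c0)^2" using c0 by simp
  show "(2 * c0)^2 * (x - x0)^2 \<le> (norm (epoint c x y0 - a))^2" if "\<rho> x \<noteq> 0" for x
   using arc_distance[OF support[OF that], of y0] by simp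
  show "(norm (epoint c x0 y0 - a))^2 = 0" by (simp add: a_def)
  show "((\<lambda>x. (norm (epoint c x y0 - a))\<^sup>2 / (x - x0)^2) \<longlongrightarrow> (speed x0)\<^sup>2) (at x0)"
   unfolding a_def by (rule arc_distance_quotient[OF y0])
  show "0 < (speed x0)^2" using speed_pos[of x0] by simp
  show "0 \<le> (epoint c x y0 - a) \<bullet> n" for x
   by (rule normal_facts'(2)[OF ellipse_form_epoint_eq[OF y0]])
  show "(epoint c x y0 - a) \<bullet> n \<le> a1 / (2 * a2^2) * (norm (epoint c x y0 - a))^2" for x
   by (rule normal_facts'(3)[OF ellipse_form_epoint_eq[OF y0]])
 qed (use B t in \<open>auto simp: inner_2\<close>)
 then show ?thesis unfolding e using speed_pos[of x0] by simp
qed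

text \<open>The arc not containing \<open>a\<close> keeps a fixed distance from it, because the two
  edges of the rectangle are \<open>2 * m\<close> apart.\<close>

lemma opposite_part_limit:
 "(\<lambda>j. LINT x|lborel. t j / dist2 j x (- y0) * \<rho> x) \<longlonglongrightarrow> 0"
proof -
 define d where "d = (2 * c0)^2 * (2 * m)^2"
 have d: "d > 0" using c0 m by (simp add: d_def)
 have y0': "- y0 = m \<or> - y0 = - m" using y0 by auto
 have dd: "d \<le> dist2 j x (- y0)" if "\<rho> x \<noteq> 0" for j x
 proof -
  have "d \<le> (2 * c0)^2 * ((x - x0)^2 + (- y0 - y0)^2)"
   unfolding d_def using y0 by (intro mult_left_mono) auto
  also have "... \<le> (norm (epoint c x (- y0) - a))^2" by (rule arc_distance[OF support[OF that]])
  also have "... \<le> dist2 j x (- y0)" unfolding dist2_def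
   using shifted_distance'(2)[OF ellipse_form_epoint_eq[OF y0'] less_imp_le[OF t(1)]] by (intro power_mono) auto
  finally show ?thesis .
 qed
 have bd: "norm (LINT x|lborel. t j / dist2 j x (- y0) * \<rho> x) \<le> t j * ((LINT x|lborel. \<bar>\<rho> x\<bar>) / d)" for j
 proof -
  have ptw: "\<bar>t j / dist2 j x (- y0) * \<rho> x\<bar> \<le> t j / d * \<bar>\<rho> x\<bar>" for x
  proof (cases "\<rho> x = 0")
   case False
   have "\<bar>t j / dist2 j x (- y0)\<bar> \<le> t j / d"
    using dd[OF False, of j] d t(1)[of j] by (simp add: abs_of_nonneg) (intro divide_left_mono mult_pos_pos; simp)
   then show ?thesis unfolding abs_mult by (intro mult_right_mono) auto
  qed simp
  have i: "integrable lborel (\<lambda>x. t j / d * \<bar>\<rho> x\<bar>)" using quasimode_facts(5)[OF qm] by simp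
  have ip: "integrable lborel (\<lambda>x. t j / dist2 j x (- y0) * \<rho> x)"
   by (rule Bochner_Integration.integrable_bound[OF i])
    (measurable, rule AE_I2, unfold real_norm_def, rule order_trans[OF ptw abs_ge_self])
  have "norm (LINT x|lborel. t j / dist2 j x (- y0) * \<rho> x) \<le> (LINT x|lborel. t j / d * \<bar>\<rho> x\<bar>)"
   by (rule Bochner_Integration.integral_norm_bound_integral[OF _ i]) (use ptw ip in auto)
  also have "... = t j / d * (LINT x|lborel. \<bar>\<rho> x\<bar>)" by (rule integral_mult_right_zero)
  finally show ?thesis by simp
 qed
 show ?thesis
 proof (rule Lim_null_comparison[OF always_eventually])
  show "\<forall>j. norm (LINT x|lborel. t j / dist2 j x (- y0) * \<rho> x) \<le> t j * ((LINT x|lborel. \<bar>\<rho> x\<bar>) / d)"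
   using bd by blast
  have "(\<lambda>j. t j * ((LINT x|lborel. \<bar>\<rho> x\<bar>) / d)) \<longlonglongrightarrow> 0 * ((LINT x|lborel. \<bar>\<rho> x\<bar>) / d)"
   by (intro tendsto_intros t)
  then show "(\<lambda>j. t j * ((LINT x|lborel. \<bar>\<rho> x\<bar>) / d)) \<longlonglongrightarrow> 0" by simp
 qed
qed

text \<open>The jump relation: only the Poisson part on the arc through \<open>a\<close> leaves an
  extra term. For \<open>\<beta> = 1 / pi\<close> it is twice the density.\<close>

lemma double_int_limit:
 "(\<lambda>j. double_int \<rho> (a - t j *\<^sub>R n) n) \<longlonglongrightarrow> double_int \<rho> a n - 2 * \<beta> * (pi * \<rho> x0 / speed x0)"
proof -
 let ?F = "\<lambda>j y. LINT x|lborel. rker j x y * \<rho> x"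
 let ?P = "\<lambda>j y. LINT x|lborel. t j / dist2 j x y * \<rho> x"
 have y0': "- y0 = m \<or> - y0 = - m" using y0 by auto
 have intP: "integrable lborel (\<lambda>x. t j / dist2 j x y * \<rho> x)" if "y = m \<or> y = -m" for j y
 proof -
  have off: "0 < dist2 j x y" if "x \<in> J" for x
   using shifted_off[OF t(1)[of j], of x y] that m \<open>y = m \<or> y = -m\<close> by (auto simp: dist2_def R_iff)
  have ce: "continuous_on J (\<lambda>x. epoint c x y)"
   using continuous_on_compose2[OF continuous_on_epoint[of UNIV], of "J" "\<lambda>x. (x, y)"]
   by (simp add: continuous_on_Pair)
  have "continuous_on J (\<lambda>x. t j / dist2 j x y)"
   unfolding dist2_def by (intro continuous_intros ce ballI) (use off in \<open>fastforce simp: dist2_def\<close>)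
  then show ?thesis using quasimode_facts[OF qm] by (intro supported_integral_eq(1)) auto
 qed
 have intD: "integrable lborel (\<lambda>x. dker (a - t j *\<^sub>R n) n x y * \<rho> x)"
  and eqD: "(LINT x|lborel. dker (a - t j *\<^sub>R n) n x y * \<rho> x) = ?F j y - 2 * \<beta> * ?P j y" if y: "y = m \<or> y = -m" for j y
 proof -
  have e: "dker (a - t j *\<^sub>R n) n x y * \<rho> x = rker j x y * \<rho> x
   - 2 * \<beta> * (t j / dist2 j x y * \<rho> x)" for x by (simp add: algebra_simps)
  show "integrable lborel (\<lambda>x. dker (a - t j *\<^sub>R n) n x y * \<rho> x)"
   by (subst e) (intro Bochner_Integration.integrable_diff integrable_mult_right regular_part_limit(1)[OF y] intP[OF y])
  show "(LINT x|lborel. dker (a - t j *\<^sub>R n) n x y * \<rho> x) = ?F j y - 2 * \<beta> * ?P j y"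
   by (subst e, subst Bochner_Integration.integral_diff)
    (auto intro!: integrable_mult_right regular_part_limit(1)[OF y] intP[OF y] simp del: times_divide_eq_left times_divide_eq_right)
 qed
 have my: "m = m \<or> m = -m" "-m = m \<or> -m = -m" by auto
 have split: "double_int \<rho> a' n = (LINT x|lborel. dker a' n x y0 * \<rho> x) + (LINT x|lborel. dker a' n x (- y0) * \<rho> x)"
  if i: "integrable lborel (\<lambda>x. dker a' n x m * \<rho> x)" "integrable lborel (\<lambda>x. dker a' n x (-m) * \<rho> x)" for a'
 proof -
  have "double_int \<rho> a' n = (LINT x|lborel. dker a' n x m * \<rho> x) + (LINT x|lborel. dker a' n x (- m) * \<rho> x)"
   unfolding double_int_def distrib_right by (rule Bochner_Integration.integral_add[OF i])
  then show ?thesis using y0 by auto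
 qed
 have E: "double_int \<rho> (a - t j *\<^sub>R n) n = (?F j y0 - 2 * \<beta> * ?P j y0) + (?F j (- y0) - 2 * \<beta> * ?P j (- y0))" for j
  by (subst split[OF intD[OF my(1)] intD[OF my(2)]]) (simp only: eqD[OF y0] eqD[OF y0'])
 have L: "(\<lambda>j. (?F j y0 - 2 * \<beta> * ?P j y0) + (?F j (- y0) - 2 * \<beta> * ?P j (- y0))) \<longlonglongrightarrow>
  ((LINT x|lborel. dker a n x y0 * \<rho> x) - 2 * \<beta> * (pi * \<rho> x0 / speed x0)) + ((LINT x|lborel. dker a n x (- y0) * \<rho> x) - 2 * \<beta> * 0)"
  by (intro tendsto_intros regular_part_limit(3) singular_part_limit opposite_part_limit y0 y0')
 have rhs: "((LINT x|lborel. dker a n x y0 * \<rho> x) - 2 * \<beta> * (pi * \<rho> x0 / speed x0)) + ((LINT x|lborel. dker a n x (- y0) * \<rho> x) - 2 * \<beta> * 0)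
   = double_int \<rho> a n - 2 * \<beta> * (pi * \<rho> x0 / speed x0)"
  unfolding split[OF regular_part_limit(2)[OF my(1)] regular_part_limit(2)[OF my(2)]] by simp
 show ?thesis using L unfolding rhs E .
qed

text \<open>Moving \<open>a\<close> outwards along the normal increases all distances to the
  ellipse, so the inverse square root singularity at \<open>x0\<close> dominates for every
  \<open>j\<close>.\<close>

lemma single_int_limit:
 "(\<lambda>j. single_int \<rho> (a - t j *\<^sub>R n)) \<longlonglongrightarrow> single_int \<rho> a"
proof -
 obtain B where B: "\<And>x. \<bar>\<rho> x\<bar> \<le> B" using quasimode_facts(4)[OF qm] by blast
 have B0: "B \<ge> 0" using B[of 0] by linarith
 define g where "g x = indicator J x *\<^sub>R (1 + 1 / sqrt (2 * c0) * (1 / sqrt \<bar>x - x0\<bar>))" for x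
 have ig: "integrable lborel g"
 proof -
  have "set_integrable lborel J (\<lambda>x. 1 + 1 / sqrt (2 * c0) * (1 / sqrt \<bar>x - x0\<bar>))"
   by (intro set_integral_add set_integrable_mult_right inverse_sqrt_set_integrable x0 borel_integrable_atLeastAtMost' continuous_on_const)
  then show ?thesis by (simp only: set_integrable_def g_def [abs_def])
 qed
 have kb: "\<bar>ker (a - s *\<^sub>R n) x y * \<rho> x\<bar> \<le> Cw * B * g x"
  if y: "y = m \<or> y = -m" and x: "x \<noteq> x0" and s: "0 \<le> s" for x y s
 proof (cases "\<rho> x = 0")
  case True
  then show ?thesis using Cw B0 c0 by (simp add: g_def)
 next
  case False
  have xin: "x \<in> J" using support[OF False] .
  define r where "r = norm (epoint c x y - (a - s *\<^sub>R n))"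
  have r: "2 * c0 * \<bar>x - x0\<bar> \<le> r"
   using arc_distance'[OF xin, of y] shifted_distance'(2)[OF ellipse_form_epoint_eq[OF y] s, of x] unfolding r_def by linarith
  have r0: "0 < 2 * c0 * \<bar>x - x0\<bar>" using c0 x by simp
  then have rp: "r > 0" using r by linarith
  have sq: "sq (a - s *\<^sub>R n) x y = \<kappa> * r^2" by (simp add: sq_def r_def)
  have sp: "sq (a - s *\<^sub>R n) x y > 0" unfolding sq using \<kappa> rp by simp
  have "(2 * c0 * \<bar>x - x0\<bar>)^2 \<le> 1 * r^2" using r r0 by (simp add: power_mono)
  also have "... \<le> \<kappa> * r^2" using \<kappa> by (intro mult_right_mono) auto
  finally have "(\<kappa> * r^2) powr (-1/4) \<le> ((2 * c0 * \<bar>x - x0\<bar>)^2) powr (-1/4)"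
   using r0 by (intro powr_mono2') auto
  also have "... = (2 * c0 * \<bar>x - x0\<bar>) powr (-1/2)" using r0 by (simp add: powr_powr flip: powr_numeral)
  also have "... = 1 / sqrt (2 * c0) * (1 / sqrt \<bar>x - x0\<bar>)"
   using r0 c0 by (simp add: powr_minus_divide powr_half_sqrt real_sqrt_mult)
  finally have "1 + (sq (a - s *\<^sub>R n) x y) powr (-1/4) \<le> g x"
   unfolding sq g_def using xin by simp
  then have "\<bar>ker (a - s *\<^sub>R n) x y\<bar> \<le> Cw * g x"
   unfolding ker_def using w_bounds(1)[OF sp] mult_left_mono[of _ "g x" Cw] Cw by (meson less_imp_le order_trans)
  then have "\<bar>ker (a - s *\<^sub>R n) x y\<bar> * \<bar>\<rho> x\<bar> \<le> (Cw * g x) * B"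
   using B by (intro mult_mono) (auto intro: order_trans[OF abs_ge_zero])
  then show ?thesis by (simp add: abs_mult ac_simps)
 qed
 have ae: "AE x in lborel. x \<noteq> x0" by (rule AE_lborel_singleton)
 show ?thesis
  unfolding single_int_def
 proof (rule integral_dominated_convergence[where w = "\<lambda>x. 2 * (Cw * B) * g x"])
  show "integrable lborel (\<lambda>x. 2 * (Cw * B) * g x)" using ig by simp
  show "AE x in lborel. norm ((ker (a - t j *\<^sub>R n) x m + ker (a - t j *\<^sub>R n) x (-m)) * \<rho> x) \<le> 2 * (Cw * B) * g x" for j
   using ae
  proof eventually_elim
   case (elim x)
   have "\<bar>ker (a - t j *\<^sub>R n) x m * \<rho> x\<bar> \<le> Cw * B * g x" "\<bar>ker (a - t j *\<^sub>R n) x (-m) * \<rho> x\<bar> \<le> Cw * B * g x"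
    using kb[OF _ elim less_imp_le[OF t(1)]] by auto
   then show ?case unfolding distrib_right real_norm_def
    by (intro order_trans[OF abs_triangle_ineq]) linarith
  qed
  show "AE x in lborel. (\<lambda>j. (ker (a - t j *\<^sub>R n) x m + ker (a - t j *\<^sub>R n) x (-m)) * \<rho> x)
   \<longlonglongrightarrow> (ker a x m + ker a x (-m)) * \<rho> x"
   using ae
  proof eventually_elim
   case (elim x)
   show ?case
   proof (cases "\<rho> x = 0")
    case False
    have "(\<lambda>j. ker (a - t j *\<^sub>R n) x y) \<longlonglongrightarrow> ker a x y" for y
    proof -
     have "isCont w (sq a x y)" using w(1)[OF sq_pos[OF off_point[OF support[OF False] elim]]] by (rule DERIV_isCont)
     then show ?thesis unfolding ker_def by (rule isCont_tendsto_compose) (rule sq_tendsto)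
    qed
    then show ?thesis by (intro tendsto_intros)
   qed simp
  qed
 qed auto
qed

end

text \<open>The estimates outside the ellipse have constants independent of the distance, so they
  survive the limit; the double layer picks up its jump.\<close>

lemma boundary_bounds:
 assumes x0: "x0 \<in> J" and y0: "y0 = m \<or> y0 = -m" and a: "a = epoint c x0 y0" and n: "n = inner_normal a1 a2 a"
  and qm: "is_quasimode m \<delta> \<epsilon> K b \<rho> \<rho>' \<rho>'' M M'" and K: "K^2 = 4 * \<kappa> * c^2"
 shows "\<bar>single_int \<rho> a\<bar> \<le> \<epsilon> * (wsup * area)"
  and "\<bar>double_int \<rho> a n - 2 * \<beta> * (pi * \<rho> x0 / speed x0)\<bar> \<le> \<epsilon> * (wsup * area)"
proof -
 define t where "t j = 1 / real (Suc j)" for j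
 have t: "t j > 0" "t \<longlonglongrightarrow> 0" for j
  unfolding t_def [abs_def] using LIMSEQ_Suc[OF lim_1_over_n[where 'a = real]] by (simp_all del: of_nat_Suc)
 have n1: "norm n \<le> 1" using inner_normal_facts(1)[OF a12 a_form[OF x0 y0 a n qm t]] n by simp
 note off = shifted_off[OF x0 y0 a n qm t t(1)]
 note ob = outside_bounds_lebesgue[OF off qm K n1 order_refl, unfolded mult_1_left]
 show "\<bar>single_int \<rho> a\<bar> \<le> \<epsilon> * (wsup * area)"
  by (rule tendsto_upperbound[OF tendsto_rabs[OF single_int_limit[OF x0 y0 a n qm t]]]) (use ob in auto)
 show "\<bar>double_int \<rho> a n - 2 * \<beta> * (pi * \<rho> x0 / speed x0)\<bar> \<le> \<epsilon> * (wsup * area)"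
  by (rule tendsto_upperbound[OF tendsto_rabs[OF double_int_limit[OF x0 y0 a n qm t]]]) (use ob in auto)
qed

end

section \<open>Arc length as a measure\<close>

lemma hausdorff1_mono: "A \<subseteq> B ==> hausdorff1 A \<le> hausdorff1 B"
 using outer_measure_space_hausdorff1 by (auto simp: outer_measure_space_def increasing_def)

text \<open>The predicate \<open>countably_subadditive\<close> speaks of disjoint families, so the
  sets are made disjoint first.\<close>

lemma hausdorff1_subadditive:
 "hausdorff1 (\<Union>i::nat. A i) \<le> (\<Sum>i. hausdorff1 (A i))"
proof -
 have "hausdorff1 (\<Union>i. disjointed A i) \<le> (\<Sum>i. hausdorff1 (disjointed A i))"
  using outer_measure_space_hausdorff1 disjoint_family_disjointed[of A]
  unfolding outer_measure_space_def countably_subadditive_def by blast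
 also have "... \<le> (\<Sum>i. hausdorff1 (A i))"
  by (intro suminf_le hausdorff1_mono disjointed_subset) auto
 finally show ?thesis by (simp add: UN_disjointed_eq)
qed

lemma hausdorff1_empty [simp]: "hausdorff1 {} = 0"
 using outer_measure_space_hausdorff1 by (auto simp: outer_measure_space_def positive_def)

lemma hausdorff1_Un: "hausdorff1 (A \<union> B) \<le> hausdorff1 A + hausdorff1 B"
proof -
 have "hausdorff1 (\<Union>i. binaryset A B i) \<le> (\<Sum>i. hausdorff1 (binaryset A B i))" by (rule hausdorff1_subadditive)
 moreover have "(\<Union>i. binaryset A B i) = A \<union> B" by (rule UN_binaryset_eq)
 moreover have "(\<Sum>i. hausdorff1 (binaryset A B i)) = hausdorff1 A + hausdorff1 B" by (rule suminf_binaryset_eq) simp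
 ultimately show ?thesis by simp
qed

lemma hausdorff1_pre_antimono: "0 < d ==> d \<le> d' ==> hausdorff1_pre d' A \<le> hausdorff1_pre d A"
 unfolding hausdorff1_pre_def by (rule INF_superset_mono) (auto intro: order_trans)

lemma hausdorff1_pre_le: "0 < d ==> hausdorff1_pre d A \<le> hausdorff1 A"
 unfolding hausdorff1_def by (rule SUP_upper) simp

text \<open>A covering set of diameter at most \<open>e < d\<close> meets at most one of
  \<open>A\<close> and \<open>B\<close>, so a cover of the union splits into two covers.\<close>

lemma hausdorff1_pre_add_separated:
 assumes d: "0 < e" "e < d" and sep: "\<And>a b. a \<in> A ==> b \<in> B ==> d \<le> dist a b"
 shows "hausdorff1_pre e A + hausdorff1_pre e B \<le> hausdorff1_pre e (A \<union> B)"
 unfolding hausdorff1_pre_def[of e "A \<union> B"]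
proof (rule INF_greatest)
 fix C :: "nat => 'a set" assume "C \<in> {C. A \<union> B \<subseteq> (\<Union>n. C n) \<and> (\<forall>n. bounded (C n) \<and> diameter (C n) \<le> e)}"
 then have C: "A \<union> B \<subseteq> (\<Union>n. C n)" "\<And>n. bounded (C n)" "\<And>n. diameter (C n) \<le> e" by auto
 define CA where "CA n = (if C n \<inter> A = {} then {} else C n)" for n
 define CB where "CB n = (if C n \<inter> B = {} then {} else C n)" for n
 have cov: "A \<subseteq> (\<Union>n. CA n)" "B \<subseteq> (\<Union>n. CB n)"
 proof -
  show "A \<subseteq> (\<Union>n. CA n)"
  proof
   fix x assume x: "x \<in> A"
   then obtain n where "x \<in> C n" using C(1) by blast
   then have "x \<in> CA n" using x by (auto simp: CA_def)
   then show "x \<in> (\<Union>n. CA n)" by blast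
  qed
  show "B \<subseteq> (\<Union>n. CB n)"
  proof
   fix x assume x: "x \<in> B"
   then obtain n where "x \<in> C n" using C(1) by blast
   then have "x \<in> CB n" using x by (auto simp: CB_def)
   then show "x \<in> (\<Union>n. CB n)" by blast
  qed
 qed
 have bd: "bounded (CA n) \<and> diameter (CA n) \<le> e" "bounded (CB n) \<and> diameter (CB n) \<le> e" for n
  using C d by (simp_all add: CA_def CB_def)
 have "hausdorff1_pre e A \<le> (\<Sum>n. ennreal (diameter (CA n)))"
  unfolding hausdorff1_pre_def by (rule INF_lower) (use cov bd in simp)
 moreover have "hausdorff1_pre e B \<le> (\<Sum>n. ennreal (diameter (CB n)))"
  unfolding hausdorff1_pre_def by (rule INF_lower) (use cov bd in simp)
 moreover have "ennreal (diameter (CA n)) + ennreal (diameter (CB n)) \<le> ennreal (diameter (C n))" for n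
 proof (cases "C n \<inter> A = {} \<or> C n \<inter> B = {}")
  case False
  then obtain a b where ab: "a \<in> C n" "b \<in> C n" "a \<in> A" "b \<in> B" by auto
  have "d \<le> dist a b" using sep ab by blast
  also have "... \<le> diameter (C n)" using diameter_bounded_bound[OF C(2) ab(1,2)] .
  finally show ?thesis using C(3)[of n] d by simp
 qed (auto simp: CA_def CB_def)
 then have "(\<Sum>n. ennreal (diameter (CA n)) + ennreal (diameter (CB n))) \<le> (\<Sum>n. ennreal (diameter (C n)))"
  by (intro suminf_le) auto
 ultimately show "hausdorff1_pre e A + hausdorff1_pre e B \<le> (\<Sum>n. ennreal (diameter (C n)))"
  by (subst (asm) suminf_add[symmetric]) (auto intro: order_trans add_mono)
qed

lemma hausdorff1_add_separated:
 assumes d: "0 < d" and sep: "\<And>a b. a \<in> A ==> b \<in> B ==> d \<le> dist a b"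
 shows "hausdorff1 A + hausdorff1 B \<le> hausdorff1 (A \<union> B)"
proof -
 have "hausdorff1_pre x A + hausdorff1_pre y B \<le> hausdorff1 (A \<union> B)" if "0 < x" "0 < y" for x y
 proof -
  define e where "e = min (min x y) (d / 2)"
  have e: "0 < e" "e < d" "e \<le> x" "e \<le> y" using that d by (auto simp: e_def)
  have "hausdorff1_pre x A + hausdorff1_pre y B \<le> hausdorff1_pre e A + hausdorff1_pre e B"
   using e by (intro add_mono hausdorff1_pre_antimono)
  also have "... \<le> hausdorff1_pre e (A \<union> B)" by (rule hausdorff1_pre_add_separated[OF e(1,2) sep])
  also have "... \<le> hausdorff1 (A \<union> B)" by (rule hausdorff1_pre_le[OF e(1)])
  finally show ?thesis .
 qed
 then have "hausdorff1_pre x A + hausdorff1 B \<le> hausdorff1 (A \<union> B)" if "0 < x" for x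
  unfolding hausdorff1_def[of B] using that
  by (subst ennreal_SUP_add_right) (auto intro!: SUP_least)
 then show ?thesis
  unfolding hausdorff1_def[of A]
  by (subst ennreal_SUP_add_left[symmetric]) (auto intro!: SUP_least)
qed

text \<open>Caratheodory's criterion: consecutive shells around \<open>F\<close> are not separated, but every other one is.\<close>

lemma closed_in_hausdorff1_measure:
 fixes F :: "'a::metric_space set"
 assumes F: "closed F"
 shows "F \<in> sets hausdorff1_measure"
proof -
 let ?H = "hausdorff1 :: 'a set => ennreal"
 have main: "?H (F \<inter> T) + ?H (T - F) \<le> ?H T" if fin: "?H T < top" and ne: "F \<noteq> {}" for T
 proof -
  define B where "B n = {x \<in> T. 1 / real (Suc n) < infdist x F}" for n
  define S where "S n = B (Suc n) - B n" for n
  have Bmono: "B n \<subseteq> B (Suc n)" for n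
  proof -
   have "1 / real (Suc (Suc n)) \<le> 1 / real (Suc n)" by (intro divide_left_mono) auto
   then show ?thesis by (auto simp: B_def)
  qed
  have cover: "T - F \<subseteq> B n \<union> (\<Union>k. S (k + n))" for n
  proof
   fix x assume x: "x \<in> T - F"
   then have "infdist x F > 0"
    using in_closed_iff_infdist_zero[OF F ne, of x] infdist_nonneg[of x F] by (auto simp: less_le)
   then obtain k where k: "inverse (real (Suc k)) < infdist x F" using reals_Archimedean by blast
   then have "x \<in> B k" using x by (simp add: B_def inverse_eq_divide)
   then have ex: "\<exists>j. x \<in> B j" by blast
   define j where "j = (LEAST j. x \<in> B j)"
   have j: "x \<in> B j" "\<And>i. i < j ==> x \<notin> B i"
    unfolding j_def using LeastI_ex[OF ex] not_less_Least by blast+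
   show "x \<in> B n \<union> (\<Union>k. S (k + n))"
   proof (cases "j \<le> n")
    case True
    have "B j \<subseteq> B n" using lift_Suc_mono_le[of B, OF Bmono True] .
    then show ?thesis using j by auto
   next
    case False
    then obtain i where i: "j = Suc i" "n \<le> i" by (cases j) auto
    then have "x \<in> S i" using j by (auto simp: S_def)
    then have "x \<in> S (i - n + n)" using i by simp
    then show ?thesis by blast
   qed
  qed
  have S_dist: "1 / real (Suc (Suc n)) < infdist x F" "infdist x F \<le> 1 / real (Suc n)" if "x \<in> S n" for x n
   using that by (auto simp: S_def B_def)
  have half: "(\<Sum>k<N. ?H (S (2 * k + e))) \<le> ?H (\<Union>k<N. S (2 * k + e))" for N e
  proof (induction N)
   case (Suc N)
   have "(\<Sum>k<Suc N. ?H (S (2 * k + e))) \<le> ?H (\<Union>k<N. S (2 * k + e)) + ?H (S (2 * N + e))"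
    using Suc by (simp add: add_right_mono)
   also have "... \<le> ?H ((\<Union>k<N. S (2 * k + e)) \<union> S (2 * N + e))"
   proof (cases "N = 0")
    case False
    define d where "d = 1 / real (2 * N + e) - 1 / real (Suc (2 * N + e))"
    have "1 / real (Suc (2 * N + e)) < 1 / real (2 * N + e)" using False by (intro divide_strict_left_mono) auto
    then have d: "d > 0" by (simp add: d_def)
    show ?thesis
    proof (rule hausdorff1_add_separated[OF d])
     fix a b assume "a \<in> (\<Union>k<N. S (2 * k + e))" and b: "b \<in> S (2 * N + e)"
     then obtain k where k: "k < N" "a \<in> S (2 * k + e)" by auto
     have "1 / real (2 * N + e) \<le> 1 / real (Suc (Suc (2 * k + e)))" using k by (intro divide_left_mono) auto
     then have "1 / real (2 * N + e) < infdist a F" using S_dist(1)[OF k(2)] by linarith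
     moreover have "infdist b F \<le> 1 / real (Suc (2 * N + e))" using S_dist(2)[OF b] .
     moreover have "infdist a F \<le> infdist b F + dist a b" by (rule infdist_triangle)
     ultimately show "d \<le> dist a b" unfolding d_def by linarith
    qed
   qed simp
   also have "(\<Union>k<N. S (2 * k + e)) \<union> S (2 * N + e) = (\<Union>k<Suc N. S (2 * k + e))" by (auto simp: lessThan_Suc)
   finally show ?case .
  qed simp
  have ST: "(\<Union>k<N. S (2 * k + e)) \<subseteq> T" for N e by (auto simp: S_def B_def)
   \<comment> \<open>Even and odd shells separately are bounded by the measure of \<open>T\<close>,
     so the series over all shells converges.\<close>
   have tot: "(\<Sum>k<N. ?H (S k)) \<le> ?H T + ?H T" for N
  proof -
   have "(\<Sum>k<N. ?H (S k)) \<le> (\<Sum>k<2 * N. ?H (S k))" by (rule sum_mono2) auto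
   also have "... = (\<Sum>k<N. ?H (S (2 * k))) + (\<Sum>k<N. ?H (S (2 * k + 1)))"
    by (induction N) (auto simp: ac_simps)
   also have "... \<le> ?H T + ?H T"
    using order_trans[OF half[where e = 0] hausdorff1_mono[OF ST]] order_trans[OF half[where e = 1] hausdorff1_mono[OF ST]]
    by (intro add_mono) auto
   finally show ?thesis .
  qed
  have sfin: "(\<Sum>k. ?H (S k)) < top"
   by (rule le_less_trans[OF suminf_le_const[OF _ tot]]) (use fin in auto)
  have FB: "?H (F \<inter> T) + ?H (B n) \<le> ?H T" for n
  proof -
   have "?H (F \<inter> T) + ?H (B n) \<le> ?H ((F \<inter> T) \<union> B n)"
   proof (rule hausdorff1_add_separated)
    show "0 < 1 / real (Suc n)" by simp
    fix a b assume "a \<in> F \<inter> T" "b \<in> B n"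
    then have "1 / real (Suc n) < infdist b F" "infdist b F \<le> dist b a" by (auto simp: B_def infdist_le)
    then show "1 / real (Suc n) \<le> dist a b" by (simp add: dist_commute)
   qed
   also have "... \<le> ?H T" by (rule hausdorff1_mono) (auto simp: B_def)
   finally show ?thesis .
  qed
  show ?thesis
  proof (rule ennreal_le_epsilon)
   fix e :: real assume e: "0 < e"
   have sumlim: "(\<lambda>n. \<Sum>k<n. ?H (S k)) \<longlonglongrightarrow> (\<Sum>k. ?H (S k))" by (rule summable_LIMSEQ) simp
   \<comment> \<open>The shells beyond \<open>n\<close> cover what \<open>B n\<close> misses of
     \<open>T - F\<close>; as a tail of a convergent series they have small total measure.\<close>
   have "\<exists>n. (\<Sum>k. ?H (S (k + n))) \<le> ennreal e"
   proof (cases "(\<Sum>k. ?H (S k)) = 0")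
    case True
    then have "(\<Sum>k. ?H (S (k + 0))) \<le> ennreal e" by simp
    then show ?thesis by blast
   next
    case False
    obtain r where r: "(\<Sum>k. ?H (S k)) = ennreal r" "0 \<le> r"
     using sfin by (cases "\<Sum>k. ?H (S k)") auto
    then have "r > 0" using False by (cases "r = 0") auto
    then have "ennreal (r - e) < (\<Sum>k. ?H (S k))" unfolding r using e by (intro ennreal_lessI) auto
    from order_tendstoD(1)[OF sumlim this]
    obtain n where n: "ennreal (r - e) < (\<Sum>k<n. ?H (S k))"
     by (auto simp: eventually_sequentially)
    have split: "(\<Sum>k. ?H (S k)) = (\<Sum>k. ?H (S (k + n))) + (\<Sum>k<n. ?H (S k))"
     by (rule suminf_offset) simp
    obtain p where p: "(\<Sum>k<n. ?H (S k)) = ennreal p" "0 \<le> p"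
     using split sfin by (cases "\<Sum>k<n. ?H (S k)") auto
    obtain q where q: "(\<Sum>k. ?H (S (k + n))) = ennreal q" "0 \<le> q"
     using split sfin by (cases "\<Sum>k. ?H (S (k + n))") auto
    have "ennreal r = ennreal (q + p)" using split p q r by (simp add: ennreal_plus)
    then have "r = q + p" using r(2) p(2) q(2) by (metis add_nonneg_nonneg ennreal_inj)
    moreover have "r - e < p" using n p by (metis ennreal_leI not_le)
    ultimately show ?thesis using q by (intro exI[of _ n]) (simp add: ennreal_leI)
   qed
   then obtain n where n: "(\<Sum>k. ?H (S (k + n))) \<le> ennreal e" by blast
   have "?H (T - F) \<le> ?H (B n \<union> (\<Union>k. S (k + n)))" by (rule hausdorff1_mono[OF cover])
   also have "... \<le> ?H (B n) + ?H (\<Union>k. S (k + n))" by (rule hausdorff1_Un)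
   also have "... \<le> ?H (B n) + ennreal e" using order_trans[OF hausdorff1_subadditive n] by (rule add_left_mono)
   finally have "?H (F \<inter> T) + ?H (T - F) \<le> ?H (F \<inter> T) + (?H (B n) + ennreal e)" by (rule add_left_mono)
   also have "... \<le> ?H T + ennreal e" unfolding add.assoc[symmetric] using FB by (rule add_right_mono)
   finally show "?H (F \<inter> T) + ?H (T - F) \<le> ?H T + ennreal e" .
  qed
 qed
 have "?H (F \<inter> T) + ?H ((UNIV - F) \<inter> T) = ?H T" for T
 proof (rule antisym)
  have e: "(UNIV - F) \<inter> T = T - F" by auto
  show "?H (F \<inter> T) + ?H ((UNIV - F) \<inter> T) \<le> ?H T"
  proof (cases "F = {} \<or> ?H T = top")
   case False
   then show ?thesis unfolding e by (intro main) (auto simp: less_top)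
  qed auto
  have "T = (F \<inter> T) \<union> ((UNIV - F) \<inter> T)" by auto
  then show "?H T \<le> ?H (F \<inter> T) + ?H ((UNIV - F) \<inter> T)" using hausdorff1_Un by metis
 qed
 then show ?thesis by (simp add: sets_hausdorff1_measure lambda_system_def)
qed

lemma space_hausdorff1_measure [simp]: "space hausdorff1_measure = UNIV"
 unfolding hausdorff1_measure_def by (simp add: space_measure_of_conv)

lemma borel_subset_hausdorff1: "sets borel \<subseteq> sets (hausdorff1_measure :: 'a::metric_space measure)"
proof -
 have "sigma_sets UNIV {S. closed S} \<subseteq> sets (hausdorff1_measure :: 'a measure)"
  using sets.sigma_sets_subset[of "{S. closed S}" "hausdorff1_measure :: 'a measure"] closed_in_hausdorff1_measure
  by auto
 then show ?thesis by (simp add: borel_eq_closed)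
qed

lemma hausdorff1_Lipschitz_image:
 fixes g :: "real => 'a::metric_space"
 assumes L: "L-lipschitz_on {a..b} g" and ab: "a \<le> b"
 shows "hausdorff1 (g ` {a..b}) \<le> ennreal (L * (b - a))"
 unfolding hausdorff1_def
proof (rule SUP_least)
 fix d :: real assume "d \<in> {0<..}"
 then have d: "d > 0" by simp
 have L0: "L \<ge> 0" using L by (rule lipschitz_on_nonneg)
 obtain N :: nat where N: "L * (b - a) / d < real N" using reals_Archimedean2 by blast
 have N0: "N > 0" using N L0 ab d by (metis divide_nonneg_pos diff_ge_0_iff_ge gr0I mult_nonneg_nonneg not_le of_nat_0)
 define h where "h = (b - a) / real N"
 have h: "h \<ge> 0" "real N * h = b - a" using ab N0 by (auto simp: h_def)
 have Lh: "L * h \<le> d" using N d N0 by (simp add: h_def pos_divide_less_eq pos_divide_le_eq mult.commute)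
 define C where "C n = (if n < N then g ` ({a + real n * h..a + real (Suc n) * h} \<inter> {a..b}) else {})" for n
 have diam: "bounded (C n) \<and> diameter (C n) \<le> L * h" for n
 proof (cases "n < N")
  case True
  have dL: "dist x y \<le> L * h" if xy: "x \<in> C n" "y \<in> C n" for x y
  proof -
   obtain s t where st: "x = g s" "y = g t" "s \<in> {a + real n * h..a + real (Suc n) * h} \<inter> {a..b}" "t \<in> {a + real n * h..a + real (Suc n) * h} \<inter> {a..b}"
   proof -
    have "x \<in> g ` ({a + real n * h..a + real (Suc n) * h} \<inter> {a..b})" "y \<in> g ` ({a + real n * h..a + real (Suc n) * h} \<inter> {a..b})"
     using xy True unfolding C_def by (simp_all only: if_True)
    then show thesis using that by (elim imageE) blast
   qed
   have "dist x y \<le> L * dist s t" using st lipschitz_onD[OF L] by auto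
   also have "... \<le> L * h" using st L0 by (intro mult_left_mono) (auto simp: dist_real_def algebra_simps)
   finally show ?thesis .
  qed
  moreover have "0 \<le> L * h" using L0 h by simp
  moreover have "bounded (C n)" unfolding bounded_two_points using dL by blast
  moreover have "diameter (C n) \<le> L * h" if "C n \<noteq> {}"
  proof -
   have "diameter (C n) = (SUP (x, y)\<in>C n \<times> C n. dist x y)" using that by (simp add: diameter_def)
   also have "... \<le> L * h" using that dL by (intro cSUP_least) auto
   finally show ?thesis .
  qed
  ultimately show ?thesis by (cases "C n = {}") auto
 qed (use L0 h in \<open>simp add: C_def\<close>)
 have cov: "g ` {a..b} \<subseteq> (\<Union>n. C n)"
 proof
  fix y assume "y \<in> g ` {a..b}"
  then obtain t where t: "t \<in> {a..b}" "y = g t" by auto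
  show "y \<in> (\<Union>n. C n)"
  proof (cases "h = 0")
   case True
   then have "b = a" using h by simp
   then have "y \<in> C 0" using t N0 True by (auto simp: C_def)
   then show ?thesis by blast
  next
   case False
   then have hp: "h > 0" using h by simp
   \<comment> \<open>The cap \<open>N - 1\<close> puts the right end point \<open>b\<close> into the
     last piece.\<close>
   define n where "n = min (nat \<lfloor>(t - a) / h\<rfloor>) (N - 1)"
   have nn: "0 \<le> (t - a) / h" using t hp by simp
   have "n < N" using N0 by (auto simp: n_def)
   moreover have "a + real n * h \<le> t"
   proof -
    have "real n \<le> real (nat \<lfloor>(t - a) / h\<rfloor>)" unfolding n_def by simp
    also have "... \<le> (t - a) / h" by (rule of_nat_floor[OF nn])
    finally have "real n \<le> (t - a) / h" .
    then show ?thesis using hp by (simp add: pos_le_divide_eq)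
   qed
   moreover have "t \<le> a + real (Suc n) * h"
   proof (cases "nat \<lfloor>(t - a) / h\<rfloor> \<le> N - 1")
    case True
    then have "n = nat \<lfloor>(t - a) / h\<rfloor>" by (simp add: n_def)
    then have "real n = of_int \<lfloor>(t - a) / h\<rfloor>" using nn by simp
    then have "(t - a) / h \<le> real n + 1" using floor_correct[of "(t - a) / h"] by linarith
    then show ?thesis using hp by (simp add: pos_divide_le_eq algebra_simps)
   next
    case False
    then have "Suc n = N" using N0 by (auto simp: n_def)
    then show ?thesis using h t by auto
   qed
   ultimately have "y \<in> C n" using t by (auto simp: C_def)
   then show ?thesis by blast
  qed
 qed
 have "hausdorff1_pre d (g ` {a..b}) \<le> (\<Sum>n. ennreal (diameter (C n)))"
  unfolding hausdorff1_pre_def by (rule INF_lower) (use cov diam Lh in \<open>auto intro: order_trans\<close>)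
 also have "... = (\<Sum>n<N. ennreal (diameter (C n)))"
  by (rule suminf_finite) (auto simp: C_def)
 also have "... \<le> (\<Sum>n<N. ennreal (L * h))" using diam by (intro sum_mono ennreal_leI) auto
 also have "... = ennreal (real N * (L * h))" by (simp add: ennreal_mult' ennreal_of_nat_eq_real_of_nat)
 also have "real N * (L * h) = L * (b - a)" using h(2) by (metis mult.left_commute)
 finally show "hausdorff1_pre d (g ` {a..b}) \<le> ennreal (L * (b - a))" .
qed

text \<open>A 1-Lipschitz function sends each set of a cover into an interval as long as its
  diameter. These intervals cover \<open>{u..v}\<close>, so subadditivity of Lebesgue measure gives
  the bound.\<close>

lemma hausdorff1_ge_projection:
 fixes p :: "'a::metric_space => real"
 assumes p: "\<And>x y. \<bar>p x - p y\<bar> \<le> dist x y" and sub: "{u..v} \<subseteq> p ` A"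
 shows "ennreal (v - u) \<le> hausdorff1 A"
proof (cases "u \<le> v")
 case True
 have "ennreal (v - u) \<le> hausdorff1_pre 1 A"
  unfolding hausdorff1_pre_def
 proof (rule INF_greatest)
  fix C :: "nat => 'a set" assume "C \<in> {C. A \<subseteq> (\<Union>n. C n) \<and> (\<forall>n. bounded (C n) \<and> diameter (C n) \<le> 1)}"
  then have C: "A \<subseteq> (\<Union>n. C n)" "\<And>n. bounded (C n)" by auto
  have ex: "\<exists>l. p ` C n \<subseteq> {l..l + diameter (C n)}" for n
  proof (cases "C n = {}")
   case False
   have bb: "\<bar>p x - p y\<bar> \<le> diameter (C n)" if "x \<in> C n" "y \<in> C n" for x y
    using p[of x y] diameter_bounded_bound[OF C(2) that] by linarith
   obtain x0 where x0: "x0 \<in> C n" using False by auto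
   have bd: "bdd_below (p ` C n)"
   proof (rule bdd_belowI2)
    show "p x0 - diameter (C n) \<le> p x" if "x \<in> C n" for x using bb[OF x0 that] by linarith
   qed
   have "p ` C n \<subseteq> {Inf (p ` C n)..Inf (p ` C n) + diameter (C n)}"
   proof
    fix y assume "y \<in> p ` C n"
    then obtain x where x: "x \<in> C n" "y = p x" by auto
    have "Inf (p ` C n) \<le> y" using x bd by (auto intro: cInf_lower)
    moreover have "y - diameter (C n) \<le> Inf (p ` C n)"
    proof (rule cInf_greatest)
     show "p ` C n \<noteq> {}" using False by simp
     fix z assume "z \<in> p ` C n"
     then obtain x' where "x' \<in> C n" "z = p x'" by auto
     then show "y - diameter (C n) \<le> z" using bb[of x x'] x by auto
    qed
    ultimately show "y \<in> {Inf (p ` C n)..Inf (p ` C n) + diameter (C n)}" by simp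
   qed
   then show ?thesis by blast
  qed simp
  define l where "l n = (SOME l. p ` C n \<subseteq> {l..l + diameter (C n)})" for n
  have l: "p ` C n \<subseteq> {l n..l n + diameter (C n)}" for n
   unfolding l_def by (rule someI_ex[OF ex])
  have "{u..v} \<subseteq> (\<Union>n. {l n..l n + diameter (C n)})"
  proof
   fix y assume "y \<in> {u..v}"
   then obtain x where x: "x \<in> A" "y = p x" using sub by auto
   then obtain n where "x \<in> C n" using C(1) by auto
   then have "y \<in> {l n..l n + diameter (C n)}" using l[of n] x(2) by (meson imageI subsetD)
   then show "y \<in> (\<Union>n. {l n..l n + diameter (C n)})" by blast
  qed
  then have "emeasure lborel {u..v} \<le> emeasure lborel (\<Union>n. {l n..l n + diameter (C n)})"
   by (rule emeasure_mono) auto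
  also have "... \<le> (\<Sum>n. emeasure lborel {l n..l n + diameter (C n)})"
   by (rule emeasure_subadditive_countably) auto
  also have "... = (\<Sum>n. ennreal (diameter (C n)))"
   using diameter_ge_0[OF C(2)] by simp
  finally show "ennreal (v - u) \<le> (\<Sum>n. ennreal (diameter (C n)))" using True by simp
 qed
 also have "... \<le> hausdorff1 A" by (rule hausdorff1_pre_le) simp
 finally show ?thesis .
qed (simp add: ennreal_neg)

lemma compact_in_hausdorff1_measure: "compact A ==> A \<in> sets hausdorff1_measure"
 by (intro closed_in_hausdorff1_measure compact_imp_closed)

lemma hausdorff1_singleton: "hausdorff1 {x} = 0"
proof -
 have "hausdorff1 ((\<lambda>t. x) ` {0..0::real}) \<le> ennreal (0 * (0 - 0))"
  by (rule hausdorff1_Lipschitz_image) (auto intro: lipschitz_on_constant)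
 then show ?thesis by simp
qed

lemma emeasure_hausdorff1_singleton: "emeasure hausdorff1_measure {x} = 0"
 by (subst emeasure_hausdorff1_measure) (auto simp: hausdorff1_singleton intro: closed_in_hausdorff1_measure)

section \<open>Arc length of a C1 arc as an integral of the speed\<close>

locale c1_arc =
 fixes \<gamma> \<gamma>' :: "real => 'a::euclidean_space" and a b :: real
 assumes deriv: "\<And>t. (\<gamma> has_vector_derivative \<gamma>' t) (at t)" and cont': "continuous_on UNIV \<gamma>'"
  and ab: "a \<le> b" and inj: "inj_on \<gamma> {a..b}"
begin

lemma cont: "continuous_on S \<gamma>"
 using deriv by (intro continuous_at_imp_continuous_on) (auto intro: has_vector_derivative_continuous)

lemma compact_arc: "compact (\<gamma> ` {s..t})"
 by (intro compact_continuous_image cont) simp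

lemma arc_sets: "\<gamma> ` {s..t} \<in> sets hausdorff1_measure" "\<gamma> ` {s..t} \<in> sets borel"
 by (rule compact_in_hausdorff1_measure[OF compact_arc])
  (rule borel_closed[OF compact_imp_closed[OF compact_arc]])

text \<open>With \<open>v = 0\<close> this is the Lipschitz bound; with \<open>v\<close> the
  derivative at a point it says that the arc is almost straight nearby, as used in
  \<open>len_deriv\<close>.\<close>

lemma arc_Lipschitz:
 assumes "\<And>z. z \<in> {s..t} ==> norm (\<gamma>' z - v) \<le> L"
 shows "x \<in> {s..t} ==> y \<in> {s..t} ==> norm (\<gamma> x - \<gamma> y - (x - y) *\<^sub>R v) \<le> L * \<bar>x - y\<bar>"
proof -
 assume xy: "x \<in> {s..t}" "y \<in> {s..t}"
 have "norm ((\<gamma> x - x *\<^sub>R v) - (\<gamma> y - y *\<^sub>R v)) \<le> L * norm (x - y)"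
 proof (rule differentiable_bound[where f = "\<lambda>x. \<gamma> x - x *\<^sub>R v" and f' = "\<lambda>z h. h *\<^sub>R (\<gamma>' z - v)"])
  show "convex {s..t}" by (rule convex_real_interval)
  fix z assume z: "z \<in> {s..t}"
  have "((\<lambda>x. \<gamma> x - x *\<^sub>R v) has_vector_derivative \<gamma>' z - v) (at z within {s..t})"
   by (auto intro!: derivative_eq_intros has_vector_derivative_at_within[OF deriv])
  then show "((\<lambda>x. \<gamma> x - x *\<^sub>R v) has_derivative (\<lambda>h. h *\<^sub>R (\<gamma>' z - v))) (at z within {s..t})"
   by (simp add: has_vector_derivative_def)
  have "onorm (\<lambda>h. h *\<^sub>R (\<gamma>' z - v)) \<le> norm (\<gamma>' z - v)"
   by (rule onorm_le) (simp add: mult.commute)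
  then show "onorm (\<lambda>h. h *\<^sub>R (\<gamma>' z - v)) \<le> L" using assms[OF z] by linarith
 qed (use xy in auto)
 then show ?thesis by (simp add: algebra_simps)
qed

lemma hausdorff1_arc_le:
 assumes "\<And>z. z \<in> {s..t} ==> norm (\<gamma>' z) \<le> L" and st: "s \<le> t"
 shows "emeasure hausdorff1_measure (\<gamma> ` {s..t}) \<le> ennreal (L * (t - s))"
proof -
 have "L \<ge> 0" using assms(1)[of s] st order_trans[OF norm_ge_zero, of "\<gamma>' s" L] by auto
 then have "L-lipschitz_on {s..t} \<gamma>"
  using arc_Lipschitz[of s t 0 L] assms(1) by (intro lipschitz_onI) (auto simp: dist_norm dist_real_def)
 then show ?thesis
  using hausdorff1_Lipschitz_image[OF _ st] by (simp add: emeasure_hausdorff1_measure[OF arc_sets(1)])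
qed

text \<open>Projection onto the direction of the chord.\<close>

lemma hausdorff1_arc_ge:
 assumes st: "s \<le> t"
 shows "ennreal (norm (\<gamma> t - \<gamma> s)) \<le> emeasure hausdorff1_measure (\<gamma> ` {s..t})"
proof (cases "\<gamma> t = \<gamma> s")
 case False
 define u where "u = (\<gamma> t - \<gamma> s) /\<^sub>R norm (\<gamma> t - \<gamma> s)"
 have u: "norm u = 1" "(\<gamma> t - \<gamma> s) \<bullet> u = norm (\<gamma> t - \<gamma> s)"
  using False by (simp_all add: u_def dot_square_norm power2_eq_square)
 have "{\<gamma> s \<bullet> u..\<gamma> t \<bullet> u} \<subseteq> (\<lambda>x. x \<bullet> u) ` \<gamma> ` {s..t}"
 proof
  fix y assume y: "y \<in> {\<gamma> s \<bullet> u..\<gamma> t \<bullet> u}"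
  have "continuous_on {s..t} (\<lambda>x. \<gamma> x \<bullet> u)" by (intro continuous_intros cont)
  then obtain x where "s \<le> x" "x \<le> t" "\<gamma> x \<bullet> u = y"
   using IVT'[of "\<lambda>x. \<gamma> x \<bullet> u" s y t] y st by auto
  then show "y \<in> (\<lambda>x. x \<bullet> u) ` \<gamma> ` {s..t}" by auto
 qed
 moreover have "\<bar>x \<bullet> u - y \<bullet> u\<bar> \<le> dist x y" for x y
  using Cauchy_Schwarz_ineq2[of "x - y" u] u(1) by (simp add: inner_diff_left dist_norm)
 ultimately have "ennreal (\<gamma> t \<bullet> u - \<gamma> s \<bullet> u) \<le> hausdorff1 (\<gamma> ` {s..t})"
  by (rule hausdorff1_ge_projection[rotated])
 then show ?thesis
  using u(2) by (simp add: inner_diff_left emeasure_hausdorff1_measure[OF arc_sets(1)])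
qed simp

definition len where "len s t = measure hausdorff1_measure (\<gamma> ` {s..t})"

lemma emeasure_arc: "s \<le> t ==> emeasure hausdorff1_measure (\<gamma> ` {s..t}) = ennreal (len s t)"
proof -
 assume st: "s \<le> t"
 have "bounded (\<gamma>' ` {s..t})"
  by (intro compact_imp_bounded compact_continuous_image continuous_on_subset[OF cont']) auto
 then obtain L where L: "\<And>z. z \<in> {s..t} ==> norm (\<gamma>' z) \<le> L" unfolding bounded_iff by blast
 have "emeasure hausdorff1_measure (\<gamma> ` {s..t}) < top"
  using le_less_trans[OF hausdorff1_arc_le[OF L st] ennreal_less_top] .
 then show ?thesis unfolding len_def by (intro emeasure_eq_ennreal_measure) auto
qed

lemma len_le: "s \<le> t ==> (\<And>z. z \<in> {s..t} ==> norm (\<gamma>' z) \<le> L) ==> len s t \<le> L * (t - s)"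
proof -
 assume st: "s \<le> t" and L: "\<And>z. z \<in> {s..t} ==> norm (\<gamma>' z) \<le> L"
 have "0 \<le> L" using L[of s] st order_trans[OF norm_ge_zero, of "\<gamma>' s" L] by auto
 then show ?thesis using hausdorff1_arc_le[OF L st] st by (simp add: emeasure_arc[OF st] ennreal_le_iff)
qed

lemma len_ge: "s \<le> t ==> norm (\<gamma> t - \<gamma> s) \<le> len s t"
 using hausdorff1_arc_ge[of s t] by (simp add: emeasure_arc ennreal_le_iff len_def)

text \<open>By injectivity the two pieces share only an end point, which is a null set.\<close>

lemma len_add:
 assumes "a \<le> r" "r \<le> s" "s \<le> t" "t \<le> b"
 shows "len r t = len r s + len s t"
proof -
 let ?M = "hausdorff1_measure :: 'a measure"
 let ?A = "\<gamma> ` {r..s}" and ?B = "\<gamma> ` {s..t}"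
 have "?B - ?A = ?B - {\<gamma> s}"
 proof
  show "?B - {\<gamma> s} \<subseteq> ?B - ?A"
  proof
   fix y assume "y \<in> ?B - {\<gamma> s}"
   then obtain x where x: "x \<in> {s..t}" "y = \<gamma> x" "x \<noteq> s" by blast
   have "y \<notin> ?A"
   proof
    assume "y \<in> ?A"
    then obtain x' where x': "x' \<in> {r..s}" "y = \<gamma> x'" by blast
    have "x = x'" by (rule inj_onD[OF inj]) (use x x' assms in auto)
    then show False using x x' by auto
   qed
   then show "y \<in> ?B - ?A" using x by auto
  qed
 qed (use assms in auto)
 moreover have "emeasure ?M (?B - {\<gamma> s}) = emeasure ?M ?B"
  by (rule emeasure_Diff_null_set) (auto simp: null_sets_def emeasure_hausdorff1_singleton arc_sets intro: closed_in_hausdorff1_measure)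
 moreover have "?A \<union> ?B = \<gamma> ` {r..t}" using assms by (subst image_Un[symmetric]) (auto simp: ivl_disj_un)
 moreover have "emeasure ?M (?A \<union> ?B) = emeasure ?M ?A + emeasure ?M (?B - ?A)"
  by (subst plus_emeasure) (auto simp: arc_sets)
 ultimately have "ennreal (len r t) = ennreal (len r s) + ennreal (len s t)"
  using assms by (simp add: emeasure_arc)
 then have "ennreal (len r t) = ennreal (len r s + len s t)" by (simp add: len_def)
 then show ?thesis by (subst (asm) ennreal_inj) (auto simp: len_def)
qed

text \<open>A short piece near \<open>x\<close> is at most as long as the local Lipschitz bound
  allows and at least as long as its chord. Per unit of the parameter both are within
  \<open>e / 2\<close> of the speed at \<open>x\<close>.\<close>

lemma len_deriv:
 assumes x: "x \<in> {a..b}"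
 shows "((\<lambda>t. len a t) has_real_derivative norm (\<gamma>' x)) (at x within {a..b})"
 unfolding has_field_derivative_iff
proof (rule tendstoI)
 fix e :: real assume e: "0 < e"
 have "isCont \<gamma>' x" using cont' by (simp add: continuous_on_eq_continuous_at)
 then obtain d where d: "d > 0" "\<And>z. dist z x < d ==> dist (\<gamma>' z) (\<gamma>' x) < e / 2"
  using e unfolding continuous_at_eps_delta by (metis half_gt_zero)
 have "dist ((len a t - len a x) / (t - x)) (norm (\<gamma>' x)) < e"
  if t: "t \<in> {a..b}" "t \<noteq> x" "dist t x < d" for t
 proof -
  define p where "p = min t x"
  define q where "q = max t x"
  have pq: "p < q" "a \<le> p" "q \<le> b" "\<bar>t - x\<bar> = q - p" "p = x \<and> q = t \<or> p = t \<and> q = x"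
   using t x by (auto simp: p_def q_def)
  have near: "norm (\<gamma>' z - \<gamma>' x) \<le> e / 2" if "z \<in> {p..q}" for z
  proof -
   have "dist z x < d" using that t(3) by (auto simp: p_def q_def dist_real_def)
   then show ?thesis using d(2)[of z] by (simp add: dist_norm)
  qed
  have up: "len p q \<le> (norm (\<gamma>' x) + e / 2) * (q - p)"
  proof (rule len_le)
   show "p \<le> q" using pq by simp
   fix z assume "z \<in> {p..q}"
   from near[OF this] show "norm (\<gamma>' z) \<le> norm (\<gamma>' x) + e / 2"
    using norm_triangle_sub[of "\<gamma>' z" "\<gamma>' x"] by linarith
  qed
  have "norm (\<gamma> q - \<gamma> p - (q - p) *\<^sub>R \<gamma>' x) \<le> e / 2 * \<bar>q - p\<bar>"
   by (rule arc_Lipschitz[OF near]) (use pq in auto)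
  moreover have "norm ((q - p) *\<^sub>R \<gamma>' x) \<le> norm (\<gamma> q - \<gamma> p) + norm (\<gamma> q - \<gamma> p - (q - p) *\<^sub>R \<gamma>' x)"
   by (metis norm_minus_commute norm_triangle_sub add.commute)
  moreover have "norm ((q - p) *\<^sub>R \<gamma>' x) = norm (\<gamma>' x) * (q - p)" "\<bar>q - p\<bar> = q - p" using pq(1) by simp_all
  moreover have "norm (\<gamma> q - \<gamma> p) \<le> len p q" using len_ge[of p q] pq(1) by simp
  ultimately have "norm (\<gamma>' x) * (q - p) - e / 2 * (q - p) \<le> len p q" by linarith
  then have lo: "(norm (\<gamma>' x) - e / 2) * (q - p) \<le> len p q" by (simp only: left_diff_distrib)
  have quot: "(len a t - len a x) / (t - x) = len p q / (q - p)"
  proof -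
   have "len a q = len a p + len p q" using pq by (intro len_add) auto
   then show ?thesis using pq(5) by (auto simp: divide_simps) (simp add: algebra_simps)
  qed
  have "len p q / (q - p) \<le> norm (\<gamma>' x) + e / 2" using up pq(1) by (simp add: pos_divide_le_eq)
  moreover have "norm (\<gamma>' x) - e / 2 \<le> len p q / (q - p)" using lo pq(1) by (simp add: pos_le_divide_eq)
  ultimately show ?thesis unfolding quot dist_real_def using e by (simp add: abs_less_iff)
 qed
 then show "\<forall>\<^sub>F t in at x within {a..b}. dist ((len a t - len a x) / (t - x)) (norm (\<gamma>' x)) < e"
  unfolding eventually_at using d(1) by blast
qed

lemma len_integral:
 assumes x: "x \<in> {a..b}"
 shows "((\<lambda>t. norm (\<gamma>' t)) has_integral len x b) {x..b}"
proof -
 have "((\<lambda>t. norm (\<gamma>' t)) has_integral (len a b - len a x)) {x..b}"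
 proof (rule fundamental_theorem_of_calculus)
  show "x \<le> b" using x by simp
  fix t assume t: "t \<in> {x..b}"
  have "((\<lambda>t. len a t) has_real_derivative norm (\<gamma>' t)) (at t within {x..b})"
   by (rule DERIV_subset[OF len_deriv]) (use x t in auto)
  then show "((\<lambda>t. len a t) has_vector_derivative norm (\<gamma>' t)) (at t within {x..b})"
   by (simp add: has_real_derivative_iff_has_vector_derivative)
 qed
 moreover have "len a b = len a x + len x b" using x by (intro len_add) auto
 ultimately show ?thesis by simp
qed

text \<open>Extended by 0 off the arc, which makes it Borel measurable on the whole space.\<close>

definition arc_inv where
 "arc_inv y = indicator (\<gamma> ` {a..b}) y *\<^sub>R the_inv_into {a..b} \<gamma> y"

lemma arc_inv: "x \<in> {a..b} ==> arc_inv (\<gamma> x) = x"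
 by (simp add: arc_inv_def the_inv_into_f_f[OF inj])

lemma arc_inv_measurable [measurable]: "arc_inv \<in> borel_measurable borel"
 unfolding arc_inv_def [abs_def]
proof (rule borel_measurable_continuous_on_indicator)
 show "\<gamma> ` {a..b} \<in> sets borel" by (rule arc_sets)
 show "continuous_on (\<gamma> ` {a..b}) (the_inv_into {a..b} \<gamma>)"
  by (rule continuous_on_inv[OF cont]) (auto simp: the_inv_into_f_f[OF inj])
qed

lemma \<gamma>_measurable [measurable]: "\<gamma> \<in> borel_measurable borel"
 by (rule borel_measurable_continuous_onI[OF cont])

lemma speed_measurable [measurable]: "(\<lambda>x. norm (\<gamma>' x)) \<in> borel_measurable borel"
 by (intro borel_measurable_continuous_onI continuous_intros cont')

definition arc_measure :: "'a measure" where
 "arc_measure = density hausdorff1_measure (indicator (\<gamma> ` {a..b}))"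

lemma measurable_hausdorff1: "f \<in> borel_measurable borel ==> f \<in> borel_measurable (hausdorff1_measure :: 'a measure)"
 using borel_subset_hausdorff1 by (auto simp: measurable_def)

text \<open>Two Borel measures on the line that are finite and equal on all rays coincide; on a ray
  both sides give the length of a subarc.\<close>

lemma arc_measure_pullback:
 "distr arc_measure borel arc_inv = density lborel (\<lambda>x. ennreal (indicator {a..b} x * norm (\<gamma>' x)))"
  (is "?N = ?L")
proof (rule measure_eqI_lessThan)
 have m: "arc_inv \<in> borel_measurable arc_measure"
  unfolding arc_measure_def by (simp add: measurable_hausdorff1)
 have L: "emeasure ?L {x<..} = ennreal (if x < a then len a b else if x < b then len x b else 0)" for x
 proof -
  have "emeasure ?L {x<..} = (\<integral>\<^sup>+t. ennreal (indicator {a..b} t * norm (\<gamma>' t)) * indicator {x<..} t \<partial>lborel)"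
   by (rule emeasure_density) auto
  also have "... = (\<integral>\<^sup>+t. ennreal (norm (\<gamma>' t)) * indicator {max a x..b} t \<partial>lborel)"
  proof (rule nn_integral_cong_AE)
   have "AE t in lborel. t \<noteq> x" by (rule AE_lborel_singleton)
   then show "AE t in lborel. ennreal (indicator {a..b} t * norm (\<gamma>' t)) * indicator {x<..} t = ennreal (norm (\<gamma>' t)) * indicator {max a x..b} t"
    by eventually_elim (auto simp: indicator_def)
  qed
  also have "... = ennreal (if x < a then len a b else if x < b then len x b else 0)"
  proof (cases "max a x \<le> b")
   case True
   have "(\<integral>\<^sup>+t. ennreal (norm (\<gamma>' t)) * indicator {max a x..b} t \<partial>lborel) = ennreal (len (max a x) b)"
    by (rule nn_integral_has_integral_lebesgue'[OF _ len_integral]) (use True ab in auto)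
   moreover have "len b b = 0" by (simp add: len_def measure_def emeasure_hausdorff1_singleton)
   ultimately show ?thesis using True by (auto simp: max_def)
  next
   case False
   then show ?thesis using ab by (auto simp: max_def)
  qed
  finally show ?thesis .
 qed
 show "sets ?N = sets borel" "sets ?L = sets borel" by simp_all
 have N: "emeasure ?N {x<..} = ennreal (if x < a then len a b else if x < b then len x b else 0)" for x
 proof -
  have "emeasure ?N {x<..} = emeasure arc_measure (arc_inv -` {x<..})"
   by (subst emeasure_distr[OF m]) (auto simp: arc_measure_def)
  also have "... = (\<integral>\<^sup>+y. indicator (\<gamma> ` {a..b}) y * indicator (arc_inv -` {x<..}) y \<partial>hausdorff1_measure)"
   unfolding arc_measure_def
  proof (rule emeasure_density)
   show "indicator (\<gamma> ` {a..b}) \<in> borel_measurable hausdorff1_measure" using arc_sets by simp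
   show "arc_inv -` {x<..} \<in> sets hausdorff1_measure"
    using measurable_sets[OF measurable_hausdorff1[OF arc_inv_measurable], of "{x<..}"] by simp
  qed
  also have "... = (\<integral>\<^sup>+y. indicator (\<gamma> ` ({a..b} \<inter> {x<..})) y \<partial>hausdorff1_measure)"
   by (intro nn_integral_cong) (auto simp: indicator_def arc_inv)
  also have "... = ennreal (if x < a then len a b else if x < b then len x b else 0)"
  proof -
   consider "x < a" | "a \<le> x" "x < b" | "b \<le> x" by linarith
   then show ?thesis
   proof cases
    case 1
    then have "{a..b} \<inter> {x<..} = {a..b}" by auto
    then show ?thesis using 1 ab by (simp add: arc_sets emeasure_arc)
   next
    case 2
    have "{a..b} \<inter> {x<..} = {x..b} - {x}" using 2 by auto
    moreover have "\<gamma> ` ({x..b} - {x}) = \<gamma> ` {x..b} - \<gamma> ` {x}"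
     by (rule inj_on_image_set_diff[OF inj]) (use 2 in auto)
    ultimately have "\<gamma> ` ({a..b} \<inter> {x<..}) = \<gamma> ` {x..b} - {\<gamma> x}" by simp
    moreover have "emeasure hausdorff1_measure (\<gamma> ` {x..b} - {\<gamma> x}) = emeasure hausdorff1_measure (\<gamma> ` {x..b})"
     by (rule emeasure_Diff_null_set) (auto simp: null_sets_def emeasure_hausdorff1_singleton arc_sets intro: closed_in_hausdorff1_measure)
    moreover have "\<gamma> ` {x..b} - {\<gamma> x} \<in> sets hausdorff1_measure"
     by (intro sets.Diff arc_sets closed_in_hausdorff1_measure) simp
    ultimately show ?thesis using 2 by (simp add: emeasure_arc)
   next
    case 3
    then have "{a..b} \<inter> {x<..} = {}" by auto
    then show ?thesis using 3 ab by simp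
   qed
  qed
  finally show ?thesis .
 qed
 show "emeasure ?N {x<..} < \<infinity>" for x unfolding N by simp
 show "emeasure ?N {x<..} = emeasure ?L {x<..}" for x unfolding N L ..
qed

text \<open>On the arc \<open>f\<close> agrees with its composition with \<open>\<gamma>\<close> and
  \<open>arc_inv\<close>, which turns the integral into one over the image measure on the
  line.\<close>

lemma arc_integral:
 fixes f :: "'a => 'b::{banach, second_countable_topology}"
 assumes f: "f \<in> borel_measurable borel"
 shows "integrable hausdorff1_measure (\<lambda>y. indicator (\<gamma> ` {a..b}) y *\<^sub>R f y)
  \<longleftrightarrow> integrable lborel (\<lambda>x. (indicator {a..b} x * norm (\<gamma>' x)) *\<^sub>R f (\<gamma> x))"
  and "(LINT y|hausdorff1_measure. indicator (\<gamma> ` {a..b}) y *\<^sub>R f y)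
  = (LINT x|lborel. (indicator {a..b} x * norm (\<gamma>' x)) *\<^sub>R f (\<gamma> x))"
proof -
 have fm: "f \<in> borel_measurable hausdorff1_measure" by (rule measurable_hausdorff1[OF f])
 have im: "arc_inv \<in> borel_measurable arc_measure"
  unfolding arc_measure_def by (simp add: measurable_hausdorff1)
 have ind: "indicator (\<gamma> ` {a..b}) \<in> borel_measurable (hausdorff1_measure :: 'a measure)" using arc_sets by simp
 have f\<gamma>: "(\<lambda>x. f (\<gamma> x)) \<in> borel_measurable borel" using f by measurable
 have am: "arc_measure = density hausdorff1_measure (\<lambda>y. ennreal (indicator (\<gamma> ` {a..b}) y))"
  unfolding arc_measure_def by (simp add: ennreal_indicator)
 have ae: "AE y in arc_measure. f y = f (\<gamma> (arc_inv y))"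
  unfolding arc_measure_def using ind by (subst AE_density) (auto simp: indicator_def arc_inv intro!: AE_I2)
 have fi: "f \<in> borel_measurable arc_measure" "(\<lambda>y. f (\<gamma> (arc_inv y))) \<in> borel_measurable arc_measure"
  using fm measurable_compose[OF im f\<gamma>] by (auto simp: arc_measure_def)
 have "integrable hausdorff1_measure (\<lambda>y. indicator (\<gamma> ` {a..b}) y *\<^sub>R f y) \<longleftrightarrow> integrable arc_measure f"
  unfolding am by (rule integrable_density[symmetric]) (use fm arc_sets in auto)
 also have "... \<longleftrightarrow> integrable arc_measure (\<lambda>y. f (\<gamma> (arc_inv y)))"
  by (rule integrable_cong_AE[OF fi ae])
 also have "... \<longleftrightarrow> integrable (distr arc_measure borel arc_inv) (\<lambda>x. f (\<gamma> x))"
  by (rule integrable_distr_eq[symmetric, OF im f\<gamma>])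
 also have "... \<longleftrightarrow> integrable lborel (\<lambda>x. (indicator {a..b} x * norm (\<gamma>' x)) *\<^sub>R f (\<gamma> x))"
  unfolding arc_measure_pullback by (rule integrable_density) (use f\<gamma> in auto)
 finally show "integrable hausdorff1_measure (\<lambda>y. indicator (\<gamma> ` {a..b}) y *\<^sub>R f y)
  \<longleftrightarrow> integrable lborel (\<lambda>x. (indicator {a..b} x * norm (\<gamma>' x)) *\<^sub>R f (\<gamma> x))" .
 have "(LINT y|hausdorff1_measure. indicator (\<gamma> ` {a..b}) y *\<^sub>R f y) = (LINT y|arc_measure. f y)"
  unfolding am by (rule integral_density[symmetric]) (use fm arc_sets in auto)
 also have "... = (LINT y|arc_measure. f (\<gamma> (arc_inv y)))" by (rule integral_cong_AE[OF fi ae])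
 also have "... = (LINT x|distr arc_measure borel arc_inv. f (\<gamma> x))"
  by (rule integral_distr[symmetric, OF im f\<gamma>])
 also have "... = (LINT x|lborel. (indicator {a..b} x * norm (\<gamma>' x)) *\<^sub>R f (\<gamma> x))"
  unfolding arc_measure_pullback by (rule integral_density) (use f\<gamma> in auto)
 finally show "(LINT y|hausdorff1_measure. indicator (\<gamma> ` {a..b}) y *\<^sub>R f y)
  = (LINT x|lborel. (indicator {a..b} x * norm (\<gamma>' x)) *\<^sub>R f (\<gamma> x))" .
qed

end

section \<open>The unit normal of a Lipschitz boundary\<close>

text \<open>In the plane the determinant \<open>D\<close> of an orthonormal pair has square 1, so
  the second vector is the first turned by a right angle, up to sign. Hence the rows of the matrix
  are orthonormal as well.\<close>

lemma orthonormal_expand: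
 fixes e1 e2 z :: "real ^ 2"
 assumes "norm e1 = 1" "norm e2 = 1" "e1 \<bullet> e2 = 0"
 shows "z = (z \<bullet> e1) *\<^sub>R e1 + (z \<bullet> e2) *\<^sub>R e2"
proof -
 define a b c d where "a = e1 $ 1" and "b = e1 $ 2" and "c = e2 $ 1" and "d = e2 $ 2"
 have ab: "a^2 + b^2 = 1" and cd: "c^2 + d^2 = 1" and o: "a * c + b * d = 0"
  using assms norm_sq_2[of e1] norm_sq_2[of e2] by (auto simp: a_def b_def c_def d_def inner_2)
 define D where "D = a * d - b * c"
 have D2: "D^2 = 1"
 proof -
  have "D^2 = (a^2 + b^2) * (c^2 + d^2) - (a * c + b * d)^2" unfolding D_def by (simp add: power2_eq_square algebra_simps)
  then show ?thesis using ab cd o by simp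
 qed
 have c: "c = - b * D" 
 proof -
  have "- b * D = b * (b * c) - a * b * d" by (simp add: D_def algebra_simps)
  also have "... = b^2 * c - a * (b * d)" by (simp add: power2_eq_square)
  also have "b * d = - (a * c)" using o by simp
  also have "b^2 * c - a * - (a * c) = (a^2 + b^2) * c" by (simp add: power2_eq_square algebra_simps)
  finally show ?thesis using ab by simp
 qed
 have d: "d = a * D"
 proof -
  have "a * D = a^2 * d - b * (a * c)" by (simp add: D_def power2_eq_square algebra_simps)
  also have "a * c = - (b * d)" using o by simp
  also have "a^2 * d - b * - (b * d) = (a^2 + b^2) * d" by (simp add: power2_eq_square algebra_simps)
  finally show ?thesis using ab by simp
 qed
 have rows: "a * a + c * c = 1" "b * b + d * d = 1" "a * b + c * d = 0"
 proof -
  have "c * c = D^2 * b^2" "d * d = D^2 * a^2" "c * d = - (D^2 * (a * b))" unfolding c d by (simp_all add: power2_eq_square)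
  then show "a * a + c * c = 1" "b * b + d * d = 1" "a * b + c * d = 0"
   using ab D2 by (simp_all add: power2_eq_square add.commute)
 qed
 have "(z $ 1 * a + z $ 2 * b) * a + (z $ 1 * c + z $ 2 * d) * c = z $ 1 * (a * a + c * c) + z $ 2 * (a * b + c * d)"
  "(z $ 1 * a + z $ 2 * b) * b + (z $ 1 * c + z $ 2 * d) * d = z $ 1 * (a * b + c * d) + z $ 2 * (b * b + d * d)"
  by (simp_all add: algebra_simps)
 then show ?thesis
  unfolding rows by (simp add: vec_eq_iff forall_2 inner_2 a_def b_def c_def d_def)
qed

locale lipschitz_chart =
 fixes \<Omega> :: "(real ^ 2) set" and p e1 e2 :: "real ^ 2" and r h L :: real and f :: "real => real"
 assumes closed: "closed \<Omega>" and on: "norm e1 = 1" "norm e2 = 1" "e1 \<bullet> e2 = 0" and rh: "0 < r" "0 < h"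
  and lip: "L-lipschitz_on {-r<..<r} f" and f_less: "\<And>s. \<bar>s\<bar> < r ==> \<bar>f s\<bar> < h"
  and iff: "\<And>s t. \<bar>s\<bar> < r ==> \<bar>t\<bar> < h ==> p + s *\<^sub>R e1 + t *\<^sub>R e2 \<in> \<Omega> \<longleftrightarrow> t \<le> f s"
begin

definition box where "box = {z. \<bar>(z - p) \<bullet> e1\<bar> < r \<and> \<bar>(z - p) \<bullet> e2\<bar> < h}"

definition G where "G s = p + s *\<^sub>R e1 + f s *\<^sub>R e2"

lemma L0: "L \<ge> 0"
 using lip by (rule lipschitz_on_nonneg)

lemma inner_simps [simp]: "e1 \<bullet> e1 = 1" "e2 \<bullet> e2 = 1" "e1 \<bullet> e2 = 0" "e2 \<bullet> e1 = 0"
 using on by (simp_all add: dot_square_norm inner_commute)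

lemma expand: "z = p + ((z - p) \<bullet> e1) *\<^sub>R e1 + ((z - p) \<bullet> e2) *\<^sub>R e2"
 using orthonormal_expand[OF on, of "z - p"] by (simp add: algebra_simps)

lemma coords [simp]: "(p + s *\<^sub>R e1 + t *\<^sub>R e2 - p) \<bullet> e1 = s" "(p + s *\<^sub>R e1 + t *\<^sub>R e2 - p) \<bullet> e2 = t"
 by (simp_all add: inner_add_left)

lemma open_box: "open box"
 unfolding box_def by (intro open_Collect_conj open_Collect_less continuous_intros)

lemma mem_\<Omega>: "z \<in> box ==> z \<in> \<Omega> \<longleftrightarrow> (z - p) \<bullet> e2 \<le> f ((z - p) \<bullet> e1)"
 using iff[of "(z - p) \<bullet> e1" "(z - p) \<bullet> e2"] expand[of z] by (auto simp: box_def)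

lemma cont_f: "continuous_on {-r<..<r} f"
 using lip by (rule lipschitz_on_continuous_on)

lemma f_lip: "\<bar>s\<bar> < r ==> \<bar>s'\<bar> < r ==> \<bar>f s - f s'\<bar> \<le> L * \<bar>s - s'\<bar>"
 using lipschitz_onD[OF lip, of s s'] by (simp add: dist_real_def abs_less_iff)

lemma G_frontier:
 assumes s: "\<bar>s\<bar> < r"
 shows "G s \<in> frontier \<Omega>"
proof -
 have G: "G s \<in> \<Omega>" unfolding G_def using iff[OF s f_less[OF s]] by simp
 have "G s \<notin> interior \<Omega>"
 proof
  assume "G s \<in> interior \<Omega>"
  then obtain e where e: "e > 0" "ball (G s) e \<subseteq> \<Omega>" by (meson mem_interior)
  define t where "t = min (e / 2) ((h - f s) / 2)"
  have fs: "\<bar>f s\<bar> < h" by (rule f_less[OF s])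
  have fs': "- h < f s" "f s < h" using fs by auto
  have t0: "0 < t" "t \<le> e / 2" "t \<le> (h - f s) / 2"
  proof -
   show "0 < t" using e(1) fs' by (simp add: t_def)
   show "t \<le> e / 2" "t \<le> (h - f s) / 2" unfolding t_def by (rule min.cobounded1, rule min.cobounded2)
  qed
  have t: "0 < t" "t < e" "\<bar>f s + t\<bar> < h" 
  proof -
   have "f s + t \<le> f s + (h - f s) / 2" using t0(3) by (rule add_left_mono)
   also have "... < h" using fs' by (simp add: field_simps)
   finally have "f s + t < h" .
   moreover have "- (f s + t) < h" using t0(1) fs'(1) by simp
   ultimately show "\<bar>f s + t\<bar> < h" by (simp only: abs_less_iff)
   show "0 < t" "t < e" using t0 e(1) by linarith+
  qed
  have "p + s *\<^sub>R e1 + (f s + t) *\<^sub>R e2 \<in> ball (G s) e"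
   using t on by (simp add: G_def dist_norm scaleR_add_left)
  then have "p + s *\<^sub>R e1 + (f s + t) *\<^sub>R e2 \<in> \<Omega>" using e by blast
  then show False using iff[OF s t(3)] t by simp
 qed
 then show ?thesis using G closed by (simp add: frontier_def)
qed

lemma frontier_graph:
 assumes z: "z \<in> frontier \<Omega>" "z \<in> box"
 shows "(z - p) \<bullet> e2 = f ((z - p) \<bullet> e1)" "z = G ((z - p) \<bullet> e1)"
proof -
 have z\<Omega>: "z \<in> \<Omega>" "z \<notin> interior \<Omega>" using z closed by (auto simp: frontier_def)
 show e: "(z - p) \<bullet> e2 = f ((z - p) \<bullet> e1)"
 proof (rule ccontr)
  assume "(z - p) \<bullet> e2 \<noteq> f ((z - p) \<bullet> e1)"
  then have lt: "(z - p) \<bullet> e2 < f ((z - p) \<bullet> e1)" using mem_\<Omega>[OF z(2)] z\<Omega> by auto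
  have "continuous_on box (\<lambda>z. f ((z - p) \<bullet> e1) - (z - p) \<bullet> e2)"
   by (intro continuous_intros continuous_on_compose2[OF cont_f]) (auto simp: box_def)
  from this[unfolded continuous_on_open_vimage[OF open_box], rule_format, OF open_greaterThan[of 0]]
  have "open ((\<lambda>z. f ((z - p) \<bullet> e1) - (z - p) \<bullet> e2) -` {0<..} \<inter> box)" .
  moreover have "(\<lambda>z. f ((z - p) \<bullet> e1) - (z - p) \<bullet> e2) -` {0<..} \<inter> box \<subseteq> \<Omega>"
   using mem_\<Omega> by auto
  moreover have "z \<in> (\<lambda>z. f ((z - p) \<bullet> e1) - (z - p) \<bullet> e2) -` {0<..} \<inter> box" using lt z by simp
  ultimately show False using z\<Omega>(2) by (meson interior_maximal subsetD)
 qed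
 then show "z = G ((z - p) \<bullet> e1)" unfolding G_def using expand[of z] by simp
qed

lemma G_dist:
 assumes s: "\<bar>s\<bar> < r" "\<bar>s'\<bar> < r"
 shows "norm (G s - G s') \<le> (1 + L) * \<bar>s - s'\<bar>"
proof -
 have "G s - G s' = (s - s') *\<^sub>R e1 + (f s - f s') *\<^sub>R e2" by (simp add: G_def algebra_simps)
 then have "norm (G s - G s') \<le> \<bar>s - s'\<bar> + \<bar>f s - f s'\<bar>"
  using norm_triangle_ineq[of "(s - s') *\<^sub>R e1" "(f s - f s') *\<^sub>R e2"] on by simp
 also have "... \<le> (1 + L) * \<bar>s - s'\<bar>" using f_lip[OF s] by (simp add: algebra_simps)
 finally show ?thesis .
qed

lemma coord_norm:
 assumes "norm n = 1"
 shows "(n \<bullet> e1)^2 + (n \<bullet> e2)^2 = 1"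
proof -
 have "n \<bullet> n = n \<bullet> ((n \<bullet> e1) *\<^sub>R e1 + (n \<bullet> e2) *\<^sub>R e2)"
  using orthonormal_expand[OF on, of n] by (rule arg_cong)
 then show ?thesis
  using assms by (simp only: inner_add_right inner_scaleR_right dot_square_norm power2_eq_square mult_1)
qed

lemma G_inner: "(G s - G s') \<bullet> n = (s - s') * (n \<bullet> e1) + (f s - f s') * (n \<bullet> e2)"
 by (simp add: G_def inner_diff_left inner_add_left inner_commute[of n] algebra_simps)

text \<open>Half the width leaves room for difference quotients with steps up to
  \<open>r / 2\<close> and places the graph over a compact interval.\<close>

definition small_box where "small_box = {z. \<bar>(z - p) \<bullet> e1\<bar> < r / 2 \<and> \<bar>(z - p) \<bullet> e2\<bar> < h}"

lemma small_box: "open small_box" "p \<in> small_box" "small_box \<subseteq> box"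
 using rh by (auto simp: small_box_def box_def intro!: open_Collect_conj open_Collect_less continuous_intros)

lemma small_box_finite: "hausdorff1 (frontier \<Omega> \<inter> small_box) < top"
proof -
 have "frontier \<Omega> \<inter> small_box \<subseteq> G ` {-r/2..r/2}"
 proof
  fix z assume z: "z \<in> frontier \<Omega> \<inter> small_box"
  then have "z = G ((z - p) \<bullet> e1)" using frontier_graph(2)[of z] small_box(3) by blast
  moreover have "(z - p) \<bullet> e1 \<in> {-r/2..r/2}" using z by (auto simp: small_box_def)
  ultimately show "z \<in> G ` {-r/2..r/2}" by blast
 qed
 then have "hausdorff1 (frontier \<Omega> \<inter> small_box) \<le> hausdorff1 (G ` {-r/2..r/2})" by (rule hausdorff1_mono)
 also have "... \<le> ennreal ((1 + L) * (r/2 - - r/2))"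
 proof (rule hausdorff1_Lipschitz_image)
  show "(1 + L)-lipschitz_on {- r / 2..r / 2} G"
  proof (rule lipschitz_onI)
   fix x y assume "x \<in> {- r / 2..r / 2}" "y \<in> {- r / 2..r / 2}"
   then have "\<bar>x\<bar> < r" "\<bar>y\<bar> < r" using rh by auto
   from G_dist[OF this] show "dist (G x) (G y) \<le> (1 + L) * dist x y" by (simp add: dist_norm)
  qed (use L0 in simp)
 qed (use rh in simp)
 finally show ?thesis by (rule le_less_trans[OF _ ennreal_less_top])
qed

definition tangent where
 "tangent y n \<longleftrightarrow> ((\<lambda>z. ((z - y) \<bullet> n) / norm (z - y)) \<longlongrightarrow> 0) (at y within frontier \<Omega>)"

lemma is_unit_normal_iff:
 "is_unit_normal \<Omega> y n \<longleftrightarrow> norm n = 1 \<and> tangent y n \<and> (\<forall>\<^sub>F t in at_right 0. y + t *\<^sub>R n \<notin> \<Omega>)"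
 by (simp add: is_unit_normal_def tangent_def)

text \<open>Tests tangency along the curve \<open>t \<mapsto> G (s + t * x)\<close>, whose distance
  from \<open>G s\<close> is of order \<open>t\<close> by the Lipschitz bound.\<close>

lemma tangent_key:
 assumes s: "\<bar>s\<bar> < r" and n: "tangent (G s) n"
 shows "((\<lambda>t. ((t * x) * (n \<bullet> e1) + (f (s + t * x) - f s) * (n \<bullet> e2)) / t) \<longlongrightarrow> 0) (at_right 0)"
proof (cases "x = 0")
 case False
 have near: "\<forall>\<^sub>F t in at_right 0. \<bar>s + t * x\<bar> < r"
 proof -
  have "((\<lambda>t. \<bar>s + t * x\<bar>) \<longlongrightarrow> \<bar>s + 0 * x\<bar>) (at_right 0)" by (intro tendsto_intros)
  then show ?thesis using s by (intro order_tendstoD(2)) auto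
 qed
 have bnd: "\<forall>\<^sub>F t in at_right 0. 0 < t \<and> \<bar>s + t * x\<bar> < r \<and> G (s + t * x) \<noteq> G s \<and> norm (G (s + t * x) - G s) \<le> (1 + L) * \<bar>x\<bar> * t"
  using near eventually_at_right_less[of 0]
 proof eventually_elim
  case (elim t)
  have "(G (s + t * x) - G s) \<bullet> e1 = t * x" by (subst G_inner) simp
  then have "G (s + t * x) \<noteq> G s" using elim False by auto
  moreover have "norm (G (s + t * x) - G s) \<le> (1 + L) * \<bar>t * x\<bar>" using G_dist[OF elim(1) s] by simp
  ultimately show ?case using elim by (simp add: abs_mult ac_simps)
 qed
 have fl: "filterlim (\<lambda>t. G (s + t * x)) (at (G s) within frontier \<Omega>) (at_right 0)"
  unfolding filterlim_at
 proof
  show "\<forall>\<^sub>F t in at_right 0. G (s + t * x) \<in> frontier \<Omega> \<and> G (s + t * x) \<noteq> G s"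
   using bnd by eventually_elim (use G_frontier in auto)
  have "((\<lambda>t. G (s + t * x) - G s) \<longlongrightarrow> 0) (at_right 0)"
  proof (rule Lim_null_comparison)
   show "\<forall>\<^sub>F t in at_right 0. norm (G (s + t * x) - G s) \<le> (1 + L) * \<bar>x\<bar> * t" using bnd by eventually_elim simp
   have "((\<lambda>t. (1 + L) * \<bar>x\<bar> * t) \<longlongrightarrow> (1 + L) * \<bar>x\<bar> * 0) (at_right 0)" by (intro tendsto_intros)
   then show "((\<lambda>t. (1 + L) * \<bar>x\<bar> * t) \<longlongrightarrow> 0) (at_right 0)" by simp
  qed
  then show "((\<lambda>t. G (s + t * x)) \<longlongrightarrow> G s) (at_right 0)" by (simp add: LIM_zero_iff)
 qed
 have q: "((\<lambda>t. ((G (s + t * x) - G s) \<bullet> n) / norm (G (s + t * x) - G s)) \<longlongrightarrow> 0) (at_right 0)"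
  using filterlim_compose[OF n[unfolded tangent_def] fl] .
 show ?thesis
 proof (rule Lim_null_comparison)
  have "((\<lambda>t. \<bar>((G (s + t * x) - G s) \<bullet> n) / norm (G (s + t * x) - G s)\<bar> * ((1 + L) * \<bar>x\<bar>)) \<longlongrightarrow> \<bar>0\<bar> * ((1 + L) * \<bar>x\<bar>)) (at_right 0)"
   by (intro tendsto_intros q)
  then show "((\<lambda>t. \<bar>((G (s + t * x) - G s) \<bullet> n) / norm (G (s + t * x) - G s)\<bar> * ((1 + L) * \<bar>x\<bar>)) \<longlongrightarrow> 0) (at_right 0)" by simp
  show "\<forall>\<^sub>F t in at_right 0. norm (((t * x) * (n \<bullet> e1) + (f (s + t * x) - f s) * (n \<bullet> e2)) / t)
   \<le> \<bar>((G (s + t * x) - G s) \<bullet> n) / norm (G (s + t * x) - G s)\<bar> * ((1 + L) * \<bar>x\<bar>)"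
   using bnd
  proof eventually_elim
   case (elim t)
   let ?v = "(G (s + t * x) - G s) \<bullet> n" and ?d = "norm (G (s + t * x) - G s)"
   have v: "(t * x) * (n \<bullet> e1) + (f (s + t * x) - f s) * (n \<bullet> e2) = ?v" by (subst G_inner) simp
   have d: "0 < ?d" using elim by simp
   have "\<bar>?v\<bar> = \<bar>?v / ?d\<bar> * ?d" using d by (simp add: abs_divide)
   also have "... \<le> \<bar>?v / ?d\<bar> * ((1 + L) * \<bar>x\<bar> * t)" using elim by (intro mult_left_mono) auto
   finally have "\<bar>?v\<bar> / t \<le> \<bar>?v / ?d\<bar> * ((1 + L) * \<bar>x\<bar>)" using elim by (simp add: pos_divide_le_eq mult.assoc)
   then show ?case unfolding v using elim by (simp add: abs_divide)
  qed
 qed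
qed simp

text \<open>Testing with \<open>x = 1\<close> excludes a horizontal \<open>n\<close>. Testing with
  \<open>x = n \<bullet> e1\<close> compares the graph with the point \<open>G s + t n\<close> above
  the same abscissa, and the side on which this point lies is decided by the sign of
  \<open>n \<bullet> e2\<close>.\<close>

lemma tangent_normal_component:
 assumes s: "\<bar>s\<bar> < r" and n: "tangent (G s) n" "norm n = 1"
 shows "n \<bullet> e2 \<noteq> 0" "(\<forall>\<^sub>F t in at_right 0. G s + t *\<^sub>R n \<notin> \<Omega>) \<longleftrightarrow> n \<bullet> e2 > 0"
proof -
 let ?a = "n \<bullet> e1" and ?b = "n \<bullet> e2"
 have nexp: "n = ?a *\<^sub>R e1 + ?b *\<^sub>R e2" by (rule orthonormal_expand[OF on])
 have nn: "?a\<^sup>2 + ?b\<^sup>2 = 1"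
  by (rule coord_norm) fact
 show b0: "?b \<noteq> 0"
 proof
  assume b: "?b = 0"
  have "((\<lambda>t. ((t * 1) * ?a + (f (s + t * 1) - f s) * ?b) / t) \<longlongrightarrow> 0) (at_right 0)"
   by (rule tangent_key[OF s n(1)])
  moreover have "\<forall>\<^sub>F t in at_right (0::real). ((t * 1) * ?a + (f (s + t * 1) - f s) * ?b) / t = ?a"
   using eventually_at_right_less[of 0] by eventually_elim (simp add: b)
  ultimately have "((\<lambda>t::real. ?a) \<longlongrightarrow> 0) (at_right (0::real))" using tendsto_cong by fastforce
  then have "?a = 0" by (simp add: tendsto_const_iff)
  then show False using nn b by simp
 qed
 have "((\<lambda>t. ((t * ?a) * ?a + (f (s + t * ?a) - f s) * ?b) / t) \<longlongrightarrow> 0) (at_right 0)"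
  by (rule tangent_key[OF s n(1)])
 then have ev: "\<forall>\<^sub>F t in at_right 0. ((t * ?a) * ?a + (f (s + t * ?a) - f s) * ?b) / t < ?b\<^sup>2"
  using b0 by (intro order_tendstoD(2)) auto
 have nearG: "\<forall>\<^sub>F t in at_right 0. \<bar>s + t * ?a\<bar> < r \<and> \<bar>f s + t * ?b\<bar> < h"
 proof (intro eventually_conj)
  have "((\<lambda>t. \<bar>s + t * ?a\<bar>) \<longlongrightarrow> \<bar>s + 0 * ?a\<bar>) (at_right 0)" "((\<lambda>t. \<bar>f s + t * ?b\<bar>) \<longlongrightarrow> \<bar>f s + 0 * ?b\<bar>) (at_right 0)"
   by (intro tendsto_intros)+
  then show "\<forall>\<^sub>F t in at_right 0. \<bar>s + t * ?a\<bar> < r" "\<forall>\<^sub>F t in at_right 0. \<bar>f s + t * ?b\<bar> < h"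
   using s f_less[OF s] by (auto intro!: order_tendstoD(2))
 qed
 have main: "\<forall>\<^sub>F t in at_right 0. (G s + t *\<^sub>R n \<notin> \<Omega>) \<longleftrightarrow> ?b > 0"
  using ev nearG eventually_at_right_less[of 0]
 proof eventually_elim
  case (elim t)
  let ?D = "f (s + t * ?a) - f s"
  have "(t * ?a) * ?a + ?D * ?b < t * ?b\<^sup>2" using elim by (simp add: pos_divide_less_eq mult.commute)
  moreover have "0 \<le> (t * ?a) * ?a" using elim(3) by (simp add: mult.assoc)
  ultimately have Db: "?D * ?b < (t * ?b) * ?b" by (simp add: power2_eq_square)
  have "G s + t *\<^sub>R n = G s + t *\<^sub>R (?a *\<^sub>R e1 + ?b *\<^sub>R e2)" using nexp by simp
  also have "... = p + (s + t * ?a) *\<^sub>R e1 + (f s + t * ?b) *\<^sub>R e2" by (simp add: G_def algebra_simps)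
  finally have "G s + t *\<^sub>R n \<in> \<Omega> \<longleftrightarrow> t * ?b \<le> ?D" using iff[of "s + t * ?a" "f s + t * ?b"] elim by auto
  moreover have "t * ?b \<le> ?D \<longleftrightarrow> \<not> ?b > 0"
  proof (cases "?b > 0")
   case True
   then have "?D < t * ?b" using Db by (simp add: mult_less_cancel_right)
   then show ?thesis using True by simp
  next
   case False
   then have "t * ?b < ?D" using Db b0 by (simp add: mult_less_cancel_right)
   then show ?thesis using False by simp
  qed
  ultimately show ?case by blast
 qed
 show "(\<forall>\<^sub>F t in at_right 0. G s + t *\<^sub>R n \<notin> \<Omega>) \<longleftrightarrow> ?b > 0"
 proof
  assume "\<forall>\<^sub>F t in at_right 0. G s + t *\<^sub>R n \<notin> \<Omega>"
  with main have "\<forall>\<^sub>F t::real in at_right 0. ?b > 0" by eventually_elim blast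
  then show "?b > 0" by simp
 next
  assume "?b > 0"
  then show "\<forall>\<^sub>F t in at_right 0. G s + t *\<^sub>R n \<notin> \<Omega>" using main by (auto elim: eventually_mono)
 qed
qed

text \<open>A tangent forces a one-sided derivative of \<open>f\<close>. That number alone
  determines the normal, which yields both its uniqueness and its measurability.\<close>

lemma slope_limit:
 assumes s: "\<bar>s\<bar> < r" and n: "tangent (G s) n" "norm n = 1"
 shows "((\<lambda>t. (f (s + t) - f s) / t) \<longlongrightarrow> - (n \<bullet> e1) / (n \<bullet> e2)) (at_right 0)"
proof -
 let ?a = "n \<bullet> e1" and ?b = "n \<bullet> e2"
 have b: "?b \<noteq> 0" by (rule tangent_normal_component(1)[OF s n])
 have "((\<lambda>t. (((t * 1) * ?a + (f (s + t * 1) - f s) * ?b) / t - ?a) / ?b) \<longlongrightarrow> (0 - ?a) / ?b) (at_right 0)"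
  by (intro tendsto_intros tangent_key[OF s n(1)] b)
 moreover have "\<forall>\<^sub>F t in at_right 0. (((t * 1) * ?a + (f (s + t * 1) - f s) * ?b) / t - ?a) / ?b = (f (s + t) - f s) / t"
  using eventually_at_right_less[of 0] by eventually_elim (use b in \<open>simp add: field_simps\<close>)
 ultimately show ?thesis using tendsto_cong by fastforce
qed

lemma normal_from_slope:
 assumes s: "\<bar>s\<bar> < r" and n: "is_unit_normal \<Omega> (G s) n"
  and lim: "((\<lambda>t. (f (s + t) - f s) / t) \<longlongrightarrow> \<sigma>) (at_right 0)"
 shows "n = (e2 - \<sigma> *\<^sub>R e1) /\<^sub>R sqrt (1 + \<sigma>^2)"
proof -
 let ?a = "n \<bullet> e1" and ?b = "n \<bullet> e2"
 have n1: "norm n = 1" "tangent (G s) n" and ev: "\<forall>\<^sub>F t in at_right 0. G s + t *\<^sub>R n \<notin> \<Omega>"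
  using n by (auto simp: is_unit_normal_iff)
 have b: "?b > 0" using tangent_normal_component(2)[OF s n1(2,1)] ev by blast
 have sl: "- ?a / ?b = \<sigma>"
  using tendsto_unique[OF _ slope_limit[OF s n1(2,1)] lim] by simp
 have nexp: "n = ?a *\<^sub>R e1 + ?b *\<^sub>R e2" by (rule orthonormal_expand[OF on])
 have nn: "?a\<^sup>2 + ?b\<^sup>2 = 1"
  by (rule coord_norm) fact
 have a: "?a = - (\<sigma> * ?b)" using sl b by (auto simp: field_simps)
 have "?b\<^sup>2 * (1 + \<sigma>^2) = 1" using nn unfolding a by (simp add: power_mult_distrib algebra_simps)
 then have "sqrt (?b\<^sup>2 * (1 + \<sigma>^2)) = 1" by simp
 then have "?b * sqrt (1 + \<sigma>^2) = 1" using b by (simp add: real_sqrt_mult)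
 then have "?b = inverse (sqrt (1 + \<sigma>^2))" by (metis inverse_unique mult.commute)
 moreover have "n = ?b *\<^sub>R (e2 - \<sigma> *\<^sub>R e1)" using nexp a by (simp add: algebra_simps)
 ultimately show ?thesis by simp
qed

lemma unit_normal_unique:
 assumes s: "\<bar>s\<bar> < r" and n: "is_unit_normal \<Omega> (G s) n"
 shows "unit_normal \<Omega> (G s) = n"
proof -
 have t: "norm n = 1" "tangent (G s) n" using n by (auto simp: is_unit_normal_iff)
 note lim = slope_limit[OF s t(2,1)]
 have u: "n' = n" if "is_unit_normal \<Omega> (G s) n'" for n'
  using normal_from_slope[OF s n lim] normal_from_slope[OF s that lim] by simp
 show ?thesis unfolding unit_normal_def by (rule the_equality[of "is_unit_normal \<Omega> (G s)", OF n u])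
qed

lemma tangent_imp_normal:
 assumes s: "\<bar>s\<bar> < r" and n: "tangent (G s) n" "norm n = 1"
 shows "\<exists>n. is_unit_normal \<Omega> (G s) n"
proof (cases "n \<bullet> e2 > 0")
 case True
 then show ?thesis using tangent_normal_component(2)[OF s n] n by (auto simp: is_unit_normal_iff)
next
 case False
 have t: "tangent (G s) (- n)" using n(1) tendsto_minus[of _ 0] unfolding tangent_def by fastforce
 have "- n \<bullet> e2 > 0" using False tangent_normal_component(1)[OF s n] by simp
 moreover have n': "norm (- n) = 1" using n(2) by simp
 ultimately have "is_unit_normal \<Omega> (G s) (- n)"
  unfolding is_unit_normal_iff using tangent_normal_component(2)[OF s t n'] t n' by blast
 then show ?thesis by blast
qed

end

section \<open>Finite covers by charts; boundedness and measurability of the unit normal\<close>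

lemma lipschitz_boundary_chart:
 assumes "compact \<Omega>" "lipschitz_boundary \<Omega>" "p \<in> frontier \<Omega>"
 shows "\<exists>e1 e2 r h L f. lipschitz_chart \<Omega> p e1 e2 r h L f"
proof -
 obtain e1 e2 r h L f where c: "norm e1 = 1 \<and> norm e2 = 1 \<and> e1 \<bullet> e2 = 0 \<and> 0 < r \<and> 0 < h \<and>
    L-lipschitz_on {-r<..<r} f \<and> (\<forall>s. \<bar>s\<bar> < r --> \<bar>f s\<bar> < h) \<and>
    (\<forall>s t. \<bar>s\<bar> < r \<and> \<bar>t\<bar> < h --> (p + s *\<^sub>R e1 + t *\<^sub>R e2 \<in> \<Omega> \<longleftrightarrow> t \<le> f s))"
  using assms(2,3) unfolding lipschitz_boundary_def by meson
 have "lipschitz_chart \<Omega> p e1 e2 r h L f"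
  by unfold_locales (use c assms(1) compact_imp_closed in auto)
 then show ?thesis by blast
qed

text \<open>Hides the chart data in a property of the open box, so that compactness delivers a
  finite set of boxes.\<close>

definition chart_box :: "(real ^ 2) set => (real ^ 2) set => bool" where
 "chart_box \<Omega> U \<longleftrightarrow> (\<exists>p e1 e2 r h L f. lipschitz_chart \<Omega> p e1 e2 r h L f \<and> U = lipschitz_chart.small_box p e1 e2 r h)"

lemma chart_boxE:
 assumes "chart_box \<Omega> U"
 obtains p e1 e2 r h L f where "lipschitz_chart \<Omega> p e1 e2 r h L f" "U = lipschitz_chart.small_box p e1 e2 r h"
 using assms unfolding chart_box_def by blast

lemma chart_box_finite:
 assumes "chart_box \<Omega> U"
 shows "open U" "hausdorff1 (frontier \<Omega> \<inter> U) < top"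
proof -
 obtain p e1 e2 r h L f where c: "lipschitz_chart \<Omega> p e1 e2 r h L f" and U: "U = lipschitz_chart.small_box p e1 e2 r h"
  using assms by (rule chart_boxE)
 show "open U" "hausdorff1 (frontier \<Omega> \<inter> U) < top" unfolding U
  by (rule lipschitz_chart.small_box(1)[OF c]) (rule lipschitz_chart.small_box_finite[OF c])
qed

lemma frontier_cover:
 assumes "compact \<Omega>" "lipschitz_boundary \<Omega>"
 obtains \<T> where "finite \<T>" "frontier \<Omega> \<subseteq> \<Union>\<T>" "\<And>U. U \<in> \<T> ==> chart_box \<Omega> U"
proof -
 have comp: "compact (frontier \<Omega>)" using assms(1) by (rule compact_frontier)
 have cov: "frontier \<Omega> \<subseteq> \<Union>{U. chart_box \<Omega> U}"
 proof
  fix p assume "p \<in> frontier \<Omega>"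
  then obtain e1 e2 r h L f where c: "lipschitz_chart \<Omega> p e1 e2 r h L f"
   using lipschitz_boundary_chart[OF assms] by blast
  have "p \<in> lipschitz_chart.small_box p e1 e2 r h" by (rule lipschitz_chart.small_box(2)[OF c])
  moreover have "chart_box \<Omega> (lipschitz_chart.small_box p e1 e2 r h)"
   unfolding chart_box_def using c by (intro exI conjI) (rule c, rule refl)
  ultimately show "p \<in> \<Union>{U. chart_box \<Omega> U}" by (intro UnionI CollectI)
 qed
 have op: "open U" if "U \<in> {U. chart_box \<Omega> U}" for U
  by (rule chart_box_finite(1)[OF CollectD[OF that]])
 obtain \<T> where T: "\<T> \<subseteq> {U. chart_box \<Omega> U}" "finite \<T>" "frontier \<Omega> \<subseteq> \<Union>\<T>"
  by (rule compactE[OF comp cov op])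
 show thesis by (rule that[OF T(2,3)]) (rule CollectD[OF subsetD[OF T(1)]])
qed

lemma surface_finite:
 assumes "compact \<Omega>" "lipschitz_boundary \<Omega>"
 shows "hausdorff1 (frontier \<Omega>) < top"
proof -
 obtain \<T> where T: "finite \<T>" "frontier \<Omega> \<subseteq> \<Union>\<T>" "\<And>U. U \<in> \<T> ==> chart_box \<Omega> U"
  using frontier_cover[OF assms] by blast
 have "finite \<S> ==> \<S> \<subseteq> \<T> ==> hausdorff1 (frontier \<Omega> \<inter> \<Union>\<S>) < top" for \<S>
 proof (induction \<S> rule: finite_induct)
  case (insert U \<S>)
  have "hausdorff1 (frontier \<Omega> \<inter> \<Union>(insert U \<S>)) \<le> hausdorff1 (frontier \<Omega> \<inter> U) + hausdorff1 (frontier \<Omega> \<inter> \<Union>\<S>)"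
   using hausdorff1_Un[of "frontier \<Omega> \<inter> U" "frontier \<Omega> \<inter> \<Union>\<S>"] by (simp add: Int_Un_distrib)
  also have "... < top" using chart_box_finite(2)[OF T(3), of U] insert by simp
  finally show ?case .
 qed simp
 from this[OF T(1) order_refl] show ?thesis using T(2) by (simp add: Int_absorb2)
qed

text \<open>Having a tangent amounts to countably many closed conditions, so it is a Borel property.\<close>

definition has_tangent :: "'a::euclidean_space set => 'a => bool" where
 "has_tangent \<Gamma> y \<longleftrightarrow> (\<exists>n. norm n = 1 \<and> ((\<lambda>z. ((z - y) \<bullet> n) / norm (z - y)) \<longlongrightarrow> 0) (at y within \<Gamma>))"

lemma has_tangent_borel:
 fixes \<Gamma> :: "'a::euclidean_space set"
 assumes \<Gamma>: "closed \<Gamma>"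
 shows "{y \<in> \<Gamma>. has_tangent \<Gamma> y} \<in> sets borel"
proof -
 \<comment> \<open>The closed conditions: \<open>q\<close> is normal to the set up to the error
   \<open>1 / (i + 1)\<close> at scale \<open>1 / (k + 1)\<close>.\<close>
 define C where "C i q k = {y \<in> \<Gamma>. \<forall>z\<in>\<Gamma>. dist z y < 1 / real (Suc k) --> \<bar>(z - y) \<bullet> q\<bar> \<le> 1 / real (Suc i) * norm (z - y)}" for i k :: nat and q :: 'a
 have clC: "closed (C i q k)" for i q k
  unfolding closed_sequential_limits
 proof (intro allI impI)
  fix Y y assume Y: "(\<forall>n. Y n \<in> C i q k) \<and> Y \<longlonglongrightarrow> y"
  then have lim: "Y \<longlonglongrightarrow> y" and YC: "\<And>n. Y n \<in> C i q k" by auto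
  have "y \<in> \<Gamma>" using closed_sequentially[OF \<Gamma> _ lim] YC by (auto simp: C_def)
  moreover have "\<bar>(z - y) \<bullet> q\<bar> \<le> 1 / real (Suc i) * norm (z - y)" if z: "z \<in> \<Gamma>" "dist z y < 1 / real (Suc k)" for z
  proof (rule tendsto_le[of sequentially])
   show "(\<lambda>n. 1 / real (Suc i) * norm (z - Y n)) \<longlonglongrightarrow> 1 / real (Suc i) * norm (z - y)"
    "(\<lambda>n. \<bar>(z - Y n) \<bullet> q\<bar>) \<longlonglongrightarrow> \<bar>(z - y) \<bullet> q\<bar>" by (intro tendsto_intros lim)+
   have "(\<lambda>n. dist z (Y n)) \<longlonglongrightarrow> dist z y" by (intro tendsto_intros lim)
   then have "\<forall>\<^sub>F n in sequentially. dist z (Y n) < 1 / real (Suc k)" using z(2) by (rule order_tendstoD)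
   then show "\<forall>\<^sub>F n in sequentially. \<bar>(z - Y n) \<bullet> q\<bar> \<le> 1 / real (Suc i) * norm (z - Y n)"
    by eventually_elim (use YC z(1) in \<open>auto simp: C_def\<close>)
  qed simp
  ultimately show "y \<in> C i q k" by (simp add: C_def)
 qed
 obtain Q :: "'a set" where Q: "countable Q" "Q \<subseteq> sphere 0 1" "sphere 0 1 \<subseteq> closure Q"
  using separable[of "sphere 0 1 :: 'a set"] by blast
 have "{y \<in> \<Gamma>. has_tangent \<Gamma> y} = (\<Inter>i. \<Union>q\<in>Q. \<Union>k. C i q k)"
 proof (intro antisym subsetI)
  fix y assume "y \<in> {y \<in> \<Gamma>. has_tangent \<Gamma> y}"
  then obtain n where y: "y \<in> \<Gamma>" and n: "norm n = 1" "((\<lambda>z. ((z - y) \<bullet> n) / norm (z - y)) \<longlongrightarrow> 0) (at y within \<Gamma>)"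
   by (auto simp: has_tangent_def)
  show "y \<in> (\<Inter>i. \<Union>q\<in>Q. \<Union>k. C i q k)"
  proof
   fix i :: nat
   define e where "e = 1 / real (Suc i) / 2"
   have e: "e > 0" by (simp add: e_def)
   have "n \<in> closure Q" using Q(3) n(1) by auto
   then obtain q where q: "q \<in> Q" "dist q n < e" using e by (auto simp: closure_approachable)
   from n(2) e obtain d where d: "d > 0" "\<And>z. z \<in> \<Gamma> ==> 0 < dist z y ==> dist z y < d ==> dist (((z - y) \<bullet> n) / norm (z - y)) 0 < e"
    unfolding Lim_within by blast
   obtain k :: nat where k: "1 / real (Suc k) < d" using reals_Archimedean[OF d(1)] by (auto simp: inverse_eq_divide)
   have "\<bar>(z - y) \<bullet> q\<bar> \<le> 1 / real (Suc i) * norm (z - y)" if z: "z \<in> \<Gamma>" "dist z y < 1 / real (Suc k)" for z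
   proof (cases "z = y")
    case False
    have "\<bar>((z - y) \<bullet> n) / norm (z - y)\<bar> < e" using d(2)[OF z(1)] False z(2) k by (simp add: dist_real_def)
    then have 1: "\<bar>(z - y) \<bullet> n\<bar> \<le> e * norm (z - y)" using False by (simp add: abs_divide pos_divide_less_eq less_imp_le)
    have "\<bar>(z - y) \<bullet> (q - n)\<bar> \<le> norm (z - y) * norm (q - n)" by (rule Cauchy_Schwarz_ineq2)
    also have "... \<le> norm (z - y) * e" using q(2) by (intro mult_left_mono) (auto simp: dist_norm)
    finally have "\<bar>(z - y) \<bullet> q - (z - y) \<bullet> n\<bar> \<le> e * norm (z - y)" by (simp add: inner_diff_right mult.commute)
    then have "\<bar>(z - y) \<bullet> q\<bar> \<le> e * norm (z - y) + e * norm (z - y)" using 1 by linarith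
    also have "... = (e + e) * norm (z - y)" by (simp add: distrib_right)
    also have "e + e = 1 / real (Suc i)" unfolding e_def by (rule field_sum_of_halves)
    finally show ?thesis .
   qed simp
   then have "y \<in> C i q k" using y by (simp add: C_def)
   then show "y \<in> (\<Union>q\<in>Q. \<Union>k. C i q k)" using q(1) by blast
  qed
 next
  \<comment> \<open>The directions \<open>q i\<close> vary with \<open>i\<close>; a limit point of
    them on the compact unit sphere is an exact normal.\<close>
  fix y assume y: "y \<in> (\<Inter>i. \<Union>q\<in>Q. \<Union>k. C i q k)"
  then have "\<forall>i. \<exists>q k. q \<in> Q \<and> y \<in> C i q k" by blast
  then obtain q k where qk: "\<And>i. q i \<in> Q" "\<And>i. y \<in> C i (q i) (k i)" by metis
  have "compact (sphere 0 1 :: 'a set)" by simp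
  moreover have "\<forall>i. q i \<in> sphere 0 1" using qk(1) Q(2) by blast
  ultimately obtain n r where n: "n \<in> sphere 0 1" "strict_mono (r :: nat => nat)" "(q \<circ> r) \<longlonglongrightarrow> n"
   unfolding compact_def by blast
  have "((\<lambda>z. ((z - y) \<bullet> n) / norm (z - y)) \<longlongrightarrow> 0) (at y within \<Gamma>)"
   unfolding Lim_within
  proof (intro allI impI)
   fix e :: real assume e: "0 < e"
   have "\<forall>\<^sub>F i in sequentially. dist ((q \<circ> r) i) n < e / 2" by (rule tendstoD[OF n(3)]) (use e in simp)
   moreover have "\<forall>\<^sub>F i in sequentially. 1 / real (Suc i) < e / 2"
    using order_tendstoD(2)[OF LIMSEQ_Suc[OF lim_1_over_n[where 'a = real]], of "e / 2"] e by simp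
   ultimately have "\<exists>i. dist ((q \<circ> r) i) n < e / 2 \<and> 1 / real (Suc i) < e / 2"
    by (rule eventually_happens'[OF sequentially_bot eventually_conj])
   then obtain i where i: "dist (q (r i)) n < e / 2" "1 / real (Suc i) < e / 2" by auto
   have "i \<le> r i" using n(2) by (rule seq_suble)
   then have "1 / real (Suc (r i)) \<le> 1 / real (Suc i)" by (intro divide_left_mono) auto
   then have ri: "1 / real (Suc (r i)) < e / 2" using i(2) by linarith
   have "dist (((z - y) \<bullet> n) / norm (z - y)) 0 < e" if z: "z \<in> \<Gamma>" "0 < dist z y" "dist z y < 1 / real (Suc (k (r i)))" for z
   proof -
    have "\<bar>(z - y) \<bullet> q (r i)\<bar> \<le> 1 / real (Suc (r i)) * norm (z - y)" using qk(2)[of "r i"] z by (simp add: C_def)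
    also have "... \<le> e / 2 * norm (z - y)" using ri by (intro mult_right_mono) auto
    finally have 1: "\<bar>(z - y) \<bullet> q (r i)\<bar> \<le> e / 2 * norm (z - y)" .
    have "\<bar>(z - y) \<bullet> (q (r i) - n)\<bar> \<le> norm (z - y) * norm (q (r i) - n)" by (rule Cauchy_Schwarz_ineq2)
    also have "... < norm (z - y) * (e / 2)" using i(1) z(2) by (intro mult_strict_left_mono) (auto simp: dist_norm)
    finally have "\<bar>(z - y) \<bullet> q (r i) - (z - y) \<bullet> n\<bar> < e / 2 * norm (z - y)" by (simp add: inner_diff_right mult.commute)
    then have "\<bar>(z - y) \<bullet> n\<bar> < e / 2 * norm (z - y) + e / 2 * norm (z - y)" using 1 by linarith
    then have "\<bar>(z - y) \<bullet> n\<bar> < e * norm (z - y)" by (simp add: field_simps)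
    then show ?thesis using z(2) by (simp add: dist_real_def abs_divide pos_divide_less_eq dist_norm)
   qed
   then show "\<exists>d>0. \<forall>z\<in>\<Gamma>. 0 < dist z y \<and> dist z y < d --> dist (((z - y) \<bullet> n) / norm (z - y)) 0 < e"
    by (intro exI[of _ "1 / real (Suc (k (r i)))"]) auto
  qed
  moreover have "y \<in> \<Gamma>" using qk(2)[of 0] by (simp add: C_def)
  ultimately show "y \<in> {y \<in> \<Gamma>. has_tangent \<Gamma> y}" using n(1) by (auto simp: has_tangent_def)
 qed
 moreover have "(\<Inter>i. \<Union>q\<in>Q. \<Union>k. C i q k) \<in> sets borel"
 proof -
  have "(\<Union>k. C i q k) \<in> sets borel" for i q
   by (rule sets.countable_UN) (use borel_closed[OF clC] in blast)
  note 1 = this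
  have "(\<Union>q\<in>Q. \<Union>k. C i q k) \<in> sets borel" for i
   by (rule sets.countable_UN'[OF Q(1)]) (use 1 in blast)
  then show ?thesis by (intro sets.countable_INT) auto
 qed
 ultimately show ?thesis by simp
qed

text \<open>The common value of \<open>unit_normal\<close> at boundary points without a normal:
  there the defining predicate is equal to \<open>\<lambda>n. False\<close>. As it is one fixed
  vector, \<open>unit_normal\<close> stays bounded and measurable.\<close>

definition junk_normal :: "real ^ 2" where "junk_normal = (THE n. False)"

context lipschitz_chart
begin

lemma has_tangent_iff: "has_tangent (frontier \<Omega>) y \<longleftrightarrow> (\<exists>n. norm n = 1 \<and> tangent y n)"
 by (simp add: has_tangent_def tangent_def)

lemma unit_normal_cases:
 assumes s: "\<bar>s\<bar> < r"
 shows "has_tangent (frontier \<Omega>) (G s) ==> is_unit_normal \<Omega> (G s) (unit_normal \<Omega> (G s))"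
  and "\<not> has_tangent (frontier \<Omega>) (G s) ==> unit_normal \<Omega> (G s) = junk_normal"
proof -
 assume "has_tangent (frontier \<Omega>) (G s)"
 then obtain n where "is_unit_normal \<Omega> (G s) n"
  using tangent_imp_normal[OF s] unfolding has_tangent_iff by blast
 then show "is_unit_normal \<Omega> (G s) (unit_normal \<Omega> (G s))" using unit_normal_unique[OF s] by simp
next
 assume "\<not> has_tangent (frontier \<Omega>) (G s)"
 then have "is_unit_normal \<Omega> (G s) = (\<lambda>n. False)"
  unfolding has_tangent_iff is_unit_normal_iff fun_eq_iff by blast
 then show "unit_normal \<Omega> (G s) = junk_normal" by (simp add: unit_normal_def junk_normal_def)
qed

text \<open>Where a tangent exists the normal is a continuous function of the one-sided slope of
  \<open>f\<close>, which is a limit of difference quotients; elsewhere it is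
  \<open>junk_normal\<close>. The two cases are glued along a Borel set before the limit is
  taken.\<close>

lemma unit_normal_on_chart:
 obtains g where "g \<in> borel_measurable borel" "\<And>y. y \<in> frontier \<Omega> \<inter> small_box ==> unit_normal \<Omega> y = g y"
proof -
 define t where "t j = (r / 2) / real (Suc j)" for j
 have t: "0 < t j" "t j \<le> r / 2" for j using rh by (auto simp: t_def divide_le_eq)
 have t0: "t \<longlonglongrightarrow> 0"
  using tendsto_mult[OF tendsto_const[of "r / 2"] LIMSEQ_Suc[OF lim_1_over_n[where 'a = real]]]
  by (simp add: t_def [abs_def])
 have fl: "filterlim t (at_right 0) sequentially"
  using t0 t(1) by (auto simp: filterlim_at intro!: always_eventually) (metis less_irrefl)
 define \<sigma> where "\<sigma> j y = (f ((y - p) \<bullet> e1 + t j) - f ((y - p) \<bullet> e1)) / t j" for j y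
 define \<nu> where "\<nu> x = (e2 - x *\<^sub>R e1) /\<^sub>R sqrt (1 + x^2)" for x :: real
 define A where "A = {y \<in> frontier \<Omega>. has_tangent (frontier \<Omega>) y}"
 have A: "A \<in> sets borel" unfolding A_def by (rule has_tangent_borel) (rule frontier_closed)
 have nz: "sqrt (1 + x^2) \<noteq> 0" for x :: real
 proof -
  have "0 < 1 + x^2" by (simp add: add_pos_nonneg)
  then show ?thesis by simp
 qed
 have c\<sigma>: "continuous_on small_box (\<lambda>y. \<sigma> j y)" for j
 proof -
  have in1: "(\<lambda>y. (y - p) \<bullet> e1 + t j) ` small_box \<subseteq> {-r<..<r}" "(\<lambda>y. (y - p) \<bullet> e1) ` small_box \<subseteq> {-r<..<r}"
   using t[of j] rh by (auto simp: small_box_def abs_less_iff)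
  have "continuous_on small_box (\<lambda>y. f ((y - p) \<bullet> e1 + t j))" "continuous_on small_box (\<lambda>y. f ((y - p) \<bullet> e1))"
   by (rule continuous_on_compose2[OF cont_f _ in1(1)], intro continuous_intros)
    (rule continuous_on_compose2[OF cont_f _ in1(2)], intro continuous_intros)
  then show ?thesis unfolding \<sigma>_def using t(1)[of j] by (intro continuous_intros) auto
 qed
 have c\<nu>: "continuous_on small_box (\<lambda>y. \<nu> (\<sigma> j y))" for j
  unfolding \<nu>_def using nz by (intro continuous_intros c\<sigma> ballI) auto
 define gj where "gj j y = indicator A y *\<^sub>R (indicator small_box y *\<^sub>R \<nu> (\<sigma> j y)) + indicator (- A) y *\<^sub>R junk_normal" for j y
 have m1: "(\<lambda>y. indicator small_box y *\<^sub>R \<nu> (\<sigma> j y)) \<in> borel_measurable borel" for j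
  by (rule borel_measurable_continuous_on_indicator[OF borel_open[OF small_box(1)] c\<nu>])
 have m2: "indicator A \<in> borel_measurable (borel :: (real ^ 2) measure)" "indicator (- A) \<in> borel_measurable (borel :: (real ^ 2) measure)"
  using A by (auto intro!: borel_measurable_indicator)
 have gm: "gj j \<in> borel_measurable borel" for j
  unfolding gj_def [abs_def] by (intro borel_measurable_add borel_measurable_scaleR m1 m2 borel_measurable_const)
 have "(\<lambda>y. lim (\<lambda>j. gj j y)) \<in> borel_measurable borel"
  by (rule borel_measurable_lim_metric) (rule gm)
 moreover have "unit_normal \<Omega> y = lim (\<lambda>j. gj j y)" if y: "y \<in> frontier \<Omega> \<inter> small_box" for y
 proof -
  define s where "s = (y - p) \<bullet> e1"
  have ys: "y = G s" using frontier_graph(2)[of y] y small_box(3) unfolding s_def by blast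
  have s: "\<bar>s\<bar> < r" using y rh unfolding s_def small_box_def by auto
  have "(\<lambda>j. gj j y) \<longlonglongrightarrow> unit_normal \<Omega> y"
  proof (cases "y \<in> A")
   case True
   then have n: "is_unit_normal \<Omega> (G s) (unit_normal \<Omega> (G s))"
    unfolding A_def ys using unit_normal_cases(1)[OF s] by blast
   let ?n = "unit_normal \<Omega> (G s)"
   let ?x = "- (?n \<bullet> e1) / (?n \<bullet> e2)"
   have tn: "tangent (G s) ?n" "norm ?n = 1" using n by (auto simp: is_unit_normal_iff)
   note lim = slope_limit[OF s tn]
   have "(\<lambda>j. \<sigma> j y) \<longlonglongrightarrow> ?x"
    unfolding \<sigma>_def s_def[symmetric] by (rule filterlim_compose[OF lim fl])
   then have "(\<lambda>j. \<nu> (\<sigma> j y)) \<longlonglongrightarrow> \<nu> ?x"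
    unfolding \<nu>_def by (intro tendsto_intros nz)
   moreover have "\<nu> ?x = ?n" unfolding \<nu>_def by (rule normal_from_slope[OF s n lim, symmetric])
   moreover have "gj j y = \<nu> (\<sigma> j y)" for j using True y by (simp add: gj_def)
   ultimately show ?thesis by (simp add: ys)
  next
   case False
   then have "unit_normal \<Omega> y = junk_normal"
    using unit_normal_cases(2)[OF s] y unfolding A_def ys by blast
   then show ?thesis using False by (simp add: gj_def)
  qed
  then show ?thesis by (rule limI[symmetric])
 qed
 ultimately show thesis using that by blast
qed

end

lemma unit_normal_on_frontier:
 assumes \<Omega>: "compact \<Omega>" "lipschitz_boundary \<Omega>"
 shows "\<exists>g \<in> borel_measurable borel. \<forall>y\<in>frontier \<Omega>. unit_normal \<Omega> y = g y"
  and "y \<in> frontier \<Omega> ==> norm (unit_normal \<Omega> y) \<le> max 1 (norm junk_normal)"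
  and "y \<in> frontier \<Omega> ==> is_unit_normal \<Omega> y n ==> unit_normal \<Omega> y = n"
proof -
 obtain \<T> where T: "finite \<T>" "frontier \<Omega> \<subseteq> \<Union>\<T>" "\<And>U. U \<in> \<T> ==> chart_box \<Omega> U"
  using frontier_cover[OF \<Omega>] by blast
 have loc: "open U \<and> (\<exists>g \<in> borel_measurable borel. \<forall>y\<in>frontier \<Omega> \<inter> U. unit_normal \<Omega> y = g y)" if UT: "U \<in> \<T>" for U
 proof -
  obtain p e1 e2 r h L f where c: "lipschitz_chart \<Omega> p e1 e2 r h L f" and U: "U = lipschitz_chart.small_box p e1 e2 r h"
   using T(3)[OF UT] by (rule chart_boxE)
  obtain g where g: "g \<in> borel_measurable borel" "\<And>y. y \<in> frontier \<Omega> \<inter> lipschitz_chart.small_box p e1 e2 r h ==> unit_normal \<Omega> y = g y"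
   using lipschitz_chart.unit_normal_on_chart[OF c] by blast
  show ?thesis unfolding U
   by (intro conjI lipschitz_chart.small_box(1)[OF c] bexI[OF _ g(1)] ballI g(2))
 qed
 have "\<exists>g \<in> borel_measurable borel. \<forall>y\<in>frontier \<Omega> \<inter> \<Union>\<S>. unit_normal \<Omega> y = g y" if "finite \<S>" "\<S> \<subseteq> \<T>" for \<S>
  using that
 proof (induction \<S> rule: finite_induct)
  case empty
  show ?case by (rule bexI[of _ "\<lambda>_. 0"]) simp_all
 next
  case (insert U \<S>)
  then obtain g where g: "g \<in> borel_measurable borel" "\<And>y. y \<in> frontier \<Omega> \<inter> \<Union>\<S> ==> unit_normal \<Omega> y = g y" by auto
  obtain g' where g': "g' \<in> borel_measurable borel" "\<And>y. y \<in> frontier \<Omega> \<inter> U ==> unit_normal \<Omega> y = g' y"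
   and U: "open U" using loc[of U] insert by auto
  have "(\<lambda>y. if y \<in> U then g' y else g y) \<in> borel_measurable borel"
   by (rule measurable_If_set[OF g'(1) g(1)]) (use U in simp)
  then show ?case using g(2) g'(2) by (intro bexI[of _ "\<lambda>y. if y \<in> U then g' y else g y"]) auto
 qed
 from this[OF T(1) order_refl] show "\<exists>g \<in> borel_measurable borel. \<forall>y\<in>frontier \<Omega>. unit_normal \<Omega> y = g y"
  using T(2) by (metis Int_absorb2)
 assume y: "y \<in> frontier \<Omega>"
 then obtain U where U: "U \<in> \<T>" "y \<in> U" using T(2) by blast
 obtain p e1 e2 r h L f where c: "lipschitz_chart \<Omega> p e1 e2 r h L f" and U': "U = lipschitz_chart.small_box p e1 e2 r h"
  using T(3)[OF U(1)] by (rule chart_boxE)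
 interpret lipschitz_chart \<Omega> p e1 e2 r h L f by (rule c)
 define s where "s = (y - p) \<bullet> e1"
 have ys: "y = G s" using frontier_graph(2)[of y] y U U' small_box(3) unfolding s_def by blast
 have s: "\<bar>s\<bar> < r" using U U' rh unfolding s_def small_box_def by auto
 show "norm (unit_normal \<Omega> y) \<le> max 1 (norm junk_normal)"
  unfolding ys using unit_normal_cases[OF s] by (cases "has_tangent (frontier \<Omega>) (G s)") (auto simp: is_unit_normal_def)
 show "unit_normal \<Omega> y = n" if "is_unit_normal \<Omega> y n" using unit_normal_unique[OF s] that unfolding ys by blast
qed

section \<open>Pairings and operator norms\<close>

text \<open>The pairing is bilinear, without conjugation, because the argument uses the transpose of
  the operator and not its Hilbert space adjoint.\<close>

lemma L2_pairing:
 assumes u: "u \<in> L2 M" and v: "v \<in> L2 M"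
 shows "integrable M (\<lambda>x. u x * v x)" "cmod (LINT x|M. u x * v x) \<le> L2_norm M u * L2_norm M v"
proof -
 have um [measurable]: "u \<in> borel_measurable M" "v \<in> borel_measurable M"
  and ui: "integrable M (\<lambda>x. (cmod (u x))\<^sup>2)" "integrable M (\<lambda>x. (cmod (v x))\<^sup>2)"
  using u v by (auto simp: L2_def)
 have "integrable M (\<lambda>x. (cmod (u x))\<^sup>2 + (cmod (v x))^2)" using ui by (rule Bochner_Integration.integrable_add)
 then show i: "integrable M (\<lambda>x. u x * v x)"
 proof (rule Bochner_Integration.integrable_bound)
  show "AE x in M. norm (u x * v x) \<le> norm ((cmod (u x))^2 + (cmod (v x))^2)"
  proof (rule AE_I2)
   fix x
   have "0 \<le> (cmod (u x) - cmod (v x))^2" by simp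
   then have "2 * (cmod (u x) * cmod (v x)) \<le> (cmod (u x))^2 + (cmod (v x))^2" by (simp add: power2_diff)
   moreover have "0 \<le> cmod (u x) * cmod (v x)" by simp
   ultimately have "cmod (u x) * cmod (v x) \<le> (cmod (u x))^2 + (cmod (v x))^2" by linarith
   then show "norm (u x * v x) \<le> norm ((cmod (u x))^2 + (cmod (v x))^2)" by (simp add: norm_mult)
  qed
 qed measurable
 define P where "P = (LINT x|M. cmod (u x) * cmod (v x))"
 have iP: "integrable M (\<lambda>x. cmod (u x) * cmod (v x))" using integrable_norm[OF i] by (simp add: norm_mult)
 have P0: "0 \<le> P" unfolding P_def by (rule integral_nonneg_AE) simp
 have ennP: "(\<integral>\<^sup>+x. ennreal (cmod (u x)) * ennreal (cmod (v x)) \<partial>M) = ennreal P"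
  unfolding P_def by (simp add: ennreal_mult[symmetric] nn_integral_eq_integral[OF iP])
 have sq: "(\<integral>\<^sup>+x. ennreal (cmod (f x)) ^ 2 \<partial>M) = ennreal ((L2_norm M f)^2)" if "integrable M (\<lambda>x. (cmod (f x))\<^sup>2)" for f
  by (simp add: ennreal_power nn_integral_eq_integral[OF that] L2_norm_def integral_nonneg_AE)
 have "(ennreal P)^2 \<le> ennreal ((L2_norm M u)^2) * ennreal ((L2_norm M v)^2)"
  using Cauchy_Schwarz_nn_integral[of "\<lambda>x. ennreal (cmod (u x))" M "\<lambda>x. ennreal (cmod (v x))"]
  unfolding ennP sq[OF ui(1)] sq[OF ui(2)] by simp
 then have "ennreal (P^2) \<le> ennreal ((L2_norm M u * L2_norm M v)^2)"
  using P0 by (simp add: ennreal_power ennreal_mult[symmetric] power_mult_distrib)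
 then have "P^2 \<le> (L2_norm M u * L2_norm M v)^2" by (subst (asm) ennreal_le_iff) simp_all
 moreover have "0 \<le> L2_norm M u * L2_norm M v" by (simp add: L2_norm_def integral_nonneg_AE)
 ultimately have "P \<le> L2_norm M u * L2_norm M v" by (rule power2_le_imp_le)
 moreover have "cmod (LINT x|M. u x * v x) \<le> P"
  unfolding P_def using integral_norm_bound[of M "\<lambda>x. u x * v x"] by (simp add: norm_mult)
 ultimately show "cmod (LINT x|M. u x * v x) \<le> L2_norm M u * L2_norm M v" by linarith
qed

lemma L2_norm_nonneg: "0 \<le> L2_norm M f"
 by (simp add: L2_norm_def integral_nonneg_AE)

lemma (in finite_measure) L2_bounded:
 assumes "f \<in> borel_measurable M" "\<And>x. x \<in> space M ==> cmod (f x) \<le> B"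
 shows "f \<in> L2 M"
proof -
 have "integrable M (\<lambda>x. (cmod (f x))\<^sup>2)"
 proof (rule integrable_const_bound)
  show "AE x in M. norm ((cmod (f x))^2) \<le> B^2"
   using assms(2) by (intro AE_I2) (simp add: power_mono)
 qed (use assms(1) in measurable)
 then show ?thesis using assms(1) by (simp add: L2_def)
qed

lemma (in finite_measure) L2_integrable:
 assumes "f \<in> L2 M"
 shows "integrable M f" "(LINT x|M. cmod (f x)) \<le> sqrt (measure M (space M)) * L2_norm M f"
proof -
 have one: "(\<lambda>_. 1) \<in> L2 M" by (rule L2_bounded[where B = 1]) auto
 have f: "(\<lambda>x. complex_of_real (cmod (f x))) \<in> L2 M" using assms by (auto simp: L2_def)
 show "integrable M f" using L2_pairing(1)[OF one assms] by simp
 have "(LINT x|M. complex_of_real (cmod (f x))) = complex_of_real (LINT x|M. cmod (f x))"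
  by (rule integral_complex_of_real)
 moreover have "0 \<le> (LINT x|M. cmod (f x))" by (simp add: integral_nonneg_AE)
 ultimately show "(LINT x|M. cmod (f x)) \<le> sqrt (measure M (space M)) * L2_norm M f"
  using L2_pairing(2)[OF one f] by (simp add: L2_norm_def)
qed

text \<open>Duality. That \<open>T f\<close> is square-integrable has to be known, since otherwise
  its norm can default to 0.\<close>

lemma L2_op_norm_ge:
 assumes f: "f \<in> L2 M" "L2_norm M f \<le> 1" and T: "T f \<in> L2 M" and v: "v \<in> L2 M" "L2_norm M v \<le> 1"
 shows "ennreal (cmod (LINT x|M. v x * T f x)) \<le> L2_op_norm M T"
proof -
 have "cmod (LINT x|M. v x * T f x) \<le> L2_norm M v * L2_norm M (T f)" by (rule L2_pairing(2)[OF v(1) T])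
 also have "... \<le> L2_norm M (T f)" using v(2) mult_right_mono[OF v(2) L2_norm_nonneg[of M "T f"]] by simp
 finally have "ennreal (cmod (LINT x|M. v x * T f x)) \<le> ennreal (L2_norm M (T f))" by (rule ennreal_leI)
 also have "... \<le> L2_op_norm M T" unfolding L2_op_norm_def using f by (intro SUP_upper) simp
 finally show ?thesis .
qed

text \<open>Let \<open>f\<close> be the preimage of the normalised \<open>p\<close>. Then
  \<open>N\<close> is the pairing of \<open>p\<close> with \<open>T f\<close>, thus of
  \<open>f\<close> with \<open>q\<close>, and is at most \<open>E\<close> times the integral of the
  modulus of \<open>f\<close>. Finiteness of the measure bounds that integral by \<open>Q\<close>
  times the norm of \<open>f\<close>.\<close>

lemma (in finite_measure) L2_inverse_norm_ge:
 fixes p :: "'a => real"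
 assumes inv: "L2_invertible M T" and p: "(\<lambda>x. complex_of_real (p x)) \<in> L2 M"
  and N: "(LINT x|M. (p x)\<^sup>2) = N^2" "N > 0"
  and adj: "\<And>f. f \<in> L2 M ==> (LINT x|M. of_real (p x) * T f x) = (LINT x|M. f x * q x)"
  and q: "\<And>x. x \<in> space M ==> cmod (q x) \<le> E" and E: "0 < E" and Q: "sqrt (measure M (space M)) \<le> Q" "0 < Q"
 shows "ennreal (N / (E * Q)) \<le> L2_op_norm M (L2_inverse M T)"
proof -
 define g where "g x = complex_of_real (p x / N)" for x
 have pm [measurable]: "(\<lambda>x. complex_of_real (p x)) \<in> borel_measurable M" and pi: "integrable M (\<lambda>x. (p x)\<^sup>2)"
  using p by (auto simp: L2_def)
 have gm: "g \<in> borel_measurable M"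
 proof -
  have "g = (\<lambda>x. complex_of_real (p x) / complex_of_real N)" by (simp add: g_def fun_eq_iff)
  then show ?thesis by simp
 qed
 have g: "g \<in> L2 M" "L2_norm M g = 1"
 proof -
  have "(cmod (g x))^2 = (p x)^2 / N^2" for x by (simp add: g_def norm_divide power_divide)
  then have 1: "(\<lambda>x. (cmod (g x))\<^sup>2) = (\<lambda>x. (p x)\<^sup>2 / N^2)" by (rule ext)
  show "g \<in> L2 M" using gm pi by (simp add: L2_def 1)
  show "L2_norm M g = 1" using N by (simp add: L2_norm_def 1)
 qed
 define f where "f = L2_inverse M T g"
 have "\<exists>f. f \<in> L2 M \<and> (AE x in M. T f x = g x)" using inv g(1) unfolding L2_invertible_def by blast
 then have "f \<in> L2 M \<and> (AE x in M. T f x = g x)"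
  unfolding f_def L2_inverse_def by (rule someI_ex)
 then have f: "f \<in> L2 M" "AE x in M. T f x = g x" by (rule conjunct1, rule conjunct2)
 have Tf: "T f \<in> L2 M" using inv f(1) unfolding L2_invertible_def by blast
 then have Tfm [measurable]: "T f \<in> borel_measurable M" by (simp add: L2_def)
 have "(LINT x|M. of_real (p x) * T f x) = (LINT x|M. of_real (p x) * g x)"
  by (rule integral_cong_AE) (use f(2) gm in auto)
 also have "... = (LINT x|M. complex_of_real ((p x)^2 / N))" by (simp add: g_def power2_eq_square)
 also have "... = complex_of_real (LINT x|M. (p x)\<^sup>2 / N)" by (rule integral_complex_of_real)
 also have "(LINT x|M. (p x)\<^sup>2 / N) = N" using N by (simp add: power2_eq_square)
 finally have "N = cmod (LINT x|M. f x * q x)" using adj[OF f(1)] N(2) by simp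
 also have "... \<le> (LINT x|M. E * cmod (f x))"
 proof (rule order_trans[OF integral_norm_bound])
  have fi: "integrable M (\<lambda>x. E * cmod (f x))" using L2_integrable(1)[OF f(1)] by simp
  show "(LINT x|M. cmod (f x * q x)) \<le> (LINT x|M. E * cmod (f x))"
   by (rule integral_mono'[OF fi]) (use q E in \<open>auto simp: norm_mult mult.commute[of E] intro!: mult_left_mono\<close>)
 qed
 also have "... = E * (LINT x|M. cmod (f x))" by simp
 also have "... \<le> E * (Q * L2_norm M f)"
  using E L2_integrable(2)[OF f(1)] mult_right_mono[OF Q(1) L2_norm_nonneg[of M f]] by (intro mult_left_mono) auto
 finally have "N / (E * Q) \<le> L2_norm M f" using E Q by (simp add: divide_le_eq mult_ac)
 then have "ennreal (N / (E * Q)) \<le> ennreal (L2_norm M (L2_inverse M T g))" unfolding f_def by (rule ennreal_leI)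
 also have "... \<le> L2_op_norm M (L2_inverse M T)" unfolding L2_op_norm_def using g by (intro SUP_upper) simp
 finally show ?thesis .
qed

lemma L2_cond_ge:
 assumes "L2_invertible M T ==> ennreal x \<le> L2_op_norm M T" "L2_invertible M T ==> ennreal y \<le> L2_op_norm M (L2_inverse M T)"
  and "0 \<le> x" "0 \<le> y"
 shows "ennreal (x * y) \<le> L2_cond M T"
 using assms by (auto simp: L2_cond_def ennreal_mult intro!: mult_mono)

text \<open>Fubini from control of a single marginal: the integrals over the first variable,
  weighted with \<open>p\<close>, are bounded uniformly in the second, and \<open>f\<close> is
  integrable.\<close>

lemma (in finite_measure) kernel_pairing:
 fixes k :: "'a \<times> 'a => complex" and p :: "'a => real"
 assumes k [measurable]: "k \<in> borel_measurable (M \<Otimes>\<^sub>M M)" and p [measurable]: "p \<in> borel_measurable M"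
  and f: "integrable M f"
  and pk: "\<And>y. y \<in> space M ==> integrable M (\<lambda>x. of_real (p x) * k (x, y))"
   "\<And>y. y \<in> space M ==> (LINT x|M. norm (of_real (p x) * k (x, y))) \<le> B"
 shows "integrable M (\<lambda>x. of_real (p x) * (LINT y|M. k (x, y) * f y))"
  and "integrable M (\<lambda>y. f y * (LINT x|M. of_real (p x) * k (x, y)))"
  and "(LINT x|M. of_real (p x) * (LINT y|M. k (x, y) * f y)) = (LINT y|M. f y * (LINT x|M. of_real (p x) * k (x, y)))"
proof -
 interpret pair_sigma_finite M M ..
 have fm [measurable]: "f \<in> borel_measurable M" using f by simp
 define F where "F y x = f y * (of_real (p x) * k (x, y))" for y x
 have Fm [measurable]: "(\<lambda>z. F (fst z) (snd z)) \<in> borel_measurable (M \<Otimes>\<^sub>M M)" unfolding F_def by measurable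
 have F: "integrable (M \<Otimes>\<^sub>M M) (case_prod F)"
 proof (rule Fubini_integrable)
  show "case_prod F \<in> borel_measurable (M \<Otimes>\<^sub>M M)" using Fm by (simp add: case_prod_unfold)
  have "integrable M (\<lambda>y. B * cmod (f y))" using f by simp
  then show "integrable M (\<lambda>y. LINT x|M. norm (case_prod F (y, x)))"
  proof (rule Bochner_Integration.integrable_bound)
   show "(\<lambda>y. LINT x|M. norm (case_prod F (y, x))) \<in> borel_measurable M"
    using Fm by (simp add: case_prod_unfold)
   show "AE y in M. norm (LINT x|M. norm (case_prod F (y, x))) \<le> norm (B * cmod (f y))"
   proof (rule AE_I2)
    fix y assume y: "y \<in> space M"
    have "(LINT x|M. norm (case_prod F (y, x))) = cmod (f y) * (LINT x|M. norm (of_real (p x) * k (x, y)))"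
     by (simp add: F_def norm_mult)
    also have "... \<le> cmod (f y) * B" by (intro mult_left_mono pk(2) y) simp
    finally show "norm (LINT x|M. norm (case_prod F (y, x))) \<le> norm (B * cmod (f y))"
     by (simp add: integral_nonneg_AE abs_of_nonneg mult.commute)
   qed
  qed
  show "AE y in M. integrable M (\<lambda>x. case_prod F (y, x))"
   using pk(1) by (intro AE_I2) (simp add: F_def)
 qed
 have e1: "(LINT x|M. F y x) = f y * (LINT x|M. of_real (p x) * k (x, y))" for y by (simp add: F_def)
 have e2: "(LINT y|M. F y x) = of_real (p x) * (LINT y|M. k (x, y) * f y)" for x
 proof -
  have "F y x = of_real (p x) * (k (x, y) * f y)" for y by (simp add: F_def mult_ac)
  then show ?thesis by simp
 qed
 show "integrable M (\<lambda>x. of_real (p x) * (LINT y|M. k (x, y) * f y))"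
  using integrable_snd[OF F] by (simp add: e2)
 show "integrable M (\<lambda>y. f y * (LINT x|M. of_real (p x) * k (x, y)))"
  using integrable_fst[OF F] by (simp add: e1)
 show "(LINT x|M. of_real (p x) * (LINT y|M. k (x, y) * f y)) = (LINT y|M. f y * (LINT x|M. of_real (p x) * k (x, y)))"
  using Fubini_integral[OF F] by (simp add: e1 e2)
qed

text \<open>For a bounded kernel the principal value is the ordinary integral, by dominated
  convergence. The two kernels may differ at \<open>x\<close>, a point that every truncation cuts
  out.\<close>

lemma principal_value_bounded:
 fixes k :: "'a::metric_space => complex"
 assumes f: "integrable M f" and km: "(\<lambda>y. k y) \<in> borel_measurable M" and k: "\<And>y. y \<in> space M ==> cmod (k y) \<le> B" and kx: "k x = 0"
  and ball: "\<And>\<epsilon>. {y. \<epsilon> \<le> dist x y} \<inter> space M \<in> sets M"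
  and eq: "\<And>y. y \<in> space M ==> y \<noteq> x ==> k' y = k y"
 shows "Lim (at_right 0) (\<lambda>\<epsilon>. LINT y:{y. \<epsilon> \<le> dist x y}|M. k' y * f y) = (LINT y|M. k y * f y)"
proof (rule tendsto_Lim)
 show "((\<lambda>\<epsilon>. LINT y:{y. \<epsilon> \<le> dist x y}|M. k' y * f y) \<longlongrightarrow> (LINT y|M. k y * f y)) (at_right 0)"
  unfolding tendsto_at_iff_sequentially comp_def
 proof (intro allI impI)
  fix X :: "nat => real" assume X: "\<forall>i. X i \<in> {0<..} - {0}" "X \<longlonglongrightarrow> 0"
  have fm [measurable]: "f \<in> borel_measurable M" using f by simp
  note km [measurable]
  define A where "A i = {y. X i \<le> dist x y} \<inter> space M" for i
  have A [measurable]: "A i \<in> sets M" for i unfolding A_def by (rule ball)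
  have e: "(LINT y:{y. X i \<le> dist x y}|M. k' y * f y) = (LINT y|M. indicator (A i) y *\<^sub>R (k y * f y))" for i
   unfolding set_lebesgue_integral_def
  proof (rule Bochner_Integration.integral_cong[OF refl])
   fix y assume "y \<in> space M"
   then show "indicator {y. X i \<le> dist x y} y *\<^sub>R (k' y * f y) = indicator (A i) y *\<^sub>R (k y * f y)"
    using eq[of y] spec[OF X(1), of i] by (cases "y = x") (auto simp: A_def indicator_def)
  qed
  show "(\<lambda>i. LINT y:{y. X i \<le> dist x y}|M. k' y * f y) \<longlonglongrightarrow> (LINT y|M. k y * f y)"
   unfolding e
  proof (rule integral_dominated_convergence[where w = "\<lambda>y. B * cmod (f y)"])
   show "integrable M (\<lambda>y. B * cmod (f y))" using f by simp
   show "AE y in M. (\<lambda>i. indicator (A i) y *\<^sub>R (k y * f y)) \<longlonglongrightarrow> k y * f y"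
   proof (rule AE_I2)
    fix y assume y: "y \<in> space M"
    show "(\<lambda>i. indicator (A i) y *\<^sub>R (k y * f y)) \<longlonglongrightarrow> k y * f y"
    proof (cases "y = x")
     case False
     then have "\<forall>\<^sub>F i in sequentially. X i < dist x y" using order_tendstoD(2)[OF X(2)] by simp
     then have "\<forall>\<^sub>F i in sequentially. indicator (A i) y *\<^sub>R (k y * f y) = k y * f y"
      by eventually_elim (use y in \<open>simp add: A_def\<close>)
     then show ?thesis by (rule tendsto_eventually)
    qed (use kx in simp)
   qed
   show "AE y in M. norm (indicator (A i) y *\<^sub>R (k y * f y)) \<le> B * cmod (f y)" for i
   proof (rule AE_I2)
    fix y assume y: "y \<in> space M"
    have "norm (indicator (A i) y *\<^sub>R (k y * f y)) \<le> cmod (k y) * cmod (f y)" by (simp add: indicator_def norm_mult)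
    also have "... \<le> B * cmod (f y)" using k[OF y] by (rule mult_right_mono) simp
    finally show "norm (indicator (A i) y *\<^sub>R (k y * f y)) \<le> B * cmod (f y)" .
   qed
  qed measurable
 qed
qed simp

section \<open>The combined layer operator\<close>

lemma hankel_measurable [measurable]:
 "hankel_re \<in> borel_measurable borel" "hankel_re' \<in> borel_measurable borel"
 "hankel_im \<in> borel_measurable borel" "hankel_im' \<in> borel_measurable borel"
proof -
 have p: "pseries c \<in> borel_measurable borel" if "entire_coeff c" for c
  using that by (intro borel_measurable_continuous_onI pseries_isCont)
 note [measurable] = p[OF entire_bessel_coeff(1)] p[OF entire_bessel_coeff(2)]
  p[OF entire_coeff_diffs[OF entire_bessel_coeff(1)]] p[OF entire_coeff_diffs[OF entire_bessel_coeff(2)]]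
 show re [measurable]: "hankel_re \<in> borel_measurable borel" "hankel_re' \<in> borel_measurable borel"
  unfolding hankel_re_def hankel_re'_def by measurable
 show "hankel_im \<in> borel_measurable borel" "hankel_im' \<in> borel_measurable borel"
  unfolding hankel_im_def [abs_def] hankel_im'_def [abs_def] by measurable
qed

text \<open>One named constant for both solutions, so that it can occur in locale instances and in
  the final bounds.\<close>

definition Ch :: real where
 "Ch = (SOME C. bessel_solution hankel_re hankel_re' hankel_re'' 0 C \<and> bessel_solution hankel_im hankel_im' hankel_im'' (1 / pi) C)"

lemma hankel_solution:
 "bessel_solution hankel_re hankel_re' hankel_re'' 0 Ch" "bessel_solution hankel_im hankel_im' hankel_im'' (1 / pi) Ch"
proof -
 obtain C where C: "C > 0" "\<And>s. s > 0 ==> \<bar>hankel_re s\<bar> \<le> C * (1 + s powr (-1/4))" "\<And>s. s > 0 ==> \<bar>hankel_im s\<bar> \<le> C * (1 + s powr (-1/4))"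
  "\<And>s. s > 0 ==> \<bar>hankel_re' s\<bar> \<le> C / sqrt s" "\<And>s. s > 0 ==> \<bar>hankel_im' s - 1 / (pi * s)\<bar> \<le> C / sqrt s"
  using hankel_bounds by blast
 have "bessel_solution hankel_re hankel_re' hankel_re'' 0 C"
  by unfold_locales (use C hankel_re_deriv hankel_ode in auto)
 moreover have "bessel_solution hankel_im hankel_im' hankel_im'' (1 / pi) C"
  by unfold_locales (use C hankel_im_deriv hankel_ode in auto)
 ultimately have "bessel_solution hankel_re hankel_re' hankel_re'' 0 Ch \<and> bessel_solution hankel_im hankel_im' hankel_im'' (1 / pi) Ch"
  unfolding Ch_def by (intro someI conjI)
 then show "bessel_solution hankel_re hankel_re' hankel_re'' 0 Ch" "bessel_solution hankel_im hankel_im' hankel_im'' (1 / pi) Ch"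
  by (rule conjunct1, rule conjunct2)
qed

lemmas Ch_pos = bessel_solution.Cw[OF hankel_solution(1)]

text \<open>The case \<open>t = 0\<close> is included because \<open>ln 0 = 0\<close>; so the
  formulas for the kernel hold on the diagonal as well, and it is measurable as a function of both
  points.\<close>

lemma hankel1_0_eq:
 assumes "0 \<le> t"
 shows "hankel1_0 t = Complex (hankel_re ((t / 2)^2)) (hankel_im ((t / 2)^2))"
proof -
 have re: "bessel_J0 t = hankel_re ((t / 2)^2)"
  by (simp add: bessel_J0_def hankel_re_def pseries_def bessel_coeff_def power_mult)
 have "(\<Sum>m. (-1) ^ m * harm m * (t / 2) ^ (2 * m) / (fact m)^2) = pseries bessel_log_coeff ((t / 2)^2)"
  by (simp add: pseries_def bessel_log_coeff_def bessel_coeff_def power_mult)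
 moreover have "2 * ln (t / 2) = ln ((t / 2)^2)"
  using assms by (cases "t = 0") (auto simp: ln_realpow)
 then have "2 / pi * (ln (t / 2) + euler_mascheroni) = (ln ((t / 2)^2) + 2 * euler_mascheroni) / pi"
  by (simp add: field_simps)
 ultimately show ?thesis unfolding hankel1_0_def bessel_Y0_def hankel_im_def re by simp
qed

lemma helmholtz_Phi_eq:
 assumes "0 \<le> k"
 shows "helmholtz_Phi k x y = \<i> / 4 * Complex (hankel_re (k^2 / 4 * (norm (x - y))^2)) (hankel_im (k^2 / 4 * (norm (x - y))^2))"
 unfolding helmholtz_Phi_def by (subst hankel1_0_eq) (use assms in \<open>simp_all add: power_mult_distrib power_divide\<close>)

text \<open>Closed form of the normal derivative. It is 0 on the diagonal, and the normal is a
  separate argument so that a Borel function can be inserted for it.\<close>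

definition dPhi :: "real => real ^ 2 => real ^ 2 => real ^ 2 => complex" where
 "dPhi k x y n = \<i> / 4 * Complex
  (2 * (k^2 / 4) * hankel_re' (k^2 / 4 * (norm (x - y))^2) * ((y - x) \<bullet> n))
  (2 * (k^2 / 4) * hankel_im' (k^2 / 4 * (norm (x - y))^2) * ((y - x) \<bullet> n))"

lemma dPhi_diag [simp]: "dPhi k x x n = 0"
 by (simp add: dPhi_def Complex_eq_0)

text \<open>Along the line \<open>y + t n\<close> the squared distance is a quadratic polynomial in
  \<open>t\<close>, so the chain rule applies to both parts of the Hankel function.\<close>

lemma normal_deriv_Phi_eq:
 assumes k: "0 < k" and xy: "x \<noteq> y"
 shows "normal_deriv_Phi \<Omega> k x y = dPhi k x y (unit_normal \<Omega> y)"
proof -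
 define n where "n = unit_normal \<Omega> y"
 define \<kappa> where "\<kappa> = k^2 / 4"
 define s where "s t = \<kappa> * ((norm (x - y))^2 + 2 * t * ((y - x) \<bullet> n) + t^2 * (n \<bullet> n))" for t
 have s_eq: "\<kappa> * (norm (x - (y + t *\<^sub>R n)))^2 = s t" for t
 proof -
  have "(norm (x - (y + t *\<^sub>R n)))^2 = (norm (x - y))^2 + 2 * t * ((y - x) \<bullet> n) + t^2 * (n \<bullet> n)"
   unfolding power2_norm_eq_inner by (simp add: inner_commute power2_eq_square algebra_simps)
  then show ?thesis by (simp add: s_def)
 qed
 have s0: "s 0 = \<kappa> * (norm (x - y))^2" "s 0 > 0" using k xy by (auto simp: s_def \<kappa>_def)
 have ds: "DERIV s 0 :> 2 * \<kappa> * ((y - x) \<bullet> n)"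
  unfolding s_def [abs_def] by (auto intro!: derivative_eq_intros)
 have dre: "DERIV (\<lambda>t. hankel_re (s t)) 0 :> hankel_re' (s 0) * (2 * \<kappa> * ((y - x) \<bullet> n))"
  by (rule DERIV_chain2[OF hankel_re_deriv(1) ds])
 have dim: "DERIV (\<lambda>t. hankel_im (s t)) 0 :> hankel_im' (s 0) * (2 * \<kappa> * ((y - x) \<bullet> n))"
  by (rule DERIV_chain2[OF hankel_im_deriv(1)[OF s0(2)] ds])
 have "((\<lambda>t. \<i> / 4 * (of_real (hankel_re (s t)) + \<i> * of_real (hankel_im (s t)))) has_vector_derivative
   \<i> / 4 * (of_real (hankel_re' (s 0) * (2 * \<kappa> * ((y - x) \<bullet> n))) + \<i> * of_real (hankel_im' (s 0) * (2 * \<kappa> * ((y - x) \<bullet> n))))) (at 0)"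
  by (intro has_vector_derivative_mult_right has_vector_derivative_add has_vector_derivative_of_real dre dim
    dre[unfolded has_real_derivative_iff_has_vector_derivative] dim[unfolded has_real_derivative_iff_has_vector_derivative])
 moreover have "\<i> / 4 * (of_real (hankel_re (s t)) + \<i> * of_real (hankel_im (s t))) = helmholtz_Phi k x (y + t *\<^sub>R n)" for t
  using helmholtz_Phi_eq[of k x "y + t *\<^sub>R n"] k s_eq[of t] by (simp add: Complex_eq \<kappa>_def)
 moreover have "\<i> / 4 * (of_real (hankel_re' (s 0) * (2 * \<kappa> * ((y - x) \<bullet> n))) + \<i> * of_real (hankel_im' (s 0) * (2 * \<kappa> * ((y - x) \<bullet> n)))) = dPhi k x y n"
  unfolding dPhi_def s0(1) \<kappa>_def Complex_eq by (simp add: mult_ac)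
 ultimately have "((\<lambda>t. helmholtz_Phi k x (y + t *\<^sub>R n)) has_vector_derivative dPhi k x y n) (at 0)" by simp
 then show ?thesis unfolding normal_deriv_Phi_def n_def[symmetric] by (rule vector_derivative_at)
qed

lemma Complex_measurable:
 assumes [measurable]: "f \<in> borel_measurable M" "g \<in> borel_measurable M"
 shows "(\<lambda>x. Complex (f x) (g x)) \<in> borel_measurable M"
 unfolding Complex_eq by measurable

lemma kernels_measurable:
 assumes [measurable]: "u \<in> borel_measurable M" "v \<in> borel_measurable M" "n \<in> borel_measurable M"
 shows "0 \<le> k ==> (\<lambda>z. helmholtz_Phi k (u z) (v z)) \<in> borel_measurable M"
  and "(\<lambda>z. dPhi k (u z) (v z) (n z)) \<in> borel_measurable M"
proof -
 show "(\<lambda>z. helmholtz_Phi k (u z) (v z)) \<in> borel_measurable M" if "0 \<le> k"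
  unfolding helmholtz_Phi_eq[OF that] by (intro borel_measurable_times borel_measurable_const Complex_measurable) measurable
 show "(\<lambda>z. dPhi k (u z) (v z) (n z)) \<in> borel_measurable M"
  unfolding dPhi_def by (intro borel_measurable_times borel_measurable_const Complex_measurable) measurable
qed

lemma open_ellipse_eq: "open_ellipse a1 a2 = {x. ellipse_form a1 a2 x < 1}"
 by (simp add: open_ellipse_def ellipse_form_def)

lemma continuous_on_ellipse_form: "continuous_on A (ellipse_form a1 a2)"
 unfolding ellipse_form_def [abs_def] divide_inverse by (intro continuous_intros)

lemma frontier_open_ellipse:
 assumes a: "0 < a2" "a2 \<le> a1"
 shows "frontier (open_ellipse a1 a2) = {x. ellipse_form a1 a2 x = 1}"
proof -
 have op: "open {x. ellipse_form a1 a2 x < 1}"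
  by (intro open_Collect_less continuous_on_ellipse_form continuous_on_const)
 have cl: "closed {x. ellipse_form a1 a2 x \<le> 1}"
  by (intro closed_Collect_le continuous_on_ellipse_form continuous_on_const)
 have sub: "closure {x. ellipse_form a1 a2 x < 1} \<subseteq> {x. ellipse_form a1 a2 x \<le> 1}"
  by (rule closure_minimal[OF _ cl]) auto
 have "y \<in> closure {x. ellipse_form a1 a2 x < 1}" if y: "ellipse_form a1 a2 y = 1" for y
 proof (rule Lim_in_closed_set)
  show "\<forall>\<^sub>F t in at_right 0. y + t *\<^sub>R inner_normal a1 a2 y \<in> closure {x. ellipse_form a1 a2 x < 1}"
   by (rule eventually_mono[OF inner_normal_facts(5)[OF a y]]) (rule subsetD[OF closure_subset CollectI])
  have "((\<lambda>t. y + t *\<^sub>R inner_normal a1 a2 y) \<longlongrightarrow> y + 0 *\<^sub>R inner_normal a1 a2 y) (at_right 0)"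
   by (intro tendsto_intros)
  then show "((\<lambda>t. y + t *\<^sub>R inner_normal a1 a2 y) \<longlongrightarrow> y) (at_right 0)" by simp
 qed simp_all
 note sup = this
 show ?thesis unfolding frontier_def open_ellipse_eq interior_open[OF op]
 proof (intro antisym subsetI)
  fix y assume "y \<in> closure {x. ellipse_form a1 a2 x < 1} - {x. ellipse_form a1 a2 x < 1}"
  then have "ellipse_form a1 a2 y \<le> 1" "\<not> ellipse_form a1 a2 y < 1" using subsetD[OF sub, of y] by simp_all
  then show "y \<in> {x. ellipse_form a1 a2 x = 1}" by simp
 next
  fix y assume "y \<in> {x. ellipse_form a1 a2 x = 1}"
  then show "y \<in> closure {x. ellipse_form a1 a2 x < 1} - {x. ellipse_form a1 a2 x < 1}" using sup[of y] by simp
 qed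
qed

section \<open>The boundary of the scatterer near the two elliptic arcs\<close>

locale scatterer = ellipse_rect c m \<delta> for c m \<delta> :: real +
 fixes \<Omega> U :: "(real ^ 2) set"
 assumes \<Omega>: "compact \<Omega>" "lipschitz_boundary \<Omega>" "open_ellipse a1 a2 \<subseteq> - \<Omega>"
  and U: "open U" "\<And>x y. x \<in> {-\<delta>..\<delta>} ==> y = m \<or> y = -m ==> epoint c x y \<in> U"
   "frontier \<Omega> \<inter> U = frontier (open_ellipse a1 a2) \<inter> U"
begin

lemma frontier_subset: "frontier \<Omega> \<subseteq> \<Omega>"
 using \<Omega>(1) by (simp add: compact_imp_closed frontier_subset_closed)

lemma frontier_form: "y \<in> frontier \<Omega> ==> 1 \<le> ellipse_form a1 a2 y"
 using frontier_subset \<Omega>(3) by (force simp: open_ellipse_eq)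

lemma frontier_form_U: "y \<in> U ==> y \<in> frontier \<Omega> \<longleftrightarrow> ellipse_form a1 a2 y = 1"
 using U(3) frontier_open_ellipse[OF a12] by blast

lemma arc_frontier: "x \<in> J ==> y = m \<or> y = -m ==> epoint c x y \<in> frontier \<Omega>"
 by (subst frontier_form_U) (auto simp: U(2) ellipse_form_epoint_eq)

text \<open>The interior of the strip lies in the open ellipse, hence off the scatterer.
  Consequently a boundary point that is not on the arcs is off the whole strip, and the outside
  estimates apply to it.\<close>

lemma frontier_epoint:
 assumes "(x, y) \<in> R" "epoint c x y \<in> frontier \<Omega>"
 shows "y = m \<or> y = -m"
proof (rule ccontr)
 assume ne: "\<not> ?thesis"
 have xy: "x \<in> J" "y \<in> {-m..m}" using assms(1) by (auto simp: R_iff)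
 have y: "\<bar>y\<bar> < m" using ne xy(2) by auto
 have "sinh \<bar>y\<bar> < sinh m" using y by (simp only: sinh_real_less_iff)
 then have 1: "(sinh y)^2 < (sinh m)^2" using power_strict_mono[of "sinh \<bar>y\<bar>" "sinh m" 2] by (simp add: abs_if split: if_splits)
 have "(cosh y)^2 \<le> (cosh m)^2" using 1 by (simp add: cosh_square_eq)
 then have c1: "(cosh y / cosh m)^2 \<le> 1" by (simp add: power_divide divide_le_eq)
 have s1: "(sinh y / sinh m)^2 < 1" using 1 m by (simp add: power_divide divide_less_eq)
 have cx: "0 < (cos x)^2"
 proof -
  have "cos x > 0" using xy(1) \<delta> pi_gt3 by (intro cos_gt_zero_pi) auto
  then show ?thesis by simp
 qed
 have "ellipse_form a1 a2 (epoint c x y) = (cosh y / cosh m)^2 * (sin x)^2 + (sinh y / sinh m)^2 * (cos x)^2"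
  using c by (simp add: ellipse_form_def a1_def a2_def power_divide power_mult_distrib)
 also have "... < 1 * (sin x)^2 + 1 * (cos x)^2"
  by (intro add_le_less_mono mult_right_mono c1 mult_strict_right_mono s1 cx) simp
 finally show False using frontier_form[OF assms(2)] by simp
qed

text \<open>The normal component of nearby boundary points is quadratically small, which is
  tangency, and the inner normal of the ellipse points out of the scatterer. Uniqueness of the
  normal does the rest.\<close>

lemma unit_normal_U:
 assumes y: "y \<in> frontier \<Omega>" "y \<in> U"
 shows "unit_normal \<Omega> y = inner_normal a1 a2 y"
proof -
 let ?n = "inner_normal a1 a2 y"
 have fy: "ellipse_form a1 a2 y = 1" using frontier_form_U[OF y(2)] y(1) by simp
 have ev: "\<forall>\<^sub>F z in at y within frontier \<Omega>. z \<in> U \<and> z \<in> frontier \<Omega>"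
 proof -
  have "\<forall>\<^sub>F z in nhds y. z \<in> U" using U(1) y(2) by (rule eventually_nhds_in_open)
  then show ?thesis by (simp add: eventually_at_filter eventually_mono)
 qed
 have "((\<lambda>z. ((z - y) \<bullet> ?n) / norm (z - y)) \<longlongrightarrow> 0) (at y within frontier \<Omega>)"
 proof (rule tendsto_sandwich[OF _ _ tendsto_const])
  show "\<forall>\<^sub>F z in at y within frontier \<Omega>. 0 \<le> ((z - y) \<bullet> ?n) / norm (z - y)"
   using ev by eventually_elim (use inner_normal_facts(2)[OF a12 fy] frontier_form_U in auto)
  show "\<forall>\<^sub>F z in at y within frontier \<Omega>. ((z - y) \<bullet> ?n) / norm (z - y) \<le> a1 / (2 * a2^2) * norm (z - y)"
   using ev
  proof eventually_elim
   case (elim z)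
   have "(z - y) \<bullet> ?n \<le> a1 / (2 * a2^2) * (norm (z - y))^2"
    by (rule inner_normal_facts(3)[OF a12 fy]) (use elim frontier_form_U in blast)
   then show ?case by (cases "z = y") (simp_all add: pos_divide_le_eq power2_eq_square mult.assoc)
  qed
  have "((\<lambda>z. a1 / (2 * a2^2) * norm (z - y)) \<longlongrightarrow> a1 / (2 * a2^2) * norm (y - y)) (at y within frontier \<Omega>)"
   by (intro tendsto_intros)
  then show "((\<lambda>z. a1 / (2 * a2^2) * norm (z - y)) \<longlongrightarrow> 0) (at y within frontier \<Omega>)" by simp
 qed
 moreover have "\<forall>\<^sub>F t in at_right 0. y + t *\<^sub>R ?n \<in> - \<Omega>"
  using inner_normal_facts(5)[OF a12 fy] by eventually_elim (use \<Omega>(3) in \<open>auto simp: open_ellipse_eq\<close>)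
 ultimately have "is_unit_normal \<Omega> y ?n"
  unfolding is_unit_normal_def using inner_normal_facts(1)[OF a12 fy] by blast
 then show ?thesis by (rule unit_normal_on_frontier(3)[OF \<Omega>(1,2) y(1)])
qed

definition normal_sup where "normal_sup = max 1 (norm junk_normal)"

lemma norm_unit_normal: "y \<in> frontier \<Omega> ==> norm (unit_normal \<Omega> y) \<le> normal_sup"
 unfolding normal_sup_def by (rule unit_normal_on_frontier(2)[OF \<Omega>(1,2)])

definition arc where "arc y = (\<lambda>x. epoint c x y) ` J"
definition arcs where "arcs = arc m \<union> arc (-m)"

lemma arcs_subset: "arcs \<subseteq> frontier \<Omega>" "arcs \<subseteq> U"
 unfolding arcs_def arc_def using arc_frontier U(2) by auto

lemma compact_arcs: "compact arcs"
proof -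
 have "compact (arc y)" for y unfolding arc_def
  by (rule compact_continuous_image[OF continuous_on_epoint_arc]) simp
 then show ?thesis unfolding arcs_def by (intro compact_Un)
qed

abbreviation "dnPhi k x y \<equiv> dPhi k x y (unit_normal \<Omega> y)"

text \<open>The arcs are smooth, and the rest of the boundary keeps away from them.\<close>

lemma normal_component_bound:
 obtains Cg where "Cg > 0"
  "\<And>x y. x \<in> arcs ==> y \<in> frontier \<Omega> ==> \<bar>(y - x) \<bullet> unit_normal \<Omega> y\<bar> \<le> Cg * (norm (x - y))^2"
proof -
 have "closed (- U)" using U(1) by (simp add: open_closed)
 moreover have "arcs \<inter> - U = {}" using arcs_subset by blast
 ultimately obtain d where d: "d > 0" "\<And>x y. x \<in> arcs ==> y \<in> - U ==> d \<le> dist x y"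
  using separate_compact_closed[OF compact_arcs, of "- U"] by blast
 \<comment> \<open>The first entry serves the elliptic part of the boundary; the second serves
   points outside \<open>U\<close>, at distance at least \<open>d\<close> from the arcs, where
   Cauchy-Schwarz is enough.\<close>
 define Cg where "Cg = max (a1 / (2 * a2^2)) (normal_sup / d)"
 have s1: "1 \<le> normal_sup" by (simp add: normal_sup_def)
 show thesis
 proof (rule that)
  have "0 < normal_sup / d" using s1 d(1) by simp
  then show "Cg > 0" by (simp add: Cg_def)
  fix x y assume x: "x \<in> arcs" and y: "y \<in> frontier \<Omega>"
  have fx: "ellipse_form a1 a2 x = 1" using frontier_form_U[of x] x arcs_subset by blast
  show "\<bar>(y - x) \<bullet> unit_normal \<Omega> y\<bar> \<le> Cg * (norm (x - y))^2"
  proof (cases "y \<in> U")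
   case True
   have fy: "ellipse_form a1 a2 y = 1" using frontier_form_U[OF True] y by simp
   note n = inner_normal_facts(2,3)[OF a12 fy fx]
   have "\<bar>(y - x) \<bullet> unit_normal \<Omega> y\<bar> = (x - y) \<bullet> inner_normal a1 a2 y"
    using n(1) unfolding unit_normal_U[OF y True] by (simp add: inner_diff_left)
   also have "... \<le> a1 / (2 * a2^2) * (norm (x - y))^2" by (rule n(2))
   also have "... \<le> Cg * (norm (x - y))^2" by (intro mult_right_mono) (auto simp: Cg_def)
   finally show ?thesis .
  next
   case False
   have r: "d \<le> norm (x - y)" using d(2)[OF x, of y] False by (simp add: dist_norm)
   have "\<bar>(y - x) \<bullet> unit_normal \<Omega> y\<bar> \<le> norm (y - x) * norm (unit_normal \<Omega> y)" by (rule Cauchy_Schwarz_ineq2)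
   also have "... \<le> norm (x - y) * normal_sup"
    unfolding norm_minus_commute[of y x] by (intro mult_left_mono norm_unit_normal y) simp
   also have "... \<le> normal_sup / d * (norm (x - y))^2"
   proof -
    have "norm (x - y) * normal_sup * d \<le> norm (x - y) * normal_sup * norm (x - y)"
     using s1 r by (intro mult_left_mono) auto
    then show ?thesis using d(1) by (simp add: pos_le_divide_eq power2_eq_square mult_ac)
   qed
   also have "... \<le> Cg * (norm (x - y))^2" by (intro mult_right_mono) (auto simp: Cg_def)
   finally show ?thesis .
  qed
 qed
qed

text \<open>The derivative of the kernel is of order \<open>k^2\<close> times
  \<open>1 / (k r)^2 + 1 / (k r)\<close>, and the normal component of order \<open>r^2\<close>. As
  \<open>r\<close> is bounded, the product is of order \<open>k\<close>, for \<open>x\<close> on the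
  arcs and \<open>y\<close> anywhere on the boundary.\<close>

lemma dPhi_bound:
 obtains B where "B > 0"
  "\<And>k x y. 2 \<le> k ==> x \<in> arcs ==> y \<in> frontier \<Omega> ==> cmod (dnPhi k x y) \<le> B * k"
proof -
 obtain Cg where Cg: "Cg > 0" "\<And>x y. x \<in> arcs ==> y \<in> frontier \<Omega> ==> \<bar>(y - x) \<bullet> unit_normal \<Omega> y\<bar> \<le> Cg * (norm (x - y))^2"
  using normal_component_bound by metis
 have "bounded (frontier \<Omega>)" using \<Omega>(1) compact_frontier compact_imp_bounded by blast
 then obtain D where D: "\<And>x y. x \<in> frontier \<Omega> ==> y \<in> frontier \<Omega> ==> dist x y \<le> D"
  unfolding bounded_two_points by blast
 define D' where "D' = max D 0"
 show thesis
 proof (rule that)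
  show "Cg * (1 + Ch * D') > 0" using Cg(1) Ch_pos by (simp add: D'_def add_pos_nonneg)
  fix k :: real and x y assume k: "2 \<le> k" and x: "x \<in> arcs" and y: "y \<in> frontier \<Omega>"
  define r where "r = norm (x - y)"
  define s where "s = k^2 / 4 * r^2"
  define I where "I = (y - x) \<bullet> unit_normal \<Omega> y"
  have rD: "r \<le> D'" using D[of x y] x y arcs_subset(1) by (auto simp: r_def D'_def dist_norm)
  show "cmod (dnPhi k x y) \<le> Cg * (1 + Ch * D') * k"
  proof (cases "x = y")
   case True
   then show ?thesis using k Cg(1) Ch_pos by (simp add: D'_def)
  next
   case False
   then have r: "r > 0" by (simp add: r_def)
   have s: "s > 0" "sqrt s = k / 2 * r" using k r by (auto simp: s_def real_sqrt_mult real_sqrt_divide)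
   have b: "\<bar>hankel_re' s\<bar> \<le> Ch / sqrt s" "\<bar>hankel_im' s\<bar> \<le> \<bar>1 / pi\<bar> / s + Ch / sqrt s"
   proof -
    show "\<bar>hankel_re' s\<bar> \<le> Ch / sqrt s" using bessel_solution.w_bounds(2)[OF hankel_solution(1) s(1)] by simp
    have "\<bar>hankel_im' s\<bar> \<le> \<bar>1 / pi / s\<bar> + \<bar>hankel_im' s - 1 / pi / s\<bar>" by linarith
    then show "\<bar>hankel_im' s\<bar> \<le> \<bar>1 / pi\<bar> / s + Ch / sqrt s"
     using bessel_solution.w_bounds(2)[OF hankel_solution(2) s(1)] s(1) by (simp add: abs_divide)
   qed
   have "cmod (dnPhi k x y) \<le> 1 / 4 * (\<bar>2 * (k^2 / 4) * hankel_re' s * I\<bar> + \<bar>2 * (k^2 / 4) * hankel_im' s * I\<bar>)"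
    unfolding dPhi_def r_def[symmetric] s_def[symmetric] I_def[symmetric] norm_mult
    using cmod_le[of "Complex (2 * (k^2 / 4) * hankel_re' s * I) (2 * (k^2 / 4) * hankel_im' s * I)"] by simp
   also have "... = k^2 / 8 * \<bar>I\<bar> * (\<bar>hankel_re' s\<bar> + \<bar>hankel_im' s\<bar>)" by (simp add: abs_mult field_simps)
   also have "... \<le> k^2 / 8 * (Cg * r^2) * (Ch / sqrt s + (\<bar>1 / pi\<bar> / s + Ch / sqrt s))"
    using Cg(2)[OF x y] b Cg(1) by (intro mult_mono add_mono mult_left_mono) (auto simp: I_def r_def)
   also have "... = Cg * (1 / (2 * pi) + Ch * k * r / 2)"
    unfolding s(2) unfolding s_def using k r by (simp add: field_simps power2_eq_square)
   also have "... \<le> Cg * (k + Ch * k * D')"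
   proof (intro mult_left_mono add_mono)
    have "1 / (2 * pi) \<le> 1" using pi_gt3 by (simp add: divide_le_eq)
    then show "1 / (2 * pi) \<le> k" using k by linarith
    have "Ch * k * r / 2 \<le> Ch * k * r" using Ch_pos k r by simp
    also have "... \<le> Ch * k * D'" using Ch_pos k rD by (intro mult_left_mono) auto
    finally show "Ch * k * r / 2 \<le> Ch * k * D'" .
   qed (use Cg in auto)
   also have "... = Cg * (1 + Ch * D') * k" by (simp add: algebra_simps)
   finally show ?thesis .
  qed
 qed
qed

end

lemma measurable_surface: "f \<in> borel_measurable borel ==> f \<in> borel_measurable (surface_measure \<Omega>)"
 unfolding surface_measure_def
 by (rule measurable_restrict_space1) (use borel_subset_hausdorff1 in \<open>auto simp: measurable_def\<close>)

lemma frontier_in_hausdorff1: "frontier \<Omega> \<inter> space hausdorff1_measure \<in> sets hausdorff1_measure"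
 by (simp add: closed_in_hausdorff1_measure frontier_closed)

lemma space_surface: "space (surface_measure \<Omega>) = frontier \<Omega>"
 by (simp add: surface_measure_def space_restrict_space)

lemma finite_surface:
 assumes "compact \<Omega>" "lipschitz_boundary \<Omega>"
 shows "finite_measure (surface_measure \<Omega>)"
proof (rule finite_measureI)
 have "emeasure (surface_measure \<Omega>) (frontier \<Omega>) = hausdorff1 (frontier \<Omega>)"
  unfolding surface_measure_def using frontier_in_hausdorff1[of \<Omega>]
  by (subst emeasure_restrict_space) (simp_all add: emeasure_hausdorff1_measure)
 then show "emeasure (surface_measure \<Omega>) (space (surface_measure \<Omega>)) \<noteq> \<infinity>"
  using surface_finite[OF assms] by (simp add: space_surface)
qed

section \<open>Densities supported on the two arcs\<close>

context scatterer
begin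

abbreviation S where "S \<equiv> surface_measure \<Omega>"

abbreviation "A \<equiv> combined_layer \<Omega>"

sublocale S: finite_measure "surface_measure \<Omega>"
 by (rule finite_surface[OF \<Omega>(1,2)])

definition tangent_vector where "tangent_vector y x = (vector [c * cosh y * cos x, - (c * sinh y * sin x)] :: real ^ 2)"

lemma c1_arc_epoint:
 assumes y: "y = m \<or> y = -m"
 shows "c1_arc (\<lambda>x. epoint c x y) (tangent_vector y) (-\<delta>) \<delta>" "norm (tangent_vector y x) = speed x"
proof -
 have t: "tangent_vector y x = (c * cosh y * cos x) *\<^sub>R axis 1 1 + (- (c * sinh y * sin x)) *\<^sub>R axis 2 1" for x
  by (simp add: vec_eq_iff forall_2 axis_def tangent_vector_def)
 show "c1_arc (\<lambda>x. epoint c x y) (tangent_vector y) (-\<delta>) \<delta>"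
 proof
  show "((\<lambda>x. epoint c x y) has_vector_derivative tangent_vector y t) (at t)" for t
   unfolding epoint_axis t by (auto intro!: derivative_eq_intros simp: mult_ac)
  show "continuous_on UNIV (tangent_vector y)" unfolding t [abs_def] by (intro continuous_intros)
  show "- \<delta> \<le> \<delta>" using \<delta> by simp
  show "inj_on (\<lambda>x. epoint c x y) J"
  proof (rule inj_onI)
   fix x x' assume x: "x \<in> J" "x' \<in> J" "epoint c x y = epoint c x' y"
   then have "2 * c0 * \<bar>x - x'\<bar> \<le> 0" using epoint_bilipschitz[OF x(1,2), of y y] by simp
   then show "x = x'" using c0 by (simp add: mult_le_0_iff)
  qed
 qed
 have "(norm (tangent_vector y x))^2 = (speed x)^2"
  unfolding speed_sq norm_sq_2 tangent_vector_def using y by (auto simp: power_mult_distrib)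
 then show "norm (tangent_vector y x) = speed x" using speed_pos[of x] by (simp add: power2_eq_iff_nonneg less_imp_le)
qed

lemma arc_disjoint: "arc m \<inter> arc (-m) = {}"
proof -
 have "epoint c x m \<noteq> epoint c x' (-m)" if "x \<in> J" "x' \<in> J" for x x'
 proof
  assume "epoint c x m = epoint c x' (-m)"
  then have "2 * c0 * sqrt ((x - x')^2 + (m - (-m))^2) \<le> 0" using epoint_bilipschitz[OF that, of m "-m"] by simp
  then have "sqrt ((x - x')^2 + (m - (-m))^2) \<le> 0" using c0 by (simp add: mult_le_0_iff)
  then have "(x - x')^2 + (m - (-m))^2 \<le> 0" by simp
  moreover have "0 < (m - (-m))^2" using m by simp
  ultimately show False by (smt (verit) zero_le_power2)
 qed
 then show ?thesis unfolding arc_def by blast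
qed

definition inv_arc where "inv_arc y = c1_arc.arc_inv (\<lambda>x. epoint c x y) (-\<delta>) \<delta>"

lemma inv_arc: "y = m \<or> y = -m ==> x \<in> J ==> inv_arc y (epoint c x y) = x"
 unfolding inv_arc_def by (rule c1_arc.arc_inv[OF c1_arc_epoint(1)])

lemma inv_arc_measurable: "y = m \<or> y = -m ==> inv_arc y \<in> borel_measurable borel"
 unfolding inv_arc_def by (rule c1_arc.arc_inv_measurable[OF c1_arc_epoint(1)])

lemma arc_borel: "y = m \<or> y = -m ==> arc y \<in> sets borel"
 unfolding arc_def by (rule c1_arc.arc_sets(2)[OF c1_arc_epoint(1)])

text \<open>Test densities given by functions of the angle on the upper and on the lower arc, zero
  elsewhere. They are defined on the whole plane in order to be Borel functions.\<close>

definition lift :: "(real => real) => (real => real) => real ^ 2 => real" where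
 "lift h h' y = indicator (arc m) y * h (inv_arc m y) + indicator (arc (-m)) y * h' (inv_arc (-m) y)"

lemma lift_arc:
 assumes "x \<in> J"
 shows "lift h h' (epoint c x m) = h x" "lift h h' (epoint c x (-m)) = h' x"
proof -
 have "epoint c x m \<in> arc m" "epoint c x (-m) \<in> arc (-m)" using assms by (auto simp: arc_def)
 moreover from this have "epoint c x m \<notin> arc (-m)" "epoint c x (-m) \<notin> arc m" using arc_disjoint by blast+
 ultimately show "lift h h' (epoint c x m) = h x" "lift h h' (epoint c x (-m)) = h' x"
  using assms by (simp_all add: lift_def inv_arc)
qed

lemma lift_off: "y \<notin> arcs ==> lift h h' y = 0"
 by (simp add: lift_def arcs_def)

lemma arcsE:
 assumes "y \<in> arcs"
 obtains x t where "x \<in> J" "t = m \<or> t = -m" "y = epoint c x t"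
 using assms unfolding arcs_def arc_def by blast

lemma lift_measurable:
 assumes [measurable]: "h \<in> borel_measurable borel" "h' \<in> borel_measurable borel"
 shows "lift h h' \<in> borel_measurable borel"
proof -
 note [measurable] = inv_arc_measurable[of m] inv_arc_measurable[of "-m"] arc_borel[of m] arc_borel[of "-m"]
 show ?thesis unfolding lift_def [abs_def] by measurable
qed

abbreviation "wgt h x \<equiv> indicator J x * speed x * h x"

lemma lift_integral:
 fixes F :: "real ^ 2 => 'b::{banach, second_countable_topology}"
 assumes [measurable]: "h \<in> borel_measurable borel" "h' \<in> borel_measurable borel" "F \<in> borel_measurable borel"
  and int: "integrable lborel (\<lambda>x. (wgt h x) *\<^sub>R F (epoint c x m))"
   "integrable lborel (\<lambda>x. (wgt h' x) *\<^sub>R F (epoint c x (-m)))"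
 shows "integrable S (\<lambda>y. lift h h' y *\<^sub>R F y)"
  "(LINT y|S. lift h h' y *\<^sub>R F y) = (LINT x|lborel. (wgt h x) *\<^sub>R F (epoint c x m))
   + (LINT x|lborel. (wgt h' x) *\<^sub>R F (epoint c x (-m)))"
proof -
 have one: "integrable hausdorff1_measure (\<lambda>y. indicator (arc t) y *\<^sub>R (g (inv_arc t y) *\<^sub>R F y))
   \<and> (LINT y|hausdorff1_measure. indicator (arc t) y *\<^sub>R (g (inv_arc t y) *\<^sub>R F y))
    = (LINT x|lborel. (wgt g x) *\<^sub>R F (epoint c x t))"
  if t: "t = m \<or> t = -m" and [measurable]: "g \<in> borel_measurable borel"
   and i: "integrable lborel (\<lambda>x. (wgt g x) *\<^sub>R F (epoint c x t))" for t g
 proof -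
  interpret c1_arc "\<lambda>x. epoint c x t" "tangent_vector t" "-\<delta>" \<delta> by (rule c1_arc_epoint(1)[OF t])
  note [measurable] = inv_arc_measurable[OF t]
  have fm: "(\<lambda>y. g (inv_arc t y) *\<^sub>R F y) \<in> borel_measurable borel" by measurable
  have e: "(indicator J x * norm (tangent_vector t x)) *\<^sub>R (g (inv_arc t (epoint c x t)) *\<^sub>R F (epoint c x t))
    = (wgt g x) *\<^sub>R F (epoint c x t)" for x
   by (cases "x \<in> J") (simp_all add: c1_arc_epoint(2)[OF t] inv_arc[OF t])
  show ?thesis unfolding arc_def using arc_integral[OF fm, unfolded e] i by simp
 qed
 note one_m = one[of m h, OF disjI1[OF refl] assms(1) int(1)] one[of "-m" h', OF disjI2[OF refl] assms(2) int(2)]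
 have split: "indicator (frontier \<Omega>) y *\<^sub>R (lift h h' y *\<^sub>R F y)
   = indicator (arc m) y *\<^sub>R (h (inv_arc m y) *\<^sub>R F y) + indicator (arc (-m)) y *\<^sub>R (h' (inv_arc (-m) y) *\<^sub>R F y)" for y
 proof (cases "y \<in> arcs")
  case True
  then have "y \<in> frontier \<Omega>" using arcs_subset by blast
  then show ?thesis by (simp add: lift_def scaleR_add_left)
 next
  case False
  then show ?thesis by (simp add: lift_off arcs_def)
 qed
 show "integrable S (\<lambda>y. lift h h' y *\<^sub>R F y)"
  unfolding surface_measure_def integrable_restrict_space[OF frontier_in_hausdorff1] split
  using one_m by (intro Bochner_Integration.integrable_add) simp_all
 show "(LINT y|S. lift h h' y *\<^sub>R F y) = (LINT x|lborel. (wgt h x) *\<^sub>R F (epoint c x m))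
   + (LINT x|lborel. (wgt h' x) *\<^sub>R F (epoint c x (-m)))"
  unfolding surface_measure_def integral_restrict_space[OF frontier_in_hausdorff1] split
  using one_m by (subst Bochner_Integration.integral_add) simp_all
qed

lemma speed_bounds: "speed x \<le> a1" "a2 \<le> speed x"
proof -
 show "speed x \<le> a1" unfolding speed_def a1_def using c
  by (intro mult_left_mono real_le_lsqrt) (simp_all add: cosh_real_nonneg)
 have "(sin x)^2 \<le> 1" by (simp add: abs_square_le_1)
 then show "a2 \<le> speed x" unfolding speed_def a2_def using c
  by (intro mult_left_mono real_le_rsqrt) (simp_all add: cosh_square_eq)
qed

lemma singular_arc_integrable:
 fixes F :: "real ^ 2 => 'b::{banach, second_countable_topology}"
 assumes [measurable]: "h \<in> borel_measurable borel" "F \<in> borel_measurable borel"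
  and h: "\<And>x. \<bar>h x\<bar> \<le> B" and D: "0 \<le> D" and x0: "x0 \<in> J"
  and F: "\<And>x. x \<in> J ==> x \<noteq> x0 ==> norm (F (epoint c x t)) \<le> D * (1 + 1 / sqrt \<bar>x - x0\<bar>)"
 shows "integrable lborel (\<lambda>x. (wgt h x) *\<^sub>R F (epoint c x t))"
  and "(LINT x|lborel. norm ((wgt h x) *\<^sub>R F (epoint c x t))) \<le> a1 * B * D * (2 * \<delta> + 4 * sqrt (2 * \<delta>))"
proof -
 let ?f = "\<lambda>x. (wgt h x) *\<^sub>R F (epoint c x t)"
 let ?G = "\<lambda>x. (a1 * B * D) * (indicator J x + indicator J x * (1 / sqrt \<bar>x - x0\<bar>)) :: real"
 have B: "B \<ge> 0" using h[of 0] by (rule order_trans[OF abs_ge_zero])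
 have i1: "integrable lborel (\<lambda>x. indicator J x :: real)"
  by (rule integrable_real_indicator) (use \<delta> in simp_all)
 have i2: "integrable lborel (\<lambda>x. indicator J x * (1 / sqrt \<bar>x - x0\<bar>))"
  "(LINT x|lborel. indicator J x * (1 / sqrt \<bar>x - x0\<bar>)) \<le> 4 * sqrt (2 * \<delta>)"
  using inverse_sqrt_set_integrable[OF x0] by (simp_all add: set_integrable_def set_lebesgue_integral_def)
 have iG: "integrable lborel ?G" by (intro integrable_mult_right Bochner_Integration.integrable_add i1 i2)
 have m: "?f \<in> borel_measurable lborel" unfolding speed_def by measurable
 have "AE x in lborel. x \<noteq> x0" by (rule AE_lborel_singleton)
 then have le: "AE x in lborel. norm (?f x) \<le> ?G x"
 proof eventually_elim
  case (elim x)
  show ?case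
  proof (cases "x \<in> J")
   case True
   have "speed x * \<bar>h x\<bar> * norm (F (epoint c x t)) \<le> a1 * B * (D * (1 + 1 / sqrt \<bar>x - x0\<bar>))"
    using speed_bounds(1)[of x] speed_pos[of x] h[of x] F[OF True elim] B a12 by (intro mult_mono) auto
   then show ?thesis using True speed_pos[of x] by (simp add: abs_mult distrib_left mult_ac)
  qed simp
 qed
 show i: "integrable lborel ?f"
 proof (rule Bochner_Integration.integrable_bound[OF iG m])
  show "AE x in lborel. norm (?f x) \<le> norm (?G x)"
   using le by eventually_elim (subst real_norm_def, linarith)
 qed
 have "(LINT x|lborel. norm (?f x)) \<le> integral\<^sup>L lborel ?G"
  by (rule integral_mono_AE[OF integrable_norm[OF i] iG le])
 also have "... = a1 * B * D * ((LINT x|lborel. indicator J x) + (LINT x|lborel. indicator J x * (1 / sqrt \<bar>x - x0\<bar>)))"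
  using i1 i2(1) by simp
 also have "... \<le> a1 * B * D * (2 * \<delta> + 4 * sqrt (2 * \<delta>))"
  using B D a12 \<delta> i2(2) by (intro mult_left_mono add_mono) auto
 finally show "(LINT x|lborel. norm (?f x)) \<le> a1 * B * D * (2 * \<delta> + 4 * sqrt (2 * \<delta>))" .
qed

lemma lift_norm: "\<bar>lift h h' y\<bar> = lift (\<lambda>x. \<bar>h x\<bar>) (\<lambda>x. \<bar>h' x\<bar>) y"
 using arc_disjoint by (auto simp: lift_def indicator_def)

text \<open>At most an inverse square root singularity, at one angle common to both arcs. The two
  kernels have this property in the first point, the single layer with a constant independent of
  \<open>k\<close>, the double layer with one of order \<open>k\<close>.\<close>

definition tame :: "real => (real ^ 2 => 'b::{banach, second_countable_topology}) => bool" where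
 "tame D F \<longleftrightarrow> F \<in> borel_measurable borel \<and> 0 \<le> D \<and> (\<exists>x0\<in>J. \<forall>x\<in>J. \<forall>t\<in>{m, -m}.
  x \<noteq> x0 --> norm (F (epoint c x t)) \<le> D * (1 + 1 / sqrt \<bar>x - x0\<bar>))"

lemma tame_bounded:
 assumes "F \<in> borel_measurable borel" "0 \<le> D" "\<And>x. x \<in> arcs ==> norm (F x) \<le> D"
 shows "tame D F"
proof -
 have "norm (F (epoint c x t)) \<le> D * (1 + 1 / sqrt \<bar>x - 0\<bar>)" if "x \<in> J" "t \<in> {m, -m}" for x t
 proof -
  have "norm (F (epoint c x t)) \<le> D * 1" using assms(3)[of "epoint c x t"] that by (auto simp: arcs_def arc_def)
  also have "... \<le> D * (1 + 1 / sqrt \<bar>x - 0\<bar>)" using assms(2) by (intro mult_left_mono) auto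
  finally show ?thesis .
 qed
 moreover have "0 \<in> J" using \<delta> by simp
 ultimately show ?thesis using assms(1,2) unfolding tame_def by blast
qed

lemma lift_tame:
 fixes F :: "real ^ 2 => 'b::{banach, second_countable_topology}"
 assumes h [measurable]: "h \<in> borel_measurable borel" "h' \<in> borel_measurable borel"
  and B: "\<And>x. \<bar>h x\<bar> \<le> B" "\<And>x. \<bar>h' x\<bar> \<le> B" and F: "tame D F"
 shows "t = m \<or> t = -m ==> integrable lborel (\<lambda>x. (wgt h x) *\<^sub>R F (epoint c x t))"
  and "integrable S (\<lambda>y. lift h h' y *\<^sub>R F y)"
  and "(LINT y|S. lift h h' y *\<^sub>R F y) = (LINT x|lborel. (wgt h x) *\<^sub>R F (epoint c x m))
   + (LINT x|lborel. (wgt h' x) *\<^sub>R F (epoint c x (-m)))"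
  and "(LINT y|S. norm (lift h h' y *\<^sub>R F y)) \<le> 2 * (a1 * B * D * (2 * \<delta> + 4 * sqrt (2 * \<delta>)))"
proof -
 obtain x0 where Fm [measurable]: "F \<in> borel_measurable borel" and D: "0 \<le> D" and x0: "x0 \<in> J"
  and b: "\<forall>x\<in>J. \<forall>t\<in>{m, -m}. x \<noteq> x0 --> norm (F (epoint c x t)) \<le> D * (1 + 1 / sqrt \<bar>x - x0\<bar>)"
  using F unfolding tame_def by blast
 have s: "integrable lborel (\<lambda>x. (wgt g x) *\<^sub>R F (epoint c x t))"
  "(LINT x|lborel. norm ((wgt g x) *\<^sub>R F (epoint c x t))) \<le> a1 * B * D * (2 * \<delta> + 4 * sqrt (2 * \<delta>))"
  if t: "t = m \<or> t = -m" and g: "g \<in> borel_measurable borel" "\<And>x. \<bar>g x\<bar> \<le> B" for t g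
 proof -
  have b': "norm (F (epoint c x t)) \<le> D * (1 + 1 / sqrt \<bar>x - x0\<bar>)" if "x \<in> J" "x \<noteq> x0" for x
   using b t that by blast
  show "integrable lborel (\<lambda>x. (wgt g x) *\<^sub>R F (epoint c x t))"
   by (rule singular_arc_integrable(1)[OF g(1) Fm g(2) D x0 b'])
  show "(LINT x|lborel. norm ((wgt g x) *\<^sub>R F (epoint c x t))) \<le> a1 * B * D * (2 * \<delta> + 4 * sqrt (2 * \<delta>))"
   by (rule singular_arc_integrable(2)[OF g(1) Fm g(2) D x0 b'])
 qed
 show "integrable lborel (\<lambda>x. (wgt h x) *\<^sub>R F (epoint c x t))" if "t = m \<or> t = -m" for t
  by (rule s(1)[OF that h(1) B(1)])
 note i = s(1)[OF disjI1[OF refl] h(1) B(1)] s(1)[OF disjI2[OF refl] h(2) B(2)]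
 show "integrable S (\<lambda>y. lift h h' y *\<^sub>R F y)" by (rule lift_integral(1)[OF h Fm i])
 show "(LINT y|S. lift h h' y *\<^sub>R F y) = (LINT x|lborel. (wgt h x) *\<^sub>R F (epoint c x m))
   + (LINT x|lborel. (wgt h' x) *\<^sub>R F (epoint c x (-m)))"
  by (rule lift_integral(2)[OF h Fm i])
 have e: "norm (lift h h' y *\<^sub>R F y) = lift (\<lambda>x. \<bar>h x\<bar>) (\<lambda>x. \<bar>h' x\<bar>) y *\<^sub>R norm (F y)" for y
  by (simp add: lift_norm)
 have e2: "(indicator J x * speed x * \<bar>g x\<bar>) *\<^sub>R norm (F (epoint c x t)) = norm ((wgt g x) *\<^sub>R F (epoint c x t))" for x t and g :: "real => real"
  using speed_pos[of x] by (simp add: abs_mult)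
 have m: "(\<lambda>x. \<bar>h x\<bar>) \<in> borel_measurable borel" "(\<lambda>x. \<bar>h' x\<bar>) \<in> borel_measurable borel" "(\<lambda>y. norm (F y)) \<in> borel_measurable borel" by measurable
 show "(LINT y|S. norm (lift h h' y *\<^sub>R F y)) \<le> 2 * (a1 * B * D * (2 * \<delta> + 4 * sqrt (2 * \<delta>)))"
  unfolding e using lift_integral(2)[OF m, unfolded e2, OF integrable_norm[OF i(1)] integrable_norm[OF i(2)]]
   s(2)[OF disjI1[OF refl] h(1) B(1)] s(2)[OF disjI2[OF refl] h(2) B(2)] by simp
qed

end

section \<open>The transpose of the combined layer operator\<close>

context scatterer
begin

text \<open>The singular angle \<open>x0\<close> comes from \<open>nearest_point_bound\<close> for
  \<open>y\<close>. As \<open>k / 2 \<ge> 1\<close>, dropping this factor from the argument only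
  weakens the estimate, so \<open>D\<close> is independent of \<open>k\<close> and
  \<open>y\<close>.\<close>

lemma Phi_tame:
 obtains D where "\<And>k y. 2 \<le> k ==> tame D (\<lambda>x. helmholtz_Phi k x y)"
proof -
 define D where "D = Ch * (1 + 1 / sqrt c0)"
 have q: "0 < 1 / sqrt c0" using c0 by simp
 show thesis
 proof (rule that)
  fix k :: real and y assume k: "2 \<le> k"
  obtain x0 y0 where z0: "(x0, y0) \<in> R"
   and nb: "\<And>x t. (x, t) \<in> R ==> c0 * sqrt ((x - x0)^2 + (t - y0)^2) \<le> norm (epoint c x t - y)"
   using nearest_point_bound[of y] by blast
  have k0: "0 \<le> k" using k by simp
  show "tame D (\<lambda>x. helmholtz_Phi k x y)" unfolding tame_def
  proof (intro conjI bexI ballI impI)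
   show "(\<lambda>x. helmholtz_Phi k x y) \<in> borel_measurable borel"
    by (rule kernels_measurable(1)[OF _ _ borel_measurable_const k0]; simp)
   show "0 \<le> D" using Ch_pos q by (simp add: D_def)
   show "x0 \<in> J" using z0 by (simp add: R_iff)
   fix x t assume x: "x \<in> J" and t: "t \<in> {m, -m}" and ne: "x \<noteq> x0"
   define r where "r = norm (epoint c x t - y)"
   define s where "s = k^2 / 4 * r^2"
   have xt: "(x, t) \<in> R" using x t m by (auto simp: R_iff)
   have "\<bar>x - x0\<bar> \<le> sqrt ((x - x0)^2 + (t - y0)^2)" by simp
   then have "c0 * \<bar>x - x0\<bar> \<le> c0 * sqrt ((x - x0)^2 + (t - y0)^2)" using c0 by (intro mult_left_mono) auto
   then have r: "c0 * \<bar>x - x0\<bar> \<le> r" using nb[OF xt] by (simp add: r_def)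
   have p: "0 < c0 * \<bar>x - x0\<bar>" using c0 ne by simp
   have "1^2 \<le> (k / 2)^2" using k by (intro power_mono) auto
   then have "1 * (c0 * \<bar>x - x0\<bar>)^2 \<le> k^2 / 4 * r^2"
    using r p by (intro mult_mono power_mono) (auto simp: power_divide)
   then have s: "(c0 * \<bar>x - x0\<bar>)^2 \<le> s" by (simp add: s_def)
   have "0 < (c0 * \<bar>x - x0\<bar>)^2" using p by (rule zero_less_power)
   then have s0: "0 < s" using s by linarith
   have "s powr (-1/4) \<le> ((c0 * \<bar>x - x0\<bar>)^2) powr (-1/4)"
    by (rule powr_mono2') (use s p in auto)
   also have "... = ((c0 * \<bar>x - x0\<bar>) powr 2) powr (-1/4)"
    by (subst powr_numeral[OF less_imp_le[OF p]]) (rule refl)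
   also have "... = (c0 * \<bar>x - x0\<bar>) powr (- (1/2))"
    by (subst powr_powr) simp
   also have "... = inverse (sqrt (c0 * \<bar>x - x0\<bar>))"
    by (simp only: powr_minus powr_half_sqrt[OF less_imp_le[OF p]])
   also have "... = 1 / sqrt c0 * (1 / sqrt \<bar>x - x0\<bar>)"
    by (simp add: real_sqrt_mult divide_inverse)
   finally have sp1: "s powr (-1/4) \<le> 1 / sqrt c0 * (1 / sqrt \<bar>x - x0\<bar>)" .
   have ab: "1 + a * b \<le> (1 + a) * (1 + b)" if "0 \<le> a" "0 \<le> b" for a b :: real
    using that by (simp add: algebra_simps)
   have sp: "1 + s powr (-1/4) \<le> (1 + 1 / sqrt c0) * (1 + 1 / sqrt \<bar>x - x0\<bar>)"
    by (rule order_trans[OF add_left_mono[OF sp1] ab]) (use q in auto)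
   have "cmod (helmholtz_Phi k (epoint c x t) y) \<le> 1 / 4 * (\<bar>hankel_re s\<bar> + \<bar>hankel_im s\<bar>)"
   proof -
    have "helmholtz_Phi k (epoint c x t) y = \<i> / 4 * Complex (hankel_re s) (hankel_im s)"
     unfolding s_def r_def by (rule helmholtz_Phi_eq[OF k0])
    then show ?thesis by (simp only: norm_mult) (use cmod_le[of "Complex (hankel_re s) (hankel_im s)"] in simp)
   qed
   also have "... \<le> 1 / 4 * (Ch * (1 + s powr (-1/4)) + Ch * (1 + s powr (-1/4)))"
    using bessel_solution.w_bounds(1)[OF hankel_solution(1) s0] bessel_solution.w_bounds(1)[OF hankel_solution(2) s0] by simp
   also have "... \<le> Ch * (1 + s powr (-1/4))" using Ch_pos by simp
   also have "... \<le> Ch * ((1 + 1 / sqrt c0) * (1 + 1 / sqrt \<bar>x - x0\<bar>))" using sp Ch_pos by (intro mult_left_mono) auto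
   finally show "cmod (helmholtz_Phi k (epoint c x t) y) \<le> D * (1 + 1 / sqrt \<bar>x - x0\<bar>)" by (simp add: D_def mult.assoc)
  qed
 qed
qed

lemma dPhi_tame:
 obtains B where "B > 0" "\<And>k y. 2 \<le> k ==> y \<in> frontier \<Omega> ==> tame (B * k) (\<lambda>x. dnPhi k x y)"
  "\<And>k x y. 2 \<le> k ==> x \<in> arcs ==> y \<in> frontier \<Omega> ==> cmod (dnPhi k x y) \<le> B * k"
proof -
 obtain B where B: "B > 0" "\<And>k x y. 2 \<le> k ==> x \<in> arcs ==> y \<in> frontier \<Omega> ==> cmod (dnPhi k x y) \<le> B * k"
  using dPhi_bound by metis
 have "tame (B * k) (\<lambda>x. dnPhi k x y)" if k: "2 \<le> k" and y: "y \<in> frontier \<Omega>" for k y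
 proof (rule tame_bounded)
  show "(\<lambda>x. dnPhi k x y) \<in> borel_measurable borel" by (rule kernels_measurable(2); simp)
  show "0 \<le> B * k" using B(1) k by simp
 qed (rule B(2)[OF k _ y])
 then show thesis using that B by blast
qed

text \<open>The transpose of the combined operator applied to a real density: the kernels are
  integrated over their first point.\<close>

definition adj :: "real => real => (real ^ 2 => real) => real ^ 2 => complex" where
 "adj k \<eta> p y = of_real (p y) + 2 * (LINT x|S. p x *\<^sub>R dnPhi k x y)
  - 2 * \<i> * of_real \<eta> * (LINT x|S. p x *\<^sub>R helmholtz_Phi k x y)"

lemma arc_point: "x \<in> J ==> t = m \<or> t = -m ==> epoint c x t \<in> arcs"
 by (auto simp: arcs_def arc_def)

lemma lift_bounded:
 assumes "\<And>x. \<bar>h x\<bar> \<le> B" "\<And>x. \<bar>h' x\<bar> \<le> B"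
 shows "\<bar>lift h h' y\<bar> \<le> B"
proof (cases "y \<in> arcs")
 case True
 then obtain x t where x: "x \<in> J" "t = m \<or> t = -m" "y = epoint c x t" by (rule arcsE)
 from x(2) show ?thesis unfolding x(3) by (elim disjE) (use lift_arc[OF x(1)] assms in simp_all)
next
 case False
 then show ?thesis using order_trans[OF abs_ge_zero assms(1)] by (simp add: lift_off)
qed

text \<open>The density vanishes off the arcs, so only values of the operator on the arcs enter, and
  there the principal value is an ordinary integral; then Fubini applies. The integrability claims
  are used again for the lower bound on the norm.\<close>

lemma adjoint:
 assumes h: "h \<in> borel_measurable borel" "h' \<in> borel_measurable borel" "\<And>x. \<bar>h x\<bar> \<le> B" "\<And>x. \<bar>h' x\<bar> \<le> B"
  and k: "2 \<le> k" and f: "f \<in> L2 S"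
 shows "(LINT x|S. of_real (lift h h' x) * A k \<eta> f x) = (LINT y|S. f y * adj k \<eta> (lift h h') y)"
  and "integrable S (\<lambda>y. f y * (LINT x|S. lift h h' x *\<^sub>R dnPhi k x y))"
  and "integrable S (\<lambda>y. f y * (LINT x|S. lift h h' x *\<^sub>R helmholtz_Phi k x y))"
proof -
 define p where "p = lift h h'"
 have pb: "p \<in> borel_measurable borel" unfolding p_def by (rule lift_measurable[OF h(1,2)])
 have p [measurable]: "p \<in> borel_measurable S" by (rule measurable_surface[OF pb])
 have pB: "\<bar>p x\<bar> \<le> B" for x unfolding p_def by (rule lift_bounded[OF h(3,4)])
 obtain g where g: "g \<in> borel_measurable borel" "\<And>y. y \<in> frontier \<Omega> ==> unit_normal \<Omega> y = g y"
  using unit_normal_on_frontier(1)[OF \<Omega>(1,2)] by blast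
 have gS [measurable]: "g \<in> borel_measurable S" by (rule measurable_surface[OF g(1)])
 have id [measurable]: "(\<lambda>x. x) \<in> borel_measurable S" by (rule measurable_surface) simp
 have fs: "fst \<in> borel_measurable (S \<Otimes>\<^sub>M S)" "snd \<in> borel_measurable (S \<Otimes>\<^sub>M S)" "(\<lambda>z. g (snd z)) \<in> borel_measurable (S \<Otimes>\<^sub>M S)"
  using measurable_compose[OF measurable_fst id] measurable_compose[OF measurable_snd id] by simp_all
 define kD where "kD z = dPhi k (fst z) (snd z) (g (snd z))" for z
 define kP where "kP z = helmholtz_Phi k (fst z) (snd z)" for z
 have k0: "0 \<le> k" "0 < k" using k by auto
 have km [measurable]: "kD \<in> borel_measurable (S \<Otimes>\<^sub>M S)" "kP \<in> borel_measurable (S \<Otimes>\<^sub>M S)"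
  unfolding kD_def [abs_def] kP_def [abs_def] by (rule kernels_measurable fs k0)+
 obtain Bd where Bd: "\<And>y. y \<in> frontier \<Omega> ==> tame (Bd * k) (\<lambda>x. dnPhi k x y)"
  "\<And>x y. x \<in> arcs ==> y \<in> frontier \<Omega> ==> cmod (dnPhi k x y) \<le> Bd * k"
  using dPhi_tame k by metis
 obtain D where D: "\<And>y. tame D (\<lambda>x. helmholtz_Phi k x y)" using Phi_tame k by metis
 define V where "V E = 2 * (a1 * B * E * (2 * \<delta> + 4 * sqrt (2 * \<delta>)))" for E
 have P: "integrable S (\<lambda>x. of_real (p x) * kP (x, y)) \<and> (LINT x|S. norm (of_real (p x) * kP (x, y))) \<le> V D" for y
  using lift_tame(2,4)[OF h D[of y]] by (simp add: p_def kP_def V_def scaleR_conv_of_real norm_mult)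
 have Dk: "integrable S (\<lambda>x. of_real (p x) * kD (x, y)) \<and> (LINT x|S. norm (of_real (p x) * kD (x, y))) \<le> V (Bd * k)" if y: "y \<in> frontier \<Omega>" for y
  using lift_tame(2,4)[OF h Bd(1)[OF y]] g(2)[OF y] by (simp add: p_def kD_def V_def scaleR_conv_of_real norm_mult)
 have fi: "integrable S f" by (rule S.L2_integrable(1)[OF f])
 note pairP = S.kernel_pairing[OF km(2) p fi conjunct1[OF P] conjunct2[OF P]]
 have DkS: "integrable S (\<lambda>x. of_real (p x) * kD (x, y))" "(LINT x|S. norm (of_real (p x) * kD (x, y))) \<le> V (Bd * k)" if "y \<in> space S" for y
  using Dk[of y] that by (auto simp: space_surface)
 have pairD1: "integrable S (\<lambda>x. of_real (p x) * (LINT y|S. kD (x, y) * f y))"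
  by (rule S.kernel_pairing(1)[OF km(1) p fi]; rule DkS; assumption)
 have pairD2: "integrable S (\<lambda>y. f y * (LINT x|S. of_real (p x) * kD (x, y)))"
  by (rule S.kernel_pairing(2)[OF km(1) p fi]; rule DkS; assumption)
 have pairD3: "(LINT x|S. of_real (p x) * (LINT y|S. kD (x, y) * f y)) = (LINT y|S. f y * (LINT x|S. of_real (p x) * kD (x, y)))"
  by (rule S.kernel_pairing(3)[OF km(1) p fi]; rule DkS; assumption)
 have pL2: "(\<lambda>x. complex_of_real (p x)) \<in> L2 S" by (rule S.L2_bounded[where B = B]) (use pB in auto)
 have pf: "integrable S (\<lambda>x. of_real (p x) * f x)" by (rule L2_pairing(1)[OF pL2 f])
 have eq: "of_real (p x) * A k \<eta> f x = of_real (p x) * f x + 2 * (of_real (p x) * (LINT y|S. kD (x, y) * f y))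
   - 2 * \<i> * of_real \<eta> * (of_real (p x) * (LINT y|S. kP (x, y) * f y))" for x
 proof (cases "x \<in> arcs")
  case True
  have "Lim (at_right 0) (\<lambda>\<epsilon>. LINT y:{y. \<epsilon> \<le> dist x y}|S. normal_deriv_Phi \<Omega> k x y * f y) = (LINT y|S. kD (x, y) * f y)"
  proof (rule principal_value_bounded[OF fi])
   show "(\<lambda>y. kD (x, y)) \<in> borel_measurable S"
    unfolding kD_def fst_conv snd_conv by (rule kernels_measurable) (simp_all add: id gS)
   show "cmod (kD (x, y)) \<le> Bd * k" if "y \<in> space S" for y
    using Bd(2)[OF True, of y] that g(2)[of y] by (simp add: kD_def space_surface)
   show "kD (x, x) = 0" by (simp add: kD_def)
   have "(\<lambda>y. dist x y) \<in> borel_measurable S" by (rule measurable_surface) simp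
   then have "{y \<in> space S. \<epsilon> \<le> dist x y} \<in> sets S" for \<epsilon> by measurable
   then show "{y. \<epsilon> \<le> dist x y} \<inter> space S \<in> sets S" for \<epsilon> by (simp add: Int_def conj_commute)
   show "normal_deriv_Phi \<Omega> k x y = kD (x, y)" if "y \<in> space S" "y \<noteq> x" for y
    using that g(2)[of y] normal_deriv_Phi_eq[OF k0(2), of x y \<Omega>] by (auto simp: kD_def space_surface)
  qed
  then show ?thesis by (simp add: combined_layer_def double_layer_def single_layer_def kP_def algebra_simps)
 next
  case False
  then show ?thesis by (simp add: p_def lift_off)
 qed
 have eq2: "f y * adj k \<eta> p y = of_real (p y) * f y + 2 * (f y * (LINT x|S. of_real (p x) * kD (x, y)))
   - 2 * \<i> * of_real \<eta> * (f y * (LINT x|S. of_real (p x) * kP (x, y)))" if "y \<in> space S" for y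
  using that g(2)[of y] by (simp add: adj_def kD_def kP_def space_surface scaleR_conv_of_real algebra_simps)
 have "(LINT x|S. of_real (p x) * A k \<eta> f x) = (LINT x|S. of_real (p x) * f x)
   + 2 * (LINT x|S. of_real (p x) * (LINT y|S. kD (x, y) * f y)) - 2 * \<i> * of_real \<eta> * (LINT x|S. of_real (p x) * (LINT y|S. kP (x, y) * f y))"
  unfolding eq using pf pairD1 pairP(1) by simp
 also have "... = (LINT y|S. of_real (p y) * f y + 2 * (f y * (LINT x|S. of_real (p x) * kD (x, y)))
   - 2 * \<i> * of_real \<eta> * (f y * (LINT x|S. of_real (p x) * kP (x, y))))"
  unfolding pairD3 pairP(3) using pf pairD2 pairP(2) by simp
 also have "... = (LINT y|S. f y * adj k \<eta> p y)"
  by (rule Bochner_Integration.integral_cong[OF refl]) (simp add: eq2)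
 finally show "(LINT x|S. of_real (lift h h' x) * A k \<eta> f x) = (LINT y|S. f y * adj k \<eta> (lift h h') y)"
  unfolding p_def .
 show "integrable S (\<lambda>y. f y * (LINT x|S. lift h h' x *\<^sub>R helmholtz_Phi k x y))"
  using pairP(2) by (simp add: p_def kP_def scaleR_conv_of_real)
 show "integrable S (\<lambda>y. f y * (LINT x|S. lift h h' x *\<^sub>R dnPhi k x y))"
  by (subst Bochner_Integration.integrable_cong[OF refl _, where g = "\<lambda>y. f y * (LINT x|S. of_real (p x) * kD (x, y))"])
   (use pairD2 g(2) in \<open>simp_all add: p_def kD_def scaleR_conv_of_real space_surface\<close>)
qed

end

lemma integral_rotated_Complex:
 assumes "integrable M (\<lambda>x. \<i> / 4 * Complex (u x) (v x))"
 shows "(LINT x|M. \<i> / 4 * Complex (u x) (v x)) = Complex (- (LINT x|M. v x) / 4) ((LINT x|M. u x) / 4)"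
proof (rule complex_eqI)
 show "Re (LINT x|M. \<i> / 4 * Complex (u x) (v x)) = Re (Complex (- (LINT x|M. v x) / 4) ((LINT x|M. u x) / 4))"
  by (subst integral_Re[symmetric, OF assms]) simp
 show "Im (LINT x|M. \<i> / 4 * Complex (u x) (v x)) = Im (Complex (- (LINT x|M. v x) / 4) ((LINT x|M. u x) / 4))"
  by (subst integral_Im[symmetric, OF assms]) simp
qed

section \<open>The approximate null vector of the transpose\<close>

context scatterer
begin

lemma speed_borel [measurable]: "speed \<in> borel_measurable borel"
 unfolding speed_def [abs_def] by measurable

lemma Crect_nonneg: "0 \<le> Crect"
 using c0 \<delta> m by (simp add: Crect_def)

context
 fixes k \<epsilon> b :: real and \<rho> \<rho>' \<rho>'' M M' :: "real => real"
 assumes k: "2 \<le> k" and \<epsilon>: "0 < \<epsilon>" and qm: "is_quasimode m \<delta> \<epsilon> (k * c) b \<rho> \<rho>' \<rho>'' M M'"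
begin

interpretation re: layer_kernel c m \<delta> hankel_re hankel_re' hankel_re'' 0 Ch "k^2 / 4"
proof (intro layer_kernel.intro layer_kernel_axioms.intro ellipse_rect_axioms hankel_solution)
 have "2^2 \<le> k^2" using k by (intro power_mono) auto
 then show "1 \<le> k^2 / 4" by simp
qed

interpretation im: layer_kernel c m \<delta> hankel_im hankel_im' hankel_im'' "1 / pi" Ch "k^2 / 4"
 by (intro layer_kernel.intro layer_kernel_axioms.intro ellipse_rect_axioms hankel_solution re.\<kappa>)

text \<open>Neumann data of the quasimode: on both edges its outward derivative in \<mu> is
  \<open>\<rho>\<close>, and division by the speed turns this into the normal derivative.\<close>

definition hq where "hq x = \<rho> x / speed x"
definition pq where "pq = lift hq hq"

lemma hq: "hq \<in> borel_measurable borel" "\<exists>B. \<forall>x. \<bar>hq x\<bar> \<le> B"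
proof -
 note q = re.quasimode_facts[OF qm]
 note [measurable] = q(3)
 show "hq \<in> borel_measurable borel" unfolding hq_def [abs_def] by measurable
 obtain B where B: "\<And>x. \<bar>\<rho> x\<bar> \<le> B" using q(4) by blast
 have "\<bar>hq x\<bar> \<le> B / a2" for x
  unfolding hq_def abs_divide using B[of x] B[of 0] speed_bounds(2)[of x] a12 by (intro frac_le) auto
 then show "\<exists>B. \<forall>x. \<bar>hq x\<bar> \<le> B" by blast
qed

lemma speed_hq: "wgt hq x = \<rho> x"
proof (cases "x \<in> J")
 case True
 then show ?thesis using speed_pos[of x] by (simp add: hq_def)
next
 case False
 then have "\<delta> \<le> \<bar>x\<bar>" by auto
 then show ?thesis using False re.quasimode_facts(2)[OF qm] by simp
qed

text \<open>The factor \<open>\<i> / 4\<close> exchanges the two parts of the Hankel function: the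
  logarithmic one becomes the real part, with a minus sign. The speed in \<open>hq\<close> cancels
  the arc length element.\<close>

lemma tame_pairing:
 assumes F: "tame D F" and e: "\<And>x t. F (epoint c x t) = \<i> / 4 * Complex (u x t) (v x t)"
 shows "(LINT x|S. pq x *\<^sub>R F x) = Complex (- (LINT x|lborel. (v x m + v x (-m)) * \<rho> x) / 4) ((LINT x|lborel. (u x m + u x (-m)) * \<rho> x) / 4)"
proof -
 obtain B where B: "\<And>x. \<bar>hq x\<bar> \<le> B" using hq(2) by blast
 note l = lift_tame[OF hq(1) hq(1) B B F, unfolded speed_hq]
 have i: "integrable lborel (\<lambda>x. \<rho> x *\<^sub>R F (epoint c x m))" "integrable lborel (\<lambda>x. \<rho> x *\<^sub>R F (epoint c x (-m)))"
  by (rule l(1), simp)+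
 have e': "\<rho> x *\<^sub>R F (epoint c x m) + \<rho> x *\<^sub>R F (epoint c x (-m)) = \<i> / 4 * Complex ((u x m + u x (-m)) * \<rho> x) ((v x m + v x (-m)) * \<rho> x)" for x
  unfolding e by (rule complex_eqI) (simp_all add: algebra_simps add_divide_distrib)
 have "(LINT x|S. pq x *\<^sub>R F x) = (LINT x|lborel. \<rho> x *\<^sub>R F (epoint c x m) + \<rho> x *\<^sub>R F (epoint c x (-m)))"
  unfolding pq_def l(3) by (rule Bochner_Integration.integral_add[symmetric, OF i])
 also have "... = Complex (- (LINT x|lborel. (v x m + v x (-m)) * \<rho> x) / 4) ((LINT x|lborel. (u x m + u x (-m)) * \<rho> x) / 4)"
  unfolding e' by (rule integral_rotated_Complex) (use Bochner_Integration.integrable_add[OF i] in \<open>simp only: e'\<close>)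
 finally show ?thesis .
qed

lemma double_pairing:
 assumes "y \<in> frontier \<Omega>" "n = unit_normal \<Omega> y"
 shows "(LINT x|S. pq x *\<^sub>R dPhi k x y n) = Complex (- im.double_int \<rho> y n / 4) (re.double_int \<rho> y n / 4)"
proof -
 obtain B where B: "tame (B * k) (\<lambda>x. dPhi k x y n)" using dPhi_tame k assms by metis
 show ?thesis unfolding re.double_int_def im.double_int_def
  by (rule tame_pairing[OF B]) (simp only: dPhi_def re.dker_def im.dker_def re.sq_def im.sq_def)
qed

lemma single_pairing:
 "(LINT x|S. pq x *\<^sub>R helmholtz_Phi k x y) = Complex (- im.single_int \<rho> y / 4) (re.single_int \<rho> y / 4)"
proof -
 obtain D where D: "tame D (\<lambda>x. helmholtz_Phi k x y)" using Phi_tame k by metis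
 have k0: "0 \<le> k" using k by simp
 show ?thesis unfolding re.single_int_def im.single_int_def
  by (rule tame_pairing[OF D]) (simp only: helmholtz_Phi_eq[OF k0] re.ker_def im.ker_def re.sq_def im.sq_def)
qed

text \<open>On the arcs the jump makes the logarithmic double layer nearly \<open>2 * pq\<close>,
  which cancels the identity term of \<open>adj\<close>; all other potentials are exponentially
  small. Off the arcs \<open>pq\<close> is 0 and the potentials are small without a jump.\<close>

lemma adj_small:
 assumes y: "y \<in> frontier \<Omega>"
 shows "cmod (adj k \<eta> pq y) \<le> (1 + \<bar>\<eta>\<bar>) * \<epsilon> * (normal_sup * (1 + Ch) * area) * k"
proof -
 define n where "n = unit_normal \<Omega> y"
 define G where "G = area"
 define X where "X = \<epsilon> * (normal_sup * ((1 + Ch) * k) * G)"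
 have G: "0 \<le> G" using \<delta> m Crect_nonneg by (simp add: G_def)
 have K: "(k * c)^2 = 4 * (k^2 / 4) * c^2" by (simp add: power_mult_distrib)
 have sk: "sqrt (k^2 / 4) = k / 2" using k by (simp add: real_sqrt_divide)
 have ns: "1 \<le> normal_sup" by (simp add: normal_sup_def)
 \<comment> \<open>As \<open>k \<ge> 2\<close>, the term with \<open>\<beta>\<close> is absorbed
   into \<open>k\<close> for both solutions.\<close>
 have b2: "2 * \<bar>0::real\<bar> + 2 * Ch * sqrt (k^2 / 4) \<le> (1 + Ch) * k" "2 * \<bar>1 / pi\<bar> + 2 * Ch * sqrt (k^2 / 4) \<le> (1 + Ch) * k"
 proof -
  have "\<bar>1 / pi\<bar> \<le> 1" using pi_gt3 by (simp add: divide_le_eq)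
  then have "2 * \<bar>1 / pi\<bar> \<le> k" using k by linarith
  then show "2 * \<bar>0::real\<bar> + 2 * Ch * sqrt (k^2 / 4) \<le> (1 + Ch) * k" "2 * \<bar>1 / pi\<bar> + 2 * Ch * sqrt (k^2 / 4) \<le> (1 + Ch) * k"
   unfolding sk using k by (simp_all add: distrib_right)
 qed
 have up: "\<epsilon> * (normal_sup * \<tau> * area) \<le> X" "\<epsilon> * (\<tau> * area) \<le> X"
  if \<tau>: "\<tau> \<le> (1 + Ch) * k" "0 \<le> \<tau>" for \<tau>
 proof -
  show "\<epsilon> * (normal_sup * \<tau> * area) \<le> X"
   unfolding X_def G_def[symmetric] using \<epsilon> ns \<tau> G by (intro mult_left_mono mult_right_mono) auto
  have "1 * \<tau> \<le> normal_sup * ((1 + Ch) * k)" using ns \<tau> by (intro mult_mono) auto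
  then show "\<epsilon> * (\<tau> * area) \<le> X"
   unfolding X_def G_def[symmetric] using \<epsilon> G by (intro mult_left_mono mult_right_mono) auto
 qed
 have t0: "0 \<le> 2 * \<bar>0::real\<bar> + 2 * Ch * sqrt (k^2 / 4)" "0 \<le> 2 * \<bar>1 / pi\<bar> + 2 * Ch * sqrt (k^2 / 4)" using Ch_pos by simp_all
 note ups = up[OF b2(1) t0(1)] up[OF b2(2) t0(2)]
 have bounds: "\<bar>re.single_int \<rho> y\<bar> \<le> X \<and> \<bar>im.single_int \<rho> y\<bar> \<le> X \<and> \<bar>re.double_int \<rho> y n\<bar> \<le> X \<and> \<bar>im.double_int \<rho> y n - 2 * pq y\<bar> \<le> X"
 proof (cases "y \<in> arcs")
  case True
  then obtain x0 y0 where x0: "x0 \<in> J" "y0 = m \<or> y0 = -m" "y = epoint c x0 y0" by (rule arcsE)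
  have n': "n = inner_normal a1 a2 y" unfolding n_def using unit_normal_U[OF y] arcs_subset True by blast
  have pq: "pq y = \<rho> x0 / speed x0" using x0 unfolding pq_def x0(3) by (elim disjE) (simp_all add: lift_arc hq_def)
  have e: "2 * (1 / pi) * (pi * \<rho> x0 / speed x0) = 2 * pq y" unfolding pq by simp
  show ?thesis
   using re.boundary_bounds[OF x0 n' qm K] im.boundary_bounds[OF x0 n' qm K] ups unfolding e by (auto intro: order_trans)
 next
  case False
  have off: "epoint c x t \<noteq> y" if "(x, t) \<in> R" for x t
  proof
   assume e: "epoint c x t = y"
   then have "t = m \<or> t = -m" using frontier_epoint[OF that] y by simp
   then have "y \<in> arcs" using arc_point[of x t] that e by (simp add: R_iff)
   then show False using False by simp
  qed
  have n1: "norm n \<le> normal_sup" unfolding n_def by (rule norm_unit_normal[OF y])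
  have pq: "pq y = 0" unfolding pq_def by (rule lift_off[OF False])
  show ?thesis
   using re.outside_bounds_lebesgue[OF off qm K n1 ns] im.outside_bounds_lebesgue[OF off qm K n1 ns] ups unfolding pq by (auto intro: order_trans)
 qed
 have "adj k \<eta> pq y = Complex (pq y - im.double_int \<rho> y n / 2 + \<eta> * re.single_int \<rho> y / 2) (re.double_int \<rho> y n / 2 + \<eta> * im.single_int \<rho> y / 2)"
  unfolding adj_def n_def[symmetric] double_pairing[OF y n_def] single_pairing by (rule complex_eqI) simp_all
 then have "cmod (adj k \<eta> pq y) \<le> \<bar>pq y - im.double_int \<rho> y n / 2 + \<eta> * re.single_int \<rho> y / 2\<bar> + \<bar>re.double_int \<rho> y n / 2 + \<eta> * im.single_int \<rho> y / 2\<bar>"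
  using cmod_le[of "adj k \<eta> pq y"] by simp
 also have "... \<le> (X / 2 + \<bar>\<eta>\<bar> * X / 2) + (X / 2 + \<bar>\<eta>\<bar> * X / 2)"
 proof (rule add_mono)
  have m: "\<bar>\<eta> * re.single_int \<rho> y\<bar> \<le> \<bar>\<eta>\<bar> * X" "\<bar>\<eta> * im.single_int \<rho> y\<bar> \<le> \<bar>\<eta>\<bar> * X"
   using bounds by (auto simp: abs_mult intro!: mult_left_mono)
  show "\<bar>pq y - im.double_int \<rho> y n / 2 + \<eta> * re.single_int \<rho> y / 2\<bar> \<le> X / 2 + \<bar>\<eta>\<bar> * X / 2"
   using bounds m(1) by linarith
  show "\<bar>re.double_int \<rho> y n / 2 + \<eta> * im.single_int \<rho> y / 2\<bar> \<le> X / 2 + \<bar>\<eta>\<bar> * X / 2"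
   using bounds m(2) by linarith
 qed
 also have "... = (1 + \<bar>\<eta>\<bar>) * X" by (simp add: algebra_simps)
 also have "... = (1 + \<bar>\<eta>\<bar>) * \<epsilon> * (normal_sup * (1 + Ch) * area) * k" by (simp add: X_def G_def)
 finally show ?thesis .
qed

text \<open>On each arc the integral is that of \<open>\<rho>^2\<close> divided by the speed;
  \<open>\<rho>\<close> is normalised and the speed is at most \<open>a1\<close>.\<close>

lemma pq_norm: "2 / a1 \<le> (LINT x|S. (pq x)\<^sup>2)"
proof -
 obtain B where B: "\<And>x. \<bar>hq x\<bar> \<le> B" using hq(2) by blast
 have pm: "pq \<in> borel_measurable borel" unfolding pq_def by (rule lift_measurable[OF hq(1) hq(1)])
 have "norm (pq x) \<le> B" for x unfolding pq_def real_norm_def by (rule lift_bounded[OF B B])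
 then have "tame B pq" using pm order_trans[OF abs_ge_zero B] by (intro tame_bounded) auto
 note l = lift_tame[OF hq(1) hq(1) B B this, unfolded speed_hq, folded pq_def]
 have half: "1 / a1 \<le> (LINT x|lborel. \<rho> x *\<^sub>R pq (epoint c x t))" if t: "t = m \<or> t = -m" for t
 proof -
  have sq: "((\<lambda>x. (\<rho> x)\<^sup>2) has_integral 1) J" using qm by (simp add: is_quasimode_def)
  have eq: "\<rho> x *\<^sub>R pq (epoint c x t) = \<rho> x * hq x" for x
  proof (cases "x \<in> J")
   case True
   then show ?thesis using t by (auto simp: pq_def lift_arc)
  next
   case False
   then have "\<delta> \<le> \<bar>x\<bar>" by auto
   then show ?thesis using re.quasimode_facts(2)[OF qm] by simp
  qed
  have cont: "continuous_on J \<rho>" by (rule continuous_on_subset[OF re.quasimode_facts(1)[OF qm]]) simp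
  note se = re.supported_integral_eq[OF cont re.quasimode_facts(1)[OF qm] re.quasimode_facts(2)[OF qm]]
  have "integral J (\<lambda>x. \<rho> x * \<rho> x) = 1" using integral_unique[OF sq] by (simp add: power2_eq_square)
  then have one: "(LINT x|lborel. \<rho> x * \<rho> x) = 1" using se(2) by simp
  have "1 / a1 = (LINT x|lborel. \<rho> x * \<rho> x / a1)" using one by simp
  also have "... \<le> (LINT x|lborel. \<rho> x *\<^sub>R pq (epoint c x t))"
  proof (rule integral_mono_AE[OF _ l(1)[OF t]])
   show "integrable lborel (\<lambda>x. \<rho> x * \<rho> x / a1)" using se(1) by simp
   show "AE x in lborel. \<rho> x * \<rho> x / a1 \<le> \<rho> x *\<^sub>R pq (epoint c x t)"
   proof (rule AE_I2)
    fix x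
    have "\<rho> x * \<rho> x / a1 \<le> \<rho> x * \<rho> x / speed x"
     using speed_bounds(1)[of x] speed_pos[of x] by (intro divide_left_mono mult_pos_pos) auto
    then show "\<rho> x * \<rho> x / a1 \<le> \<rho> x *\<^sub>R pq (epoint c x t)" unfolding eq by (simp add: hq_def)
   qed
  qed
  finally show ?thesis .
 qed
 have "1 / a1 + 1 / a1 \<le> (LINT x|S. pq x *\<^sub>R pq x)"
  unfolding l(3) by (rule add_mono[OF half half]) simp_all
 then show ?thesis by (simp add: power2_eq_square)
qed

lemma inverse_norm:
 assumes inv: "L2_invertible S (A k \<eta>)"
 shows "ennreal (sqrt (2 / a1) / ((1 + \<bar>\<eta>\<bar>) * \<epsilon> * (normal_sup * (1 + Ch) * area) * k * (1 + sqrt (measure S (space S)))))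
  \<le> L2_op_norm S (L2_inverse S (A k \<eta>))"
proof -
 define E where "E = (1 + \<bar>\<eta>\<bar>) * \<epsilon> * (normal_sup * (1 + Ch) * area) * k"
 define Q where "Q = 1 + sqrt (measure S (space S))"
 define N where "N = sqrt (LINT x|S. (pq x)\<^sup>2)"
 have "0 < 2 / a1" using a12 by simp
 then have "0 < (LINT x|S. (pq x)\<^sup>2)" using pq_norm by (rule less_le_trans)
 then have N: "sqrt (2 / a1) \<le> N" "0 < N" "(LINT x|S. (pq x)\<^sup>2) = N^2"
  unfolding N_def using pq_norm by (simp_all add: real_sqrt_le_mono)
 have G: "0 < area" using \<delta> m Crect_nonneg by (simp add: add_pos_nonneg)
 have "0 < normal_sup" by (simp add: normal_sup_def)
 then have E: "0 < E" unfolding E_def using \<epsilon> k Ch_pos G by (intro mult_pos_pos) auto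
 have Q: "sqrt (measure S (space S)) \<le> Q" "0 < Q" by (simp_all add: Q_def add_pos_nonneg)
 obtain B where B: "\<And>x. \<bar>hq x\<bar> \<le> B" using hq(2) by blast
 have pm: "pq \<in> borel_measurable borel" unfolding pq_def by (rule lift_measurable[OF hq(1) hq(1)])
 note [measurable] = measurable_surface[OF pm]
 have pB: "\<bar>pq x\<bar> \<le> B" for x unfolding pq_def by (rule lift_bounded[OF B B])
 have pL2: "(\<lambda>x. complex_of_real (pq x)) \<in> L2 S"
  by (rule S.L2_bounded[where B = B]) (use pB in auto)
 have adj: "(LINT x|S. of_real (pq x) * A k \<eta> f x) = (LINT y|S. f y * adj k \<eta> pq y)" if "f \<in> L2 S" for f
  unfolding pq_def by (rule adjoint(1)[OF hq(1) hq(1) B B k that])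
 have "ennreal (N / (E * Q)) \<le> L2_op_norm S (L2_inverse S (A k \<eta>))"
  by (rule S.L2_inverse_norm_ge[OF inv pL2 N(3,2) adj _ E Q])
   (use adj_small in \<open>simp_all add: space_surface E_def\<close>)
 moreover have "sqrt (2 / a1) / (E * Q) \<le> N / (E * Q)" using N E Q by (intro divide_right_mono) auto
 ultimately show ?thesis unfolding E_def[symmetric] Q_def[symmetric]
  using order_trans[OF ennreal_leI] by blast
qed

end

end

text \<open>The real part \<open>\<mu> + 2 * \<eta> * I\<close> may cancel, but only when
  \<open>\<bar>\<eta>\<bar> * R\<close> is comparable to \<open>\<mu>\<close>, and then the
  imaginary part compensates for it.\<close>

lemma rotated_modulus_bound:
 fixes d :: complex and \<mu> \<eta> R I :: real
 assumes d: "cmod d \<le> \<mu> / 4" and R: "0 \<le> R" and I: "\<bar>I\<bar> \<le> R"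
 shows "\<mu> / 8 + \<bar>\<eta>\<bar> * R / 2 \<le> cmod (of_real \<mu> + d - 2 * \<i> * of_real \<eta> * Complex R I)"
proof -
 define w where "w = of_real \<mu> - 2 * \<i> * of_real \<eta> * Complex R I"
 define t where "t = 2 * \<bar>\<eta>\<bar> * R"
 have w: "Re w = \<mu> + 2 * \<eta> * I" "Im w = - (2 * \<eta> * R)" by (simp_all add: w_def)
 have "\<bar>2 * \<eta> * I\<bar> \<le> t" unfolding t_def using mult_left_mono[OF I, of "2 * \<bar>\<eta>\<bar>"] by (simp add: abs_mult)
 then have "\<mu> - t \<le> Re w" unfolding w by linarith
 then have 1: "\<mu> - t \<le> cmod w" using complex_Re_le_cmod[of w] by linarith
 have "\<bar>Im w\<bar> = t" unfolding w t_def using R by (simp add: abs_mult)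
 then have 2: "t \<le> cmod w" using abs_Im_le_cmod[of w] by simp
 have "cmod w \<le> cmod (w + d) + cmod d" using norm_triangle_ineq4[of "w + d" d] by simp
 \<comment> \<open>The lower bounds \<open>\<mu> - t\<close> and \<open>t\<close> are combined with
   weights 3/8 and 5/8, and \<open>\<mu> / 4\<close> is lost to \<open>d\<close>.\<close>
 then have "\<mu> / 8 + t / 4 \<le> cmod (w + d)" using 1 2 d by linarith
 then show ?thesis unfolding w_def t_def by (simp add: algebra_simps)
qed

context scatterer
begin

text \<open>For a short arc of length comparable to \<open>1/k\<close>, the imaginary part of the fundamental solution
 dominates its real part, so the single layer potential contributes proportionally to \<open>\<bar>\<eta>\<bar>\<close>.\<close>

lemma op_norm_combined_layer_ge:
 obtains C where "C > 0"
  "\<And>k \<eta>. 2 \<le> k ==> L2_invertible S (A k \<eta>) ==> ennreal (C * (1 + \<bar>\<eta>\<bar>) / k) \<le> L2_op_norm S (A k \<eta>)"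
proof -
 obtain Bd where Bd: "Bd > 0" "\<And>k x y. 2 \<le> k ==> x \<in> arcs ==> y \<in> frontier \<Omega> ==> cmod (dnPhi k x y) \<le> Bd * k"
  using dPhi_tame by metis
 obtain s0 where s0: "s0 > 0" "\<And>s. 0 < s ==> s \<le> s0 ==> hankel_im s \<le> -1 \<and> \<bar>hankel_re s\<bar> \<le> - hankel_im s"
  using hankel_small_argument by blast
 obtain D where D: "\<And>k y. 2 \<le> k ==> tame D (\<lambda>x. helmholtz_Phi k x y)" using Phi_tame by metis
 have a1: "0 < a1" using a12 by simp
 \<comment> \<open>The test arc has angle \<open>l / k\<close>. The first entry keeps it inside the
   strip, the second makes the double layer term at most a quarter of its mass, and the third keeps
   the Bessel argument where the logarithm dominates.\<close>
 define l where "l = min \<delta> (min (1 / (8 * Bd * a1)) (sqrt s0 / a1))"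
 have l: "0 < l" "l \<le> \<delta>" "l \<le> 1 / (8 * Bd * a1)" "l \<le> sqrt s0 / a1"
  unfolding l_def using \<delta> Bd(1) s0(1) a1 by (simp_all add: min_def)
 have l': "Bd * (a1 * l) \<le> 1 / 8" "(a1 * l)^2 \<le> s0"
 proof -
  show "Bd * (a1 * l) \<le> 1 / 8" using l(3) Bd(1) a1 by (simp add: pos_le_divide_eq mult_ac)
  have "a1 * l \<le> sqrt s0" using l(4) a1 by (simp add: pos_le_divide_eq mult_ac)
  then have "(a1 * l)^2 \<le> (sqrt s0)^2" using a1 l(1) by (intro power_mono) auto
  then show "(a1 * l)^2 \<le> s0" using s0(1) by simp
 qed
 \<comment> \<open>The factor 1/8 comes from \<open>rotated_modulus_bound\<close>; the minimum
   serves the terms 1 and \<open>\<bar>\<eta>\<bar> * \<mu>\<close> together, as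
   \<open>\<mu>\<close> is at least \<open>a2 * l / k\<close>.\<close>
 define C where "C = min 1 (a2 * l) / 8"
 show thesis
 proof (rule that)
  show "C > 0" using a12 l(1) by (simp add: C_def)
  fix k \<eta> :: real assume k: "2 \<le> k" and inv: "L2_invertible S (A k \<eta>)"
  define L where "L = l / k"
  have L: "0 < L" "L \<le> \<delta>"
  proof -
   show "0 < L" using l(1) k by (simp add: L_def)
   have "l / k \<le> l / 1" using l(1) k by (intro divide_left_mono) auto
   then show "L \<le> \<delta>" using l(2) by (simp add: L_def)
  qed
  define h :: "real => real" where "h = (\<lambda>x. indicator {0..L} x)"
  define h' :: "real => real" where "h' = (\<lambda>x. 0)"
  have h: "h \<in> borel_measurable borel" "h' \<in> borel_measurable borel" "\<bar>h x\<bar> \<le> 1" "\<bar>h' x\<bar> \<le> 1" for x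
   by (simp_all add: h_def h'_def)
  define p where "p = lift h h'"
  have pm: "p \<in> borel_measurable borel" unfolding p_def by (rule lift_measurable[OF h(1,2)])
  note [measurable] = measurable_surface[OF pm]
  have p01: "p y = 0 \<or> p y = 1 \<and> (\<exists>x\<in>{0..L}. y = epoint c x m)" for y
  proof (cases "y \<in> arcs")
   case True
   then obtain x t where x: "x \<in> J" "t = m \<or> t = -m" "y = epoint c x t" by (rule arcsE)
   from x(2) show ?thesis
   proof
    assume t: "t = m"
    show ?thesis unfolding p_def x(3) t lift_arc(1)[OF x(1)] h_def by (cases "x \<in> {0..L}") auto
   next
    assume t: "t = -m"
    show ?thesis unfolding p_def x(3) t lift_arc(2)[OF x(1)] h'_def by simp
   qed
  qed (simp add: p_def lift_off)
  have p0: "0 \<le> p y" "\<bar>p y\<bar> \<le> 1" "(p y)^2 = p y" for y using p01[of y] by auto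
  have parc: "y \<in> arcs" if "p y \<noteq> 0" for y using that lift_off[of y h h'] unfolding p_def by blast
  define q where "q x = wgt h x" for x
  have q0: "0 \<le> q x" for x using speed_pos[of x] by (simp add: q_def h_def)
  have qm [measurable]: "q \<in> borel_measurable borel" unfolding q_def [abs_def] using h(1) by measurable
  define \<mu> where "\<mu> = (LINT y|S. p y)"
  have "tame 1 (\<lambda>_. 1 :: real)" by (rule tame_bounded) simp_all
  note one = lift_tame[OF h this]
  have qi: "integrable lborel q" using one(1)[OF disjI1[OF refl]] by (simp add: q_def [abs_def])
  have pi: "integrable S p" using one(2) by (simp add: p_def [abs_def])
  have \<mu>q: "\<mu> = (LINT x|lborel. q x)" using one(3) by (simp add: \<mu>_def p_def q_def h'_def)
  have iL: "integrable lborel (\<lambda>x. indicator {0..L} x :: real)" "(LINT x|lborel. indicator {0..L} x :: real) = L"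
   using L by (simp_all add: integrable_real_indicator)
  have \<mu>: "a2 * L \<le> \<mu>" "\<mu> \<le> a1 * L"
  proof -
   have "(LINT x|lborel. a2 * indicator {0..L} x) \<le> (LINT x|lborel. q x)"
    by (rule integral_mono[OF _ qi]) (use iL(1) speed_bounds(2) L in \<open>auto simp: q_def h_def indicator_def\<close>)
   then show "a2 * L \<le> \<mu>" using iL(2) by (simp add: \<mu>q)
   have "(LINT x|lborel. q x) \<le> (LINT x|lborel. a1 * indicator {0..L} x)"
    by (rule integral_mono[OF qi]) (use iL(1) speed_bounds(1) a1 L in \<open>auto simp: q_def h_def indicator_def\<close>)
   then show "\<mu> \<le> a1 * L" using iL(2) by (simp add: \<mu>q)
  qed
  have \<mu>0: "0 < \<mu>" using \<mu>(1) mult_pos_pos[OF _ L(1), of a2] a12 by linarith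
  define f where "f y = complex_of_real (p y)" for y
  have fL2: "f \<in> L2 S" unfolding f_def [abs_def] by (rule S.L2_bounded[where B = 1]) (use p0 in auto)
  define Dp where "Dp y = (LINT x|S. p x *\<^sub>R dnPhi k x y)" for y
  define Pp where "Pp y = (LINT x|S. p x *\<^sub>R helmholtz_Phi k x y)" for y
  have iD: "integrable S (\<lambda>y. f y * Dp y)" and iP: "integrable S (\<lambda>y. f y * Pp y)"
   using adjoint(2,3)[OF h k fL2] by (simp_all add: p_def Dp_def Pp_def)
  have Dp: "cmod (Dp y) \<le> Bd * k * \<mu>" if y: "y \<in> frontier \<Omega>" for y
  proof -
   have "cmod (Dp y) \<le> (LINT x|S. norm (p x *\<^sub>R dnPhi k x y))"
    unfolding Dp_def by (rule integral_norm_bound)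
   also have "... \<le> (LINT x|S. p x * (Bd * k))"
   proof (rule integral_mono')
    show "integrable S (\<lambda>x. p x * (Bd * k))" using pi by simp
    show "norm (p x *\<^sub>R dnPhi k x y) \<le> p x * (Bd * k)" for x
    proof (cases "p x = 0")
     case False
     then show ?thesis using Bd(2)[OF k parc[OF False] y] p0(1)[of x] by (simp add: mult_left_mono)
    qed simp
    show "0 \<le> p x * (Bd * k)" for x using p0(1)[of x] Bd(1) k by simp
   qed
   also have "... = Bd * k * \<mu>" by (simp add: \<mu>_def)
   finally show ?thesis .
  qed
  have k0: "0 \<le> k" using k by simp
  have Pp: "\<mu> / 4 \<le> Re (Pp y)" "\<bar>Im (Pp y)\<bar> \<le> Re (Pp y)" if py: "p y \<noteq> 0" for y
  proof -
   obtain y1 where y1: "y1 \<in> {0..L}" "y = epoint c y1 m" using p01[of y] py by blast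
   note lt = lift_tame[OF h D[OF k, of y]]
   let ?F = "\<lambda>x. q x *\<^sub>R helmholtz_Phi k (epoint c x m) y"
   have iF: "integrable lborel ?F"
    unfolding q_def by (rule lt(1)) simp
   have "Pp y = (LINT x|lborel. ?F x)"
    using lt(3) unfolding Pp_def p_def q_def h'_def by simp
   then have ReP: "Re (Pp y) = (LINT x|lborel. Re (?F x))" and ImP: "Im (Pp y) = (LINT x|lborel. Im (?F x))"
    using integral_Re[OF iF] integral_Im[OF iF] by simp_all
   have "AE x in lborel. x \<noteq> y1" by (rule AE_lborel_singleton)
   then have ae: "AE x in lborel. q x / 4 \<le> Re (?F x) \<and> \<bar>Im (?F x)\<bar> \<le> Re (?F x)"
   proof eventually_elim
    case (elim x)
    show ?case
    proof (cases "x \<in> {0..L}")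
     case True
     have xy: "x \<in> J" "y1 \<in> J" using True y1(1) L \<delta> by auto
     define r where "r = norm (epoint c x m - y)"
     define s where "s = k^2 / 4 * r^2"
     have "r \<le> a1 * \<bar>x - y1\<bar>"
     proof -
      interpret c1_arc "\<lambda>x. epoint c x m" "tangent_vector m" "-\<delta>" \<delta> by (rule c1_arc_epoint(1)[OF disjI1[OF refl]])
      have "norm (tangent_vector m z - 0) \<le> a1" for z
       using speed_bounds(1)[of z] by (simp add: c1_arc_epoint(2)[OF disjI1[OF refl]])
      from arc_Lipschitz[OF this xy] show ?thesis by (simp add: r_def y1(2))
     qed
     also have "... \<le> a1 * L" using True y1(1) a1 by (intro mult_left_mono) auto
     finally have rL: "r \<le> a1 * L" .
     have "2 * c0 * \<bar>x - y1\<bar> \<le> r" using epoint_bilipschitz[OF xy, of m m] by (simp add: r_def y1(2))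
     moreover have "0 < 2 * c0 * \<bar>x - y1\<bar>" using c0 elim by simp
     ultimately have r: "0 < r" by linarith
     have s1: "0 < s" using r k by (simp add: s_def)
     have "k * r / 2 \<le> k * (a1 * L) / 2" using rL k by simp
     also have "... = a1 * l / 2" using k by (simp add: L_def)
     also have "... \<le> a1 * l" using a1 l(1) by simp
     finally have "(k * r / 2)^2 \<le> (a1 * l)^2" using k r by (intro power_mono) auto
     then have s2: "s \<le> s0" using l'(2) by (simp add: s_def power_mult_distrib power_divide)
     have Phi: "helmholtz_Phi k (epoint c x m) y = \<i> / 4 * Complex (hankel_re s) (hankel_im s)"
      unfolding s_def r_def by (rule helmholtz_Phi_eq[OF k0])
     have ReF: "Re (?F x) = q x * (- hankel_im s / 4)" and ImF: "Im (?F x) = q x * (hankel_re s / 4)" unfolding Phi by simp_all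
     note hs = s0(2)[OF s1 s2]
     have "q x * (1 / 4) \<le> q x * (- hankel_im s / 4)" using hs by (intro mult_left_mono q0) auto
     moreover have "q x * \<bar>hankel_re s / 4\<bar> \<le> q x * (- hankel_im s / 4)" using hs by (intro mult_left_mono q0) auto
     ultimately show ?thesis unfolding ReF ImF abs_mult abs_of_nonneg[OF q0] by simp
    next
     case False
     then show ?thesis by (simp add: q_def h_def)
    qed
   qed
   have iRe: "integrable lborel (\<lambda>x. Re (?F x))" and iIm: "integrable lborel (\<lambda>x. Im (?F x))"
    using iF by (rule integrable_Re, rule integrable_Im)
   have "(LINT x|lborel. q x / 4) \<le> (LINT x|lborel. Re (?F x))"
    by (rule integral_mono_AE[OF _ iRe]) (use qi ae in auto)
   then show "\<mu> / 4 \<le> Re (Pp y)" unfolding ReP \<mu>q by simp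
   have "\<bar>LINT x|lborel. Im (?F x)\<bar> \<le> (LINT x|lborel. \<bar>Im (?F x)\<bar>)"
    using integral_norm_bound[of lborel "\<lambda>x. Im (?F x)"] by simp
   also have "... \<le> (LINT x|lborel. Re (?F x))"
    by (rule integral_mono_AE[OF _ iRe]) (use iIm ae in auto)
   finally show "\<bar>Im (Pp y)\<bar> \<le> Re (Pp y)" unfolding ReP ImP .
  qed
  \<comment> \<open>The forms of double and single layer at the indicator. The first is small
    against the mass \<open>\<mu>\<close>, the second is bounded below by its square.\<close>
  define DD where "DD = (LINT y|S. f y * Dp y)"
  define PP where "PP = (LINT y|S. f y * Pp y)"
  have DD: "cmod (2 * DD) \<le> \<mu> / 4"
  proof -
   have "cmod DD \<le> (LINT y|S. norm (f y * Dp y))" unfolding DD_def by (rule integral_norm_bound)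
   also have "... \<le> (LINT y|S. p y * (Bd * k * \<mu>))"
   proof (rule integral_mono)
    show "integrable S (\<lambda>y. norm (f y * Dp y))" using iD by (rule integrable_norm)
    show "integrable S (\<lambda>y. p y * (Bd * k * \<mu>))" using pi by simp
    show "norm (f y * Dp y) \<le> p y * (Bd * k * \<mu>)" if "y \<in> space S" for y
     using Dp[of y] that p0(1)[of y] by (simp add: norm_mult f_def space_surface mult_left_mono)
   qed
   also have "... = Bd * k * \<mu> * \<mu>" by (simp add: \<mu>_def)
   also have "... \<le> 1 / 8 * \<mu>"
   proof (rule mult_right_mono)
    have "Bd * k * \<mu> \<le> Bd * k * (a1 * L)" using \<mu>(2) Bd(1) k by (intro mult_left_mono) auto
    also have "... = Bd * (a1 * l)" using k by (simp add: L_def)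
    finally show "Bd * k * \<mu> \<le> 1 / 8" using l'(1) by linarith
   qed (use \<mu>0 in simp)
   finally show ?thesis by (simp add: norm_mult)
  qed
  have RePP: "Re PP = (LINT y|S. p y * Re (Pp y))" and ImPP: "Im PP = (LINT y|S. p y * Im (Pp y))"
   using integral_Re[OF iP] integral_Im[OF iP] by (simp_all add: PP_def f_def)
  have iRe: "integrable S (\<lambda>y. p y * Re (Pp y))" and iIm: "integrable S (\<lambda>y. p y * Im (Pp y))"
   using integrable_Re[OF iP] integrable_Im[OF iP] by (simp_all add: f_def)
  have PP: "\<mu> * \<mu> / 4 \<le> Re PP" "\<bar>Im PP\<bar> \<le> Re PP"
  proof -
   have "(LINT y|S. p y * (\<mu> / 4)) \<le> (LINT y|S. p y * Re (Pp y))"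
   proof (rule integral_mono[OF _ iRe])
    show "integrable S (\<lambda>y. p y * (\<mu> / 4))" using pi by simp
    show "p y * (\<mu> / 4) \<le> p y * Re (Pp y)" for y
     using Pp(1)[of y] p0(1)[of y] by (cases "p y = 0") (simp_all add: mult_left_mono del: times_divide_eq_right)
   qed
   then show "\<mu> * \<mu> / 4 \<le> Re PP" by (simp add: RePP \<mu>_def)
   have "\<bar>Im PP\<bar> \<le> (LINT y|S. \<bar>p y * Im (Pp y)\<bar>)"
    using integral_norm_bound[of S "\<lambda>y. p y * Im (Pp y)"] by (simp add: ImPP)
   also have "... \<le> (LINT y|S. p y * Re (Pp y))"
   proof (rule integral_mono[OF _ iRe])
    show "integrable S (\<lambda>y. \<bar>p y * Im (Pp y)\<bar>)" using iIm by (rule integrable_abs)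
    show "\<bar>p y * Im (Pp y)\<bar> \<le> p y * Re (Pp y)" for y
     using Pp(2)[of y] p0(1)[of y] by (cases "p y = 0") (simp_all add: abs_mult mult_left_mono)
   qed
   finally show "\<bar>Im PP\<bar> \<le> Re PP" by (simp add: RePP)
  qed
  \<comment> \<open>The indicator divided by its norm, used both as argument and as test function;
    \<open>p^2 = p\<close> makes its square \<open>p / \<mu>\<close>.\<close>
  define g where "g y = complex_of_real (p y / sqrt \<mu>)" for y
  have g: "g \<in> L2 S" "L2_norm S g \<le> 1"
  proof -
   have gf: "g = (\<lambda>y. f y * complex_of_real (1 / sqrt \<mu>))" by (simp add: g_def f_def fun_eq_iff)
   have "f \<in> borel_measurable S" using fL2 by (simp add: L2_def)
   then have gm: "g \<in> borel_measurable S" unfolding gf by simp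
   have sq: "(\<lambda>y. (cmod (g y))\<^sup>2) = (\<lambda>y. p y / \<mu>)"
    unfolding g_def norm_of_real using \<mu>0 p0(3) by (simp add: fun_eq_iff power_divide)
   show "g \<in> L2 S" using gm pi by (simp add: L2_def sq)
   show "L2_norm S g \<le> 1" using \<mu>0 by (simp add: L2_norm_def sq \<mu>_def[symmetric])
  qed
  have Tg: "A k \<eta> g \<in> L2 S" using inv g(1) by (simp add: L2_invertible_def)
  have "(LINT x|S. g x * A k \<eta> g x) = (LINT x|S. complex_of_real (1 / sqrt \<mu>) * (of_real (lift h h' x) * A k \<eta> g x))"
   by (rule Bochner_Integration.integral_cong[OF refl]) (simp add: g_def p_def mult_ac)
  also have "... = complex_of_real (1 / sqrt \<mu>) * (LINT y|S. g y * adj k \<eta> p y)"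
   using adjoint(1)[OF h k g(1), of \<eta>] by (simp add: p_def)
  also have "(LINT y|S. g y * adj k \<eta> p y) = (LINT y|S. complex_of_real (1 / sqrt \<mu>) * (of_real (p y) + 2 * (f y * Dp y) - 2 * \<i> * of_real \<eta> * (f y * Pp y)))"
  proof (rule Bochner_Integration.integral_cong[OF refl])
   fix y
   have "complex_of_real (p y) * complex_of_real (p y) = complex_of_real (p y)"
    unfolding of_real_mult[symmetric] using p0(3)[of y] by (simp add: power2_eq_square)
   then have "f y * adj k \<eta> p y = of_real (p y) + 2 * (f y * Dp y) - 2 * \<i> * of_real \<eta> * (f y * Pp y)"
    unfolding adj_def f_def Dp_def[symmetric] Pp_def[symmetric] by (simp add: algebra_simps)
   then show "g y * adj k \<eta> p y = complex_of_real (1 / sqrt \<mu>) * (of_real (p y) + 2 * (f y * Dp y) - 2 * \<i> * of_real \<eta> * (f y * Pp y))"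
    by (simp add: g_def f_def)
  qed
  also have "... = complex_of_real (1 / sqrt \<mu>) * (of_real \<mu> + 2 * DD - 2 * \<i> * of_real \<eta> * PP)"
   using pi iD iP by (simp add: DD_def PP_def \<mu>_def)
  finally have eq: "(LINT x|S. g x * A k \<eta> g x)
    = complex_of_real (1 / sqrt \<mu>) * (complex_of_real (1 / sqrt \<mu>) * (of_real \<mu> + 2 * DD - 2 * \<i> * of_real \<eta> * Complex (Re PP) (Im PP)))" by simp
  have "0 \<le> Re PP" using PP(1) \<mu>0 by (meson order_trans divide_nonneg_nonneg mult_nonneg_nonneg less_imp_le zero_le_numeral)
  then have low: "\<mu> / 8 + \<bar>\<eta>\<bar> * Re PP / 2 \<le> cmod (of_real \<mu> + 2 * DD - 2 * \<i> * of_real \<eta> * Complex (Re PP) (Im PP))"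
   by (intro rotated_modulus_bound DD PP)
  have "cmod (LINT x|S. g x * A k \<eta> g x) = cmod (of_real \<mu> + 2 * DD - 2 * \<i> * of_real \<eta> * Complex (Re PP) (Im PP)) / \<mu>"
   unfolding eq norm_mult norm_of_real using \<mu>0 by (simp add: real_sqrt_mult_self field_simps)
  also have "... \<ge> (\<mu> / 8 + \<bar>\<eta>\<bar> * Re PP / 2) / \<mu>" using low \<mu>0 by (intro divide_right_mono) auto
  also have "(\<mu> / 8 + \<bar>\<eta>\<bar> * Re PP / 2) / \<mu> \<ge> (\<mu> / 8 + \<bar>\<eta>\<bar> * (\<mu> * \<mu> / 4) / 2) / \<mu>"
   using PP(1) \<mu>0 by (intro divide_right_mono add_left_mono mult_left_mono) auto
  also have "(\<mu> / 8 + \<bar>\<eta>\<bar> * (\<mu> * \<mu> / 4) / 2) / \<mu> = (1 + \<bar>\<eta>\<bar> * \<mu>) / 8" using \<mu>0 by (simp add: field_simps)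
  also have "... \<ge> C * (1 + \<bar>\<eta>\<bar>) / k"
  proof -
   have "8 * C \<le> 1" "8 * C \<le> a2 * l" by (simp_all add: C_def)
   have C0: "0 \<le> C" using a12 l(1) by (simp add: C_def)
   have "8 * C / k \<le> 1 / k" using \<open>8 * C \<le> 1\<close> k by (intro divide_right_mono) auto
   also have "... \<le> 1" using k by simp
   finally have 1: "8 * C / k \<le> 1" .
   have "8 * C / k \<le> a2 * l / k" using \<open>8 * C \<le> a2 * l\<close> k by (intro divide_right_mono) auto
   also have "... \<le> \<mu>" using \<mu>(1) by (simp add: L_def)
   finally have 2: "\<bar>\<eta>\<bar> * (8 * C / k) \<le> \<bar>\<eta>\<bar> * \<mu>" by (intro mult_left_mono) auto
   have "C * (1 + \<bar>\<eta>\<bar>) / k = (8 * C / k + \<bar>\<eta>\<bar> * (8 * C / k)) / 8" using k by (simp add: field_simps)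
   also have "... \<le> (1 + \<bar>\<eta>\<bar> * \<mu>) / 8" using 1 2 by (intro divide_right_mono add_mono) auto
   finally show ?thesis .
  qed
  finally have "C * (1 + \<bar>\<eta>\<bar>) / k \<le> cmod (LINT x|S. g x * A k \<eta> g x)" .
  then show "ennreal (C * (1 + \<bar>\<eta>\<bar>) / k) \<le> L2_op_norm S (A k \<eta>)"
   using L2_op_norm_ge[where f = g and v = g and T = "A k \<eta>", OF g Tg g]
   by (rule order_trans[OF ennreal_leI])
 qed
qed

end

section \<open>Growth of the condition number and the theorem\<close>

context scatterer
begin

text \<open>The two norm bounds lose a factor \<open>1 / k^2\<close> in total. It is paid for with
  half of the exponent, since an exponential dominates half the square of its argument.\<close>

lemma condition_number_grows:
 obtains \<gamma> C where "\<gamma> > 0" "C > 0"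
  "\<And>B. \<exists>k>B. \<forall>\<eta>. ennreal (C * exp (\<gamma> * k)) \<le> L2_cond S (A k \<eta>)"
proof -
 have "\<delta> < pi / 2" using \<delta>(2) pi_gt3 by linarith
 then obtain \<gamma> Cq where \<gamma>: "\<gamma> > 0" and Cq: "Cq > 0"
  and qm: "\<And>B. \<exists>K>B. \<exists>b \<rho> \<rho>' \<rho>'' M M'. is_quasimode m \<delta> (Cq * exp (- \<gamma> * K)) K b \<rho> \<rho>' \<rho>'' M M'"
  using quasimodes_exist[OF m \<delta>(1)] by metis
 obtain CA where CA: "CA > 0"
  "\<And>k \<eta>. 2 \<le> k ==> L2_invertible S (A k \<eta>) ==> ennreal (CA * (1 + \<bar>\<eta>\<bar>) / k) \<le> L2_op_norm S (A k \<eta>)"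
  using op_norm_combined_layer_ge by metis
 define CE where "CE = normal_sup * (1 + Ch) * area"
 define Q where "Q = 1 + sqrt (measure S (space S))"
 have "0 < normal_sup" by (simp add: normal_sup_def)
 moreover have "0 < area" using \<delta> m Crect_nonneg by (simp add: add_pos_nonneg)
 ultimately have CE: "CE > 0" unfolding CE_def using Ch_pos by simp
 have Q: "Q > 0" by (simp add: Q_def add_pos_nonneg)
 have a1: "sqrt (2 / a1) > 0" using a12 by simp
 define C' where "C' = CA * sqrt (2 / a1) / (Cq * CE * Q)"
 have C': "C' > 0" unfolding C'_def using CA(1) Cq CE Q a1 by simp
 \<comment> \<open>Half of the exponent \<open>\<gamma> * K\<close>, expressed in \<open>k\<close>
   by \<open>K = k * c\<close>.\<close>
 define g where "g = \<gamma> * c / 2"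
 have g: "g > 0" using \<gamma> c by (simp add: g_def)
 show thesis
 proof (rule that)
  show "g > 0" by (rule g)
  show "C' * (g^2 / 2) > 0" using C' g by simp
  fix B :: real
  \<comment> \<open>Division by \<open>c\<close> turns the two thresholds into \<open>k > B\<close>
    and \<open>k \<ge> 2\<close>.\<close>
  obtain K b \<rho> \<rho>' \<rho>'' M M' where K: "K > max (B * c) (2 * c)" and q: "is_quasimode m \<delta> (Cq * exp (- \<gamma> * K)) K b \<rho> \<rho>' \<rho>'' M M'"
   using qm by blast
  define k where "k = K / c"
  have Kk: "K = k * c" using c by (simp add: k_def)
  have k: "k > B" "k \<ge> 2" using K c by (simp_all add: k_def pos_less_divide_eq pos_le_divide_eq)
  define \<epsilon> where "\<epsilon> = Cq * exp (- \<gamma> * K)"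
  have \<epsilon>: "\<epsilon> > 0" using Cq by (simp add: \<epsilon>_def)
  have "ennreal (C' * (g^2 / 2) * exp (g * k)) \<le> L2_cond S (A k \<eta>)" for \<eta>
  proof -
   define x where "x = CA * (1 + \<bar>\<eta>\<bar>) / k"
   define y where "y = sqrt (2 / a1) / ((1 + \<bar>\<eta>\<bar>) * \<epsilon> * CE * k * Q)"
   have pos: "0 < 1 + \<bar>\<eta>\<bar>" by (simp add: add_pos_nonneg)
   have "ennreal (x * y) \<le> L2_cond S (A k \<eta>)"
   proof (rule L2_cond_ge)
    show "ennreal x \<le> L2_op_norm S (A k \<eta>)" if "L2_invertible S (A k \<eta>)"
     unfolding x_def by (rule CA(2)[OF k(2) that])
    show "ennreal y \<le> L2_op_norm S (L2_inverse S (A k \<eta>))" if "L2_invertible S (A k \<eta>)"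
     using inverse_norm[OF k(2) \<epsilon> q[folded \<epsilon>_def, unfolded Kk] that] unfolding y_def CE_def Q_def .
    show "0 \<le> x" "0 \<le> y" using CA(1) pos k a1 \<epsilon> CE Q by (simp_all add: x_def y_def)
   qed
   moreover have "C' * (g^2 / 2) * exp (g * k) \<le> x * y"
   proof -
    have gk: "\<gamma> * K = g * k + g * k" by (simp add: g_def Kk)
    have "x * y = C' * exp (\<gamma> * K) / k^2"
    proof -
     have "(CA * E / k) * (r / (E * (Cq * inverse e) * CE * k * Q)) = CA * r / (Cq * CE * Q) * e / k^2"
      if "0 < E" "0 < e" for E e r
      using that k(2) Cq CE Q by (simp add: field_simps power2_eq_square)
     from this[OF pos exp_gt_zero] show ?thesis by (simp add: x_def y_def C'_def \<epsilon>_def exp_minus)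
    qed
    also have "... = C' * exp (g * k) * (exp (g * k) / k^2)" unfolding gk exp_add by simp
    also have "... \<ge> C' * exp (g * k) * (g^2 / 2)"
    proof (rule mult_left_mono)
     have "0 \<le> g * k" using g k by simp
     then have "(g * k)^2 / 2 \<le> exp (g * k)" using exp_lower_Taylor_quadratic[of "g * k"] by linarith
     then show "g^2 / 2 \<le> exp (g * k) / k^2" using k by (simp add: pos_le_divide_eq power_mult_distrib)
    qed (use C' in simp)
    finally show ?thesis by (simp add: mult_ac)
   qed
   ultimately show ?thesis by (meson ennreal_leI order_trans)
  qed
  then show "\<exists>k>B. \<forall>\<eta>. ennreal (C' * (g^2 / 2) * exp (g * k)) \<le> L2_cond S (A k \<eta>)"
   using k(1) by blast
 qed
qed

end

lemma unbounded_imp_strict_mono_sequence: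
 fixes P :: "real => bool"
 assumes "\<And>B. \<exists>k>B. P k"
 obtains k :: "nat => real" where "0 < k 0" "strict_mono k" "filterlim k at_top sequentially" "\<And>n. P (k n)"
proof -
 obtain g where g: "\<And>B. g B > B" "\<And>B. P (g B)" using assms by metis
 \<comment> \<open>The maximum with the previous value gives strict growth, the one with
   \<open>n + 1\<close> divergence.\<close>
 define k where "k = rec_nat (g 0) (\<lambda>n x. g (max x (real (Suc n))))"
 have k0: "k 0 = g 0" and kS: "k (Suc n) = g (max (k n) (real (Suc n)))" for n by (simp_all add: k_def)
 show thesis
 proof (rule that)
  show "0 < k 0" using g(1)[of 0] by (simp add: k0)
  show "strict_mono k" using g(1)[of "max (k _) _"] by (intro strict_mono_Suc_iff[THEN iffD2] allI) (simp add: kS)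
  have "real n \<le> k n" for n
  proof (cases n)
   case 0
   then show ?thesis using g(1)[of 0] by (simp add: k0)
  next
   case (Suc j)
   then show ?thesis using g(1)[of "max (k j) (real (Suc j))"] by (simp add: kS)
  qed
  then show "filterlim k at_top sequentially"
   by (intro filterlim_at_top_mono[OF filterlim_real_sequentially] always_eventually) simp
  show "P (k n)" for n using g(2) by (cases n) (simp_all add: k0 kS)
 qed
qed

theorem theorem2p13:
  fixes \<Omega> :: "(real ^ 2) set" and a1 a2 :: real
  assumes "compact \<Omega>"
    and "lipschitz_boundary \<Omega>"
    and "connected (- \<Omega>)"
    and "a1 > a2" and "a2 > 0"
    and "open_ellipse a1 a2 \<subseteq> - \<Omega>"
    and "\<forall>p \<in> {vector [0, a2], vector [0, - a2]}. \<exists>U. open U \<and> p \<in> U \<and>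
           frontier \<Omega> \<inter> U = frontier (open_ellipse a1 a2) \<inter> U"
  shows "\<exists>(k :: nat \<Rightarrow> real) \<gamma> C.
           0 < k 0 \<and> strict_mono k \<and> filterlim k at_top sequentially \<and> \<gamma> > 0 \<and> C > 0 \<and>
           (\<forall>\<eta> :: real. \<forall>m. \<eta> \<noteq> 0 \<longrightarrow>
              L2_cond (surface_measure \<Omega>) (combined_layer \<Omega> (k m) \<eta>)
                \<ge> ennreal (C * exp (\<gamma> * k m)))"
proof -
 \<comment> \<open>\<open>c\<close> is half the distance of the foci and \<open>m\<close> the radial
   coordinate of the given ellipse in its confocal family; \<open>a1 > a2\<close> makes the foci
   distinct.\<close>
 define c where "c = sqrt (a1^2 - a2^2)"
 define m where "m = arsinh (a2 / c)"
 have a: "a2^2 < a1^2" using assms(4,5) by (intro power_strict_mono) auto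
 then have c: "c > 0" "c^2 = a1^2 - a2^2" by (simp_all add: c_def)
 have sm: "c * sinh m = a2" using c(1) by (simp add: m_def)
 have cm: "c * cosh m = a1"
 proof -
  have "(c * cosh m)^2 = c^2 + (c * sinh m)^2" by (simp add: power_mult_distrib cosh_square_eq distrib_left)
  also have "... = a1^2" unfolding sm c(2) by simp
  finally show ?thesis using c(1) assms(4,5) by (subst (asm) power2_eq_iff_nonneg) (simp_all add: cosh_real_nonneg)
 qed
 have m: "m > 0" using sm assms(5) c(1) by (metis sinh_real_pos_iff zero_less_mult_pos)
 obtain U1 where U1: "open U1" "vector [0, a2] \<in> U1" "frontier \<Omega> \<inter> U1 = frontier (open_ellipse a1 a2) \<inter> U1"
  using assms(7) by blast
 obtain U2 where U2: "open U2" "vector [0, - a2] \<in> U2" "frontier \<Omega> \<inter> U2 = frontier (open_ellipse a1 a2) \<inter> U2"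
  using assms(7) by blast
 have near: "\<exists>d>0. \<forall>x. \<bar>x\<bar> < d --> epoint c x t \<in> V" if V: "open V" "epoint c 0 t \<in> V" for V t
 proof -
  have "isCont (\<lambda>x. epoint c x t) 0" unfolding epoint_axis by (intro continuous_intros)
  then have "\<forall>\<^sub>F x in nhds 0. epoint c x t \<in> V"
   using V by (metis continuous_at_imp_continuous_within isCont_def tendsto_nhds_iff topological_tendstoD)
  then show ?thesis by (auto simp: eventually_nhds_metric dist_real_def)
 qed
 have "epoint c 0 m = vector [0, a2]" "epoint c 0 (- m) = vector [0, - a2]"
  by (simp_all add: epoint_def sm)
 then obtain d1 d2 where d1: "d1 > 0" "\<And>x. \<bar>x\<bar> < d1 ==> epoint c x m \<in> U1" and d2: "d2 > 0" "\<And>x. \<bar>x\<bar> < d2 ==> epoint c x (- m) \<in> U2"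
  using near[OF U1(1)] near[OF U2(1)] U1(2) U2(2) by metis
 \<comment> \<open>Half of the smaller radius, so that the closed angular interval fits into both
   neighbourhoods; 1 is the limit set by the coordinate estimates.\<close>
 define \<delta> where "\<delta> = min 1 (min d1 d2 / 2)"
 have \<delta>: "0 < \<delta>" "\<delta> \<le> 1" "\<delta> < d1" "\<delta> < d2" using d1(1) d2(1) by (auto simp: \<delta>_def min_def)
 interpret er: ellipse_rect c m \<delta> by unfold_locales (use c m \<delta> in auto)
 have a12: "er.a1 = a1" "er.a2 = a2" by (simp_all add: er.a1_def er.a2_def cm sm)
 interpret scatterer c m \<delta> \<Omega> "U1 \<union> U2"
 proof
  show "compact \<Omega>" "lipschitz_boundary \<Omega>" by fact+
  show "open_ellipse er.a1 er.a2 \<subseteq> - \<Omega>" unfolding a12 by fact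
  show "open (U1 \<union> U2)" using U1(1) U2(1) by blast
  show "epoint c x y \<in> U1 \<union> U2" if "x \<in> {-\<delta>..\<delta>}" "y = m \<or> y = - m" for x y
  proof -
   have "\<bar>x\<bar> < d1" "\<bar>x\<bar> < d2" using that(1) \<delta> by auto
   then show ?thesis using that(2) d1(2) d2(2) by blast
  qed
  show "frontier \<Omega> \<inter> (U1 \<union> U2) = frontier (open_ellipse er.a1 er.a2) \<inter> (U1 \<union> U2)"
   unfolding a12 Int_Un_distrib U1(3) U2(3) ..
 qed
 obtain \<gamma> C where gC: "\<gamma> > 0" "C > 0"
  and big: "\<And>B. \<exists>k>B. \<forall>\<eta>. ennreal (C * exp (\<gamma> * k)) \<le> L2_cond (surface_measure \<Omega>) (combined_layer \<Omega> k \<eta>)"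
  using condition_number_grows by metis
 obtain k :: "nat => real" where "0 < k 0" "strict_mono k" "filterlim k at_top sequentially"
  "\<And>n. \<forall>\<eta>. ennreal (C * exp (\<gamma> * k n)) \<le> L2_cond (surface_measure \<Omega>) (combined_layer \<Omega> (k n) \<eta>)"
  using unbounded_imp_strict_mono_sequence[OF big] by metis
 then show ?thesis using gC by blast
qed

end
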